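(* Let $M$ be a compact connected oriented smooth $3$-manifold (without boundary). The $G_2^2$-cone of $M$, i.e. the set of classes $[\rho]=[\rho_0]+[\rho_1]+[\rho_2]+[\rho_3]\in H^\bullet(M,\mathbb{R})$ having a representative in $\Omega^\bullet(M)$ that is a $G_2^2$-structure compatible with the orientation of $M$, is equal to $$\{[\rho]\in H^\bullet(M,\mathbb{R}) : [\rho_0]\neq 0 \text{ and } [\rho_0][\rho_3]-[\rho_1][\rho_2]>0\}\ \cup\ \big(C\oplus H^3(M,\mathbb{R})\big),$$ where $$C=\{(\alpha,\beta) : \alpha\in C_1,\ \beta\in H^2(M,\mathbb{R}),\ \alpha\cup\beta<0\}$$ and $C_1\subset H^1(M,\mathbb{R})$ is the set of cohomology classes that can be represented by a nowhere vanishing closed $1$-form.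
   Context: For $\rho=\rho_0+\rho_1+\rho_2+\rho_3\in\Omega^\bullet(M)$ (with $\rho_i\in\Omega^i(M)$), set $\langle\rho,\rho\rangle = 2(\rho_0\rho_3-\rho_1\wedge\rho_2)\in\Omega^3(M)$. A $G_2^2$-structure on $M$ is a form $\rho\in\Omega^\bullet(M)$ with $d\rho=0$ such that $\langle\rho,\rho\rangle$ is nowhere vanishing; it is compatible with the orientation of $M$ if $\langle\rho,\rho\rangle>0$, i.e. $\langle\rho,\rho\rangle$ is a positive volume form. Inequalities $>0$, $<0$ between classes in $H^3(M,\mathbb{R})$ are understood via the isomorphism $H^3(M,\mathbb{R})\cong\mathbb{R}$ given by integration over the oriented manifold $M$; products are cup products. The set $C\oplus H^3(M,\mathbb{R})$ is the set of classes $\alpha+\beta+\gamma\in H^\bullet(M,\mathbb{R})$ with zero degree $0$ component, $(\alpha,\beta)\in C$ and $\gamma\in H^3(M,\mathbb{R})$ arbitrary. *)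

theory Defs
  imports "HOL-Analysis.Analysis" "HOL-Library.Function_Algebras"
begin

section \<open>Calculus on open subsets of a Euclidean space\<close>

text \<open>\<open>S\<close> is meant to be open. Differentiability at every stage makes the previous derivatives
  continuous, so \<open>Ck_on k\<close> is the usual class of \<open>k\<close> times continuously differentiable maps.\<close>

primrec Ck_on :: "nat \<Rightarrow> 'a set \<Rightarrow> ('a::euclidean_space \<Rightarrow> 'b::euclidean_space) \<Rightarrow> bool" where
  "Ck_on 0 S f \<longleftrightarrow> continuous_on S f"
| "Ck_on (Suc k) S f \<longleftrightarrow>
     (\<forall>x\<in>S. f differentiable (at x)) \<and>
     (\<forall>v. Ck_on k S (\<lambda>x. frechet_derivative f (at x) v))"

definition smooth_on :: "'a set \<Rightarrow> ('a::euclidean_space \<Rightarrow> 'b::euclidean_space) \<Rightarrow> bool" where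
  "smooth_on S f \<longleftrightarrow> (\<forall>k. Ck_on k S f)"

text \<open>A \<open>k\<close>-linear form is a function on lists, extended by \<open>0\<close> to lists whose length is not \<open>k\<close>.\<close>

definition alternating_form :: "nat \<Rightarrow> ('a::euclidean_space list \<Rightarrow> real) \<Rightarrow> bool" where
  "alternating_form k w \<longleftrightarrow>
     (\<forall>vs. length vs \<noteq> k \<longrightarrow> w vs = 0) \<and>
     (\<forall>vs i. length vs = k \<and> i < k \<longrightarrow> linear (\<lambda>v. w (vs[i := v]))) \<and>
     (\<forall>vs i j. length vs = k \<and> i < j \<and> j < k \<and> vs ! i = vs ! j \<longrightarrow> w vs = 0)"

text \<open>The normalisation is the one for which \<open>dx \<and> dy\<close> takes the value \<open>1\<close> on the standard basis.\<close>

definition wedge ::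
  "nat \<Rightarrow> nat \<Rightarrow> ('a list \<Rightarrow> real) \<Rightarrow> ('a list \<Rightarrow> real) \<Rightarrow> 'a list \<Rightarrow> real" where
  "wedge k l a b vs =
     (if length vs = k + l then
        (\<Sum>p | p permutes {..<k + l}.
           of_int (sign p) * a (map (\<lambda>i. vs ! p i) [0..<k]) * b (map (\<lambda>i. vs ! p i) [k..<k + l]))
        / (fact k * fact l)
      else 0)"

text \<open>\<open>d\<omega>(v\<^sub>0,\<dots>,v\<^sub>k) = \<Sum>\<^sub>i (-1)^i D\<^bsub>v\<^sub>i\<^esub> (\<omega>(v\<^sub>0,\<dots>,v\<^sub>i omitted,\<dots>,v\<^sub>k))\<close> for constant vector fields.\<close>

definition ext_deriv ::
  "('a::euclidean_space \<Rightarrow> 'a list \<Rightarrow> real) \<Rightarrow> 'a \<Rightarrow> 'a list \<Rightarrow> real" where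
  "ext_deriv w x vs =
     (\<Sum>i<length vs.
        (-1) ^ i * frechet_derivative (\<lambda>y. w y (take i vs @ drop (Suc i) vs)) (at x) (vs ! i))"


section \<open>Oriented smooth 3-manifolds\<close>

text \<open>A chart is an open domain together with a coordinate map, of which only the values on the
  domain matter.\<close>

type_synonym 'a chart = "'a set \<times> ('a \<Rightarrow> real ^ 3)"

definition chart_image :: "'a chart \<Rightarrow> (real ^ 3) set" where
  "chart_image c = snd c ` fst c"

definition chart_inv :: "'a chart \<Rightarrow> real ^ 3 \<Rightarrow> 'a" where
  "chart_inv c = inv_into (fst c) (snd c)"

definition overlap :: "'a chart \<Rightarrow> 'a chart \<Rightarrow> (real ^ 3) set" where
  "overlap c c' = snd c ` (fst c \<inter> fst c')"

definition transition :: "'a chart \<Rightarrow> 'a chart \<Rightarrow> real ^ 3 \<Rightarrow> real ^ 3" where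
  "transition c c' = snd c' \<circ> chart_inv c"

definition is_chart :: "'a topology \<Rightarrow> 'a chart \<Rightarrow> bool" where
  "is_chart X c \<longleftrightarrow>
     openin X (fst c) \<and> open (chart_image c) \<and>
     homeomorphic_map (subtopology X (fst c)) (top_of_set (chart_image c)) (snd c)"

text \<open>The smooth structure and the orientation are both given by an atlas with
  orientation-preserving smooth transition maps. The atlas need not be maximal.\<close>

definition oriented_smooth_atlas :: "'a topology \<Rightarrow> 'a chart set \<Rightarrow> bool" where
  "oriented_smooth_atlas X A \<longleftrightarrow>
     (\<forall>c\<in>A. is_chart X c) \<and> (\<Union>c\<in>A. fst c) = topspace X \<and>
     (\<forall>c\<in>A. \<forall>c'\<in>A. smooth_on (overlap c c') (transition c c') \<and>
        (\<forall>x\<in>overlap c c'. 0 < det (matrix (frechet_derivative (transition c c') (at x)))))"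

definition oriented_smooth_3manifold :: "'a topology \<Rightarrow> 'a chart set \<Rightarrow> bool" where
  "oriented_smooth_3manifold X A \<longleftrightarrow>
     Hausdorff_space X \<and> second_countable X \<and> oriented_smooth_atlas X A"


section \<open>Differential forms\<close>

text \<open>A differential form is the family of its local expressions in the charts of the atlas,
  compatible under pullback along the transition maps. The family vanishes outside the atlas and
  outside the chart images, so that equality of forms is equality of functions.\<close>

type_synonym 'a dform = "'a chart \<Rightarrow> real ^ 3 \<Rightarrow> (real ^ 3) list \<Rightarrow> real"

definition forms :: "'a chart set \<Rightarrow> nat \<Rightarrow> 'a dform set" where
  "forms A k = {w.
     (\<forall>c x. c \<notin> A \<or> x \<notin> chart_image c \<longrightarrow> w c x = 0) \<and>
     (\<forall>c\<in>A. (\<forall>x\<in>chart_image c. alternating_form k (w c x)) \<and>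
            (\<forall>vs. smooth_on (chart_image c) (\<lambda>x. w c x vs))) \<and>
     (\<forall>c\<in>A. \<forall>c'\<in>A. \<forall>x\<in>overlap c c'. \<forall>vs.
        w c x vs =
        w c' (transition c c' x) (map (frechet_derivative (transition c c') (at x)) vs))}"

definition form_wedge :: "nat \<Rightarrow> nat \<Rightarrow> 'a dform \<Rightarrow> 'a dform \<Rightarrow> 'a dform" where
  "form_wedge k l w v = (\<lambda>c x. wedge k l (w c x) (v c x))"

definition form_d :: "'a chart set \<Rightarrow> 'a dform \<Rightarrow> 'a dform" where
  "form_d A w = (\<lambda>c x. if c \<in> A \<and> x \<in> chart_image c then ext_deriv (w c) x else 0)"

definition nowhere_vanishing :: "'a chart set \<Rightarrow> 'a dform \<Rightarrow> bool" where
  "nowhere_vanishing A w \<longleftrightarrow> (\<forall>c\<in>A. \<forall>x\<in>chart_image c. w c x \<noteq> 0)"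

definition std_basis :: "(real ^ 3) list" where
  "std_basis = [axis 1 1, axis 2 1, axis 3 1]"

definition positive_volume_form :: "'a chart set \<Rightarrow> 'a dform \<Rightarrow> bool" where
  "positive_volume_form A w \<longleftrightarrow>
     w \<in> forms A 3 \<and> (\<forall>c\<in>A. \<forall>x\<in>chart_image c. 0 < w c x std_basis)"


section \<open>Integration of 3-forms over a compact manifold\<close>

definition smooth_function :: "'a chart set \<Rightarrow> ('a \<Rightarrow> real) \<Rightarrow> bool" where
  "smooth_function A f \<longleftrightarrow> (\<forall>c\<in>A. smooth_on (chart_image c) (f \<circ> chart_inv c))"

definition partition_of_unity ::
  "'a topology \<Rightarrow> 'a chart set \<Rightarrow> 'a chart set \<Rightarrow> ('a chart \<Rightarrow> 'a \<Rightarrow> real) \<Rightarrow> bool" where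
  "partition_of_unity X A F u \<longleftrightarrow>
     finite F \<and> F \<subseteq> A \<and>
     (\<forall>c\<in>F. smooth_function A (u c) \<and> (\<forall>p\<in>topspace X. 0 \<le> u c p) \<and>
            X closure_of {p \<in> topspace X. u c p \<noteq> 0} \<subseteq> fst c) \<and>
     (\<forall>p\<in>topspace X. (\<Sum>c\<in>F. u c p) = 1)"

text \<open>The value does not depend on the partition of unity, and one exists by compactness.\<close>

definition form_integral :: "'a topology \<Rightarrow> 'a chart set \<Rightarrow> 'a dform \<Rightarrow> real" where
  "form_integral X A w = (THE s. \<exists>F u. partition_of_unity X A F u \<and>
     s = (\<Sum>c\<in>F. integral (chart_image c) (\<lambda>x. u c (chart_inv c x) * w c x std_basis)))"


section \<open>De Rham cohomology\<close>

definition closed_forms :: "'a chart set \<Rightarrow> nat \<Rightarrow> 'a dform set" where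
  "closed_forms A k = {w \<in> forms A k. form_d A w = 0}"

definition exact_forms :: "'a chart set \<Rightarrow> nat \<Rightarrow> 'a dform set" where
  "exact_forms A k = (case k of 0 \<Rightarrow> {0} | Suc j \<Rightarrow> form_d A ` forms A j)"

definition cohomologous :: "'a chart set \<Rightarrow> nat \<Rightarrow> ('a dform \<times> 'a dform) set" where
  "cohomologous A k =
     {(w, v). w \<in> closed_forms A k \<and> v \<in> closed_forms A k \<and> w - v \<in> exact_forms A k}"

definition coho :: "'a chart set \<Rightarrow> nat \<Rightarrow> 'a dform set set" where
  "coho A k = closed_forms A k // cohomologous A k"

definition coho_class :: "'a chart set \<Rightarrow> nat \<Rightarrow> 'a dform \<Rightarrow> 'a dform set" where
  "coho_class A k w = cohomologous A k `` {w}"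

definition coho_zero :: "'a chart set \<Rightarrow> nat \<Rightarrow> 'a dform set" where
  "coho_zero A k = coho_class A k 0"

definition coho_diff :: "'a chart set \<Rightarrow> nat \<Rightarrow> 'a dform set \<Rightarrow> 'a dform set \<Rightarrow> 'a dform set" where
  "coho_diff A k a b = (\<Union>w\<in>a. \<Union>v\<in>b. coho_class A k (w - v))"

definition cup ::
  "'a chart set \<Rightarrow> nat \<Rightarrow> nat \<Rightarrow> 'a dform set \<Rightarrow> 'a dform set \<Rightarrow> 'a dform set" where
  "cup A k l a b = (\<Union>w\<in>a. \<Union>v\<in>b. coho_class A (k + l) (form_wedge k l w v))"

text \<open>By Stokes' theorem the integral is constant on a class of degree 3.\<close>

definition coho_integral :: "'a topology \<Rightarrow> 'a chart set \<Rightarrow> 'a dform set \<Rightarrow> real" where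
  "coho_integral X A a = the_elem (form_integral X A ` a)"


section \<open>The cone\<close>

text \<open>Inhomogeneous forms and classes are the tuples of their components in degrees 0, 1, 2, 3;
  forms of higher degree on a 3-manifold are zero.\<close>

type_synonym 'a mform = "'a dform \<times> 'a dform \<times> 'a dform \<times> 'a dform"
type_synonym 'a mclass = "'a dform set \<times> 'a dform set \<times> 'a dform set \<times> 'a dform set"

definition mforms :: "'a chart set \<Rightarrow> 'a mform set" where
  "mforms A = forms A 0 \<times> forms A 1 \<times> forms A 2 \<times> forms A 3"

fun mform_d :: "'a chart set \<Rightarrow> 'a mform \<Rightarrow> 'a mform" where
  "mform_d A (w0, w1, w2, w3) = (0, form_d A w0, form_d A w1, form_d A w2)"

definition total_coho :: "'a chart set \<Rightarrow> 'a mclass set" where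
  "total_coho A = coho A 0 \<times> coho A 1 \<times> coho A 2 \<times> coho A 3"

fun mclass_of :: "'a chart set \<Rightarrow> 'a mform \<Rightarrow> 'a mclass" where
  "mclass_of A (w0, w1, w2, w3) =
     (coho_class A 0 w0, coho_class A 1 w1, coho_class A 2 w2, coho_class A 3 w3)"

fun self_pairing :: "'a mform \<Rightarrow> 'a dform" where
  "self_pairing (w0, w1, w2, w3) =
     (\<lambda>c x vs. 2 * (form_wedge 0 3 w0 w3 c x vs - form_wedge 1 2 w1 w2 c x vs))"

definition G22_structure :: "'a chart set \<Rightarrow> 'a mform \<Rightarrow> bool" where
  "G22_structure A w \<longleftrightarrow>
     w \<in> mforms A \<and> mform_d A w = (0, 0, 0, 0) \<and> nowhere_vanishing A (self_pairing w)"

definition G22_cone :: "'a chart set \<Rightarrow> 'a mclass set" where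
  "G22_cone A =
     {mclass_of A w | w. G22_structure A w \<and> positive_volume_form A (self_pairing w)}"

definition nonvanishing_classes :: "'a chart set \<Rightarrow> 'a dform set set" where
  "nonvanishing_classes A = {a \<in> coho A 1. \<exists>w\<in>a. nowhere_vanishing A w}"

definition C_cone :: "'a topology \<Rightarrow> 'a chart set \<Rightarrow> ('a dform set \<times> 'a dform set) set" where
  "C_cone X A =
     {(a, b). a \<in> nonvanishing_classes A \<and> b \<in> coho A 2 \<and> coho_integral X A (cup A 1 2 a b) < 0}"

end

theory Submission
	imports Defs
begin

text \<open>
	If \<open>\<rho>\<^sub>0 \<noteq> 0\<close>, it is a constant \<open>k\<close>. A 3-form with integral zero on a closed connected manifold is exact, so within its
	class \<open>\<rho>\<^sub>3\<close> can be chosen such that \<open>k \<rho>\<^sub>3 - \<rho>\<^sub>1 \<and> \<rho>\<^sub>2\<close> is any 3-form of the right integral, in particular a volume form.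

	If \<open>\<rho>\<^sub>0 = 0\<close>, then \<open>\<alpha> = \<rho>\<^sub>1\<close> has no zeros, and the point is that a closed 2-form \<open>\<beta>\<close> with \<open>\<integral> \<alpha> \<and> \<beta> > 0\<close> can be changed by an exact form
	such that \<open>\<alpha> \<and> \<beta>\<close> becomes positive. Consider 3-forms modulo \<open>\<alpha> \<and> d\<Omega>\<^sup>1\<close>. In charts with \<open>\<alpha> = dz\<close> this means equality of the
	integrals along the plaques \<open>z = const\<close>, so moving densities in the direction of \<open>z\<close> is well defined modulo this relation, and so is \<open>\<partial>\<^sub>z\<close>.
	Moreover \<open>d\<sigma> \<equiv> \<partial>\<^sub>z (\<alpha> \<and> \<sigma>)\<close>; in particular \<open>\<partial>\<^sub>z (\<alpha> \<and> \<beta>) \<equiv> 0\<close>. By compactness, the orbit of a small bump under a vertical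
	translation \<open>T\<close> almost returns to its plaque; integrating the bump along the orbit gives \<open>e \<ge> 0\<close> with \<open>\<partial>\<^sub>z e \<equiv> 0\<close>, and finitely many of these
	add up to a positive \<open>e\<close>. Write \<open>\<alpha> \<and> \<beta> = k e + d\<sigma>\<close> with \<open>k > 0\<close> and put \<open>\<nu> = \<alpha> \<and> \<sigma>\<close>. Integrating \<open>d\<sigma> \<equiv> \<partial>\<^sub>z \<nu>\<close> over
	\<open>n\<close> translation steps of length \<open>\<delta>\<close> gives \<open>n \<delta> (\<alpha> \<and> \<beta>) \<equiv> n \<delta> k e + \<nu> - T\<^sup>n \<nu>\<close>, and the last two terms are bounded by multiples of \<open>e\<close>
	independent of \<open>n\<close>.

	Charts with \<open>\<alpha> = dz\<close> belong to the maximal atlas, to which all forms extend.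
\<close>

text \<open>If \<rho>_0 = 0, only forms \<alpha> \<and> d\<gamma> may be added to \<alpha> \<and>
  \<beta>, and since the leaves of ker \<alpha> can be dense, there is no reasonable leaf space on
  which to average. The relation modulo such forms takes its place. Translation is assembled from
  finitely many charts: it depends on a partition of unity and satisfies its composition law only
  modulo the relation, but it preserves positivity of the forms themselves. This is why the bounds
  do not depend on n: C e - \<nu> \<ge> 0 implies T^n (C e - \<nu>) \<ge> 0, and T^n e \<equiv> e,
  so the error stays between fixed multiples of e while n \<delta> k e grows. The return of a bump
  is only approximate because an upward orbit need not close up. The remaining offset a is absorbed
  by starting the orbit integral at time a instead of 0, which makes its two boundary terms
  equivalent. The other inclusion integrates the pointwise inequality; for \<rho>_0 = 0 that
  inequality also shows that \<rho>_1 has no zeros.\<close>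

abbreviation img :: "'a chart => (real ^ 3) set" where "img == chart_image"
abbreviation trn :: "'a chart => 'a chart => real ^ 3 => real ^ 3" where "trn == transition"
notation scaleR (infixr "*R" 75)

section \<open>Smooth maps between Euclidean spaces\<close>

abbreviation fd :: "('a::euclidean_space => 'b::euclidean_space) => 'a => 'a => 'b" where
	"fd f x \<equiv> frechet_derivative f (at x)"

lemma fd_eqI: "(f has_derivative f') (at x) ==> fd f x = f'"
	using frechet_derivative_at by metis

lemma fd_cong:
	assumes "open S" "x : S" "!!y. y : S ==> f y = g y"
	shows "fd f x = fd g x"
proof -
	have "(f has_derivative h) (at x) \<longleftrightarrow> (g has_derivative h) (at x)" for h
		using assms has_derivative_transform_within_open[of f h x UNIV S g]
			has_derivative_transform_within_open[of g h x UNIV S f] by auto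
	then show ?thesis unfolding frechet_derivative_def by simp
qed

lemma Ck_on_cong:
	assumes "open S" "!!x. x : S ==> f x = g x" "Ck_on k S f"
	shows "Ck_on k S g"
	using assms
proof (induction k arbitrary: f g)
	case 0
	then show ?case using continuous_on_cong by (metis Ck_on.simps(1))
next
	case (Suc k)
	have eq: "fd f x v = fd g x v" if "x : S" for x v
		using fd_cong[OF Suc.prems(1) that, of f g] Suc.prems(2) by simp
	have "g differentiable (at x)" if "x : S" for x
	proof -
		have "(f has_derivative fd f x) (at x)"
			using Suc.prems(3) that by (auto simp: frechet_derivative_works)
		then have "(g has_derivative fd f x) (at x)"
			using Suc.prems(1,2) that has_derivative_transform_within_open[of f "fd f x" x UNIV S g] by auto
		then show ?thesis by (auto simp: differentiable_def)
	qed
	moreover have "Ck_on k S (%x. fd g x v)" for v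
		by (rule Suc.IH[OF Suc.prems(1) eq[of _ v]]) (use Suc.prems(3) in auto)
	ultimately show ?case by auto
qed

text \<open>Lets an explicitly computed derivative \<open>f'\<close> stand in for the choice made by
  \<open>frechet_derivative\<close>. The closure properties below go by induction on
  \<open>k\<close> through this equivalence, with the product or chain rule supplying
  \<open>f'\<close>.\<close>

lemma Ck_on_Suc_iff:
	assumes "open S" "!!x. x : S ==> (f has_derivative f' x) (at x)"
	shows "Ck_on (Suc k) S f \<longleftrightarrow> (\<forall>v. Ck_on k S (%x. f' x v))"
proof
	assume "Ck_on (Suc k) S f"
	then have "Ck_on k S (%x. fd f x v)" for v by auto
	then show "\<forall>v. Ck_on k S (%x. f' x v)"
		using Ck_on_cong[OF assms(1), of "%x. fd f x v" "%x. f' x v" for v] fd_eqI[OF assms(2)] by simp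
next
	assume "\<forall>v. Ck_on k S (%x. f' x v)"
	then show "Ck_on (Suc k) S f"
		using assms(2) Ck_on_cong[OF assms(1), of "%x. f' x v" "%x. fd f x v" for v] fd_eqI[OF assms(2)]
		by (auto simp: differentiable_def)
qed

lemma Ck_on_subset: "Ck_on k S f ==> T <= S ==> Ck_on k T f"
	by (induction k arbitrary: f) (auto intro: continuous_on_subset)

text \<open>The neighbourhood \<open>T\<close> need not lie inside \<open>S\<close>:
  differentiability at a point refers to a full neighbourhood anyway.\<close>

lemma Ck_on_local:
	assumes "!!x. x : S ==> \<exists>T. open T & x : T & Ck_on k T f"
	shows "Ck_on k S f"
	using assms
proof (induction k arbitrary: f)
	case 0
	then have "isCont f x" if "x : S" for x
		using that by (metis Ck_on.simps(1) continuous_on_eq_continuous_at)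
	then show ?case by (simp add: continuous_at_imp_continuous_on)
next
	case (Suc k)
	have "f differentiable (at x)" if "x : S" for x
		using Suc.prems[OF that] by auto
	moreover have "Ck_on k S (%x. fd f x v)" for v
		by (rule Suc.IH) (use Suc.prems in fastforce)
	ultimately show ?case by auto
qed

lemma Ck_on_continuous: "Ck_on k S f ==> continuous_on S f"
	by (cases k) (auto intro!: continuous_at_imp_continuous_on differentiable_imp_continuous_within)

lemma Ck_on_Suc_imp: "Ck_on (Suc k) S f ==> Ck_on k S f"
proof (induction k arbitrary: f)
	case 0
	then show ?case using Ck_on_continuous Ck_on.simps(1) by blast
next
	case (Suc k)
	then show ?case by (metis Ck_on.simps(2))
qed

lemma Ck_on_const: "Ck_on k S (%x. c)"
proof (induction k arbitrary: c)
	case (Suc k)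
	then show ?case by (auto intro: Suc)
qed auto

lemma Ck_on_linear: "linear f ==> Ck_on k S f"
proof (cases k)
	case (Suc j)
	assume "linear f"
	then have d: "(f has_derivative f) (at x)" for x
		by (simp add: linear_imp_has_derivative)
	then show ?thesis
		using Suc fd_eqI[OF d] by (auto simp: differentiable_def intro: Ck_on_const)
qed (simp add: linear_continuous_on linear_conv_bounded_linear)

lemma Ck_on_add:
	assumes "open S" shows "Ck_on k S f ==> Ck_on k S g ==> Ck_on k S (%x. f x + g x)"
proof (induction k arbitrary: f g)
	case (Suc k)
	have "((%x. f x + g x) has_derivative (%v. fd f x v + fd g x v)) (at x)" if "x : S" for x
		using Suc.prems that by (intro has_derivative_add) (auto simp: frechet_derivative_works)
	then show ?case
		using Suc by (subst Ck_on_Suc_iff[OF assms]) auto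
qed (auto intro: continuous_on_add)

lemma Ck_on_scaleR:
	fixes f :: "'a::euclidean_space => real"
	assumes "open S" shows "Ck_on k S f ==> Ck_on k S g ==> Ck_on k S (%x. f x *R g x)"
proof (induction k arbitrary: f g)
	case (Suc k)
	have "((%x. f x *R g x) has_derivative (%v. f x *R fd g x v + fd f x v *R g x)) (at x)" if "x : S" for x
		using Suc.prems that by (intro has_derivative_scaleR) (auto simp: frechet_derivative_works)
	moreover have "Ck_on k S (%x. f x *R fd g x v + fd f x v *R g x)" for v
		using Suc.prems Ck_on_Suc_imp[OF Suc.prems(1)] Ck_on_Suc_imp[OF Suc.prems(2)]
		by (intro Ck_on_add assms Suc.IH) simp_all
	ultimately show ?case
		by (subst Ck_on_Suc_iff[OF assms]) auto
qed (auto intro: continuous_on_scaleR)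

lemma Ck_on_sum:
	assumes "open S" "!!i. i : I ==> Ck_on k S (f i)"
	shows "Ck_on k S (%x. \<Sum>i\<in>I. f i x)"
	using assms(2) by (induction I rule: infinite_finite_induct) (auto intro: Ck_on_const Ck_on_add assms(1))

text \<open>The chain rule gives \<open>fd f (g x) (fd g x v)\<close>, whose direction varies with
  x. Expanding it over \<open>Basis\<close> separates coefficients that involve only
  \<open>g\<close> from the maps \<open>fd f (g x) b\<close> with fixed direction, to which the
  induction hypothesis applies.\<close>

lemma Ck_on_compose:
	assumes "open S" "open T" "g ` S <= T"
	shows "Ck_on k T f ==> Ck_on k S g ==> Ck_on k S (%x. f (g x))"
proof (induction k arbitrary: f)
	case 0
	then show ?case using assms by (auto intro: continuous_on_compose2)
next
	case (Suc k)
	have df: "(f has_derivative fd f (g x)) (at (g x))" and dg: "(g has_derivative fd g x) (at x)"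
		if "x : S" for x
		using Suc.prems assms(3) that by (auto simp: frechet_derivative_works)
	have "((%x. f (g x)) has_derivative (%v. fd f (g x) (fd g x v))) (at x)" if "x : S" for x
		using diff_chain_at[OF dg[OF that] df[OF that]] by (simp add: o_def)
	moreover have "Ck_on k S (%x. fd f (g x) (fd g x v))" for v
	proof (rule Ck_on_cong[OF assms(1)])
		show "Ck_on k S (%x. \<Sum>b\<in>Basis. (fd g x v \<bullet> b) *R fd f (g x) b)"
		proof (intro Ck_on_sum Ck_on_scaleR assms(1))
			fix b :: 'b
			show "Ck_on k S (%x. fd f (g x) b)"
				using Suc.prems Ck_on_Suc_imp[OF Suc.prems(2)] by (intro Suc.IH) simp_all
			have comp: "Ck_on j S h ==> Ck_on j S (%x. h x \<bullet> b)" for j and h :: "'a => 'b"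
			proof (induction j arbitrary: h)
				case (Suc j)
				have "((%x. h x \<bullet> b) has_derivative (%v. fd h x v \<bullet> b)) (at x)" if "x : S" for x
					using Suc.prems that by (intro has_derivative_inner_left) (auto simp: frechet_derivative_works)
				then show ?case using Suc by (subst Ck_on_Suc_iff[OF assms(1)]) auto
			qed (auto intro: continuous_intros)
			show "Ck_on k S (%x. fd g x v \<bullet> b)"
				using Suc.prems by (intro comp) auto
		qed
		fix x assume x: "x : S"
		interpret linear "fd f (g x)" using df[OF x] has_derivative_linear by blast
		have "fd f (g x) (fd g x v) = fd f (g x) (\<Sum>b\<in>Basis. (fd g x v \<bullet> b) *R b)"
			by (simp add: euclidean_representation)
		then show "(\<Sum>b\<in>Basis. (fd g x v \<bullet> b) *R fd f (g x) b) = fd f (g x) (fd g x v)"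
			by (simp add: sum scale)
	qed
	ultimately show ?case by (subst Ck_on_Suc_iff[OF assms(1)]) auto
qed

text \<open>The derivative of the reciprocal is polynomial in the reciprocal, so the induction feeds
  on itself.\<close>

lemma Ck_on_inverse: "Ck_on k {x. x ~= 0} (inverse :: real => real)"
proof (induction k)
	case 0
	then show ?case by (auto intro!: continuous_intros)
next
	case (Suc k)
	have o: "open {x::real. x ~= 0}" by (simp add: open_Collect_neq continuous_on_const)
	have "((inverse :: real => real) has_derivative (%v. (inverse x *R inverse x) *R (- v))) (at x)"
		if "x ~= 0" for x
		using has_derivative_inverse'[OF that, of UNIV] by (simp add: mult_ac)
	moreover have "Ck_on k {x::real. x ~= 0} (%x. (inverse x *R inverse x) *R (- v))" for v :: real
		using Suc by (intro Ck_on_scaleR Ck_on_const o) auto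
	ultimately show ?case by (subst Ck_on_Suc_iff[OF o, of _ "%x v. (inverse x *R inverse x) *R (- v)"]) auto
qed

lemma smooth_on_cong: "open S ==> (!!x. x : S ==> f x = g x) ==> smooth_on S f ==> smooth_on S g"
	unfolding smooth_on_def using Ck_on_cong by blast

lemma smooth_on_subset: "smooth_on S f ==> T <= S ==> smooth_on T f"
	unfolding smooth_on_def using Ck_on_subset by blast

lemma smooth_on_local:
	assumes "!!x. x : S ==> \<exists>T. open T & x : T & smooth_on T f"
	shows "smooth_on S f"
	unfolding smooth_on_def by (intro allI Ck_on_local) (use assms smooth_on_def in blast)

lemma smooth_on_continuous: "smooth_on S f ==> continuous_on S f"
	unfolding smooth_on_def using Ck_on_continuous by blast

lemma smooth_on_const [simp, intro]: "smooth_on S (%x. c)"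
	by (simp add: smooth_on_def Ck_on_const)

lemma smooth_on_linear: "linear f ==> smooth_on S f"
	by (simp add: smooth_on_def Ck_on_linear)

lemma smooth_on_ident [simp]: "smooth_on S (%x. x)"
	by (rule smooth_on_linear) (rule linear_ident)

lemma smooth_on_add: "open S ==> smooth_on S f ==> smooth_on S g ==> smooth_on S (%x. f x + g x)"
	by (simp add: smooth_on_def Ck_on_add)

lemma smooth_on_scaleR:
	fixes f :: "'a::euclidean_space => real"
	shows "open S ==> smooth_on S f ==> smooth_on S g ==> smooth_on S (%x. f x *R g x)"
	by (simp add: smooth_on_def Ck_on_scaleR)

lemma smooth_on_mult:
	fixes f :: "'a::euclidean_space => real"
	shows "open S ==> smooth_on S f ==> smooth_on S g ==> smooth_on S (%x. f x * g x)"
	using smooth_on_scaleR[of S f g] by simp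

lemma smooth_on_sum:
	"open S ==> (!!i. i : I ==> smooth_on S (f i)) ==> smooth_on S (%x. \<Sum>i\<in>I. f i x)"
	by (simp add: smooth_on_def Ck_on_sum)

lemma smooth_on_compose:
	"open S ==> open T ==> g ` S <= T ==> smooth_on T f ==> smooth_on S g ==> smooth_on S (%x. f (g x))"
	unfolding smooth_on_def using Ck_on_compose by blast

lemma smooth_on_compose_UNIV:
	"open S ==> smooth_on UNIV f ==> smooth_on S g ==> smooth_on S (%x. f (g x))"
	by (rule smooth_on_compose[of S UNIV]) auto

lemma smooth_on_linear_compose:
	"open S ==> linear f ==> smooth_on S g ==> smooth_on S (%x. f (g x))"
	by (rule smooth_on_compose_UNIV) (auto intro: smooth_on_linear)

lemma smooth_on_minus: "open S ==> smooth_on S f ==> smooth_on S (%x. - f x)"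
	using smooth_on_scaleR[of S "%x. -1" f] by simp

lemma smooth_on_diff: "open S ==> smooth_on S f ==> smooth_on S g ==> smooth_on S (%x. f x - g x)"
	using smooth_on_add[of S f "%x. - g x"] smooth_on_minus[of S g] by simp

lemma smooth_on_inner_const: "open S ==> smooth_on S f ==> smooth_on S (%x. f x \<bullet> b)"
	by (rule smooth_on_linear_compose[of S "%y. y \<bullet> b"])
		 (auto simp: bounded_linear.linear bounded_linear_inner_left)

lemma smooth_on_inverse:
	fixes f :: "'a::euclidean_space => real"
	assumes "open S" "smooth_on S f" "!!x. x : S ==> f x ~= 0"
	shows "smooth_on S (%x. inverse (f x))"
	by (rule smooth_on_compose[of S "{x. x ~= 0}" f inverse])
		 (use assms Ck_on_inverse in \<open>auto simp: smooth_on_def open_Collect_neq\<close>)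

lemma smooth_on_divide:
	fixes f g :: "'a::euclidean_space => real"
	assumes "open S" "smooth_on S f" "smooth_on S g" "!!x. x : S ==> g x ~= 0"
	shows "smooth_on S (%x. f x / g x)"
	unfolding divide_inverse by (intro smooth_on_mult smooth_on_inverse assms)

lemma smooth_on_component_iff:
	assumes "open S"
	shows "smooth_on S f \<longleftrightarrow> (\<forall>b\<in>Basis. smooth_on S (%x. f x \<bullet> b))"
proof
	assume "\<forall>b\<in>Basis. smooth_on S (%x. f x \<bullet> b)"
	then have "smooth_on S (%x. \<Sum>b\<in>Basis. (f x \<bullet> b) *R b)"
		using assms by (intro smooth_on_sum smooth_on_scaleR) auto
	then show "smooth_on S f" by (simp add: euclidean_representation)
qed (auto intro: smooth_on_inner_const assms)

lemma smooth_on_has_derivative: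
	assumes "smooth_on S f" "x : S"
	shows "(f has_derivative fd f x) (at x)"
proof -
	have "Ck_on (Suc 0) S f" using assms smooth_on_def by blast
	then show ?thesis using assms by (simp add: frechet_derivative_works)
qed

lemma smooth_on_differentiable: "smooth_on S f ==> x : S ==> f differentiable (at x)"
	using smooth_on_has_derivative differentiable_def by blast

lemma smooth_on_fd: "smooth_on S f ==> smooth_on S (%x. fd f x v)"
	unfolding smooth_on_def by (metis Ck_on.simps(2))

lemma linear_fd: "f differentiable (at x) ==> linear (fd f x)"
	by (metis frechet_derivative_works has_derivative_linear)

lemma smooth_on_linear_fd: "smooth_on S f ==> x : S ==> linear (fd f x)"
	using linear_fd smooth_on_differentiable by blast

lemma fd_compose:
	assumes "f differentiable (at (g x))" "g differentiable (at x)"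
	shows "fd (%y. f (g y)) x v = fd f (g x) (fd g x v)"
	using frechet_derivative_compose[OF assms(2,1)] by (simp add: o_def)

lemma smooth_on_compose_fd:
	assumes "smooth_on T f" "smooth_on S g" "x : S" "g x : T"
	shows "fd (%y. f (g y)) x v = fd f (g x) (fd g x v)"
	by (intro fd_compose) (use assms smooth_on_differentiable in blast)+

lemma fd_add: "f differentiable (at x) ==> g differentiable (at x) ==>
		fd (%x. f x + g x) x v = fd f x v + fd g x v"
	by (intro fun_cong[OF fd_eqI] has_derivative_add) (auto simp: frechet_derivative_works)

lemma fd_diff: "f differentiable (at x) ==> g differentiable (at x) ==>
		fd (%x. f x - g x) x v = fd f x v - fd g x v"
	by (intro fun_cong[OF fd_eqI] has_derivative_diff) (auto simp: frechet_derivative_works)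

lemma fd_minus: "f differentiable (at x) ==> fd (%x. - f x) x v = - fd f x v"
	by (intro fun_cong[OF fd_eqI] has_derivative_minus) (auto simp: frechet_derivative_works)

lemma fd_mult:
	fixes f g :: "'a::euclidean_space => real"
	shows "f differentiable (at x) ==> g differentiable (at x) ==>
		fd (%x. f x * g x) x v = f x * fd g x v + fd f x v * g x"
	by (intro fun_cong[OF fd_eqI] has_derivative_mult) (auto simp: frechet_derivative_works)

lemma fd_cmult:
	fixes f :: "'a::euclidean_space => real"
	shows "f differentiable (at x) ==> fd (%x. c * f x) x v = c * fd f x v"
	using fd_mult[of "%x. c" x f v] by simp

lemma fd_linear: "linear f ==> fd f x = f"
	by (intro fd_eqI linear_imp_has_derivative)

text \<open>The integrand has this general shape because differentiating in x reproduces it, with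
  weight \<open>\<kappa> t * b t\<close> and with \<open>fd f\<close> in a fixed direction in place
  of \<open>f\<close>; smoothness then follows by induction. It covers translations along a line
  (\<open>b t = 1\<close>), line integrals through a projection \<open>B\<close>, and the radial
  integrals of the Poincare lemma (\<open>b t = t\<close>).\<close>

lemma smooth_on_integral:
	fixes f :: "'b::euclidean_space => 'c::euclidean_space" and B :: "'a::euclidean_space => 'b"
		and \<kappa> b :: "real => real" and c :: "real => 'b"
	assumes "open U" "open S" and f: "smooth_on S f" and B: "linear B"
		and c1: "continuous_on {l..r} \<kappa>" and c2: "continuous_on {l..r} b" and c3: "continuous_on {l..r} c"
		and inS: "!!x t. x : U ==> t : {l..r} ==> c t + b t *R B x : S"
	shows has_derivative_parameter_integral: "!!x. x : U ==>
			((%x. integral {l..r} (%t. \<kappa> t *R f (c t + b t *R B x))) has_derivative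
				(%v. integral {l..r} (%t. (\<kappa> t * b t) *R fd f (c t + b t *R B x) (B v)))) (at x)"
		and smooth_on_parameter_integral:
			"smooth_on U (%x. integral {l..r} (%t. \<kappa> t *R f (c t + b t *R B x)))"
proof -
	have bB: "bounded_linear B" using B linear_conv_bounded_linear by blast
	have cont: "continuous_on (U' \<times> {l..r}) (%(x,t). k t *R g (c t + b t *R B x))"
		if "smooth_on S g" "continuous_on {l..r} k" "U' <= U" for g :: "'b => 'c" and k :: "real => real" and U'
	proof -
		have 1: "continuous_on (U' \<times> {l..r}) (%p. c (snd p) + b (snd p) *R B (fst p))"
			by (intro continuous_intros bounded_linear.continuous_on[OF bB]
					continuous_on_compose2[OF c2] continuous_on_compose2[OF c3]) auto
		have 2: "continuous_on (U' \<times> {l..r}) (%p. g (c (snd p) + b (snd p) *R B (fst p)))"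
			by (rule continuous_on_compose2[OF smooth_on_continuous[OF that(1)] 1]) (use inS that(3) in auto)
		have 3: "continuous_on (U' \<times> {l..r}) (%p. k (snd p) *R g (c (snd p) + b (snd p) *R B (fst p)))"
			by (intro continuous_on_scaleR 2 continuous_on_compose2[OF that(2)] continuous_intros) auto
		then show ?thesis by (simp add: case_prod_beta')
	qed
	have cont1: "continuous_on {l..r} (%t. k t *R g (c t + b t *R B x))"
		if "smooth_on S g" "continuous_on {l..r} k" "x : U" for g :: "'b => 'c" and k :: "real => real" and x
	proof -
		have "continuous_on {l..r} (%t. case (x, t) of (x,t) => k t *R g (c t + b t *R B x))"
			by (rule continuous_on_compose2[OF cont[OF that(1,2), of "{x}"]]) (use that(3) in \<open>auto intro!: continuous_intros\<close>)
		then show ?thesis by simp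
	qed
	have der: "((%x. integral {l..r} (%t. k t *R g (c t + b t *R B x))) has_derivative
				(%v. integral {l..r} (%t. (k t * b t) *R fd g (c t + b t *R B x) (B v)))) (at x)"
		if x: "x : U" and g: "smooth_on S g" and k: "continuous_on {l..r} k"
		for x and g :: "'b => 'c" and k :: "real => real"
	proof -
		obtain e where e: "e > 0" "ball x e <= U" using x assms(1) open_contains_ball by blast
		\<comment> \<open>Leibniz' rule wants the derivative as a map into bounded linear operators; its
		  joint continuity is checked on basis vectors.\<close>
		define D where "D = (%y t. Blinfun (%v. (k t * b t) *R fd g (c t + b t *R B y) (B v)))"
		have bl: "bounded_linear (%v. (k t * b t) *R fd g (c t + b t *R B y) (B v))"
			if "y : U" "t : {l..r}" for y t
			by (intro bounded_linear_scaleR_right[THEN bounded_linear_compose] bounded_linear_compose[OF _ bB])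
				 (use smooth_on_linear_fd[OF g inS[OF that]] linear_conv_bounded_linear in blast)
		have Dapp: "blinfun_apply (D y t) v = (k t * b t) *R fd g (c t + b t *R B y) (B v)"
			if "y : U" "t : {l..r}" for y t v
			unfolding D_def using bounded_linear_Blinfun_apply[OF bl[OF that]] by simp
		have "((%x. integral (cbox l r) (%t. k t *R g (c t + b t *R B x))) has_derivative
				blinfun_apply (integral (cbox l r) (D x))) (at x within ball x e)"
		proof (rule leibniz_rule)
			fix y t assume y: "y : ball x e" and t: "t : cbox l r"
			have yU: "y : U" and t': "t : {l..r}" using y t e by auto
			have "((%y. c t + b t *R B y) has_derivative (%v. b t *R B v)) (at y)"
				using has_derivative_add[OF has_derivative_const[of "c t"]
						has_derivative_scaleR_right[OF bounded_linear.has_derivative[OF bB has_derivative_ident]]] by simp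
			from diff_chain_at[OF this smooth_on_has_derivative[OF g inS[OF yU t']]]
			have "((%y. g (c t + b t *R B y)) has_derivative (%v. fd g (c t + b t *R B y) (b t *R B v))) (at y)"
				by (simp add: o_def)
			then have "((%y. k t *R g (c t + b t *R B y)) has_derivative
					(%v. k t *R fd g (c t + b t *R B y) (b t *R B v))) (at y)"
				by (intro derivative_intros)
			moreover have "(%v. k t *R fd g (c t + b t *R B y) (b t *R B v)) = blinfun_apply (D y t)"
				using linear_scale[OF smooth_on_linear_fd[OF g inS[OF yU t']]] Dapp[OF yU t'] by auto
			ultimately show "((%y. k t *R g (c t + b t *R B y)) has_derivative blinfun_apply (D y t)) (at y within ball x e)"
				by (simp add: has_derivative_at_withinI)
		next
			fix y assume "y : ball x e"
			then show "(%t. k t *R g (c t + b t *R B y)) integrable_on cbox l r"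
				using cont1[OF g k] e by (intro integrable_continuous) auto
		next
			show "continuous_on (ball x e \<times> cbox l r) (%(y, t). D y t)"
			proof (rule continuous_on_blinfun_componentwise)
				fix i :: 'a assume "i : Basis"
				have "continuous_on (ball x e \<times> {l..r}) (%(y,t). (k t * b t) *R fd g (c t + b t *R B y) (B i))"
					using cont[OF smooth_on_fd[OF g] continuous_on_mult[OF k c2] e(2), of "B i"] by simp
				then show "continuous_on (ball x e \<times> cbox l r) (%p. blinfun_apply (case p of (y, t) => D y t) i)"
					unfolding box_real by (rule continuous_on_eq) (use e Dapp in auto)
			qed
		qed (use e in auto)
		moreover have "blinfun_apply (integral (cbox l r) (D x))
				= (%v. integral {l..r} (%t. (k t * b t) *R fd g (c t + b t *R B x) (B v)))"
		proof
			fix v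
			have "D x integrable_on cbox l r"
			proof (rule integrable_continuous, rule continuous_on_blinfun_componentwise)
				fix i :: 'a assume "i : Basis"
				have "continuous_on {l..r} (%t. (k t * b t) *R fd g (c t + b t *R B x) (B i))"
					using cont1[OF smooth_on_fd[OF g] continuous_on_mult[OF k c2] x, of "B i"] by simp
				then show "continuous_on (cbox l r) (%t. blinfun_apply (D x t) i)"
					unfolding box_real by (rule continuous_on_eq)
						 (use x Dapp in auto)
			qed
			then have "blinfun_apply (integral (cbox l r) (D x)) v = integral (cbox l r) (%t. blinfun_apply (D x t) v)"
				by (rule blinfun_apply_integral)
			also have "... = integral {l..r} (%t. (k t * b t) *R fd g (c t + b t *R B x) (B v))"
				using Dapp[OF x] by (auto intro!: integral_cong)
			finally show "blinfun_apply (integral (cbox l r) (D x)) v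
				= integral {l..r} (%t. (k t * b t) *R fd g (c t + b t *R B x) (B v))" .
		qed
		ultimately have "((%x. integral (cbox l r) (%t. k t *R g (c t + b t *R B x))) has_derivative
				(%v. integral {l..r} (%t. (k t * b t) *R fd g (c t + b t *R B x) (B v)))) (at x within ball x e)"
			by simp
		then show ?thesis
			using e at_within_open[of x "ball x e"] by simp
	qed
	show "((%x. integral {l..r} (%t. \<kappa> t *R f (c t + b t *R B x))) has_derivative
				(%v. integral {l..r} (%t. (\<kappa> t * b t) *R fd f (c t + b t *R B x) (B v)))) (at x)"
		if "x : U" for x by (rule der[OF that f c1])
	have "Ck_on k U (%x. integral {l..r} (%t. \<kappa> t *R f (c t + b t *R B x)))" for k
		using f c1
	proof (induction k arbitrary: f \<kappa>)
		case 0
		then show ?case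
			using der[OF _ 0] by (auto intro!: continuous_at_imp_continuous_on has_derivative_continuous)
	next
		case (Suc k)
		show ?case
			by (subst Ck_on_Suc_iff[OF assms(1) der[OF _ Suc.prems]])
				 (auto intro!: Suc.IH smooth_on_fd Suc.prems continuous_on_mult c2)
	qed
	then show "smooth_on U (%x. integral {l..r} (%t. \<kappa> t *R f (c t + b t *R B x)))"
		by (simp add: smooth_on_def)
qed

lemma FTC_line:
	fixes f :: "'a::euclidean_space => real"
	assumes "smooth_on S f" "a <= b" "!!t. t : {a..b} ==> x + t *R u : S"
	shows "((%t. fd f (x + t *R u) u) has_integral (f (x + b *R u) - f (x + a *R u))) {a..b}"
proof (rule fundamental_theorem_of_calculus[OF assms(2)])
	fix t assume t: "t : {a..b}"
	have "((%t. x + t *R u) has_derivative (%s. s *R u)) (at t)"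
		using has_derivative_add[OF has_derivative_const[of x] has_derivative_scaleR_left[OF has_derivative_ident]] by simp
	from diff_chain_at[OF this smooth_on_has_derivative[OF assms(1) assms(3)[OF t]]]
	have "((%t. f (x + t *R u)) has_derivative (%s. fd f (x + t *R u) (s *R u))) (at t)"
		by (simp add: o_def)
	then show "((%t. f (x + t *R u)) has_vector_derivative fd f (x + t *R u) u) (at t within {a..b})"
		unfolding has_vector_derivative_def
		using linear_scale[OF smooth_on_linear_fd[OF assms(1) assms(3)[OF t]]]
		by (auto intro: has_derivative_at_withinI)
qed

text \<open>Both sides are the derivative at \<open>s = 0\<close> of
	\<open>D\<^sub>v f(x + su) = D\<^sub>v f(x) + \<integral>\<^sub>0\<^sup>s D\<^sub>v D\<^sub>u f(x + tu) dt\<close>.\<close>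

lemma fd_commute:
	fixes f :: "'a::euclidean_space => real"
	assumes "open S" "smooth_on S f" "x : S"
	shows "fd (%y. fd f y v) x u = fd (%y. fd f y u) x v"
proof -
	obtain e where e: "e > 0" "ball x e <= S" using assms open_contains_ball by blast
	\<comment> \<open>Segments in direction u with parameter at most r that start in the ball of radius
	  e/2 stay in the ball of radius e; the summand 1 covers u = 0.\<close>
	define r where "r = e / (2 * (norm u + 1))"
	have r: "r > 0" using e by (auto simp: r_def add_nonneg_pos)
	have inS: "y + t *R u : S" if "y : ball x (e/2)" "t : {0..r}" for y t
	proof -
		have "norm (t *R u) <= r * norm u" using that by (auto intro: mult_right_mono)
		also have "... < r * (norm u + 1)" using r by simp
		also have "... = e/2" unfolding r_def by (simp add: add_nonneg_pos field_simps add_nonneg_eq_0_iff)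
		finally have "norm (t *R u) < e/2" .
		moreover have "norm (x - y) < e/2" using that by (simp add: dist_norm)
		ultimately have "norm (x - y - t *R u) < e" using norm_triangle_ineq4[of "x-y" "t *R u"] by linarith
		then show ?thesis using e by (auto simp: dist_norm algebra_simps)
	qed
	define U where "U = ball x (e/2)"
	have U: "open U" "x : U" using e by (auto simp: U_def)
	define g where "g = (%y. fd f y u)"
	have g: "smooth_on S g" unfolding g_def by (rule smooth_on_fd[OF assms(2)])
	have eq: "fd f (x + s *R u) v = fd f x v + integral {0..s} (%t. fd g (x + t *R u) v)"
		if s: "s : {0..r}" for s
	proof -
		have "f (y + s *R u) = f y + integral {0..s} (%t. 1 *R g (t *R u + 1 *R y))" if "y : U" for y
			using integral_unique[OF FTC_line[OF assms(2), of 0 s y u]] s inS that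
			by (auto simp: U_def g_def add.commute)
		then have "fd (%y. f (y + s *R u)) x v = fd (%y. f y + integral {0..s} (%t. 1 *R g (t *R u + 1 *R y))) x v"
			by (intro fun_cong[OF fd_cong[OF U]])
		also have "... = fd f x v + integral {0..s} (%t. (1 * 1) *R fd g (t *R u + 1 *R x) v)"
			by (intro fun_cong[OF fd_eqI] has_derivative_add smooth_on_has_derivative[OF assms(2,3)]
					has_derivative_parameter_integral[OF U(1) assms(1) g, where B="%x. x"])
				 (use inS s U in \<open>auto simp: U_def add.commute intro!: continuous_intros linear_ident\<close>)
		also have "fd (%y. f (y + s *R u)) x v = fd f (x + s *R u) v"
		proof -
			have "((%y. y + s *R u) has_derivative (%v. v)) (at x)"
				using has_derivative_add[OF has_derivative_ident has_derivative_const[of "s *R u"]] by simp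
			moreover have "x + s *R u : S" using inS s U unfolding U_def by blast
			ultimately have "((%y. f (y + s *R u)) has_derivative fd f (x + s *R u)) (at x)"
				using diff_chain_at[of "%y. y + s *R u" "%v. v" x f] smooth_on_has_derivative[OF assms(2)]
				by (auto simp: o_def)
			then show ?thesis using fd_eqI by metis
		qed
		finally show ?thesis by (simp add: add.commute)
	qed
	have "((%s. fd f (x + s *R u) v) has_vector_derivative fd (%y. fd f y v) x u) (at 0 within {0..r})"
	proof -
		have "((%t. x + t *R u) has_derivative (%s. s *R u)) (at 0)"
			using has_derivative_add[OF has_derivative_const[of x] has_derivative_scaleR_left[OF has_derivative_ident]] by simp
		moreover have "((%y. fd f y v) has_derivative fd (%y. fd f y v) x) (at (x + 0 *R u))"
			using smooth_on_has_derivative[OF smooth_on_fd[OF assms(2)] assms(3)] by simp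
		ultimately have "((%t. fd f (x + t *R u) v) has_derivative (%s. fd (%y. fd f y v) x (s *R u))) (at 0)"
			using diff_chain_at[of "%t. x + t *R u" "%s. s *R u" 0 "%y. fd f y v"] by (simp add: o_def)
		then show ?thesis
			unfolding has_vector_derivative_def
			using linear_scale[OF smooth_on_linear_fd[OF smooth_on_fd[OF assms(2)] assms(3)]]
			by (auto intro: has_derivative_at_withinI)
	qed
	moreover have "((%s. fd f (x + s *R u) v) has_vector_derivative fd g x v) (at 0 within {0..r})"
	proof -
		have c: "continuous_on {0..r} (%t. fd g (x + t *R u) v)"
			by (rule continuous_on_compose2[OF smooth_on_continuous[OF smooth_on_fd[OF g]]])
				 (use inS U in \<open>auto simp: U_def intro!: continuous_intros\<close>)
		have "((%s. fd f x v + integral {0..s} (%t. fd g (x + t *R u) v)) has_vector_derivative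
				0 + fd g (x + 0 *R u) v) (at 0 within {0..r})"
			by (intro has_vector_derivative_add has_vector_derivative_const integral_has_vector_derivative c)
				 (use r in auto)
		then have "((%s. fd f x v + integral {0..s} (%t. fd g (x + t *R u) v)) has_vector_derivative
				fd g x v) (at 0 within {0..r})"
			by simp
		then show ?thesis
			by (rule has_vector_derivative_transform[rotated 2]) (use eq r in auto)
	qed
	ultimately show ?thesis
		using vector_derivative_unique_within_closed_interval[of 0 r 0] r unfolding g_def by auto
qed

text \<open>\<open>flat n\<close> runs through the functions occurring in the derivatives of \<open>exp(-1/x)\<close>.\<close>

definition flat :: "nat => real => real" where
	"flat n x = (if x > 0 then exp (- inverse x) * inverse x ^ n else 0)"

lemma flat_tendsto_0: "(flat n \<longlongrightarrow> 0) (at 0)"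
proof -
	have "((%y. y ^ n / exp y) \<longlongrightarrow> (0::real)) at_top" by (rule tendsto_power_div_exp_0)
	then have "((%x. inverse x ^ n / exp (inverse x)) \<longlongrightarrow> (0::real)) (at_right 0)"
		by (rule filterlim_compose) (rule filterlim_inverse_at_top_right)
	then have "(flat n \<longlongrightarrow> 0) (at_right 0)"
		by (rule Lim_transform_eventually)
			 (auto simp: eventually_at_filter flat_def exp_minus field_simps)
	moreover have "(flat n \<longlongrightarrow> 0) (at_left 0)"
		by (rule Lim_transform_eventually[OF tendsto_const]) (auto simp: eventually_at_filter flat_def)
	ultimately show ?thesis by (simp add: filterlim_split_at)
qed

text \<open>Differentiation stays inside the family, raising the exponent by at most 2. At 0 the
  difference quotient of \<open>flat n\<close> is \<open>flat (Suc n)\<close>, which tends to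
  0.\<close>

lemma flat_has_derivative:
	"(flat n has_real_derivative (flat (n + 2) x - real n * flat (Suc n) x)) (at x)"
proof (cases x "0::real" rule: linorder_cases)
	case greater
	have "((%x. exp (- inverse x) * inverse x ^ n) has_real_derivative
			(flat (n + 2) x - real n * flat (Suc n) x)) (at x)"
	proof (cases n)
		case (Suc m)
		have d: "(inverse has_real_derivative - (inverse x * inverse x)) (at x)"
			using DERIV_inverse[of x UNIV] greater by (simp add: power2_eq_square)
		have "((%x. exp (- inverse x) * inverse x ^ n) has_real_derivative
				exp (- inverse x) * (real n * (inverse x ^ m * (- (inverse x * inverse x)))) +
				(exp (- inverse x) * (inverse x * inverse x)) * inverse x ^ n) (at x)"
			using DERIV_mult'[OF DERIV_fun_exp[OF DERIV_minus[OF d]] DERIV_power[OF d, of n]] Suc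
			by (simp add: mult_ac)
		moreover have "exp (- inverse x) * (real n * (inverse x ^ m * (- (inverse x * inverse x)))) +
				(exp (- inverse x) * (inverse x * inverse x)) * inverse x ^ n
				= flat (n + 2) x - real n * flat (Suc n) x"
			using greater Suc by (simp add: flat_def algebra_simps)
		ultimately show ?thesis by simp
	qed (use greater in \<open>auto intro!: derivative_eq_intros simp: flat_def power2_eq_square\<close>)
	then show ?thesis
		by (rule has_field_derivative_transform_within_open[of _ _ _ "{0<..}"])
			 (use greater in \<open>auto simp: flat_def\<close>)
next
	case less
	have "((%x. 0) has_real_derivative 0) (at x)" by simp
	then have "(flat n has_real_derivative 0) (at x)"
		by (rule has_field_derivative_transform_within_open[of _ _ _ "{..<0}"])
			 (use less in \<open>auto simp: flat_def\<close>)
	then show ?thesis using less by (simp add: flat_def)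
next
	case equal
	have "((%h. (flat n (0 + h) - flat n 0) / h) \<longlongrightarrow> 0) (at 0)"
		by (rule Lim_transform_eventually[OF flat_tendsto_0[of "Suc n"]])
			 (auto simp: eventually_at_filter flat_def divide_inverse mult_ac)
	then have "(flat n has_real_derivative 0) (at 0)" by (simp add: DERIV_def)
	then show ?thesis using equal by (simp add: flat_def)
qed

lemma smooth_flat: "smooth_on UNIV (flat n)"
	unfolding smooth_on_def
proof
	fix k show "Ck_on k UNIV (flat n)"
	proof (induction k arbitrary: n)
		case 0
		then show ?case
			using flat_has_derivative[THEN DERIV_isCont] by (simp add: continuous_at_imp_continuous_on)
	next
		case (Suc k)
		have d: "(flat n has_derivative (%v. (flat (n + 2) x + (- real n) *R flat (Suc n) x) *R v)) (at x)" for x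
			using flat_has_derivative[of n x] by (simp add: has_field_derivative_def)
		show ?case
			by (subst Ck_on_Suc_iff[OF open_UNIV d])
				 (intro allI Ck_on_scaleR Ck_on_add Ck_on_const Suc open_UNIV)
	qed
qed

text \<open>The unnormalised standard mollifier exp(-1/(r^2 - |x - a|^2)), positive exactly on the
  open ball.\<close>

definition ball_bump :: "'a::euclidean_space => real => 'a => real" where
	"ball_bump a r x = flat 0 (r\<^sup>2 - (x - a) \<bullet> (x - a))"

lemma smooth_ball_bump: "smooth_on UNIV (ball_bump a r)"
proof -
	have "smooth_on UNIV (%x::'a. r\<^sup>2 - (\<Sum>b\<in>Basis. ((x - a) \<bullet> b) * ((x - a) \<bullet> b)))"
		by (intro smooth_on_diff smooth_on_sum smooth_on_mult smooth_on_inner_const smooth_on_const smooth_on_ident open_UNIV)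
	then have "smooth_on UNIV (%x::'a. r\<^sup>2 - (x - a) \<bullet> (x - a))"
		by (simp only: euclidean_inner[symmetric])
	then show ?thesis
		unfolding ball_bump_def[abs_def] by (intro smooth_on_compose_UNIV[OF open_UNIV smooth_flat])
qed

lemma ball_bump_nonneg: "0 <= ball_bump a r x"
	by (simp add: ball_bump_def flat_def)

lemma ball_bump_pos_iff: "0 < r ==> 0 < ball_bump a r x \<longleftrightarrow> x : ball a r"
proof -
	assume r: "0 < r"
	have "0 < ball_bump a r x \<longleftrightarrow> (norm (x - a))\<^sup>2 < r\<^sup>2"
		by (simp add: ball_bump_def flat_def power2_norm_eq_inner)
	also have "... \<longleftrightarrow> norm (x - a) < r"
		using r by (meson norm_ge_zero power2_less_imp_less power_strict_mono less_imp_le zero_less_numeral)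
	finally show ?thesis by (simp add: dist_norm norm_minus_commute)
qed

lemma ball_bump_eq_0_iff: "0 < r ==> ball_bump a r x = 0 \<longleftrightarrow> x ~: ball a r"
	using ball_bump_pos_iff[of r a x] ball_bump_nonneg[of a r x] by linarith

section \<open>Compactly supported functions on \<open>real ^ 3\<close>\<close>

text \<open>Cubes rather than balls: the line integrals used below do not enlarge such supports, and
  a vertical translation by s enlarges the radius by at most |s|.\<close>

definition ccube :: "real => (real ^ 3) set" where
	"ccube r = {x. \<forall>i. \<bar>x $ i\<bar> <= r}"

definition ocube :: "real => (real ^ 3) set" where
	"ocube r = {x. \<forall>i. \<bar>x $ i\<bar> < r}"

lemma ccube_cbox: "ccube r = cbox (\<chi> i. - r) (\<chi> i. r)"
	by (auto simp: ccube_def mem_box_cart abs_le_iff minus_le_iff)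

lemma ocube_box: "ocube r = box (\<chi> i. - r) (\<chi> i. r)"
	by (auto simp: ocube_def mem_box_cart abs_less_iff minus_less_iff)

lemma compact_ccube: "compact (ccube r)" and closed_ccube: "closed (ccube r)"
	by (simp_all add: ccube_cbox closed_cbox compact_cbox)

lemma open_ocube: "open (ocube r)"
	by (simp add: ocube_box open_box)

lemma ccube_mono: "r <= s ==> ccube r <= ccube s"
	by (auto simp: ccube_def intro: order_trans)

lemma ccube_subset_ocube: "r < s ==> ccube r <= ocube s"
	by (auto simp: ccube_def ocube_def intro: le_less_trans)

lemma not_ccubeE:
	assumes "x ~: ccube r" obtains i where "r < \<bar>x $ i\<bar>"
	using assms by (auto simp: ccube_def not_le)

lemma ocube_subset_ccube: "ocube r <= ccube r"
	by (auto simp: ccube_def ocube_def intro: less_imp_le)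

text \<open>The maximum norm attains its supremum on \<open>K\<close>. The gap between
  \<open>s\<close> and \<open>r\<close> is later the room in which densities are translated without
  leaving the chart.\<close>

lemma compact_subset_ccube:
	assumes "compact K" "K <= ocube r" "0 < r"
	obtains s where "0 < s" "s < r" "K <= ccube s"
proof (cases "K = {}")
	case True
	then show ?thesis using that[of "r/2"] assms by auto
next
	case False
	have "continuous_on K (%x. Max ((%i. \<bar>x $ i\<bar>) ` UNIV))"
	proof -
		have "(%x::real^3. Max ((%i. \<bar>x $ i\<bar>) ` UNIV)) = (%x. max \<bar>x $ 1\<bar> (max \<bar>x $ 2\<bar> \<bar>x $ 3\<bar>))"
			by (auto simp: UNIV_3 max.assoc)
		then show ?thesis by (simp only:) (intro continuous_intros)
	qed
	then obtain x where x: "x : K" "!!y. y : K ==> Max ((%i. \<bar>y $ i\<bar>) ` UNIV) <= Max ((%i. \<bar>x $ i\<bar>) ` UNIV)"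
		using continuous_attains_sup[OF assms(1) False] by metis
	define s where "s = Max ((%i. \<bar>x $ i\<bar>) ` UNIV)"
	have "s < r" using x(1) assms(2) by (auto simp: s_def ocube_def)
	moreover have "K <= ccube s"
		using x(2) by (auto simp: ccube_def s_def)
	\<comment> \<open>The supremum is 0 if K is the origin; the maximum with r/2 keeps the radius
	  positive.\<close>
	ultimately show ?thesis
		using that[of "max s (r/2)"] assms(3) ccube_mono[of s "max s (r/2)"] by auto
qed

definition cc :: "real => (real ^ 3 => real) => bool" where
	"cc r f \<longleftrightarrow> continuous_on UNIV f & (\<forall>x. x ~: ccube r --> f x = 0)"

text \<open>The radius is explicit in order to control how far operators spread supports. The
  functions live on the whole space, so that integrals can be taken over \<open>UNIV\<close> and
  translated freely.\<close>

definition test :: "real => (real ^ 3 => real) => bool" where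
	"test r f \<longleftrightarrow> smooth_on UNIV f & (\<forall>x. x ~: ccube r --> f x = 0)"

lemma test_cc: "test r f ==> cc r f"
	by (simp add: test_def cc_def smooth_on_continuous)

lemma test_smooth: "test r f ==> smooth_on UNIV f"
	by (simp add: test_def)

lemma cc_mono: "cc r f ==> r <= s ==> cc s f"
	using ccube_mono by (auto simp: cc_def)

lemma test_mono: "test r f ==> r <= s ==> test s f"
	using ccube_mono by (auto simp: test_def)

lemma test_differentiable: "test r f ==> f differentiable (at x)"
	using smooth_on_differentiable[of UNIV f] by (simp add: test_def)

lemma cc_integrable: "cc r f ==> f integrable_on UNIV"
	by (rule integrable_on_superset[of f "ccube r"])
		 (auto simp: cc_def ccube_cbox intro!: integrable_continuous intro: continuous_on_subset)

lemma cc_abs_integrable: "cc r f ==> f absolutely_integrable_on UNIV"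
	using cc_integrable[of r f] cc_integrable[of r "%x. \<bar>f x\<bar>"]
	by (auto simp: cc_def absolutely_integrable_on_def intro: continuous_on_rabs)

lemma cc_integral_cbox:
	assumes "cc r f" "ccube r <= S"
	shows "integral S f = integral UNIV f"
proof -
	have "(f has_integral integral (ccube r) f) (ccube r)"
		using assms by (auto simp: cc_def ccube_cbox intro!: integrable_integral integrable_continuous intro: continuous_on_subset)
	then have "(f has_integral integral (ccube r) f) S" "(f has_integral integral (ccube r) f) UNIV"
		using assms has_integral_on_superset[of f _ "ccube r"] by (auto simp: cc_def)
	then show ?thesis by (metis integral_unique)
qed

lemma cc_integral_eq_ccube: "cc r f ==> integral UNIV f = integral (ccube r) f"
	using cc_integral_cbox[of r f "ccube r"] by simp

lemma cc_mult: "cc r f ==> continuous_on UNIV h ==> cc r (%x. f x * h x)"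
	by (auto simp: cc_def intro: continuous_on_mult)

lemma test_mult: "test r f ==> smooth_on UNIV h ==> test r (%x. f x * h x)"
	by (auto simp: test_def intro: smooth_on_mult)

lemma test_add: "test r f ==> test r g ==> test r (%x. f x + g x)"
	by (auto simp: test_def intro: smooth_on_add)

lemma test_diff: "test r f ==> test r g ==> test r (%x. f x - g x)"
	by (auto simp: test_def intro: smooth_on_diff)

lemma test_minus: "test r f ==> test r (%x. - f x)"
	by (auto simp: test_def intro: smooth_on_minus)

lemma test_cmult: "test r f ==> test r (%x. c * f x)"
	using smooth_on_mult[of UNIV "%x. c" f] by (auto simp: test_def)

lemma test_zero [simp]: "test r (%x. 0)"
	by (simp add: test_def)

lemma test_sum: "(!!i. i : I ==> test r (f i)) ==> test r (%x. \<Sum>i\<in>I. f i x)"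
	by (induction I rule: infinite_finite_induct) (auto intro: test_add)

lemma test_fd:
	assumes "test r f" shows "test r (%x. fd f x v)"
proof -
	have "fd f x v = 0" if "x ~: ccube r" for x
	proof -
		have "fd f x = fd (%x. 0) x"
			by (rule fd_cong[of "- ccube r"]) (use that assms closed_ccube in \<open>auto simp: test_def\<close>)
		then show ?thesis by simp
	qed
	then show ?thesis using assms smooth_on_fd by (auto simp: test_def)
qed

lemma cc_shift:
	assumes "cc r f" "!!i. \<bar>c $ i\<bar> <= s"
	shows "cc (r + s) (%x. f (x + c))"
proof -
	have "f (x + c) = 0" if "x ~: ccube (r + s)" for x
	proof -
		obtain i where i: "\<bar>x $ i\<bar> > r + s" using \<open>x ~: ccube (r + s)\<close> not_ccubeE by blast
		have "\<bar>x $ i + c $ i\<bar> > r" using assms(2)[of i] i by linarith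
		then have "\<bar>(x + c) $ i\<bar> > r" by simp
		then show ?thesis using assms(1) unfolding cc_def ccube_def by (metis (mono_tags, lifting) mem_Collect_eq not_less)
	qed
	moreover have "continuous_on UNIV (%x. f (x + c))"
		using assms(1) by (auto simp: cc_def intro!: continuous_on_compose2[of UNIV f UNIV "%x. x + c"] continuous_intros)
	ultimately show ?thesis by (simp add: cc_def)
qed

lemma test_shift:
	assumes "test r f" "!!i. \<bar>c $ i\<bar> <= s"
	shows "test (r + s) (%x. f (x + c))"
proof -
	have "smooth_on UNIV (%x. f (x + c))"
		using assms(1)
		by (auto simp: test_def intro!: smooth_on_compose_UNIV[of UNIV f "%x. x + c"] smooth_on_add)
	then show ?thesis using cc_shift[OF test_cc[OF assms(1)] assms(2)] by (simp add: test_def cc_def)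
qed

lemma integral_shift_UNIV:
	assumes "cc r f" shows "integral UNIV (%x. f (x + c)) = integral UNIV f"
proof -
	define s where "s = norm c"
	have s: "\<bar>c $ i\<bar> <= s" for i by (simp add: s_def component_le_norm_cart)
	have "integral UNIV (%x. f (x + c)) = integral (ccube (r + s)) (%x. f (x + c))"
		by (rule cc_integral_eq_ccube[OF cc_shift[OF assms s]])
	also have "... = integral (cbox ((\<chi> i. - (r + s)) + c) ((\<chi> i. r + s) + c)) f"
		unfolding ccube_cbox using integral_shift_cbox_plus[of _ _ f c] by (simp add: o_def add.commute[of c])
	also have "... = integral UNIV f"
	proof (rule cc_integral_cbox[OF assms])
		have "- (r + s) + c $ i <= y" if "- r <= y" for i y using s[of i] that by linarith
		moreover have "y <= r + s + c $ i" if "y <= r" for i y using s[of i] that by linarith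
		ultimately show "ccube r <= cbox ((\<chi> i. - (r + s)) + c) ((\<chi> i. r + s) + c)"
			by (auto simp: ccube_cbox mem_box_cart)
	qed
	finally show ?thesis .
qed

lemma integral_nonneg_eq_0:
	assumes "cc r f" "!!x. 0 <= f x" "integral UNIV f = 0"
	shows "f x = 0"
proof -
	\<comment> \<open>The cube of radius \<open>r\<close> may be empty or a point. The enlarged one is
	  a box with interior, on which a continuous nonnegative function of integral zero
	  vanishes.\<close>
	define s where "s = max r 1"
	have s: "cc s f" "s > 0" using cc_mono[OF assms(1)] by (auto simp: s_def)
	have "integral (cbox (\<chi> i. - s) (\<chi> i. s)) f = 0"
		using cc_integral_eq_ccube[OF s(1)] assms(3) by (simp add: ccube_cbox)
	moreover have "box (\<chi> i. - s) (\<chi> i. s) ~= ({} :: (real^3) set)"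
		using s(2) by (auto simp: box_ne_empty inner_axis Basis_vec_def)
	moreover have "continuous_on (cbox (\<chi> i. - s) (\<chi> i. s)) f"
		using s(1) by (auto simp: cc_def intro: continuous_on_subset)
	ultimately have "\<forall>x\<in>cbox (\<chi> i. - s) (\<chi> i. s). f x = 0"
		using assms(2) by (subst (asm) integral_cbox_eq_0_iff) auto
	then show ?thesis using s(1) by (auto simp: cc_def ccube_cbox)
qed

lemma integral_pos:
	assumes "cc r f" "!!x. 0 <= f x" "f x > 0"
	shows "0 < integral UNIV f"
	using integral_nonneg_eq_0[OF assms(1,2), of x] assms(2,3) integral_nonneg[OF cc_integrable[OF assms(1)]]
	by (metis UNIV_I less_eq_real_def order_less_irrefl)

text \<open>Average \<open>f(x + tv)\<close> over \<open>t \<in> {0..1}\<close>: by translation invariance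
	\<open>\<integral>D\<^sub>v f = \<integral>f(x + v) - \<integral>f(x) = 0\<close>.\<close>

lemma integral_fd_eq_0:
	assumes "test r f" shows "integral UNIV (%x. fd f x v) = 0"
proof -
	define s where "s = norm v"
	have s: "\<bar>(t *R v) $ i\<bar> <= s" if "t : {0..1}" for i t
	proof -
		have "\<bar>(t *R v) $ i\<bar> <= norm (t *R v)" by (rule component_le_norm_cart)
		also have "... <= 1 * norm v" using that unfolding norm_scaleR by (intro mult_right_mono) auto
		finally show ?thesis by (simp add: s_def)
	qed
	have D: "cc r (%x. fd f x v)" using test_cc[OF test_fd[OF assms]] .
	have c: "continuous_on UNIV (%x. fd f x v)" using D by (simp add: cc_def)
	have "integral UNIV (%x. fd f x v) = integral {0..1} (%t::real. integral UNIV (%x. fd f x v))"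
		by simp
	also have "... = integral {0..1} (%t. integral (ccube (r + s)) (%x. fd f (x + t *R v) v))"
		using integral_shift_UNIV[OF D] cc_integral_eq_ccube[OF cc_shift[OF D s]]
		by (intro integral_cong) metis
	also have "... = integral (ccube (r + s)) (%x. integral {0..1} (%t. fd f (x + t *R v) v))"
	proof -
		have "continuous_on UNIV (%p::real \<times> (real^3). fd f (snd p + fst p *R v) v)"
			by (rule continuous_on_compose2[OF c]) (auto intro!: continuous_intros)
		then have "continuous_on (cbox (0, \<chi> i. - (r+s)) (1, \<chi> i. r + s)) (%(t, x). fd f (x + t *R v) v)"
			by (auto simp: case_prod_beta' intro: continuous_on_subset)
		from integral_swap_continuous[OF this] show ?thesis by (simp add: ccube_cbox)
	qed
	also have "... = integral (ccube (r + s)) (%x. f (x + v) - f x)"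
		using integral_unique[OF FTC_line[of UNIV f 0 1 _ v]] assms
		by (intro integral_cong) (auto simp: test_def)
	also have "... = integral UNIV (%x. f (x + v) - f x)"
	proof (rule cc_integral_eq_ccube[symmetric])
		have s0: "0 <= s" by (simp add: s_def)
		have "cc (r + s) (%x. f (x + v))" using cc_shift[OF test_cc[OF assms], of v s] s[of 1] by simp
		moreover have "cc (r + s) f" using cc_mono[OF test_cc[OF assms]] s0 by simp
		ultimately show "cc (r + s) (%x. f (x + v) - f x)"
			by (auto simp: cc_def intro: continuous_on_diff)
	qed
	also have "... = 0"
	proof -
		have "cc (r + s) (%x. f (x + v))" using cc_shift[OF test_cc[OF assms], of v s] s[of 1] by simp
		then show ?thesis
			using integral_diff[OF cc_integrable cc_integrable[OF test_cc[OF assms]], of _ "%x. f (x + v)"]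
				integral_shift_UNIV[OF test_cc[OF assms], of v] by simp
	qed
	finally show ?thesis .
qed

lemma normalized_bump:
	assumes "0 < r"
	obtains \<theta> :: "real => real" where "smooth_on UNIV \<theta>" "!!t. 0 <= \<theta> t" "!!t. r < \<bar>t\<bar> ==> \<theta> t = 0"
		"!!t. \<bar>t\<bar> < r ==> 0 < \<theta> t" "integral {-r..r} \<theta> = 1"
proof -
	define Z where "Z = integral {-r..r} (ball_bump (0::real) r)"
	have c: "continuous_on UNIV (ball_bump (0::real) r)" by (rule smooth_on_continuous[OF smooth_ball_bump])
	have int: "ball_bump (0::real) r integrable_on {-r..r}"
		using c by (intro integrable_continuous_real) (auto intro: continuous_on_subset)
	have "Z ~= 0"
	proof
		assume "Z = 0"
		moreover have "continuous_on (cbox (-r) r) (ball_bump (0::real) r)" using c continuous_on_subset by blast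
		moreover have "box (-r) r ~= {}" using assms by simp
		ultimately have "\<forall>x\<in>cbox (-r) r. ball_bump (0::real) r x = 0"
			using integral_cbox_eq_0_iff[of "-r" r "ball_bump (0::real) r"] ball_bump_nonneg
			unfolding Z_def box_real[symmetric] by blast
		moreover have "0 : cbox (-r) r" using assms by simp
		ultimately have "ball_bump (0::real) r 0 = 0" by blast
		then show False using ball_bump_pos_iff[of r "0::real" 0] assms by simp
	qed
	moreover have "Z \<ge> 0" unfolding Z_def using int by (intro integral_nonneg) (auto simp: ball_bump_nonneg)
	ultimately have Z: "Z > 0" by simp
	show ?thesis
	proof (rule that[of "%t. inverse Z * ball_bump 0 r t"])
		show "smooth_on UNIV (%t. inverse Z * ball_bump (0::real) r t)"
			by (intro smooth_on_mult smooth_ball_bump open_UNIV smooth_on_const)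
		show "inverse Z * ball_bump 0 r t = 0" if "r < \<bar>t\<bar>" for t
			using that assms ball_bump_eq_0_iff[of r "0::real" t] by auto
		show "0 < inverse Z * ball_bump 0 r t" if "\<bar>t\<bar> < r" for t
			using that assms ball_bump_pos_iff[of r "0::real" t] Z by (auto simp: dist_norm)
		show "integral {-r..r} (%t. inverse Z * ball_bump 0 r t) = 1"
			using Z by (simp add: Z_def[symmetric])
		show "0 <= inverse Z * ball_bump 0 r t" for t :: real
			using Z ball_bump_nonneg[of "0::real" r t] by simp
	qed
qed

section \<open>Compactly supported primitives along the coordinate axes\<close>

abbreviation ax :: "3 => real ^ 3" where "ax i \<equiv> axis i 1"

definition proj0 :: "3 => real ^ 3 => real ^ 3" where
	"proj0 i x = x - (x $ i) *R ax i"

lemma proj0_nth: "proj0 i x $ j = (if j = i then 0 else x $ j)"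
	by (simp add: proj0_def axis_def)

lemma linear_proj0: "linear (proj0 i)"
	by (rule linearI) (simp_all add: proj0_def algebra_simps scaleR_add_left)

lemma linear_vec_nth: "linear (%x::real^3. x $ i)"
	by (rule linearI) auto

lemma smooth_on_vec_nth: "open S ==> smooth_on S g ==> smooth_on S (%x. (g x :: real^3) $ i)"
	by (rule smooth_on_linear_compose[OF _ linear_vec_nth])

lemma smooth_on_coord_compose:
	fixes h :: "real => real"
	shows "smooth_on UNIV h ==> smooth_on UNIV (%x::real^3. h (x $ i))"
	by (rule smooth_on_compose_UNIV[OF open_UNIV]) (auto intro: smooth_on_linear linear_vec_nth)

definition line_int :: "3 => real => (real ^ 3 => real) => real ^ 3 => real" where
	"line_int i r f x = integral {-r..r} (%t. f (t *R ax i + proj0 i x))"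

lemma smooth_line_int: "smooth_on UNIV f ==> smooth_on UNIV (line_int i r f)"
	using smooth_on_parameter_integral[of UNIV UNIV f "proj0 i" "-r" r "%t. 1" "%t. 1" "%t. t *R ax i"]
	by (simp add: line_int_def[abs_def] linear_proj0 continuous_intros)

lemma line_int_cong: "proj0 i x = proj0 i y ==> line_int i r f x = line_int i r f y"
	by (simp add: line_int_def)

lemma line_int_invariant:
	assumes "!!x y. proj0 j x = proj0 j y ==> f x = f y" "proj0 j x = proj0 j y"
	shows "line_int i r f x = line_int i r f y"
	unfolding line_int_def
proof (rule integral_cong, rule assms(1))
	fix t
	show "proj0 j (t *R ax i + proj0 i x) = proj0 j (t *R ax i + proj0 i y)"
		using assms(2) by (auto simp: vec_eq_iff proj0_nth axis_def split: if_splits)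
qed

lemma line_int_support:
	assumes "test r f" "j ~= i" "r < \<bar>x $ j\<bar>"
	shows "line_int i r f x = 0"
proof -
	have "f (t *R ax i + proj0 i x) = 0" for t
	proof -
		have "(t *R ax i + proj0 i x) $ j = x $ j" using assms(2) by (simp add: proj0_nth axis_def)
		then have "t *R ax i + proj0 i x ~: ccube r"
			using assms(3) unfolding ccube_def by (metis (mono_tags, lifting) mem_Collect_eq not_less)
		then show ?thesis using assms(1) by (simp add: test_def)
	qed
	then show ?thesis by (simp add: line_int_def)
qed

text \<open>Integrating \<open>f\<close> from the left along the axis gives a primitive that
  vanishes left of the support, and the vanishing line integrals make it vanish on the right too.
  The integral \<open>P\<close> over a window of length R is this primitive only while the window
  starts left of the support, so it is replaced by 0 beyond x_i = r; on the strip r < x_i < r + 1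
  both definitions agree.\<close>

lemma primitive:
	assumes f: "test r f" and r: "0 < r" and zero: "!!x. line_int i r f x = 0"
	shows "\<exists>A. test r A & (\<forall>x. fd A x (ax i) = f x)"
proof -
	have sm: "smooth_on UNIV f" using f by (simp add: test_def)
	\<comment> \<open>With this length the far end of the window has left the support whenever x_i < r
	  + 1.\<close>
	define R where "R = 2 * r + 1"
	define P where "P = (%x. integral {-R..0} (%t. f (t *R ax i + x)))"
	have smP: "smooth_on UNIV P"
		using smooth_on_parameter_integral[of UNIV UNIV f "%x. x" "-R" 0 "%t. 1" "%t. 1" "%t. t *R ax i"] sm
		by (simp add: P_def continuous_intros linear_ident)
	have f0: "f x = 0" if "r < \<bar>x $ j\<bar>" for x j
		using f that unfolding test_def ccube_def by (metis (mono_tags, lifting) mem_Collect_eq not_less)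
	have fdP: "fd P x (ax i) = f x - f (x - R *R ax i)" for x
	proof -
		have "(P has_derivative (%v. integral {-R..0} (%t. fd f (t *R ax i + x) v))) (at x)"
			using has_derivative_parameter_integral[of UNIV UNIV f "%x. x" "-R" 0 "%t. 1" "%t. 1" "%t. t *R ax i" x] sm
			by (simp add: P_def continuous_intros linear_ident)
		from fun_cong[OF fd_eqI[OF this], of "ax i"]
		have "fd P x (ax i) = integral {-R..0} (%t. fd f (x + t *R ax i) (ax i))"
			by (simp add: add.commute)
		also have "... = f x - f (x - R *R ax i)"
			using integral_unique[OF FTC_line[OF sm, of "-R" 0 x "ax i"]] r
			by (simp add: R_def algebra_simps)
		finally show ?thesis .
	qed
	have P0: "P x = 0" if "r < x $ i" "x $ i < r + 1" for x
	proof -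
		have "P x = integral {-R..0} (%t. f ((t + x $ i) *R ax i + proj0 i x))"
			unfolding P_def by (intro integral_cong arg_cong[of _ _ f]) (simp add: proj0_def algebra_simps)
		also have "... = integral {-R + x $ i..0 + x $ i} (%s. f (s *R ax i + proj0 i x))"
			using integral_shift_Icc_real[of "-R" 0 "%s. f (s *R ax i + proj0 i x)" "x $ i"]
			by (simp add: o_def add.commute[of "x $ i"])
		also have "... = line_int i r f x"
		proof -
			have out: "f (s *R ax i + proj0 i x) = 0" if "s ~: {-r..r}" for s
				by (rule f0[of _ i]) (use that in \<open>auto simp: proj0_nth\<close>)
			have c: "continuous_on {-r..r} (%s. f (s *R ax i + proj0 i x))"
				by (rule continuous_on_compose2[OF smooth_on_continuous[OF sm]]) (auto intro!: continuous_intros)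
			have "((%s. f (s *R ax i + proj0 i x)) has_integral line_int i r f x) {-r..r}"
				unfolding line_int_def by (intro integrable_integral integrable_continuous_real c)
			then have "((%s. f (s *R ax i + proj0 i x)) has_integral line_int i r f x) {-R + x $ i..0 + x $ i}"
				by (rule has_integral_on_superset) (use out that in \<open>auto simp: R_def\<close>)
			then show ?thesis by blast
		qed
		finally show ?thesis using zero by simp
	qed
	define A where "A = (%x. if x $ i <= r then P x else 0)"
	have op: "open {x::real^3. x $ i < r + 1}" "open {x::real^3. r < x $ i}"
		by (auto intro!: open_Collect_less continuous_intros)
	have A1: "A x = P x" if "x : {x. x $ i < r + 1}" for x using P0 that by (auto simp: A_def)
	have A2: "A x = 0" if "x : {x. r < x $ i}" for x using that by (auto simp: A_def)
	have "smooth_on UNIV A"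
	proof (rule smooth_on_local)
		fix x :: "real^3"
		have "smooth_on {x. x $ i < r + 1} A"
			by (rule smooth_on_cong[OF op(1) _ smooth_on_subset[OF smP]]) (use A1 in auto)
		moreover have "smooth_on {x. r < x $ i} A"
			by (rule smooth_on_cong[OF op(2) _ smooth_on_const]) (use A2 in auto)
		moreover have "x $ i < r + 1 \<or> r < x $ i" by linarith
		ultimately show "\<exists>T. open T & x : T & smooth_on T A"
			using op by blast
	qed
	moreover have "A x = 0" if "x ~: ccube r" for x
	proof -
		obtain j where j: "r < \<bar>x $ j\<bar>" using \<open>x ~: ccube r\<close> not_ccubeE by blast
		show ?thesis
		proof (cases "x $ i <= r")
			case True
			have "f (t *R ax i + x) = 0" if "t : {-R..0}" for t
			proof (cases "j = i")
				case True
				then have "x $ i < - r" using j \<open>x $ i <= r\<close> by auto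
				then show ?thesis using that r by (intro f0[of _ i]) (auto simp: abs_if)
			next
				case False
				then show ?thesis using j by (intro f0[of _ j]) (auto simp: axis_def)
			qed
			then have "P x = integral {-R..0} (%t. 0)" unfolding P_def by (intro integral_cong)
			then show ?thesis by (simp add: A_def)
		qed (simp add: A_def)
	qed
	moreover have "fd A x (ax i) = f x" for x
	proof (cases "x $ i < r + 1")
		case True
		have "fd A x = fd P x" by (rule fd_cong[OF op(1)]) (use True A1 in auto)
		moreover have "f (x - R *R ax i) = 0" using True r by (intro f0[of _ i]) (auto simp: R_def)
		ultimately show ?thesis using fdP by simp
	next
		case False
		have "fd A x = fd (%x. 0) x" by (rule fd_cong[OF op(2)]) (use False A2 in auto)
		moreover have "f x = 0" using False r by (intro f0[of _ i]) auto
		ultimately show ?thesis by simp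
	qed
	ultimately show ?thesis unfolding test_def by blast
qed

lemma line_int_mult_coord:
	assumes "smooth_on UNIV g" "!!x y. proj0 i x = proj0 i y ==> g x = g y" "integral {-r..r} \<theta> = 1"
	shows "line_int i r (%x. \<theta> (x $ i) * g x) x = g x"
proof -
	have "g (t *R ax i + proj0 i x) = g x" for t
		by (rule assms(2)) (simp add: vec_eq_iff proj0_nth axis_def)
	then show ?thesis using assms(3)
		by (simp add: line_int_def proj0_nth integral_mult_left)
qed

lemma line_int_diff:
	assumes "smooth_on UNIV f" "smooth_on UNIV g"
	shows "line_int i r (%x. f x - g x) x = line_int i r f x - line_int i r g x"
	unfolding line_int_def
	by (intro integral_diff integrable_continuous_real continuous_on_compose2[OF smooth_on_continuous[OF assms(1)]]
			continuous_on_compose2[OF smooth_on_continuous[OF assms(2)]]) (auto intro!: continuous_intros)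

text \<open>\<open>line_int i r f\<close> is constant along the axis and \<theta> has integral 1, so
  subtracting their product from \<open>f\<close> makes all line integrals zero and
  \<open>primitive\<close> applies.\<close>

lemma primitive_mod_bump:
	assumes r: "0 < r" and f: "test r f"
		and \<theta>: "smooth_on UNIV \<theta>" "!!t. r < \<bar>t\<bar> ==> \<theta> t = 0" "integral {-r..r} \<theta> = 1"
	shows "test r (%x. \<theta> (x $ i) * line_int i r f x)"
		and "\<exists>A. test r A & (\<forall>x. f x = fd A x (ax i) + \<theta> (x $ i) * line_int i r f x)"
proof -
	have smf: "smooth_on UNIV f" using f by (simp add: test_def)
	have smL: "smooth_on UNIV (%x. \<theta> (x $ i) * line_int i r f x)"
		by (intro smooth_on_mult open_UNIV smooth_on_coord_compose \<theta> smooth_line_int smf)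
	have "\<theta> (x $ i) * line_int i r f x = 0" if "x ~: ccube r" for x
	proof -
		obtain j where j: "r < \<bar>x $ j\<bar>" using \<open>x ~: ccube r\<close> not_ccubeE by blast
		then show ?thesis using \<theta>(2) line_int_support[OF f] by (cases "j = i") auto
	qed
	then show t: "test r (%x. \<theta> (x $ i) * line_int i r f x)" using smL by (simp add: test_def)
	have "\<exists>A. test r A & (\<forall>x. fd A x (ax i) = f x - \<theta> (x $ i) * line_int i r f x)"
	proof (rule primitive[OF test_diff[OF f t] r])
		fix x show "line_int i r (%x. f x - \<theta> (x $ i) * line_int i r f x) x = 0"
			using line_int_diff[OF smf smL] line_int_mult_coord[OF smooth_line_int[OF smf] line_int_cong \<theta>(3)]
			by simp
	qed
	then show "\<exists>A. test r A & (\<forall>x. f x = fd A x (ax i) + \<theta> (x $ i) * line_int i r f x)"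
		by (metis (no_types, lifting) diff_add_cancel)
qed

lemma line_int_mult_other:
	assumes "j ~= i"
	shows "line_int j r (%x. \<theta> (x $ i) * g x) x = \<theta> (x $ i) * line_int j r g x"
	using assms by (simp add: line_int_def proj0_nth axis_def)

text \<open>Reducing along the axes 1 and 2 in turn leaves a fixed horizontal profile times the
  function \<open>h\<close> of plaque integrals. This is a normal form of a density modulo
  horizontal divergences.\<close>

lemma plaque_decomposition:
	assumes r: "0 < r" and f: "test r f"
		and \<theta>: "smooth_on UNIV \<theta>" "!!t. r < \<bar>t\<bar> ==> \<theta> t = 0" "integral {-r..r} \<theta> = 1"
	shows "\<exists>A B h. test r A & test r B & smooth_on UNIV h & test r (%x::real^3. \<theta> (x $ 1) * (\<theta> (x $ 2) * h (x $ 3))) &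
		(\<forall>x. f x = fd A x (ax 1) + fd B x (ax 2) + \<theta> (x $ 1) * (\<theta> (x $ 2) * h (x $ 3)))"
proof -
	note P = primitive_mod_bump[OF r _ \<theta>]
	obtain A where A: "test r A" "!!x. f x = fd A x (ax 1) + \<theta> (x $ 1) * line_int 1 r f x"
		using P(2)[OF f, of 1] by blast
	define f1 where "f1 = (%x. \<theta> (x $ 1) * line_int 1 r f x)"
	have f1: "test r f1" unfolding f1_def by (rule P(1)[OF f])
	obtain B where B: "test r B" "!!x. f1 x = fd B x (ax 2) + \<theta> (x $ 2) * line_int 2 r f1 x"
		using P(2)[OF f1, of 2] by blast
	define m where "m = line_int 2 r (line_int 1 r f)"
	have L: "line_int 2 r f1 x = \<theta> (x $ 1) * m x" for x
		unfolding f1_def m_def by (rule line_int_mult_other) simp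
	have smf: "smooth_on UNIV f" using f by (simp add: test_def)
	have smm: "smooth_on UNIV m" unfolding m_def by (intro smooth_line_int smf)
	define h where "h = (%z. m (z *R ax 3))"
	have mh: "m x = h (x $ 3)" for x
	proof -
		have "m x = m (proj0 2 x)"
			unfolding m_def by (rule line_int_cong) (simp add: vec_eq_iff proj0_nth)
		also have "... = m (proj0 1 (proj0 2 x))"
			unfolding m_def by (rule line_int_invariant[of 1, OF line_int_cong]) (simp_all add: vec_eq_iff proj0_nth)
		also have "proj0 1 (proj0 2 x) = x $ 3 *R ax 3"
			by (simp add: vec_eq_iff proj0_nth axis_def forall_3)
		finally show ?thesis by (simp add: h_def)
	qed
	have "linear (%z::real. z *R ax 3)" by (rule linearI) (auto simp: scaleR_add_left)
	then have "smooth_on UNIV h"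
		unfolding h_def by (intro smooth_on_compose_UNIV[OF open_UNIV smm] smooth_on_linear)
	moreover have eq2: "\<theta> (x $ 2) * line_int 2 r f1 x = \<theta> (x $ 1) * (\<theta> (x $ 2) * h (x $ 3))" for x
		using L[of x] mh[of x] by simp
	moreover have "test r (%x::real^3. \<theta> (x $ 1) * (\<theta> (x $ 2) * h (x $ 3)))"
		using P(1)[OF f1, of 2] by (simp add: eq2)
	moreover have "f x = fd A x (ax 1) + fd B x (ax 2) + \<theta> (x $ 1) * (\<theta> (x $ 2) * h (x $ 3))" for x
	proof -
		have "f1 x = \<theta> (x $ 1) * line_int 1 r f x" by (simp add: f1_def)
		then show ?thesis using A(2)[of x] B(2)[of x] eq2[of x] by linarith
	qed
	ultimately show ?thesis using A(1) B(1) by blast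
qed

lemma fd_mult_coord_other:
	fixes h :: "real => real"
	assumes "smooth_on UNIV h" "j ~= i"
	shows "fd (%x::real^3. h (x $ i)) x (ax j) = 0"
proof -
	have "fd (%x::real^3. h (x $ i)) x (ax j) = fd h (x $ i) (fd (%x::real^3. x $ i) x (ax j))"
		by (rule smooth_on_compose_fd[OF assms(1) smooth_on_linear[OF linear_vec_nth, of UNIV]]) auto
	also have "fd (%x::real^3. x $ i) x (ax j) = 0"
		using fd_linear[OF linear_vec_nth[of i], of x] assms(2) by (simp add: axis_def)
	also have "fd h (x $ i) 0 = 0"
		using smooth_on_linear_fd[OF assms(1), of "x $ i"] linear_0 by auto
	finally show ?thesis .
qed

text \<open>Testing with \<open>h\<close> equal to the function of \<open>x $ 3\<close> that remains in the decomposition shows that it vanishes.\<close>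

lemma plaque_exact:
	assumes r: "0 < r" and f: "test r f"
		and zero: "!!h. smooth_on UNIV h ==> integral UNIV (%x. f x * h (x $ 3)) = 0"
	shows "\<exists>A B. test r A & test r B & (\<forall>x. f x = fd A x (ax 1) + fd B x (ax 2))"
proof -
	obtain \<theta> :: "real => real" where \<theta>: "smooth_on UNIV \<theta>" "!!t. 0 <= \<theta> t" "!!t. r < \<bar>t\<bar> ==> \<theta> t = 0"
		"!!t. \<bar>t\<bar> < r ==> 0 < \<theta> t" "integral {-r..r} \<theta> = 1"
		using normalized_bump[OF r] by blast
	obtain A B h where A: "test r A" and B: "test r B" and h: "smooth_on UNIV h"
		and t: "test r (%x::real^3. \<theta> (x $ 1) * (\<theta> (x $ 2) * h (x $ 3)))"
		and eq: "!!x. f x = fd A x (ax 1) + fd B x (ax 2) + \<theta> (x $ 1) * (\<theta> (x $ 2) * h (x $ 3))"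
		using plaque_decomposition[OF r f \<theta>(1,3,5)] by blast
	have h3: "smooth_on UNIV (%x::real^3. h (x $ 3))" by (rule smooth_on_coord_compose[OF h])
	have part: "integral UNIV (%x. fd F x (ax j) * h (x $ 3)) = 0 & cc r (%x. fd F x (ax j) * h (x $ 3))"
		if F: "test r F" and j: "j ~= 3" for F j
	proof -
		have "fd (%x. F x * h (x $ 3)) x (ax j) = fd F x (ax j) * h (x $ 3)" for x
			using fd_mult[OF test_differentiable[OF F] smooth_on_differentiable[OF h3 UNIV_I]] fd_mult_coord_other[OF h j]
			by simp
		then show ?thesis
			using integral_fd_eq_0[OF test_mult[OF F h3], of "ax j"] cc_mult[OF test_cc[OF test_fd[OF F]] smooth_on_continuous[OF h3]]
			by simp
	qed
	define w where "w = (%x::real^3. \<theta> (x $ 1) * (\<theta> (x $ 2) * h (x $ 3)) * h (x $ 3))"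
	have w: "cc r w" unfolding w_def by (rule cc_mult[OF test_cc[OF t] smooth_on_continuous[OF h3]])
	have "integral UNIV (%x. f x * h (x $ 3)) =
			integral UNIV (%x. fd A x (ax 1) * h (x $ 3) + fd B x (ax 2) * h (x $ 3) + w x)"
		by (simp add: eq w_def algebra_simps)
	also have "... = integral UNIV w"
	proof -
		have 1: "integral UNIV (%x. fd A x (ax 1) * h (x $ 3)) = 0" "(%x. fd A x (ax 1) * h (x $ 3)) integrable_on UNIV"
			"integral UNIV (%x. fd B x (ax 2) * h (x $ 3)) = 0" "(%x. fd B x (ax 2) * h (x $ 3)) integrable_on UNIV"
			"w integrable_on UNIV"
			using part[OF A, of 1] part[OF B, of 2] w by (auto intro: cc_integrable)
		then show ?thesis by (simp add: integral_add integrable_add)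
	qed
	finally have "integral UNIV w = 0" using zero[OF h] by simp
	moreover have "0 <= w x" for x
	proof -
		have "w x = (\<theta> (x $ 1) * \<theta> (x $ 2)) * (h (x $ 3) * h (x $ 3))" by (simp add: w_def)
		then show ?thesis using \<theta>(2) by simp
	qed
	ultimately have w0: "w x = 0" for x
		by (rule integral_nonneg_eq_0[OF w, rotated])
	have "h z = 0" if "\<bar>z\<bar> <= r" for z
		using w0[of "z *R ax 3"] \<theta>(4)[of 0] r by (simp add: w_def axis_def)
	then have "\<theta> (x $ 1) * (\<theta> (x $ 2) * h (x $ 3)) = 0" for x :: "real^3"
		using t by (cases "\<bar>x $ 3\<bar> <= r") (auto simp: test_def ccube_def)
	then show ?thesis using A B eq by (intro exI[of _ A] exI[of _ B]) simp
qed

text \<open>The reduction along the third axis leaves \<open>k\<close> times a product of bumps.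
  Divergences integrate to zero and the product has positive integral, so \<open>k = 0\<close>. This
  is the top degree Poincare lemma with compact supports.\<close>

lemma divergence_exact:
	assumes r: "0 < r" and f: "test r f" and zero: "integral UNIV f = 0"
	shows "\<exists>A B C. test r A & test r B & test r C & (\<forall>x. f x = fd A x (ax 1) + fd B x (ax 2) + fd C x (ax 3))"
proof -
	obtain \<theta> :: "real => real" where \<theta>: "smooth_on UNIV \<theta>" "!!t. 0 <= \<theta> t" "!!t. r < \<bar>t\<bar> ==> \<theta> t = 0"
		"!!t. \<bar>t\<bar> < r ==> 0 < \<theta> t" "integral {-r..r} \<theta> = 1"
		using normalized_bump[OF r] by blast
	note P = primitive_mod_bump[OF r _ \<theta>(1,3,5)]
	obtain A B h where A: "test r A" and B: "test r B" and h: "smooth_on UNIV h"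
		and t: "test r (%x::real^3. \<theta> (x $ 1) * (\<theta> (x $ 2) * h (x $ 3)))"
		and eq: "!!x. f x = fd A x (ax 1) + fd B x (ax 2) + \<theta> (x $ 1) * (\<theta> (x $ 2) * h (x $ 3))"
		using plaque_decomposition[OF r f \<theta>(1,3,5)] by blast
	define f2 where "f2 = (%x::real^3. \<theta> (x $ 1) * (\<theta> (x $ 2) * h (x $ 3)))"
	have f2: "test r f2" using t by (simp add: f2_def)
	obtain C where C: "test r C" "!!x. f2 x = fd C x (ax 3) + \<theta> (x $ 3) * line_int 3 r f2 x"
		using P(2)[OF f2, of 3] by blast
	define k where "k = integral {-r..r} h"
	have L: "line_int 3 r f2 x = \<theta> (x $ 1) * (\<theta> (x $ 2) * k)" for x
		by (simp add: f2_def line_int_def proj0_nth k_def axis_def)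
	define w where "w = (%x::real^3. \<theta> (x $ 1) * (\<theta> (x $ 2) * \<theta> (x $ 3)))"
	have w: "cc r w"
		unfolding cc_def w_def
	proof (intro conjI allI impI)
		show "continuous_on UNIV (%x::real^3. \<theta> (x $ 1) * (\<theta> (x $ 2) * \<theta> (x $ 3)))"
			by (intro continuous_on_mult smooth_on_continuous smooth_on_coord_compose \<theta>)
		fix x :: "real^3" assume "x ~: ccube r"
		then obtain j where "r < \<bar>x $ j\<bar>" using not_ccubeE by blast
		then show "\<theta> (x $ 1) * (\<theta> (x $ 2) * \<theta> (x $ 3)) = 0"
			using \<theta>(3) exhaust_3[of j] by auto
	qed
	have "integral UNIV f = integral UNIV (%x. fd A x (ax 1) + fd B x (ax 2) + (fd C x (ax 3) + w x * k))"
	proof (rule arg_cong[of _ _ "integral UNIV"], rule ext)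
		fix x
		show "f x = fd A x (ax 1) + fd B x (ax 2) + (fd C x (ax 3) + w x * k)"
			using eq[of x] C(2)[of x] L[of x] unfolding f2_def w_def by simp
	qed
	also have "... = k * integral UNIV w"
	proof -
		have "cc r (%x. w x * k)" by (rule cc_mult[OF w]) simp
		then have 1: "(%x. w x * k) integrable_on UNIV" "(%x. fd A x (ax 1)) integrable_on UNIV"
			"(%x. fd B x (ax 2)) integrable_on UNIV" "(%x. fd C x (ax 3)) integrable_on UNIV"
			using test_cc[OF test_fd[OF A]] test_cc[OF test_fd[OF B]] test_cc[OF test_fd[OF C(1)]]
			by (auto intro: cc_integrable)
		then show ?thesis
			using integral_fd_eq_0[OF A, of "ax 1"] integral_fd_eq_0[OF B, of "ax 2"] integral_fd_eq_0[OF C(1), of "ax 3"]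
			by (simp add: integral_add integrable_add)
	qed
	finally have "k * integral UNIV w = 0" using zero by simp
	moreover have "integral UNIV w > 0"
		by (rule integral_pos[OF w, of 0]) (use \<theta> r in \<open>auto simp: w_def\<close>)
	ultimately have "k = 0" by simp
	then show ?thesis
		using A B C(1) C(2) L eq unfolding f2_def by (intro exI[of _ A] exI[of _ B] exI[of _ C]) simp
qed

section \<open>Exterior calculus on \<open>real ^ 3\<close>\<close>

text \<open>Vector proxies: forms of degree 0, 1, 2, 3 on \<open>real ^ 3\<close> correspond to a
  function, a vector field, again a vector field (contracted into the volume form) and a density.
  Wedge products and \<open>ext_deriv\<close> then become products of vectors and grad, curl,
  div.\<close>

definition form0 :: "real => (real ^ 3) list => real" where
	"form0 f vs = (if vs = [] then f else 0)"

definition form1 :: "real ^ 3 => (real ^ 3) list => real" where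
	"form1 a vs = (case vs of [u] => a \<bullet> u | _ => 0)"

definition form2 :: "real ^ 3 => (real ^ 3) list => real" where
	"form2 b vs = (case vs of [u, v] => b \<bullet> cross3 u v | _ => 0)"

definition form3 :: "real => (real ^ 3) list => real" where
	"form3 f vs = (case vs of [u, v, w] => f * (u \<bullet> cross3 v w) | _ => 0)"

lemma form_eval [simp]:
	"form0 f [] = f" "form1 a [u] = a \<bullet> u" "form2 b [u, v] = b \<bullet> cross3 u v"
	"form3 f [u, v, w] = f * (u \<bullet> cross3 v w)"
	by (simp_all add: form0_def form1_def form2_def form3_def)

lemma form_length:
	"length vs ~= 0 ==> form0 f vs = 0" "length vs ~= 1 ==> form1 a vs = 0"
	"length vs ~= 2 ==> form2 b vs = 0" "length vs ~= 3 ==> form3 f vs = 0"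
	by (auto simp: form0_def form1_def form2_def form3_def split: list.splits)

lemma form_zero [simp]: "form0 0 = 0" "form1 0 = 0" "form2 0 = 0" "form3 0 = 0"
	by (auto simp: form0_def form1_def form2_def form3_def fun_eq_iff split: list.splits)

lemma length1: "length vs = 1 \<longleftrightarrow> (\<exists>u. vs = [u])"
	and length2: "length vs = 2 \<longleftrightarrow> (\<exists>u v. vs = [u, v])"
	and length3: "length vs = 3 \<longleftrightarrow> (\<exists>u v w. vs = [u, v, w])"
	by (auto simp: length_Suc_conv numeral_eq_Suc)

lemma alternating_form_0_iff: "alternating_form 0 w \<longleftrightarrow> (\<forall>vs. length vs ~= 0 --> w vs = 0)"
	by (simp add: alternating_form_def)

lemma alternating_form_1_iff: "alternating_form 1 w \<longleftrightarrow>
		(\<forall>vs. length vs ~= 1 --> w vs = 0) & linear (%v. w [v])" (is "_ \<longleftrightarrow> ?R")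
proof
	assume "alternating_form 1 w"
	then have 1: "\<forall>vs. length vs ~= 1 --> w vs = 0"
		and 2: "length vs = 1 & i < 1 ==> linear (%v. w (vs[i := v]))" for vs i
		unfolding alternating_form_def by blast+
	show ?R using 1 2[of "[undefined]" 0] by simp
next
	assume R: ?R
	have "linear (%v. w (vs[i := v]))" if l: "length vs = 1 & i < 1" for vs :: "'a list" and i :: nat
	proof -
		obtain u where "vs = [u]" using l unfolding length1 by auto
		then show ?thesis using R l by simp
	qed
	then show "alternating_form 1 w"
		unfolding alternating_form_def using R by (intro conjI allI impI) (blast, blast, linarith)
qed

lemma alternating_form_2_iff:
	fixes w :: "'a::euclidean_space list => real"
	shows "alternating_form 2 w \<longleftrightarrow>
		(\<forall>vs. length vs ~= 2 --> w vs = 0) & (\<forall>u. linear (%v. w [u, v])) & (\<forall>u. linear (%v. w [v, u])) &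
		(\<forall>u. w [u, u] = 0)" (is "_ \<longleftrightarrow> ?R")
proof
	assume a: "alternating_form 2 w"
	have lin: "linear (%v. w ([a, b][i := v]))" if "i < 2" for a b and i :: nat
	proof -
		have "length [a, b] = 2 & i < 2" using that by simp
		then show ?thesis using a unfolding alternating_form_def by metis
	qed
	have z: "w [u, u] = 0" for u
	proof -
		have "length [u, u] = 2 & (0::nat) < 1 & (1::nat) < 2 & [u, u] ! 0 = [u, u] ! 1" by simp
		then show ?thesis using a unfolding alternating_form_def by metis
	qed
	show ?R
		using a lin[of 0] lin[of 1] z by (auto simp: alternating_form_def)
next
	assume R: ?R
	show "alternating_form 2 w"
		unfolding alternating_form_def
	proof (intro conjI allI impI)
		fix vs :: "'a list" and i :: nat assume "length vs = 2 & i < 2"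
		moreover from this obtain a b where "vs = [a, b]" unfolding length2 by auto
		ultimately show "linear (%v. w (vs[i := v]))" using R by (auto simp: less_2_cases_iff)
	next
		fix vs :: "'a list" and i j :: nat assume "length vs = 2 & i < j & j < 2 & vs ! i = vs ! j"
		moreover from this obtain a b where "vs = [a, b]" unfolding length2 by auto
		ultimately show "w vs = 0" using R by (auto simp: less_2_cases_iff)
	qed (use R in blast)
qed

lemma less_3_cases: "i < (3::nat) \<longleftrightarrow> i = 0 \<or> i = 1 \<or> i = 2"
	by auto

lemma alternating_form_3_iff:
	fixes w :: "'a::euclidean_space list => real"
	shows "alternating_form 3 w \<longleftrightarrow>
		(\<forall>vs. length vs ~= 3 --> w vs = 0) &
		(\<forall>a b. linear (%v. w [v, a, b])) & (\<forall>a b. linear (%v. w [a, v, b])) & (\<forall>a b. linear (%v. w [a, b, v])) &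
		(\<forall>u v. w [u, u, v] = 0) & (\<forall>u v. w [u, v, u] = 0) & (\<forall>u v. w [v, u, u] = 0)" (is "_ \<longleftrightarrow> ?R")
proof
	assume a: "alternating_form 3 w"
	have lin: "linear (%v. w ([a, b, c][i := v]))" if "i < 3" for a b c and i :: nat
	proof -
		have "length [a, b, c] = 3 & i < 3" using that by simp
		then show ?thesis using a unfolding alternating_form_def by metis
	qed
	have z: "w [a, b, c] = 0" if "i < j" "j < 3" "[a, b, c] ! i = [a, b, c] ! j" for a b c and i j :: nat
	proof -
		have "length [a, b, c] = 3 & i < j & j < 3 & [a, b, c] ! i = [a, b, c] ! j" using that by simp
		then show ?thesis using a unfolding alternating_form_def by metis
	qed
	show ?R
		using a lin[of 0] lin[of 1] lin[of 2] z[of 0 1] z[of 0 2] z[of 1 2]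
		by (auto simp: alternating_form_def)
next
	assume R: ?R
	show "alternating_form 3 w"
		unfolding alternating_form_def
	proof (intro conjI allI impI)
		fix vs :: "'a list" and i :: nat assume "length vs = 3 & i < 3"
		moreover from this obtain a b c where "vs = [a, b, c]" unfolding length3 by auto
		ultimately show "linear (%v. w (vs[i := v]))" using R by (auto simp: less_3_cases)
	next
		fix vs :: "'a list" and i j :: nat assume "length vs = 3 & i < j & j < 3 & vs ! i = vs ! j"
		moreover from this obtain a b c where "vs = [a, b, c]" unfolding length3 by auto
		ultimately show "w vs = 0" using R by (auto simp: less_3_cases less_2_cases_iff)
	qed (use R in blast)
qed

lemma lin3_expand:
	fixes g :: "real ^ 3 => 'b::real_vector"
	assumes "linear g"
	shows "g v = (v $ 1) *R g (ax 1) + (v $ 2) *R g (ax 2) + (v $ 3) *R g (ax 3)"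
proof -
	have "v = (v $ 1) *R ax 1 + (v $ 2) *R ax 2 + (v $ 3) *R ax 3"
		by (simp add: vec_eq_iff forall_3 axis_def)
	then have "g v = g ((v $ 1) *R ax 1 + (v $ 2) *R ax 2 + (v $ 3) *R ax 3)" by simp
	then show ?thesis using assms by (simp add: linear_add linear_scale)
qed

lemma axis_nth: "axis i (1::real) $ j = (if j = i then 1 else 0)"
	by (simp add: axis_def)

lemmas vec3_simps = inner_vec_def sum_3 cross_components vector_3 axis_nth

lemma linear_inner_cross: "linear (%v. b \<bullet> cross3 u v)" "linear (%v. b \<bullet> cross3 v u)"
	"linear (%v. v \<bullet> cross3 a c)" "linear (%v. a \<bullet> cross3 v c)" "linear (%v. f * (v \<bullet> cross3 a c))"
	"linear (%v. f * (a \<bullet> cross3 v c))" "linear (%v. f * (a \<bullet> cross3 c v))"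
	by (rule linearI; simp add: vec3_simps algebra_simps)+

lemma alternating_forms [simp]:
	"alternating_form 0 (form0 f)" "alternating_form 1 (form1 a)"
	"alternating_form 2 (form2 b)" "alternating_form 3 (form3 f)"
proof -
	show "alternating_form 0 (form0 f)" by (simp add: alternating_form_0_iff form_length)
	show "alternating_form 1 (form1 a)"
		unfolding alternating_form_1_iff
		by (simp add: form_length(2) bounded_linear.linear bounded_linear_inner_right)
	show "alternating_form 2 (form2 b)"
		by (simp add: alternating_form_2_iff form_length linear_inner_cross)
	show "alternating_form 3 (form3 f)"
		by (simp add: alternating_form_3_iff form_length linear_inner_cross dot_cross_self)
qed

lemma alternating_0_eq: "alternating_form 0 w ==> w = form0 (w [])"
	by (auto simp: alternating_form_0_iff form0_def fun_eq_iff)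

lemma alternating_1_eq:
	assumes "alternating_form 1 w" shows "w = form1 (\<chi> i. w [ax i])"
proof
	fix vs
	show "w vs = form1 (\<chi> i. w [ax i]) vs"
	proof (cases "length vs = 1")
		case True
		then obtain u where "vs = [u]" unfolding length1 by auto
		moreover have "w [u] = (\<chi> i. w [ax i]) \<bullet> u"
			using lin3_expand[of "%v. w [v]" u] assms
			by (simp add: alternating_form_1_iff[simplified] vec3_simps algebra_simps)
		ultimately show ?thesis by simp
	next
		case False
		then show ?thesis using assms by (simp add: alternating_form_1_iff[simplified] form_length[simplified])
	qed
qed

lemma alternating_2_skew:
	assumes "alternating_form 2 w" shows "w [u, v] = - w [v, u]"
proof -
	have l: "linear (%v. w [u', v])" "linear (%v. w [v, u'])" and z: "w [u', u'] = 0" for u'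
		using assms by (auto simp: alternating_form_2_iff)
	have "0 = w [u + v, u + v]" using z by simp
	also have "... = w [u, v] + w [v, u]"
		using linear_add[OF l(1)[of "u + v"], of u v] linear_add[OF l(2)[of u], of u v] linear_add[OF l(2)[of v], of u v] z by simp
	finally show ?thesis by simp
qed

lemma alternating_2_eq:
	assumes "alternating_form 2 w"
	shows "w = form2 (vector [w [ax 2, ax 3], w [ax 3, ax 1], w [ax 1, ax 2]])"
proof
	fix vs
	have l: "linear (%v. w [u', v])" "linear (%v. w [v, u'])" and z: "w [u', u'] = 0" for u'
		using assms by (auto simp: alternating_form_2_iff)
	show "w vs = form2 (vector [w [ax 2, ax 3], w [ax 3, ax 1], w [ax 1, ax 2]]) vs"
	proof (cases "length vs = 2")
		case True
		then obtain u v where vs: "vs = [u, v]" unfolding length2 by auto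
		have "w [u, v] = (u $ 1) * w [ax 1, v] + (u $ 2) * w [ax 2, v] + (u $ 3) * w [ax 3, v]"
			using lin3_expand[OF l(2)[of v], of u] by simp
		moreover have "w [ax i, v] = (v $ 1) * w [ax i, ax 1] + (v $ 2) * w [ax i, ax 2] + (v $ 3) * w [ax i, ax 3]" for i
			using lin3_expand[OF l(1)[of "ax i"], of v] by simp
		moreover have "w [ax 2, ax 1] = - w [ax 1, ax 2]" "w [ax 3, ax 2] = - w [ax 2, ax 3]" "w [ax 1, ax 3] = - w [ax 3, ax 1]"
			by (rule alternating_2_skew[OF assms])+
		ultimately show ?thesis using vs z by (simp add: vec3_simps algebra_simps)
	next
		case False
		then show ?thesis using assms by (simp add: alternating_form_2_iff form_length)
	qed
qed

lemma alternating_3_skew: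
	assumes "alternating_form 3 w"
	shows "w [u, v, t] = - w [v, u, t]" "w [u, v, t] = - w [u, t, v]"
proof -
	have a: "\<forall>vs. length vs ~= 3 --> w vs = 0" using assms by (auto simp: alternating_form_3_iff)
	have l: "linear (%v. w [v, a, b])" "linear (%v. w [a, v, b])" "linear (%v. w [a, b, v])"
		and z: "w [a, a, b] = 0" "w [b, a, a] = 0" for a b
		using assms by (auto simp: alternating_form_3_iff)
	have "0 = w [u + v, u + v, t]" using z by simp
	also have "... = w [u, v, t] + w [v, u, t]"
		using linear_add[OF l(1)[of "u + v" t], of u v] linear_add[OF l(2)[of u t], of u v] linear_add[OF l(2)[of v t], of u v] z by simp
	finally show "w [u, v, t] = - w [v, u, t]" by simp
	have "0 = w [u, v + t, v + t]" using z by simp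
	also have "... = w [u, v, t] + w [u, t, v]"
		using linear_add[OF l(2)[of u "v + t"], of v t] linear_add[OF l(3)[of u v], of v t] linear_add[OF l(3)[of u t], of v t] z by simp
	finally show "w [u, v, t] = - w [u, t, v]" by simp
qed

lemma alternating_3_eq:
	assumes "alternating_form 3 w"
	shows "w = form3 (w std_basis)"
proof
	fix vs
	have l: "linear (%v. w [v, a, b])" "linear (%v. w [a, v, b])" "linear (%v. w [a, b, v])"
		and z: "w [a, a, b] = 0" "w [b, a, a] = 0" "w [a, b, a] = 0" for a b
		using assms by (auto simp: alternating_form_3_iff)
	note s = alternating_3_skew[OF assms]
	show "w vs = form3 (w std_basis) vs"
	proof (cases "length vs = 3")
		case True
		then obtain a b c where vs: "vs = [a, b, c]" unfolding length3 by auto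
		have 1: "w [a, b, c] = (a $ 1) * w [ax 1, b, c] + (a $ 2) * w [ax 2, b, c] + (a $ 3) * w [ax 3, b, c]"
			using lin3_expand[OF l(1)[of b c], of a] by simp
		have 2: "w [ax i, b, c] = (b $ 1) * w [ax i, ax 1, c] + (b $ 2) * w [ax i, ax 2, c] + (b $ 3) * w [ax i, ax 3, c]" for i
			using lin3_expand[OF l(2)[of "ax i" c], of b] by simp
		have 3: "w [ax i, ax j, c] = (c $ 1) * w [ax i, ax j, ax 1] + (c $ 2) * w [ax i, ax j, ax 2] + (c $ 3) * w [ax i, ax j, ax 3]" for i j
			using lin3_expand[OF l(3)[of "ax i" "ax j"], of c] by simp
		have 4: "w [ax 2, ax 1, ax 3] = - w [ax 1, ax 2, ax 3]" by (rule s(1))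
		have 5: "w [ax 1, ax 3, ax 2] = - w [ax 1, ax 2, ax 3]" by (rule s(2))
		have 6: "w [ax 3, ax 1, ax 2] = w [ax 1, ax 2, ax 3]" using s(1)[of "ax 3" "ax 1" "ax 2"] 5 by simp
		have 7: "w [ax 2, ax 3, ax 1] = w [ax 1, ax 2, ax 3]" using s(2)[of "ax 2" "ax 3" "ax 1"] 4 by simp
		have 8: "w [ax 3, ax 2, ax 1] = - w [ax 1, ax 2, ax 3]" using s(2)[of "ax 3" "ax 2" "ax 1"] 6 by simp
		show ?thesis unfolding vs std_basis_def
			by (simp add: 1 2 3 z 4 5 6 7 8 vec3_simps) (simp add: algebra_simps)
	next
		case False
		then show ?thesis using assms by (simp add: alternating_form_3_iff form_length)
	qed
qed

lemma form3_std_basis [simp]: "form3 f std_basis = f"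
	by (simp add: std_basis_def vec3_simps)

lemma form_inject [simp]: "form0 f = form0 g \<longleftrightarrow> f = g" "form1 a = form1 b \<longleftrightarrow> a = b"
	"form2 a = form2 b \<longleftrightarrow> a = b" "form3 f = form3 g \<longleftrightarrow> f = g"
proof -
	show "form0 f = form0 g \<longleftrightarrow> f = g" by (metis form_eval(1))
	have "a = b" if "form1 a = form1 b"
		using fun_cong[OF that, of "[ax 1]"] fun_cong[OF that, of "[ax 2]"] fun_cong[OF that, of "[ax 3]"]
		by (simp add: vec_eq_iff vec3_simps forall_3)
	then show "form1 a = form1 b \<longleftrightarrow> a = b" by auto
	have "a = b" if "form2 a = form2 b"
		using fun_cong[OF that, of "[ax 2, ax 3]"] fun_cong[OF that, of "[ax 3, ax 1]"] fun_cong[OF that, of "[ax 1, ax 2]"]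
		by (simp add: vec_eq_iff vec3_simps forall_3)
	then show "form2 a = form2 b \<longleftrightarrow> a = b" by auto
	show "form3 f = form3 g \<longleftrightarrow> f = g" by (metis form3_std_basis)
qed

lemma form3_map_std_basis:
	assumes "linear L" shows "form3 f (map L std_basis) = f * det (matrix L)"
	by (simp add: std_basis_def matrix_def det_3 vec3_simps algebra_simps)

section \<open>Wedge products in terms of vector proxies\<close>

lemma permutes_sum_2:
	fixes f :: "(nat => nat) => real"
	shows "sum f {p. p permutes {..<2}} = f id + f (Transposition.transpose 0 1)"
proof -
	have e: "{..<2::nat} = insert 0 {1}" by auto
	have "sum f {p. p permutes {..<2}} = (\<Sum>b\<in>{0,1}. \<Sum>q\<in>{p. p permutes {1}}. f (Transposition.transpose 0 b \<circ> q))"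
		unfolding e by (rule sum_over_permutations_insert) auto
	then show ?thesis by (simp add: permutes_sing)
qed

lemma permutes_sum_3:
	fixes f :: "(nat => nat) => real"
	shows "sum f {p. p permutes {..<3}} = f id + f (Transposition.transpose 1 2) + f (Transposition.transpose 0 1) +
		f (Transposition.transpose 0 1 \<circ> Transposition.transpose 1 2) + f (Transposition.transpose 0 2) + f (Transposition.transpose 0 2 \<circ> Transposition.transpose 1 2)"
proof -
	have e: "{..<3::nat} = insert 0 {1,2}" by auto
	have "sum f {p. p permutes {..<3}} = (\<Sum>b\<in>insert 0 {1,2}. \<Sum>q\<in>{p. p permutes {1,2}}. f (Transposition.transpose 0 b \<circ> q))"
		unfolding e by (rule sum_over_permutations_insert) auto
	moreover have "(\<Sum>q\<in>{p. p permutes {1,2::nat}}. g q) = g id + g (Transposition.transpose 1 2)" for g :: "_ => real"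
	proof -
		have "(\<Sum>q\<in>{p. p permutes {1,2::nat}}. g q) = (\<Sum>b\<in>insert 1 {2}. \<Sum>q\<in>{p. p permutes {2}}. g (Transposition.transpose 1 b \<circ> q))"
			by (rule sum_over_permutations_insert) auto
		then show ?thesis by (simp add: permutes_sing)
	qed
	ultimately show ?thesis by (simp add: add.assoc)
qed

lemma sign_perms_3:
	"sign (id :: nat => nat) = 1" "sign (Transposition.transpose 1 2 :: nat => nat) = -1" "sign (Transposition.transpose 0 1 :: nat => nat) = -1"
	"sign (Transposition.transpose 0 2 :: nat => nat) = -1" "sign (Transposition.transpose 0 1 \<circ> Transposition.transpose 1 2 :: nat => nat) = 1"
	"sign (Transposition.transpose 0 2 \<circ> Transposition.transpose 1 2 :: nat => nat) = 1"
	by (simp_all add: sign_id sign_swap_id permutation_swap_id sign_compose)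

lemma wedge_1_1: "wedge 1 1 (form1 a) (form1 b) = form2 (cross3 a b)"
proof
	fix vs :: "(real^3) list"
	show "wedge 1 1 (form1 a) (form1 b) vs = form2 (cross3 a b) vs"
	proof (cases "length vs = 2")
		case True
		then obtain u v where vs: "vs = [u, v]" unfolding length2 by auto
		have u: "[Suc 0..<2] = [1::nat]" by (auto simp: upt_rec)
		have "wedge 1 1 (form1 a) (form1 b) vs =
				(\<Sum>p | p permutes {..<2}. of_int (sign p) * (a \<bullet> ([u, v] ! p 0)) * (b \<bullet> ([u, v] ! p 1)))"
			by (simp add: wedge_def vs u numeral_2_eq_2)
		also have "... = (a \<bullet> u) * (b \<bullet> v) - (a \<bullet> v) * (b \<bullet> u)"
			unfolding permutes_sum_2 by (simp add: sign_perms_3[simplified])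
		also have "... = form2 (cross3 a b) vs"
			by (simp add: vs vec3_simps) (simp add: algebra_simps)
		finally show ?thesis .
	qed (simp add: wedge_def form_length)
qed

text \<open>If u, v, w form a basis, then v \<times> w, w \<times> u and u \<times> v are the dual
  basis up to the factor \<open>u \<bullet> cross3 v w\<close>, and this is the expansion of
  \<open>a\<close> in it. It evaluates the alternating sums in a wedge product and in the exterior
  derivatives of 2-forms and 3-forms.\<close>

lemma cross3_expansion:
	"(a \<bullet> u) *R cross3 v w - (a \<bullet> v) *R cross3 u w + (a \<bullet> w) *R cross3 u v = (u \<bullet> cross3 v w) *R a"
	unfolding vec_eq_iff forall_3
	by (intro conjI; simp only: vector_add_component vector_minus_component vector_scaleR_component
			inner_vec_def sum_3 cross_components inner_real_def real_scaleR_def; simp add: algebra_simps)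

lemma wedge_1_2: "wedge 1 2 (form1 a) (form2 b) = form3 (a \<bullet> b)"
proof
	fix vs :: "(real^3) list"
	show "wedge 1 2 (form1 a) (form2 b) vs = form3 (a \<bullet> b) vs"
	proof (cases "length vs = 3")
		case True
		then obtain u v w where vs: "vs = [u, v, w]" unfolding length3 by auto
		have u: "[Suc 0..<3] = [1::nat, 2]" by (auto simp: upt_rec)
		have "wedge 1 2 (form1 a) (form2 b) vs =
				(\<Sum>p | p permutes {..<3}. of_int (sign p) * (a \<bullet> ([u, v, w] ! p 0)) *
					(b \<bullet> cross3 ([u, v, w] ! p 1) ([u, v, w] ! p 2))) / 2"
			by (simp add: wedge_def vs u fact_numeral) (simp add: numeral_3_eq_3 numeral_2_eq_2)
		also have "... = (a \<bullet> u) * (b \<bullet> cross3 v w) - (a \<bullet> v) * (b \<bullet> cross3 u w) + (a \<bullet> w) * (b \<bullet> cross3 u v)"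
		proof -
			have "cross3 w u = - cross3 u w" "cross3 v u = - cross3 u v" "cross3 w v = - cross3 v w"
				by (rule cross_skew)+
			then show ?thesis unfolding permutes_sum_3 sign_perms_3 by (simp add: Transposition.transpose_def)
		qed
		also have "... = b \<bullet> ((a \<bullet> u) *R cross3 v w - (a \<bullet> v) *R cross3 u w + (a \<bullet> w) *R cross3 u v)"
			by (simp add: inner_add_right inner_diff_right)
		also have "(a \<bullet> u) *R cross3 v w - (a \<bullet> v) *R cross3 u w + (a \<bullet> w) *R cross3 u v
				= (u \<bullet> cross3 v w) *R a"
			by (rule cross3_expansion)
		also have "b \<bullet> ... = form3 (a \<bullet> b) vs"
			by (simp add: vs inner_commute)
		finally show ?thesis .
	qed (simp add: wedge_def form_length)
qed

lemma wedge_0_3: "wedge 0 3 (form0 f) (form3 g) = form3 (f * g)"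
proof
	fix vs :: "(real^3) list"
	show "wedge 0 3 (form0 f) (form3 g) vs = form3 (f * g) vs"
	proof (cases "length vs = 3")
		case True
		then obtain u v w where vs: "vs = [u, v, w]" unfolding length3 by auto
		have u: "[0..<3] = [0::nat, 1, 2]" by (auto simp: upt_rec)
		have "wedge 0 3 (form0 f) (form3 g) vs =
				(\<Sum>p | p permutes {..<3}. of_int (sign p) * f * (g * (([u, v, w] ! p 0) \<bullet>
					cross3 ([u, v, w] ! p 1) ([u, v, w] ! p 2)))) / 6"
			by (simp add: wedge_def vs u fact_numeral)
		also have "... = form3 (f * g) vs"
		proof -
			have "v \<bullet> cross3 u w = - (u \<bullet> cross3 v w)" "w \<bullet> cross3 u v = u \<bullet> cross3 v w"
				"u \<bullet> cross3 w v = - (u \<bullet> cross3 v w)" "v \<bullet> cross3 w u = u \<bullet> cross3 v w"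
				"w \<bullet> cross3 v u = - (u \<bullet> cross3 v w)"
				by (simp_all add: inner_vec_def sum_3 cross_components) (simp_all add: algebra_simps)
			then show ?thesis unfolding permutes_sum_3 sign_perms_3 by (simp add: vs Transposition.transpose_def)
		qed
		finally show ?thesis .
	qed (simp add: wedge_def form_length)
qed

lemma fd_commute_vec:
	fixes f :: "'a::euclidean_space => 'b::euclidean_space"
	assumes "open S" "smooth_on S f" "x : S"
	shows "fd (%y. fd f y v) x u = fd (%y. fd f y u) x v"
proof (rule euclidean_eqI)
	fix b :: 'b
	have comp: "fd g y w \<bullet> b = fd (%z. g z \<bullet> b) y w" if "smooth_on S g" "y : S" for g :: "'a => 'b" and y w
		using fun_cong[OF fd_eqI[OF has_derivative_inner_left[OF smooth_on_has_derivative[OF that]]]] by metis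
	have sb: "smooth_on S (%z. f z \<bullet> b)" by (rule smooth_on_inner_const[OF assms(1,2)])
	have "fd (%y. fd f y v') x u' \<bullet> b = fd (%y. fd (%z. f z \<bullet> b) y v') x u'" for u' v'
	proof -
		have "fd (%y. fd f y v') x u' \<bullet> b = fd (%y. fd f y v' \<bullet> b) x u'"
			by (rule comp[OF smooth_on_fd[OF assms(2)] assms(3)])
		also have "... = fd (%y. fd (%z. f z \<bullet> b) y v') x u'"
			by (rule fun_cong[OF fd_cong[OF assms(1,3)]]) (rule comp[OF assms(2)])
		finally show ?thesis .
	qed
	then show "fd (%y. fd f y v) x u \<bullet> b = fd (%y. fd f y u) x v \<bullet> b"
		using fd_commute[OF assms(1) sb assms(3)] by simp
qed

section \<open>The exterior derivative as gradient, curl and divergence\<close>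

definition grad :: "(real ^ 3 => real) => real ^ 3 => real ^ 3" where
	"grad f x = (\<chi> i. fd f x (ax i))"

definition curl :: "(real ^ 3 => real ^ 3) => real ^ 3 => real ^ 3" where
	"curl a x = vector [fd a x (ax 2) $ 3 - fd a x (ax 3) $ 2, fd a x (ax 3) $ 1 - fd a x (ax 1) $ 3,
		 fd a x (ax 1) $ 2 - fd a x (ax 2) $ 1]"

definition divg :: "(real ^ 3 => real ^ 3) => real ^ 3 => real" where
	"divg b x = fd b x (ax 1) $ 1 + fd b x (ax 2) $ 2 + fd b x (ax 3) $ 3"

lemma ext_deriv_eval:
	"ext_deriv w x [u] = fd (%y. w y []) x u"
	"ext_deriv w x [u, v] = fd (%y. w y [v]) x u - fd (%y. w y [u]) x v"
	"ext_deriv w x [u, v, t] = fd (%y. w y [v, t]) x u - fd (%y. w y [u, t]) x v + fd (%y. w y [u, v]) x t"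
	"ext_deriv w x [u, v, t, s] = fd (%y. w y [v, t, s]) x u - fd (%y. w y [u, t, s]) x v
		 + fd (%y. w y [u, v, s]) x t - fd (%y. w y [u, v, t]) x s"
	by (simp_all add: ext_deriv_def lessThan_Suc lessThan_nat_numeral numeral_eq_Suc)

lemma ext_deriv_length:
	assumes "open S" "x : S" "!!y vs. y : S ==> length vs ~= k ==> w y vs = 0" "length vs ~= Suc k"
	shows "ext_deriv w x vs = 0"
	unfolding ext_deriv_def
proof (rule sum.neutral, rule ballI)
	fix i assume i: "i : {..<length vs}"
	have "length (take i vs @ drop (Suc i) vs) ~= k" using i assms(4) by auto
	then have "fd (%y. w y (take i vs @ drop (Suc i) vs)) x = fd (%y. 0) x"
		using assms(3) by (intro fd_cong[OF assms(1,2)]) auto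
	then show "(- 1) ^ i * fd (%y. w y (take i vs @ drop (Suc i) vs)) x (vs ! i) = 0" by simp
qed

lemma ext_deriv_cong:
	assumes "open S" "x : S" "!!y. y : S ==> w y = w' y"
	shows "ext_deriv w x = ext_deriv w' x"
	unfolding ext_deriv_def by (intro ext sum.cong refl arg_cong2[of _ _ _ _ "(*)"] fun_cong[OF fd_cong[OF assms(1,2)]])
		(simp add: assms(3))

lemma fd_inner_const:
	assumes "smooth_on S a" "x : S" shows "fd (%y. a y \<bullet> v) x u = fd a x u \<bullet> v"
	by (rule fun_cong[OF fd_eqI[OF has_derivative_inner_left[OF smooth_on_has_derivative[OF assms]]]])

lemma fd_expand:
	fixes a :: "real ^ 3 => 'b::euclidean_space"
	assumes "smooth_on S a" "x : S"
	shows "fd a x u = (u $ 1) *R fd a x (ax 1) + (u $ 2) *R fd a x (ax 2) + (u $ 3) *R fd a x (ax 3)"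
	by (rule lin3_expand[OF smooth_on_linear_fd[OF assms]])

lemma ext_deriv_form0:
	assumes S: "open S" "x : S" and f: "smooth_on S f" and w: "!!y. y : S ==> w y = form0 (f y)"
	shows "ext_deriv w x = form1 (grad f x)"
proof
	fix vs
	show "ext_deriv w x vs = form1 (grad f x) vs"
	proof (cases "length vs = 1")
		case True
		then obtain u where vs: "vs = [u]" unfolding length1 by auto
		have "fd (%y. w y []) x = fd f x" by (rule fd_cong[OF S]) (simp add: w)
		then show ?thesis using fd_expand[OF f S(2), of u]
			by (simp add: vs ext_deriv_eval grad_def inner_vec_def sum_3)
	next
		case False
		then show ?thesis using ext_deriv_length[OF S, of 0 w vs] w by (simp add: form_length)
	qed
qed

lemma ext_deriv_form1:
	assumes S: "open S" "x : S" and f: "smooth_on S a" and w: "!!y. y : S ==> w y = form1 (a y)"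
	shows "ext_deriv w x = form2 (curl a x)"
proof
	fix vs
	show "ext_deriv w x vs = form2 (curl a x) vs"
	proof (cases "length vs = 2")
		case True
		then obtain u v where vs: "vs = [u, v]" unfolding length2 by auto
		have "fd (%y. w y [v]) x u = fd a x u \<bullet> v" for u v
		proof -
			have "fd (%y. w y [v]) x = fd (%y. a y \<bullet> v) x" by (rule fd_cong[OF S]) (simp add: w)
			then show ?thesis using fd_inner_const[OF f S(2)] by simp
		qed
		then show ?thesis using fd_expand[OF f S(2), of u] fd_expand[OF f S(2), of v]
			by (simp add: vs ext_deriv_eval curl_def inner_vec_def sum_3 cross_components) (simp add: algebra_simps)
	next
		case False
		then show ?thesis using ext_deriv_length[OF S, of 1 w vs] w by (simp add: form_length)
	qed
qed

lemma ext_deriv_form2: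
	assumes S: "open S" "x : S" and f: "smooth_on S b" and w: "!!y. y : S ==> w y = form2 (b y)"
	shows "ext_deriv w x = form3 (divg b x)"
proof
	fix vs
	show "ext_deriv w x vs = form3 (divg b x) vs"
	proof (cases "length vs = 3")
		case True
		then obtain u v t where vs: "vs = [u, v, t]" unfolding length3 by auto
		have d: "fd (%y. w y [v, t]) x u = fd b x u \<bullet> cross3 v t" for u v t
		proof -
			have "fd (%y. w y [v, t]) x = fd (%y. b y \<bullet> cross3 v t) x" by (rule fd_cong[OF S]) (simp add: w)
			then show ?thesis using fd_inner_const[OF f S(2)] by simp
		qed
		have "fd b x (ax i) \<bullet> ((u $ i) *R cross3 v t - (v $ i) *R cross3 u t + (t $ i) *R cross3 u v)
				= (u \<bullet> cross3 v t) * fd b x (ax i) $ i" for i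
			using cross3_expansion[of "ax i" u v t] by (simp add: inner_axis' inner_axis)
		from this[of 1] this[of 2] this[of 3]
		have "(fd b x (ax 1) \<bullet> ((u $ 1) *R cross3 v t - (v $ 1) *R cross3 u t + (t $ 1) *R cross3 u v))
				+ (fd b x (ax 2) \<bullet> ((u $ 2) *R cross3 v t - (v $ 2) *R cross3 u t + (t $ 2) *R cross3 u v))
				+ (fd b x (ax 3) \<bullet> ((u $ 3) *R cross3 v t - (v $ 3) *R cross3 u t + (t $ 3) *R cross3 u v))
				= divg b x * (u \<bullet> cross3 v t)" by (simp add: divg_def algebra_simps)
		moreover have "ext_deriv w x vs = fd b x u \<bullet> cross3 v t - fd b x v \<bullet> cross3 u t + fd b x t \<bullet> cross3 u v"
			by (simp add: vs ext_deriv_eval d)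
		ultimately show ?thesis
			using fd_expand[OF f S(2), of u] fd_expand[OF f S(2), of v] fd_expand[OF f S(2), of t]
			by (simp add: vs inner_add_left inner_add_right inner_diff_right)
	next
		case False
		then show ?thesis using ext_deriv_length[OF S, of 2 w vs] w by (simp add: form_length)
	qed
qed

text \<open>On four vectors of a 3-dimensional space the alternating sum is
  \<open>cross3_expansion\<close> paired with the fourth vector, hence zero.\<close>

lemma ext_deriv_form3:
	assumes S: "open S" "x : S" and f: "smooth_on S f" and w: "!!y. y : S ==> w y = form3 (f y)"
	shows "ext_deriv w x = 0"
proof
	fix vs
	show "ext_deriv w x vs = 0 vs"
	proof (cases "length vs = 4")
		case True
		then obtain a b c d where vs: "vs = [a, b, c, d]" by (auto simp: length_Suc_conv numeral_eq_Suc)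
		define g where "g = grad f x"
		have D: "fd (%y. w y [v, t, s]) x u = (g \<bullet> u) * (v \<bullet> cross3 t s)" for u v t s
		proof -
			have "fd (%y. w y [v, t, s]) x = fd (%y. (v \<bullet> cross3 t s) * f y) x"
				by (rule fd_cong[OF S]) (simp add: w)
			then have "fd (%y. w y [v, t, s]) x u = (v \<bullet> cross3 t s) * fd f x u"
				using fd_cmult[OF smooth_on_differentiable[OF f S(2)]] by simp
			also have "fd f x u = g \<bullet> u"
				using fd_expand[OF f S(2), of u] by (simp add: g_def grad_def inner_vec_def sum_3)
			finally show ?thesis by simp
		qed
		have "((g \<bullet> a) *R cross3 b c - (g \<bullet> b) *R cross3 a c + (g \<bullet> c) *R cross3 a b) \<bullet> d
				= ((a \<bullet> cross3 b c) *R g) \<bullet> d"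
			by (simp only: cross3_expansion)
		then show ?thesis
			using cross_triple[of b c d] cross_triple[of a c d] cross_triple[of a b d]
				cross_triple[of c d b] cross_triple[of c d a] cross_triple[of b d a]
			by (simp add: vs ext_deriv_eval D inner_add_left inner_diff_left inner_commute algebra_simps)
	next
		case False
		then show ?thesis using ext_deriv_length[OF S, of 3 w vs] w by (simp add: form_length)
	qed
qed

lemma smooth_on_vec_iff:
	assumes "open S"
	shows "smooth_on S (a :: _ => real ^ 3) \<longleftrightarrow> (\<forall>i. smooth_on S (%x. a x $ i))"
proof -
	have B: "(Basis :: (real^3) set) = range ax" by (auto simp: Basis_vec_def)
	have "smooth_on S a \<longleftrightarrow> (\<forall>b\<in>range ax. smooth_on S (%x. a x \<bullet> b))"
		using smooth_on_component_iff[OF assms, of a] unfolding B .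
	then show ?thesis by (simp add: inner_axis)
qed

lemma smooth_on_vec_lambda:
	assumes "open S" "!!i. smooth_on S (%x. a x i)"
	shows "smooth_on S (%x. (\<chi> i. a x i) :: real ^ 3)"
	unfolding smooth_on_vec_iff[OF assms(1)] using assms(2) by simp

lemma smooth_on_vector3:
	assumes "open S" "smooth_on S a" "smooth_on S b" "smooth_on S c"
	shows "smooth_on S (%x. vector [a x, b x, c x] :: real ^ 3)"
	unfolding smooth_on_vec_iff[OF assms(1)] forall_3 vector_3 using assms by simp

lemma smooth_on_inner:
	fixes a b :: "'a::euclidean_space => real ^ 3"
	assumes "open S" "smooth_on S a" "smooth_on S b"
	shows "smooth_on S (%x. a x \<bullet> b x)"
	unfolding inner_vec_def inner_real_def
	by (intro smooth_on_sum smooth_on_mult assms smooth_on_vec_nth)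

lemma smooth_on_cross:
	fixes a b :: "'a::euclidean_space => real ^ 3"
	assumes "open S" "smooth_on S a" "smooth_on S b"
	shows "smooth_on S (%x. cross3 (a x) (b x))"
	unfolding smooth_on_vec_iff[OF assms(1)] forall_3 cross_components
	by (intro conjI smooth_on_diff smooth_on_mult smooth_on_vec_nth assms)

lemma smooth_on_grad: "open S ==> smooth_on S f ==> smooth_on S (grad f)"
	unfolding grad_def[abs_def] by (intro smooth_on_vec_lambda smooth_on_fd)

lemma smooth_on_curl: "open S ==> smooth_on S a ==> smooth_on S (curl a)"
	unfolding curl_def[abs_def] by (intro smooth_on_vector3 smooth_on_diff smooth_on_vec_nth smooth_on_fd)

lemma smooth_on_divg: "open S ==> smooth_on S b ==> smooth_on S (divg b)"
	unfolding divg_def[abs_def] by (intro smooth_on_add smooth_on_vec_nth smooth_on_fd)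

lemma fd_vec_nth:
	fixes a :: "'a::euclidean_space => real ^ 3"
	assumes "smooth_on S a" "x : S" shows "fd (%y. a y $ i) x u = fd a x u $ i"
	using fd_inner_const[OF assms, of "ax i" u] by (simp add: inner_axis)

lemma divg_curl: "open S ==> smooth_on S a ==> x : S ==> divg (curl a) x = 0"
proof -
	assume a: "open S" "smooth_on S a" "x : S"
	have D: "fd (curl a) x u $ i = fd (%y. curl a y $ i) x u" for i u
		using fd_vec_nth[OF smooth_on_curl[OF a(1,2)] a(3)] by simp
	define h where "h = (%i j k. fd (%y. fd (%z. a z $ i) y (ax j)) x (ax k))"
	have s: "smooth_on S (%z. a z $ i)" for i by (rule smooth_on_vec_nth[OF a(1,2)])
	have e: "fd (%y. fd a y (ax j) $ i) x (ax k) = h i j k" for i j k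
		unfolding h_def by (rule fun_cong[OF fd_cong[OF a(1,3)]]) (rule fd_vec_nth[OF a(2), symmetric])
	have dif: "(%y. fd a y (ax j) $ i) differentiable (at x)" for i j
		by (rule smooth_on_differentiable[OF smooth_on_vec_nth[OF a(1) smooth_on_fd[OF a(2)]] a(3)])
	have sym: "h i j k = h i k j" for i j k unfolding h_def by (rule fd_commute[OF a(1) s a(3)])
	show ?thesis
		unfolding divg_def D
		using sym[of 3 2 1] sym[of 2 3 1] sym[of 1 3 2]
		by (simp add: curl_def vector_3 fd_diff[OF dif dif] e)
qed

lemma bounded_bilinear_cross: "bounded_bilinear cross3"
	using bilinear_cross bilinear_conv_bounded_bilinear by blast

text \<open>Differentiating a pulled back form of positive degree produces second derivatives of
  \<open>T\<close>. They are symmetric in the two directions while \<open>ext_deriv\<close>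
  alternates, so they cancel. Degrees 0 to 2 suffice since 3-forms have zero derivative.\<close>

lemma pullback_ext_deriv:
	assumes S: "open S" "x : S" and S': "open S'" "T ` S <= S'" and T: "smooth_on S T"
		and w: "!!y vs. y : S ==> w y vs = w' (T y) (map (fd T y) vs)"
		and form: "(\<exists>f. smooth_on S' f & (\<forall>z\<in>S'. w' z = form0 (f z))) \<or>
			(\<exists>a. smooth_on S' a & (\<forall>z\<in>S'. w' z = form1 (a z))) \<or>
			(\<exists>b. smooth_on S' b & (\<forall>z\<in>S'. w' z = form2 (b z)))"
	shows "ext_deriv w x vs = ext_deriv w' (T x) (map (fd T x) vs)"
proof -
	have Tx: "T y : S'" if "y : S" for y using that S' by auto
	have dT: "(T has_derivative fd T x) (at x)" by (rule smooth_on_has_derivative[OF T S(2)])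
	define P where "P = (%u v. fd (%y. fd T y v) x u)"
	have dP: "((%y. fd T y v) has_derivative (%u. P u v)) (at x)" for v
		unfolding P_def by (rule smooth_on_has_derivative[OF smooth_on_fd[OF T] S(2)])
	have sym: "P u v = P v u" for u v unfolding P_def by (rule fd_commute_vec[OF S(1) T S(2)])
	have chain: "((%y. g (T y)) has_derivative (%u. fd g (T x) (fd T x u))) (at x)"
		if "smooth_on S' g" for g :: "_ => 'c::euclidean_space"
		using diff_chain_at[OF dT smooth_on_has_derivative[OF that Tx[OF S(2)]]] by (simp add: o_def)
	from form show ?thesis
	proof (elim disjE exE conjE)
		fix f assume f: "smooth_on S' f" and w': "\<forall>z\<in>S'. w' z = form0 (f z)"
		show ?thesis
		proof (cases "length vs = 1")
			case True
			then obtain u where vs: "vs = [u]" unfolding length1 by auto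
			have "fd (%y. w y []) x = fd (%y. f (T y)) x" by (rule fd_cong[OF S]) (simp add: w w' Tx)
			moreover have "fd (%y. w' y []) (T x) = fd f (T x)" by (rule fd_cong[OF S'(1) Tx[OF S(2)]]) (simp add: w')
			ultimately show ?thesis using fd_eqI[OF chain[OF f]] by (simp add: vs ext_deriv_eval)
		next
			case False
			then show ?thesis
				using ext_deriv_length[OF S, of 0 w vs] ext_deriv_length[OF S'(1) Tx[OF S(2)], of 0 w' "map (fd T x) vs"] w w' Tx
				by (simp add: form_length)
		qed
	next
		fix a assume f: "smooth_on S' a" and w': "\<forall>z\<in>S'. w' z = form1 (a z)"
		show ?thesis
		proof (cases "length vs = 2")
			case True
			then obtain u v where vs: "vs = [u, v]" unfolding length2 by auto
			have 1: "fd (%y. w y [v]) x u = a (T x) \<bullet> P u v + fd a (T x) (fd T x u) \<bullet> fd T x v" for u v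
			proof -
				have "fd (%y. w y [v]) x = fd (%y. a (T y) \<bullet> fd T y v) x" by (rule fd_cong[OF S]) (simp add: w w' Tx)
				then show ?thesis using fun_cong[OF fd_eqI[OF has_derivative_inner[OF chain[OF f] dP]]] by metis
			qed
			have 2: "fd (%y. w' y [V]) (T x) U = fd a (T x) U \<bullet> V" for U V
			proof -
				have "fd (%y. w' y [V]) (T x) = fd (%z. a z \<bullet> V) (T x)"
					by (rule fd_cong[OF S'(1) Tx[OF S(2)]]) (simp add: w')
				then show ?thesis using fd_inner_const[OF f Tx[OF S(2)]] by simp
			qed
			show ?thesis using sym[of u v] by (simp add: vs ext_deriv_eval 1 2)
		next
			case False
			then show ?thesis
				using ext_deriv_length[OF S, of 1 w vs] ext_deriv_length[OF S'(1) Tx[OF S(2)], of 1 w' "map (fd T x) vs"] w w' Tx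
				by (simp add: form_length)
		qed
	next
		fix b assume f: "smooth_on S' b" and w': "\<forall>z\<in>S'. w' z = form2 (b z)"
		show ?thesis
		proof (cases "length vs = 3")
			case True
			then obtain u v t where vs: "vs = [u, v, t]" unfolding length3 by auto
			have 1: "fd (%y. w y [v, t]) x u = b (T x) \<bullet> (cross3 (fd T x v) (P u t) + cross3 (P u v) (fd T x t))
					+ fd b (T x) (fd T x u) \<bullet> cross3 (fd T x v) (fd T x t)" for u v t
			proof -
				have "fd (%y. w y [v, t]) x = fd (%y. b (T y) \<bullet> cross3 (fd T y v) (fd T y t)) x"
					by (rule fd_cong[OF S]) (simp add: w w' Tx)
				then show ?thesis
					using fun_cong[OF fd_eqI[OF has_derivative_inner[OF chain[OF f]
							bounded_bilinear.FDERIV[OF bounded_bilinear_cross dP dP]]]] by metis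
			qed
			have 2: "fd (%y. w' y [V, W]) (T x) U = fd b (T x) U \<bullet> cross3 V W" for U V W
			proof -
				have "fd (%y. w' y [V, W]) (T x) = fd (%z. b z \<bullet> cross3 V W) (T x)"
					by (rule fd_cong[OF S'(1) Tx[OF S(2)]]) (simp add: w')
				then show ?thesis using fd_inner_const[OF f Tx[OF S(2)]] by simp
			qed
			show ?thesis
				using sym[of u v] sym[of u t] sym[of v t] cross_skew[of "P u t" "fd T x v"]
				by (simp add: vs ext_deriv_eval 1 2 inner_add_right inner_diff_right)
		next
			case False
			then show ?thesis
				using ext_deriv_length[OF S, of 2 w vs] ext_deriv_length[OF S'(1) Tx[OF S(2)], of 2 w' "map (fd T x) vs"] w w' Tx
				by (simp add: form_length)
		qed
	qed
qed

section \<open>Charts\<close>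

lemma chart_topspace:
	assumes "is_chart X c"
	shows "fst c <= topspace X" "topspace (subtopology X (fst c)) = fst c"
	using assms openin_subset by (auto simp: is_chart_def topspace_subtopology_subset)

lemma chart_inj: "is_chart X c ==> inj_on (snd c) (fst c)"
	using homeomorphic_imp_injective_map chart_topspace by (metis is_chart_def)

lemma chart_inv_into: "is_chart X c ==> x : img c ==> chart_inv c x : fst c"
	by (simp add: chart_image_def chart_inv_def inv_into_into)

lemma chart_chart_inv: "is_chart X c ==> x : img c ==> snd c (chart_inv c x) = x"
	by (simp add: chart_image_def chart_inv_def f_inv_into_f)

lemma chart_inv_chart: "is_chart X c ==> p : fst c ==> chart_inv c (snd c p) = p"
	using chart_inj by (fastforce simp: chart_inv_def)

lemma chart_into: "p : fst c ==> snd c p : img c"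
	by (simp add: chart_image_def)

lemma chart_open_image:
	assumes "is_chart X c" "openin X U"
	shows "open (snd c ` (fst c \<inter> U))"
proof -
	have "openin (subtopology X (fst c)) (fst c \<inter> U)"
		using assms(2) by (metis inf_commute openin_subtopology)
	then have "openin (top_of_set (img c)) (snd c ` (fst c \<inter> U))"
		using assms(1) homeomorphic_imp_open_map open_map_def unfolding is_chart_def by blast
	then show ?thesis using assms(1) openin_open_trans is_chart_def by blast
qed

lemma chart_open_preimage:
	assumes "is_chart X c" "open V"
	shows "openin X {p : fst c. snd c p : V}"
proof -
	have "continuous_map (subtopology X (fst c)) (top_of_set (img c)) (snd c)"
		using assms(1) homeomorphic_imp_continuous_map unfolding is_chart_def by blast
	moreover have "openin (top_of_set (img c)) (img c \<inter> V)"
		using assms(2) by (simp add: openin_open_Int)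
	ultimately have "openin (subtopology X (fst c)) {p : topspace (subtopology X (fst c)). snd c p : img c \<inter> V}"
		using openin_continuous_map_preimage by blast
	then have "openin (subtopology X (fst c)) {p : fst c. snd c p : V}"
		using chart_topspace[OF assms(1)] by (auto simp: chart_image_def elim!: back_subst[of "openin _"])
	then show ?thesis using assms(1) openin_trans_full unfolding is_chart_def by blast
qed

lemma chart_inv_image_eq:
	assumes "is_chart X c" "K <= img c"
	shows "chart_inv c ` K = {p : fst c. snd c p : K}"
proof (intro set_eqI iffI)
	fix p assume "p : chart_inv c ` K"
	then obtain x where x: "x : K" "p = chart_inv c x" by blast
	then show "p : {p : fst c. snd c p : K}"
		using assms(2) chart_inv_into[OF assms(1), of x] chart_chart_inv[OF assms(1), of x] by auto
next
	fix p assume "p : {p : fst c. snd c p : K}"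
	then show "p : chart_inv c ` K"
		using chart_inv_chart[OF assms(1), of p] by (metis (mono_tags, lifting) imageI mem_Collect_eq)
qed

lemma chart_compact_preimage:
	assumes "is_chart X c" "compact K" "K <= img c"
	shows "compactin X (chart_inv c ` K)"
proof -
	obtain g where g: "homeomorphic_maps (subtopology X (fst c)) (top_of_set (img c)) (snd c) g"
		using assms(1) unfolding is_chart_def homeomorphic_map_maps by blast
	then have "continuous_map (top_of_set (img c)) (subtopology X (fst c)) g"
		by (simp add: homeomorphic_maps_def)
	moreover have "compactin (top_of_set (img c)) K"
		using assms by (simp add: compactin_subtopology)
	ultimately have "compactin (subtopology X (fst c)) (g ` K)" using image_compactin by blast
	then have "compactin X (g ` K)" by (simp add: compactin_subtopology)
	moreover have "g ` K = chart_inv c ` K"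
	proof (rule image_cong[OF refl])
		fix x assume "x : K"
		then have x: "x : img c" using assms(3) by blast
		have cg: "continuous_map (top_of_set (img c)) (subtopology X (fst c)) g"
			using g by (simp add: homeomorphic_maps_def)
		have "g x : topspace (subtopology X (fst c))"
			using continuous_map_image_subset_topspace[OF cg] x by auto
		then have "g x : fst c" using chart_topspace[OF assms(1)] by simp
		moreover have "snd c (g x) = x" using g x by (auto simp: homeomorphic_maps_def)
		ultimately have "snd c (g x) = x" "g x : fst c" by auto
		then show "g x = chart_inv c x" using chart_inv_chart[OF assms(1)] by metis
	qed
	ultimately show ?thesis by simp
qed

lemma chart_compact_image:
	assumes "is_chart X c" "compactin X K" "K <= fst c"
	shows "compact (snd c ` K)"
proof -
	have "continuous_map (subtopology X (fst c)) (top_of_set (img c)) (snd c)"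
		using assms(1) homeomorphic_imp_continuous_map unfolding is_chart_def by blast
	moreover have "compactin (subtopology X (fst c)) K" using assms by (simp add: compactin_subtopology)
	ultimately have "compactin (top_of_set (img c)) (snd c ` K)" using image_compactin by blast
	then show ?thesis by (simp add: compactin_subtopology)
qed

section \<open>Overlaps and transition maps\<close>

lemma overlap_iff:
	assumes "is_chart X c"
	shows "x : overlap c c' \<longleftrightarrow> x : img c & chart_inv c x : fst c'"
proof
	assume "x : overlap c c'"
	then obtain p where "p : fst c" "p : fst c'" "x = snd c p" by (auto simp: overlap_def)
	then show "x : img c & chart_inv c x : fst c'"
		using chart_inv_chart[OF assms] chart_into by metis
next
	assume "x : img c & chart_inv c x : fst c'"
	then show "x : overlap c c'"
		using chart_inv_into[OF assms] chart_chart_inv[OF assms] unfolding overlap_def by (metis IntI imageI)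
qed

lemma overlapI: "p : fst c ==> p : fst c' ==> snd c p : overlap c c'"
	by (auto simp: overlap_def)

lemma overlap_subset: "overlap c c' <= img c"
	by (auto simp: overlap_def chart_image_def)

lemma open_overlap: "is_chart X c ==> is_chart X c' ==> open (overlap c c')"
	using chart_open_image[of X c "fst c'"] by (simp add: overlap_def is_chart_def)

lemma overlap_self: "overlap c c = img c"
	by (auto simp: overlap_def chart_image_def)

lemma transition_chart: "is_chart X c ==> p : fst c ==> trn c c' (snd c p) = snd c' p"
	by (simp add: transition_def chart_inv_chart)

lemma transition_overlap:
	assumes "is_chart X c" "is_chart X c'" "x : overlap c c'"
	shows "trn c c' x : overlap c' c" "chart_inv c' (trn c c' x) = chart_inv c x"
		"trn c' c (trn c c' x) = x"
proof -
	obtain p where p: "p : fst c" "p : fst c'" "x = snd c p" using assms(3) by (auto simp: overlap_def)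
	have t: "trn c c' x = snd c' p" using p transition_chart[OF assms(1)] by simp
	then show "trn c c' x : overlap c' c" using p by (auto simp: overlap_def)
	show "chart_inv c' (trn c c' x) = chart_inv c x"
		using t p chart_inv_chart[OF assms(1)] chart_inv_chart[OF assms(2)] by simp
	show "trn c' c (trn c c' x) = x"
		using t p transition_chart[OF assms(2)] by simp
qed

text \<open>Hausdorffness makes compact sets closed, so that forms with compact support in a chart
  can be extended by zero.\<close>

locale atlas =
	fixes X :: "'a topology" and A :: "'a chart set"
	assumes atlas: "oriented_smooth_atlas X A" and hausdorff: "Hausdorff_space X"
begin

lemma chart: "c : A ==> is_chart X c"
	using atlas by (simp add: oriented_smooth_atlas_def)

lemma covers: "p : topspace X ==> \<exists>c\<in>A. p : fst c"
	using atlas by (auto simp: oriented_smooth_atlas_def)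

lemma chart_subset: "c : A ==> fst c <= topspace X"
	using chart chart_topspace by blast

lemma open_image: "c : A ==> open (img c)"
	using chart is_chart_def by blast

lemma smooth_transition: "c : A ==> c' : A ==> smooth_on (overlap c c') (trn c c')"
	using atlas by (simp add: oriented_smooth_atlas_def)

lemma det_transition: "c : A ==> c' : A ==> x : overlap c c' ==> 0 < det (matrix (fd (trn c c') x))"
	using atlas by (simp add: oriented_smooth_atlas_def)

lemma open_ovl: "c : A ==> c' : A ==> open (overlap c c')"
	using open_overlap chart by blast

lemma linear_transition: "c : A ==> c' : A ==> x : overlap c c' ==> linear (fd (trn c c') x)"
	using smooth_on_linear_fd smooth_transition by blast

lemma transition_cocycle:
	assumes "c : A" "c' : A" "c'' : A" "x : overlap c c'" "x : overlap c c''"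
	shows "trn c c' x : overlap c' c''"
		"trn c' c'' (trn c c' x) = trn c c'' x"
		"fd (trn c c'') x v = fd (trn c' c'') (trn c c' x) (fd (trn c c') x v)"
proof -
	have on: "trn c c' y : overlap c' c''" and
		eq: "trn c' c'' (trn c c' y) = trn c c'' y"
		if "y : overlap c c' \<inter> overlap c c''" for y
	proof -
		have y: "y : img c" "chart_inv c y : fst c'" "chart_inv c y : fst c''"
			using that overlap_iff[OF chart[OF assms(1)]] by auto
		then show "trn c c' y : overlap c' c''"
			by (auto simp: transition_def overlap_def)
		show "trn c' c'' (trn c c' y) = trn c c'' y"
			using y chart_inv_chart[OF chart[OF assms(2)]] by (simp add: transition_def)
	qed
	then show "trn c c' x : overlap c' c''" "trn c' c'' (trn c c' x) = trn c c'' x"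
		using assms by auto
	have op: "open (overlap c c' \<inter> overlap c c'')" using open_ovl assms by blast
	have "fd (trn c c'') x v = fd (%y. trn c' c'' (trn c c' y)) x v"
		by (rule fun_cong[OF fd_cong[OF op]]) (use assms eq in auto)
	also have "... = fd (trn c' c'') (trn c c' x) (fd (trn c c') x v)"
		by (rule smooth_on_compose_fd[OF smooth_transition[OF assms(2,3)] smooth_transition[OF assms(1,2)] assms(4)])
			 (use on assms in auto)
	finally show "fd (trn c c'') x v = fd (trn c' c'') (trn c c' x) (fd (trn c c') x v)" .
qed

lemma transition_self:
	assumes "c : A" "x : img c"
	shows "trn c c x = x" "fd (trn c c) x v = v"
proof -
	have e: "trn c c y = y" if "y : img c" for y
		using that chart_chart_inv[OF chart[OF assms(1)]] by (simp add: transition_def)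
	then show "trn c c x = x" using assms by simp
	have "fd (trn c c) x = fd (%y. y) x"
		by (rule fd_cong[OF open_image[OF assms(1)] assms(2)]) (rule e)
	then show "fd (trn c c) x v = v" by simp
qed

section \<open>Algebra of differential forms\<close>

lemma form_outside: "w : forms A k ==> c ~: A \<or> x ~: img c ==> w c x = 0"
	unfolding forms_def by blast

lemma form_alternating: "w : forms A k ==> c : A ==> x : img c ==> alternating_form k (w c x)"
	by (simp add: forms_def)

lemma form_smooth: "w : forms A k ==> c : A ==> smooth_on (img c) (%x. w c x vs)"
	by (simp add: forms_def)

lemma form_transition: "w : forms A k ==> c : A ==> c' : A ==> x : overlap c c' ==>
		w c x vs = w c' (trn c c' x) (map (fd (trn c c') x) vs)"
	by (simp add: forms_def)

lemma formsI:
	assumes "!!c x. c ~: A \<or> x ~: img c ==> w c x = 0"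
		"!!c x. c : A ==> x : img c ==> alternating_form k (w c x)"
		"!!c vs. c : A ==> smooth_on (img c) (%x. w c x vs)"
		"!!c c' x vs. c : A ==> c' : A ==> x : overlap c c' ==>
			 w c x vs = w c' (trn c c' x) (map (fd (trn c c') x) vs)"
	shows "w : forms A k"
	using assms by (auto simp: forms_def)

lemma form_zero_transition:
	assumes "w : forms A k" "c : A" "c' : A" "x : overlap c c'" "w c' (trn c c' x) = 0"
	shows "w c x = 0"
	using form_transition[OF assms(1-4)] assms(5) by (auto simp: fun_eq_iff)

lemma forms_eqI:
	assumes w: "w : forms A k" "v : forms A k"
		and eq: "!!p. p : topspace X ==> \<exists>c\<in>A. p : fst c & w c (snd c p) = v c (snd c p)"
	shows "w = v"
proof (intro ext)
	fix c x vs
	show "w c x vs = v c x vs"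
	proof (cases "c : A & x : img c")
		case True
		then have p: "chart_inv c x : fst c" using chart_inv_into[OF chart] by blast
		then obtain c' where c': "c' : A" "chart_inv c x : fst c'"
			"w c' (snd c' (chart_inv c x)) = v c' (snd c' (chart_inv c x))"
			using eq chart_subset True by blast
		have x: "x : overlap c c'" using overlap_iff[OF chart] True c' by blast
		show ?thesis
			using form_transition[OF w(1) _ c'(1) x] form_transition[OF w(2) _ c'(1) x] c'(3) True
			by (simp add: transition_def)
	next
		case False
		then show ?thesis using form_outside w by metis
	qed
qed

lemma alternating_lincomb:
	assumes "alternating_form k a" "alternating_form k b"
	shows "alternating_form k (%vs. r * a vs + s * b vs)"
proof -
	have "linear (%v. r * a (vs[i := v]) + s * b (vs[i := v]))" if "length vs = k & i < k" for vs i
	proof -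
		have "linear (%v. a (vs[i := v]))" "linear (%v. b (vs[i := v]))"
			using assms that unfolding alternating_form_def by blast+
		from linear_compose_add[OF linear_compose_scale_right[OF this(1), of r] linear_compose_scale_right[OF this(2), of s]]
		show ?thesis by simp
	qed
	moreover have "r * a vs + s * b vs = 0" if "length vs ~= k" for vs
		using assms that unfolding alternating_form_def by simp
	moreover have "r * a vs + s * b vs = 0" if "length vs = k & i < j & j < k & vs ! i = vs ! j" for vs i j
	proof -
		have "a vs = 0" "b vs = 0" using assms that unfolding alternating_form_def by blast+
		then show ?thesis by simp
	qed
	ultimately show ?thesis unfolding alternating_form_def by blast
qed

lemma forms_lincomb:
	assumes w: "w : forms A k" "v : forms A k"
	shows "(%c x vs. r * w c x vs + s * v c x vs) : forms A k"
proof (rule formsI)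
	fix c x assume "c ~: A \<or> x ~: img c"
	then show "(%vs. r * w c x vs + s * v c x vs) = 0"
		using form_outside[OF w(1)] form_outside[OF w(2)] by (auto simp: fun_eq_iff)
next
	fix c vs assume "c : A"
	then show "smooth_on (img c) (%x. r * w c x vs + s * v c x vs)"
		by (intro smooth_on_add smooth_on_mult open_image smooth_on_const form_smooth[OF w(1)] form_smooth[OF w(2)])
next
	fix c c' x vs assume "c : A" "c' : A" "x : overlap c c'"
	then show "r * w c x vs + s * v c x vs = r * w c' (trn c c' x) (map (fd (trn c c') x) vs)
			+ s * v c' (trn c c' x) (map (fd (trn c c') x) vs)"
		using form_transition[OF w(1)] form_transition[OF w(2)] by metis
qed (intro alternating_lincomb form_alternating[OF w(1)] form_alternating[OF w(2)])

lemma forms_0: "0 : forms A k"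
	by (rule formsI) (auto simp: alternating_form_def intro: linear_zero)

lemma forms_add: "w : forms A k ==> v : forms A k ==> w + v : forms A k"
	using forms_lincomb[of w k v 1 1] by (simp add: plus_fun_def)

lemma forms_diff: "w : forms A k ==> v : forms A k ==> w - v : forms A k"
	using forms_lincomb[of w k v 1 "-1"] by (simp add: fun_diff_def)

definition scale :: "real => 'a dform => 'a dform" where
	"scale r w = (%c x vs. r * w c x vs)"

lemma forms_scale: "w : forms A k ==> scale r w : forms A k"
	using forms_lincomb[of w k w r 0] by (simp add: scale_def)

lemma forms_sum: "(!!i. i : I ==> w i : forms A k) ==> (\<Sum>i\<in>I. w i) : forms A k"
	by (induction I rule: infinite_finite_induct) (auto intro: forms_add forms_0)

definition smul :: "('a => real) => 'a dform => 'a dform" where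
	"smul g w = (%c x vs. g (chart_inv c x) * w c x vs)"

lemma smooth_functionD:
	"smooth_function A g ==> c : A ==> smooth_on (img c) (%x. g (chart_inv c x))"
	by (simp add: smooth_function_def o_def)

lemma forms_smul:
	assumes g: "smooth_function A g" and w: "w : forms A k"
	shows "smul g w : forms A k"
	unfolding smul_def
proof (rule formsI)
	fix c x assume "c ~: A \<or> x ~: img c"
	then show "(%vs. g (chart_inv c x) * w c x vs) = 0"
		using form_outside[OF w(1)] by (auto simp: fun_eq_iff)
next
	fix c x assume "c : A" "x : img c"
	then show "alternating_form k (%vs. g (chart_inv c x) * w c x vs)"
		using alternating_lincomb[OF form_alternating[OF w] form_alternating[OF w], of c x c x _ 0] by simp
next
	fix c vs assume "c : A"
	then show "smooth_on (img c) (%x. g (chart_inv c x) * w c x vs)"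
		by (intro smooth_on_mult open_image smooth_functionD[OF g] form_smooth[OF w(1)])
next
	fix c c' x vs assume "c : A" "c' : A" "x : overlap c c'"
	then show "g (chart_inv c x) * w c x vs =
			g (chart_inv c' (trn c c' x)) * w c' (trn c c' x) (map (fd (trn c c') x) vs)"
		using form_transition[OF w(1)] transition_overlap(2)[OF chart chart] by metis
qed

definition vec1 :: "'a dform => 'a chart => real ^ 3 => real ^ 3" where
	"vec1 w c x = (\<chi> i. w c x [ax i])"

definition vec2 :: "'a dform => 'a chart => real ^ 3 => real ^ 3" where
	"vec2 w c x = vector [w c x [ax 2, ax 3], w c x [ax 3, ax 1], w c x [ax 1, ax 2]]"

text \<open>The coefficient of dx dy dz. It is multiplied by the Jacobian determinant under a change
  of chart (\<open>dens_transition\<close>), so its sign does not depend on the chart.\<close>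

definition dens :: "'a dform => 'a chart => real ^ 3 => real" where
	"dens w c x = w c x std_basis"

lemma zero_alternating: "alternating_form k (0 :: 'b::euclidean_space list => real)"
	by (auto simp: alternating_form_def intro: linear_zero)

lemma form_alternating_all: "w : forms A k ==> alternating_form k (w c x)"
	using form_alternating form_outside zero_alternating by metis

lemma form0_repr: "w : forms A 0 ==> w c x = form0 (w c x [])"
	by (rule alternating_0_eq[OF form_alternating_all])

lemma form1_repr: "w : forms A 1 ==> w c x = form1 (vec1 w c x)"
	unfolding vec1_def by (rule alternating_1_eq[OF form_alternating_all])

lemma form2_repr: "w : forms A 2 ==> w c x = form2 (vec2 w c x)"
	unfolding vec2_def by (rule alternating_2_eq[OF form_alternating_all])

lemma form3_repr: "w : forms A 3 ==> w c x = form3 (dens w c x)"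
	unfolding dens_def by (rule alternating_3_eq[OF form_alternating_all])

lemma smooth_vec1: "w : forms A 1 ==> c : A ==> smooth_on (img c) (vec1 w c)"
	unfolding vec1_def[abs_def] by (intro smooth_on_vec_lambda open_image form_smooth)

lemma smooth_vec2: "w : forms A 2 ==> c : A ==> smooth_on (img c) (vec2 w c)"
	unfolding vec2_def[abs_def] by (intro smooth_on_vector3 open_image form_smooth)

lemma smooth_dens: "w : forms A 3 ==> c : A ==> smooth_on (img c) (dens w c)"
	unfolding dens_def[abs_def] by (intro form_smooth)

lemma dens_transition:
	assumes "w : forms A 3" "c : A" "c' : A" "x : overlap c c'"
	shows "dens w c x = det (matrix (fd (trn c c') x)) * dens w c' (trn c c' x)"
proof -
	have "dens w c x = w c' (trn c c' x) (map (fd (trn c c') x) std_basis)"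
		unfolding dens_def by (rule form_transition[OF assms])
	also have "... = form3 (dens w c' (trn c c' x)) (map (fd (trn c c') x) std_basis)"
		using form3_repr[OF assms(1)] by metis
	finally show ?thesis
		using form3_map_std_basis[OF linear_transition[OF assms(2-4)]] by (simp add: mult.commute)
qed

lemma form3_eqI:
	assumes w: "w : forms A 3" "v : forms A 3"
		and eq: "!!p. p : topspace X ==> \<exists>c\<in>A. p : fst c & dens w c (snd c p) = dens v c (snd c p)"
	shows "w = v"
proof (rule forms_eqI[OF w])
	fix p assume "p : topspace X"
	then show "\<exists>c\<in>A. p : fst c & w c (snd c p) = v c (snd c p)"
		using eq form3_repr[OF w(1)] form3_repr[OF w(2)] by metis
qed

lemma wedge_map:
	"wedge k l a b (map L vs) = wedge k l (%us. a (map L us)) (%us. b (map L us)) vs"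
proof (cases "length vs = k + l")
	case True
	have "map (%i. map L vs ! p i) [i..<j] = map L (map (%i. vs ! p i) [i..<j])"
		if "p permutes {..<k + l}" "j <= k + l" for p i j
	proof -
		have "p n < length vs" if "n < j" for n
			using permutes_in_image[OF \<open>p permutes {..<k + l}\<close>, of n] True that \<open>j <= k + l\<close> by auto
		then show ?thesis by simp
	qed
	note [simp] = this
	show ?thesis
		using True unfolding wedge_def by (auto intro!: sum.cong simp del: map_map map_eq_conv)
qed (simp add: wedge_def)

lemma form_wedge_transition:
	assumes "w : forms A k" "v : forms A l" "c : A" "c' : A" "x : overlap c c'"
	shows "form_wedge k l w v c x vs =
		form_wedge k l w v c' (trn c c' x) (map (fd (trn c c') x) vs)"
proof -
	have "w c x = (%vs. w c' (trn c c' x) (map (fd (trn c c') x) vs))"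
		"v c x = (%vs. v c' (trn c c' x) (map (fd (trn c c') x) vs))"
		using form_transition[OF assms(1,3-5)] form_transition[OF assms(2,3-5)] by auto
	then show ?thesis by (simp add: form_wedge_def wedge_map)
qed

lemma form_wedge_11: "w : forms A 1 ==> v : forms A 1 ==>
		form_wedge 1 1 w v c x = form2 (cross3 (vec1 w c x) (vec1 v c x))"
	unfolding form_wedge_def using form1_repr wedge_1_1 by metis

lemma form_wedge_12: "w : forms A 1 ==> v : forms A 2 ==>
		form_wedge 1 2 w v c x = form3 (vec1 w c x \<bullet> vec2 v c x)"
	unfolding form_wedge_def using form1_repr form2_repr wedge_1_2 by metis

lemma form_wedge_03: "w : forms A 0 ==> v : forms A 3 ==>
		form_wedge 0 3 w v c x = form3 (w c x [] * dens v c x)"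
	unfolding form_wedge_def using form0_repr form3_repr wedge_0_3 by metis

lemma smooth_form_eval:
	assumes "open S"
	shows "smooth_on S f ==> smooth_on S (%x. form0 (f x) vs)"
		"smooth_on S a ==> smooth_on S (%x. form1 (a x) vs)"
		"smooth_on S a ==> smooth_on S (%x. form2 (a x) vs)"
		"smooth_on S f ==> smooth_on S (%x. form3 (f x) vs)"
proof -
	show "smooth_on S (%x. form0 (f x) vs)" if "smooth_on S f"
		using that by (cases "vs = []") (simp_all add: form0_def)
	show "smooth_on S (%x. form1 (a x) vs)" if a: "smooth_on S a"
	proof (cases "length vs = 1")
		case True
		then obtain u where "vs = [u]" unfolding length1 by auto
		then show ?thesis using smooth_on_inner_const[OF assms a] by simp
	qed (simp add: form_length(2))
	show "smooth_on S (%x. form2 (a x) vs)" if a: "smooth_on S a"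
	proof (cases "length vs = 2")
		case True
		then obtain u v where "vs = [u, v]" unfolding length2 by auto
		then show ?thesis using smooth_on_inner_const[OF assms a] by simp
	qed (simp add: form_length(3))
	show "smooth_on S (%x. form3 (f x) vs)" if f: "smooth_on S f"
	proof (cases "length vs = 3")
		case True
		then obtain u v w where "vs = [u, v, w]" unfolding length3 by auto
		then show ?thesis using smooth_on_mult[OF assms f smooth_on_const] by simp
	qed (simp add: form_length(4))
qed

lemma vec_outside:
	assumes "c ~: A \<or> x ~: img c"
	shows "w : forms A 1 ==> vec1 w c x = 0" "w : forms A 2 ==> vec2 w c x = 0" "w : forms A 3 ==> dens w c x = 0"
		"w : forms A 0 ==> w c x [] = 0"
	using form_outside[OF _ assms]
	by (simp_all add: vec1_def vec2_def dens_def vec_eq_iff forall_3 vector_3)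

lemma forms_wedge_11:
	assumes w: "w : forms A 1" and v: "v : forms A 1" shows "form_wedge 1 1 w v : forms A 2"
proof (rule formsI)
	fix c vs assume "c : A"
	then show "smooth_on (img c) (%x. form_wedge 1 1 w v c x vs)"
		unfolding form_wedge_11[OF assms]
		by (intro smooth_form_eval smooth_on_cross open_image smooth_vec1[OF w] smooth_vec1[OF v])
next
	fix c x assume "c ~: A \<or> x ~: img c"
	then show "form_wedge 1 1 w v c x = 0"
		unfolding form_wedge_11[OF assms] by (simp add: vec_outside(1)[OF _ w])
next
	fix c x show "alternating_form 2 (form_wedge 1 1 w v c x)"
		unfolding form_wedge_11[OF assms] by simp
next
	fix c c' x vs assume "c : A" "c' : A" "x : overlap c c'"
	then show "form_wedge 1 1 w v c x vs = form_wedge 1 1 w v c' (trn c c' x) (map (fd (trn c c') x) vs)"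
		by (rule form_wedge_transition[OF assms])
qed

lemma forms_wedge_12:
	assumes w: "w : forms A 1" and v: "v : forms A 2" shows "form_wedge 1 2 w v : forms A 3"
proof (rule formsI)
	fix c vs assume "c : A"
	then show "smooth_on (img c) (%x. form_wedge 1 2 w v c x vs)"
		unfolding form_wedge_12[OF assms]
		by (intro smooth_form_eval smooth_on_inner open_image smooth_vec1[OF w] smooth_vec2[OF v])
next
	fix c x assume "c ~: A \<or> x ~: img c"
	then show "form_wedge 1 2 w v c x = 0"
		unfolding form_wedge_12[OF assms] by (simp add: vec_outside(1)[OF _ w])
next
	fix c x show "alternating_form 3 (form_wedge 1 2 w v c x)"
		unfolding form_wedge_12[OF assms] by simp
qed (rule form_wedge_transition[OF assms])

lemma forms_wedge_03:
	assumes w: "w : forms A 0" and v: "v : forms A 3" shows "form_wedge 0 3 w v : forms A 3"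
proof (rule formsI)
	fix c vs assume "c : A"
	then show "smooth_on (img c) (%x. form_wedge 0 3 w v c x vs)"
		unfolding form_wedge_03[OF assms]
		by (intro smooth_form_eval smooth_on_mult open_image form_smooth[OF w] smooth_dens[OF v])
next
	fix c x assume "c ~: A \<or> x ~: img c"
	then show "form_wedge 0 3 w v c x = 0"
		unfolding form_wedge_03[OF assms] by (simp add: vec_outside(3)[OF _ v])
next
	fix c x show "alternating_form 3 (form_wedge 0 3 w v c x)"
		unfolding form_wedge_03[OF assms] by simp
qed (rule form_wedge_transition[OF assms])

section \<open>The exterior derivative\<close>

lemma form_d_eq: "c : A ==> x : img c ==> form_d A w c x = ext_deriv (w c) x"
	by (simp add: form_d_def)

lemma form_d_0:
	assumes "w : forms A 0" "c : A" "x : img c"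
	shows "form_d A w c x = form1 (grad (%y. w c y []) x)"
	unfolding form_d_eq[OF assms(2,3)]
	by (rule ext_deriv_form0[OF open_image[OF assms(2)] assms(3) form_smooth[OF assms(1,2)]])
		 (rule form0_repr[OF assms(1)])

lemma form_d_1:
	assumes "w : forms A 1" "c : A" "x : img c"
	shows "form_d A w c x = form2 (curl (vec1 w c) x)"
	unfolding form_d_eq[OF assms(2,3)]
	by (rule ext_deriv_form1[OF open_image[OF assms(2)] assms(3) smooth_vec1[OF assms(1,2)]])
		 (rule form1_repr[OF assms(1)])

lemma form_d_2:
	assumes "w : forms A 2" "c : A" "x : img c"
	shows "form_d A w c x = form3 (divg (vec2 w c) x)"
	unfolding form_d_eq[OF assms(2,3)]
	by (rule ext_deriv_form2[OF open_image[OF assms(2)] assms(3) smooth_vec2[OF assms(1,2)]])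
		 (rule form2_repr[OF assms(1)])

lemma form_d_3: "w : forms A 3 ==> form_d A w = 0"
proof (intro ext)
	fix c x vs assume w: "w : forms A 3"
	show "form_d A w c x vs = 0 c x vs"
	proof (cases "c : A & x : img c")
		case True
		then have "ext_deriv (w c) x = 0"
			by (intro ext_deriv_form3[OF open_image _ smooth_dens[OF w]]) (auto intro: form3_repr[OF w])
		then show ?thesis using True by (simp add: form_d_eq)
	qed (auto simp: form_d_def)
qed

lemma form_d_outside: "c ~: A \<or> x ~: img c ==> form_d A w c x = 0"
	by (auto simp: form_d_def)

lemma form_d_transition:
	assumes w: "w : forms A 0 \<or> w : forms A 1 \<or> w : forms A 2"
		and c: "c : A" "c' : A" "x : overlap c c'"
	shows "form_d A w c x vs = form_d A w c' (trn c c' x) (map (fd (trn c c') x) vs)"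
proof -
	have sub: "trn c c' ` overlap c c' <= overlap c' c"
		using transition_overlap(1)[OF chart[OF c(1)] chart[OF c(2)]] by blast
	have x: "x : img c" "trn c c' x : img c'"
		using c(3) sub overlap_subset by blast+
	have sm: "smooth_on (overlap c' c) f" if "smooth_on (img c') f" for f :: "_ => 'c::euclidean_space"
		using smooth_on_subset[OF that overlap_subset] .
	have "ext_deriv (w c) x vs = ext_deriv (w c') (trn c c' x) (map (fd (trn c c') x) vs)"
	proof (rule pullback_ext_deriv[OF open_ovl[OF c(1,2)] c(3) open_ovl[OF c(2,1)] sub smooth_transition[OF c(1,2)]])
		fix y vs assume "y : overlap c c'"
		then show "w c y vs = w c' (trn c c' y) (map (fd (trn c c') y) vs)"
			using w form_transition c by blast
	next
		from w show "(\<exists>f. smooth_on (overlap c' c) f & (\<forall>z\<in>overlap c' c. w c' z = form0 (f z))) \<or>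
			(\<exists>a. smooth_on (overlap c' c) a & (\<forall>z\<in>overlap c' c. w c' z = form1 (a z))) \<or>
			(\<exists>b. smooth_on (overlap c' c) b & (\<forall>z\<in>overlap c' c. w c' z = form2 (b z)))"
		proof (elim disjE)
			assume w: "w : forms A 0"
			show ?thesis using sm[OF form_smooth[OF w c(2)]] form0_repr[OF w] by blast
		next
			assume w: "w : forms A 1"
			show ?thesis using sm[OF smooth_vec1[OF w c(2)]] form1_repr[OF w] by blast
		next
			assume w: "w : forms A 2"
			show ?thesis using sm[OF smooth_vec2[OF w c(2)]] form2_repr[OF w] by blast
		qed
	qed
	then show ?thesis using c x by (simp add: form_d_eq)
qed

lemma forms_d_0: assumes w: "w : forms A 0" shows "form_d A w : forms A 1"
proof (rule formsI)
	fix c vs assume c: "c : A"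
	show "smooth_on (img c) (%x. form_d A w c x vs)"
		by (rule smooth_on_cong[OF open_image[OF c] _ smooth_form_eval(2)[OF open_image[OF c] smooth_on_grad[OF open_image[OF c] form_smooth[OF w c]]]])
			 (simp add: form_d_0[OF w c])
next
	fix c x assume "c : A" "x : img c"
	then show "alternating_form 1 (form_d A w c x)"
		using form_d_0[OF w] alternating_forms(2) by metis
qed (use form_d_transition w form_d_outside in blast)+

lemma forms_d_1: assumes w: "w : forms A 1" shows "form_d A w : forms A 2"
proof (rule formsI)
	fix c vs assume c: "c : A"
	show "smooth_on (img c) (%x. form_d A w c x vs)"
		by (rule smooth_on_cong[OF open_image[OF c] _ smooth_form_eval(3)[OF open_image[OF c] smooth_on_curl[OF open_image[OF c] smooth_vec1[OF w c]]]])
			 (simp add: form_d_1[OF w c])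
next
	fix c x assume "c : A" "x : img c"
	then show "alternating_form 2 (form_d A w c x)"
		using form_d_1[OF w] alternating_forms(3) by metis
qed (use form_d_transition w form_d_outside in blast)+

lemma forms_d_2: assumes w: "w : forms A 2" shows "form_d A w : forms A 3"
proof (rule formsI)
	fix c vs assume c: "c : A"
	show "smooth_on (img c) (%x. form_d A w c x vs)"
		by (rule smooth_on_cong[OF open_image[OF c] _ smooth_form_eval(4)[OF open_image[OF c] smooth_on_divg[OF open_image[OF c] smooth_vec2[OF w c]]]])
			 (simp add: form_d_2[OF w c])
next
	fix c x assume "c : A" "x : img c"
	then show "alternating_form 3 (form_d A w c x)"
		using form_d_2[OF w] alternating_forms(4) by metis
qed (use form_d_transition w form_d_outside in blast)+

lemma form_d_lincomb:
	assumes w: "w : forms A k" "v : forms A k"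
	shows "form_d A (%c x vs. r * w c x vs + s * v c x vs) = (%c x vs. r * form_d A w c x vs + s * form_d A v c x vs)"
proof (intro ext)
	fix c x vs
	show "form_d A (%c x vs. r * w c x vs + s * v c x vs) c x vs = r * form_d A w c x vs + s * form_d A v c x vs"
	proof (cases "c : A & x : img c")
		case True
		then have d: "(%y. u c y us) differentiable (at x)" if "u : forms A k" for u us
			using smooth_on_differentiable[OF form_smooth[OF that]] by blast
		have "fd (%y. r * w c y us + s * v c y us) x u = r * fd (%y. w c y us) x u + s * fd (%y. v c y us) x u" for us u
			using fd_add[of "%y. r * w c y us" x "%y. s * v c y us" u] fd_cmult[OF d[OF w(1)]] fd_cmult[OF d[OF w(2)]]
				d[OF w(1)] d[OF w(2)] by simp
		then show ?thesis using True
			by (simp add: form_d_def ext_deriv_def sum_distrib_left sum.distrib[symmetric] algebra_simps)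
	qed (auto simp: form_d_def)
qed

lemma form_d_add: "w : forms A k ==> v : forms A k ==> form_d A (w + v) = form_d A w + form_d A v"
	using form_d_lincomb[of w k v 1 1] by (simp add: plus_fun_def)

lemma form_d_diff: "w : forms A k ==> v : forms A k ==> form_d A (w - v) = form_d A w - form_d A v"
	using form_d_lincomb[of w k v 1 "-1"] by (simp add: fun_diff_def)

lemma form_d_scale: "w : forms A k ==> form_d A (scale r w) = scale r (form_d A w)"
	using form_d_lincomb[of w k w r 0] by (simp add: scale_def)

lemma form_d_zero: "form_d A 0 = 0"
	using form_d_lincomb[OF forms_0[of 0] forms_0[of 0], of 0 0] by (simp add: zero_fun_def)

lemma form_d_sum: "(!!i. i : I ==> w i : forms A k) ==> form_d A (\<Sum>i\<in>I. w i) = (\<Sum>i\<in>I. form_d A (w i))"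
proof (induction I rule: infinite_finite_induct)
	case (insert i I)
	have "form_d A (w i + (\<Sum>i\<in>I. w i)) = form_d A (w i) + form_d A (\<Sum>i\<in>I. w i)"
		by (intro form_d_add[of _ k] forms_sum) (auto intro: insert.prems)
	moreover have "form_d A (\<Sum>i\<in>I. w i) = (\<Sum>i\<in>I. form_d A (w i))"
		by (rule insert.IH) (auto intro: insert.prems)
	ultimately show ?case by (simp only: sum.insert[OF insert.hyps(1,2)])
qed (auto simp: form_d_zero)

lemma d_d_1: assumes w: "w : forms A 1" shows "form_d A (form_d A w) = 0"
proof (intro ext)
	fix c x vs
	show "form_d A (form_d A w) c x vs = 0 c x vs"
	proof (cases "c : A & x : img c")
		case True
		then have "form_d A (form_d A w) c x = form3 (divg (curl (vec1 w c)) x)"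
			unfolding form_d_eq[OF conjunct1[OF True] conjunct2[OF True]]
			by (intro ext_deriv_form2[OF open_image _ smooth_on_curl[OF open_image smooth_vec1[OF w]]])
				 (auto simp: form_d_1[OF w])
		then show ?thesis using True divg_curl[OF open_image smooth_vec1[OF w]] by simp
	qed (auto simp: form_d_def)
qed

end

section \<open>Change of variables and extension by zero\<close>

lemma cov_real:
	fixes f :: "real ^ 3 => real" and g :: "real ^ 3 => real ^ 3"
	assumes "open S" and der: "!!x. x : S ==> (g has_derivative g' x) (at x)" and "inj_on g S"
		and "f absolutely_integrable_on (g ` S)"
	shows "integral S (%x. \<bar>det (matrix (g' x))\<bar> * f (g x)) = integral (g ` S) f"
proof -
	\<comment> \<open>The change of variables is carried out for functions with values in
	  \<open>real ^ 1\<close> and read off in the single component.\<close>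
	define F where "F = (%x. vec (f x) :: real^1)"
	have F1: "F x $ 1 = f x" for x by (simp add: F_def)
	have "F absolutely_integrable_on (g ` S)"
		using assms(4) by (subst absolutely_integrable_on_1_iff) (simp add: F1)
	moreover have "S : sets lebesgue" using assms(1) by (intro sets_completionI_sets) simp
	ultimately have "integral S (%x. \<bar>det (matrix (g' x))\<bar> *R F (g x)) = integral (g ` S) F"
		using has_absolute_integral_change_of_variables[OF _ has_derivative_at_withinI[OF der] assms(3), of F "integral (g ` S) F"]
		by simp
	then have "integral S (%x. \<bar>det (matrix (g' x))\<bar> *R F (g x)) $ 1 = integral (g ` S) F $ 1" by simp
	then show ?thesis by (simp add: integral_on_1_eq F1)
qed

lemma smooth_extend_zero:
	assumes "open S" "smooth_on S f" "closed K" "K <= S" "!!x. x ~: K ==> f x = 0"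
	shows "smooth_on UNIV f"
proof (rule smooth_on_local)
	fix x
	have "smooth_on (- K) f"
		by (rule smooth_on_cong[OF _ _ smooth_on_const[of _ 0]]) (use assms in auto)
	then show "\<exists>T. open T & x : T & smooth_on T f"
		using assms by (cases "x : S") (blast, metis ComplI open_Compl subsetD)
qed

lemma compact_in_some_ccube:
	assumes "compact K" obtains r where "0 < r" "K <= ccube r"
proof -
	obtain b where b: "!!x. x : K ==> norm x <= b" using compact_imp_bounded[OF assms] bounded_iff by blast
	have "K <= ccube (max b 1)"
	proof
		fix x assume "x : K"
		then have "norm x <= max b 1" using b by force
		then show "x : ccube (max b 1)"
			using component_le_norm_cart order_trans unfolding ccube_def by blast
	qed
	then show ?thesis using that[of "max b 1"] by simp
qed

lemma alternating_map:
	assumes "alternating_form k w" "linear L"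
	shows "alternating_form k (%vs. w (map L vs))"
proof -
	have "linear (%v. w (map L (vs[i := v])))" if "length vs = k & i < k" for vs i
	proof -
		have "linear (%v. w ((map L vs)[i := v]))"
			using assms(1) that unfolding alternating_form_def by simp
		from linear_compose[OF assms(2) this] show ?thesis by (simp add: map_update o_def)
	qed
	moreover have "w (map L vs) = 0" if "length vs ~= k" for vs
		using assms(1) that unfolding alternating_form_def by simp
	moreover have "w (map L vs) = 0" if "length vs = k & i < j & j < k & vs ! i = vs ! j" for vs i j
	proof -
		have "length (map L vs) = k & i < j & j < k & map L vs ! i = map L vs ! j" using that by simp
		then show ?thesis using assms(1) unfolding alternating_form_def by blast
	qed
	ultimately show ?thesis unfolding alternating_form_def by blast
qed

lemma smooth_pullback:
	assumes S: "open S" and T: "smooth_on S T"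
	shows "smooth_on S (%x. f (T x)) ==> smooth_on S (%x. form0 (f (T x)) (map (fd T x) vs))"
		"smooth_on S (%x. a (T x)) ==> smooth_on S (%x. form1 (a (T x)) (map (fd T x) vs))"
		"smooth_on S (%x. a (T x)) ==> smooth_on S (%x. form2 (a (T x)) (map (fd T x) vs))"
		"smooth_on S (%x. f (T x)) ==> smooth_on S (%x. form3 (f (T x)) (map (fd T x) vs))"
proof -
	show "smooth_on S (%x. form0 (f (T x)) (map (fd T x) vs))" if "smooth_on S (%x. f (T x))"
		using that by (cases "vs = []") (simp_all add: form0_def)
	show "smooth_on S (%x. form1 (a (T x)) (map (fd T x) vs))" if a: "smooth_on S (%x. a (T x))"
	proof (cases "length vs = 1")
		case True
		then obtain u where "vs = [u]" unfolding length1 by auto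
		then show ?thesis using smooth_on_inner[OF S a smooth_on_fd[OF T]] by simp
	qed (simp add: form_length(2))
	show "smooth_on S (%x. form2 (a (T x)) (map (fd T x) vs))" if a: "smooth_on S (%x. a (T x))"
	proof (cases "length vs = 2")
		case True
		then obtain u v where "vs = [u, v]" unfolding length2 by auto
		then show ?thesis using smooth_on_inner[OF S a smooth_on_cross[OF S smooth_on_fd[OF T] smooth_on_fd[OF T]]] by simp
	qed (simp add: form_length(3))
	show "smooth_on S (%x. form3 (f (T x)) (map (fd T x) vs))" if f: "smooth_on S (%x. f (T x))"
	proof (cases "length vs = 3")
		case True
		then obtain u v w where "vs = [u, v, w]" unfolding length3 by auto
		then show ?thesis
			using smooth_on_mult[OF S f smooth_on_inner[OF S smooth_on_fd[OF T] smooth_on_cross[OF S smooth_on_fd[OF T] smooth_on_fd[OF T]]]]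
			by simp
	qed (simp add: form_length(4))
qed

context atlas
begin

section \<open>Compactly supported forms in a chart\<close>

text \<open>A bound for the set where the form is nonzero, stated for points of the manifold so that
  one \<open>K\<close> serves all charts.\<close>

definition vanish_out :: "'a dform => 'a set => bool" where
	"vanish_out w K \<longleftrightarrow> (\<forall>c\<in>A. \<forall>x\<in>img c. chart_inv c x ~: K --> w c x = 0)"

lemma compact_closed: "compactin X K ==> closedin X K"
	using compactin_imp_closedin[OF hausdorff] .

lemma open_outside:
	assumes "c : A" "closedin X K"
	shows "open {x : img c. chart_inv c x ~: K}"
proof -
	have "openin X (topspace X - K)" using assms(2) by blast
	then have "open (snd c ` (fst c \<inter> (topspace X - K)))" by (rule chart_open_image[OF chart[OF assms(1)]])
	moreover have "snd c ` (fst c \<inter> (topspace X - K)) = {x : img c. chart_inv c x ~: K}"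
	proof (intro set_eqI iffI)
		fix x assume "x : snd c ` (fst c \<inter> (topspace X - K))"
		then show "x : {x : img c. chart_inv c x ~: K}"
			using chart_inv_chart[OF chart[OF assms(1)]] chart_into[of _ c] by auto
	next
		fix x assume x: "x : {x : img c. chart_inv c x ~: K}"
		then have "chart_inv c x : fst c \<inter> (topspace X - K)" "x = snd c (chart_inv c x)"
			using chart_inv_into[OF chart[OF assms(1)]] chart_chart_inv[OF chart[OF assms(1)]] chart_subset[OF assms(1)] by auto
		then show "x : snd c ` (fst c \<inter> (topspace X - K))" by blast
	qed
	ultimately show ?thesis by simp
qed

text \<open>Extension by zero of a form given in the single chart \<open>c\<close>; in other charts
  it is the pullback along the transition map.\<close>

definition emb :: "'a chart => (real ^ 3 => (real ^ 3) list => real) => 'a dform" where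
	"emb c \<omega> = (%c' x vs. if c' : A & x : overlap c' c
		 then \<omega> (trn c' c x) (map (fd (trn c' c) x) vs) else 0)"

lemma emb_self:
	assumes "c : A" "x : img c" shows "emb c \<omega> c x = \<omega> x"
proof
	fix vs
	have "fd (trn c c) x = (%v. v)" using transition_self[OF assms] by auto
	then show "emb c \<omega> c x vs = \<omega> x vs"
		using assms transition_self[OF assms] by (simp add: emb_def overlap_self)
qed

lemma emb_outside: "x ~: overlap c' c ==> emb c \<omega> c' x = 0"
	by (auto simp: emb_def fun_eq_iff)

lemma emb_vanish:
	assumes c: "c : A" and z: "!!x. x : img c ==> x ~: K ==> \<omega> x = 0"
	shows "vanish_out (emb c \<omega>) (chart_inv c ` K)"
	unfolding vanish_out_def
proof (intro ballI impI)
	fix c' x assume c': "c' : A" and x: "x : img c'" "chart_inv c' x ~: chart_inv c ` K"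
	show "emb c \<omega> c' x = 0"
	proof (cases "x : overlap c' c")
		case True
		note t = transition_overlap[OF chart[OF c'] chart[OF c] True]
		have "trn c' c x ~: K" using t(2) x(2) by force
		then have "\<omega> (trn c' c x) = 0" using z t(1) overlap_subset by blast
		then show ?thesis by (auto simp: emb_def fun_eq_iff)
	qed (rule emb_outside)
qed

text \<open>The issue is smoothness at points outside the domain of \<open>c\<close>: the preimage
  of the compact set \<open>K\<close> is closed, so the form vanishes on a whole neighbourhood of
  such a point. On the overlap it is the pullback assumed smooth in \<open>sm\<close>.\<close>

lemma emb_forms:
	assumes c: "c : A" and K: "compact K" "K <= img c"
		and z: "!!x. x : img c ==> x ~: K ==> \<omega> x = 0"
		and alt: "!!x. alternating_form k (\<omega> x)"
		and sm: "!!c' vs. c' : A ==> smooth_on (overlap c' c) (%x. \<omega> (trn c' c x) (map (fd (trn c' c) x) vs))"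
	shows "emb c \<omega> : forms A k"
proof (rule formsI)
	fix c' x assume "c' ~: A \<or> x ~: img c'"
	then show "emb c \<omega> c' x = 0"
		using emb_outside overlap_subset[of c' c] unfolding emb_def by (auto simp: fun_eq_iff)
next
	fix c' x assume c': "c' : A" "x : img c'"
	show "alternating_form k (emb c \<omega> c' x)"
	proof (cases "x : overlap c' c")
		case True
		then have "emb c \<omega> c' x = (%vs. \<omega> (trn c' c x) (map (fd (trn c' c) x) vs))"
			using c' by (simp add: emb_def)
		then show ?thesis using alternating_map[OF alt linear_transition[OF c'(1) c True]] by simp
	next
		case False
		then show ?thesis using emb_outside zero_alternating by metis
	qed
next
	fix c' vs assume c': "c' : A"
	show "smooth_on (img c') (%x. emb c \<omega> c' x vs)"
	proof (rule smooth_on_local)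
		fix x assume x: "x : img c'"
		let ?V = "{x : img c'. chart_inv c' x ~: chart_inv c ` K}"
		have oV: "open ?V"
			by (rule open_outside[OF c' compact_closed[OF chart_compact_preimage[OF chart[OF c] K]]])
		show "\<exists>T. open T & x : T & smooth_on T (%x. emb c \<omega> c' x vs)"
		proof (cases "x : overlap c' c")
			case True
			have "smooth_on (overlap c' c) (%x. emb c \<omega> c' x vs)"
				by (rule smooth_on_cong[OF open_ovl[OF c' c] _ sm[OF c']]) (use c' in \<open>simp add: emb_def\<close>)
			then show ?thesis using open_ovl[OF c' c] True by blast
		next
			case False
			then have "chart_inv c' x ~: fst c" using x overlap_iff[OF chart[OF c']] by blast
			then have "x : ?V" using x chart_inv_image_eq[OF chart[OF c] K(2)] by auto
			moreover have "smooth_on ?V (%x. emb c \<omega> c' x vs)"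
				by (rule smooth_on_cong[OF oV _ smooth_on_const[of _ 0]])
					 (use emb_vanish[OF c z] c' in \<open>auto simp: vanish_out_def\<close>)
			ultimately show ?thesis using oV by blast
		qed
	qed
next
	fix c' c'' x vs assume c': "c' : A" and c'': "c'' : A" and x: "x : overlap c' c''"
	show "emb c \<omega> c' x vs = emb c \<omega> c'' (trn c' c'' x) (map (fd (trn c' c'') x) vs)"
	proof (cases "x : overlap c' c")
		case True
		note t = transition_cocycle[OF c' c'' c x True]
		have "map (fd (trn c' c) x) vs = map (fd (trn c'' c) (trn c' c'' x)) (map (fd (trn c' c'') x) vs)"
			using t(3) by simp
		then show ?thesis using True t(1,2) c' c'' by (simp add: emb_def del: map_map map_eq_conv)
	next
		case False
		have "trn c' c'' x ~: overlap c'' c"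
			using False x transition_overlap(2)[OF chart[OF c'] chart[OF c''] x] overlap_iff[OF chart[OF c']] overlap_iff[OF chart[OF c'']]
			by auto
		then show ?thesis using False by (simp add: emb_outside)
	qed
qed

lemma smooth_transition_compose:
	assumes "c : A" "c' : A" "smooth_on (img c) f"
	shows "smooth_on (overlap c' c) (%x. f (trn c' c x))"
proof (rule smooth_on_compose[OF open_ovl[OF assms(2,1)] open_image[OF assms(1)] _ assms(3) smooth_transition[OF assms(2,1)]])
	show "trn c' c ` overlap c' c <= img c"
		using transition_overlap(1)[OF chart[OF assms(2)] chart[OF assms(1)]] overlap_subset by blast
qed

lemma emb_form0:
	assumes "c : A" "compact K" "K <= img c" "!!x. x : img c ==> x ~: K ==> f x = 0" "smooth_on (img c) f"
	shows "emb c (%x. form0 (f x)) : forms A 0"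
	by (rule emb_forms[OF assms(1-3)])
		 (auto simp: assms(4) intro!: smooth_pullback(1) open_ovl smooth_transition smooth_transition_compose assms)

lemma emb_form1:
	assumes "c : A" "compact K" "K <= img c" "!!x. x : img c ==> x ~: K ==> a x = 0" "smooth_on (img c) a"
	shows "emb c (%x. form1 (a x)) : forms A 1"
proof (rule emb_forms[OF assms(1-3)])
	fix c' vs assume "c' : A"
	then show "smooth_on (overlap c' c) (%x. form1 (a (trn c' c x)) (map (fd (trn c' c) x) vs))"
		by (intro smooth_pullback(2) open_ovl smooth_transition smooth_transition_compose assms)
qed (simp add: assms(4), rule alternating_forms)

lemma emb_form2:
	assumes "c : A" "compact K" "K <= img c" "!!x. x : img c ==> x ~: K ==> a x = 0" "smooth_on (img c) a"
	shows "emb c (%x. form2 (a x)) : forms A 2"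
proof (rule emb_forms[OF assms(1-3)])
	fix c' vs assume "c' : A"
	then show "smooth_on (overlap c' c) (%x. form2 (a (trn c' c x)) (map (fd (trn c' c) x) vs))"
		by (intro smooth_pullback(3) open_ovl smooth_transition smooth_transition_compose assms)
qed (simp add: assms(4), rule alternating_forms)

lemma emb_form3:
	assumes "c : A" "compact K" "K <= img c" "!!x. x : img c ==> x ~: K ==> f x = 0" "smooth_on (img c) f"
	shows "emb c (%x. form3 (f x)) : forms A 3"
proof (rule emb_forms[OF assms(1-3)])
	fix c' vs assume "c' : A"
	then show "smooth_on (overlap c' c) (%x. form3 (f (trn c' c x)) (map (fd (trn c' c) x) vs))"
		by (intro smooth_pullback(4) open_ovl smooth_transition smooth_transition_compose assms)
qed (simp add: assms(4), rule alternating_forms)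

lemma vec_emb:
	assumes "c : A" "x : img c"
	shows "vec1 (emb c (%x. form1 (a x))) c x = a x" "vec2 (emb c (%x. form2 (a x))) c x = a x"
		"dens (emb c (%x. form3 (f x))) c x = f x"
	using emb_self[OF assms]
	by (simp_all add: vec1_def vec2_def dens_def vec_eq_iff forall_3 vector_3 vec3_simps)

lemma form_d_vanish:
	assumes w: "w : forms A k" and K: "closedin X K" and v: "vanish_out w K"
	shows "vanish_out (form_d A w) K"
	unfolding vanish_out_def
proof (intro ballI impI)
	fix c x assume c: "c : A" and x: "x : img c" "chart_inv c x ~: K"
	have "ext_deriv (w c) x = ext_deriv (%_. 0) x"
		by (rule ext_deriv_cong[OF open_outside[OF c K]]) (use x v c in \<open>auto simp: vanish_out_def\<close>)
	also have "... = 0" by (auto simp: ext_deriv_def fun_eq_iff)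
	finally show "form_d A w c x = 0" using c x by (simp add: form_d_eq)
qed

lemma form_d_emb:
	assumes c: "c : A" and K: "compact K" "K <= img c"
	shows "(!!x. x : img c ==> x ~: K ==> a x = 0) ==> smooth_on (img c) a ==>
			form_d A (emb c (%x. form1 (a x))) = emb c (%x. form2 (curl a x))"
		"(!!x. x : img c ==> x ~: K ==> a x = 0) ==> smooth_on (img c) a ==>
			form_d A (emb c (%x. form2 (a x))) = emb c (%x. form3 (divg a x))"
proof -
	let ?K = "chart_inv c ` K"
	have cl: "closedin X ?K" by (rule compact_closed[OF chart_compact_preimage[OF chart[OF c] K]])
	have fd0: "fd a x = fd (%_. 0) x" if "!!x. x : img c ==> x ~: K ==> a x = 0" "x : img c" "x ~: K"
		for x and a :: "real^3 => real^3"
		by (rule fd_cong[of "img c - K"]) (use that K open_image[OF c] in \<open>auto intro!: open_Diff compact_imp_closed\<close>)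
	\<comment> \<open>Two forms that vanish outside the same subset of the domain of \<open>c\<close>
	  are determined by their expressions in \<open>c\<close>.\<close>
	have *: "u = v" if u: "u : forms A k" "vanish_out u ?K" and v: "v : forms A k" "vanish_out v ?K"
		and e: "!!x. x : img c ==> u c x = v c x" for u v k
	proof (rule forms_eqI[OF u(1) v(1)])
		fix p assume p: "p : topspace X"
		show "\<exists>c\<in>A. p : fst c & u c (snd c p) = v c (snd c p)"
		proof (cases "p : fst c")
			case True
			then show ?thesis by (intro bexI[of _ c] conjI e chart_into c)
		next
			case False
			obtain c' where c': "c' : A" "p : fst c'" using covers[OF p] by blast
			have "chart_inv c' (snd c' p) ~: ?K"
				using False chart_inv_chart[OF chart[OF c'(1)] c'(2)] chart_inv_image_eq[OF chart[OF c] K(2)] by auto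
			then have "u c' (snd c' p) = 0" "v c' (snd c' p) = 0"
				using c'(1) u(2) v(2) chart_into[OF c'(2)] unfolding vanish_out_def by simp_all
			then show ?thesis using c' by (intro bexI[of _ c'] conjI) simp_all
		qed
	qed
	show "form_d A (emb c (%x. form1 (a x))) = emb c (%x. form2 (curl a x))"
		if z: "!!x. x : img c ==> x ~: K ==> a x = 0" and s: "smooth_on (img c) a"
	proof (rule *[of _ 2])
		have E: "emb c (%x. form1 (a x)) : forms A 1" by (rule emb_form1[OF c K z s])
		have c0: "curl a x = 0" if "x : img c" "x ~: K" for x
			using fd0[OF z that] by (simp add: curl_def vec_eq_iff forall_3 vector_3)
		show "form_d A (emb c (%x. form1 (a x))) : forms A 2" by (rule forms_d_1[OF E])
		show "vanish_out (form_d A (emb c (%x. form1 (a x)))) ?K"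
			by (rule form_d_vanish[OF E cl emb_vanish[OF c]]) (simp add: z)
		show "emb c (%x. form2 (curl a x)) : forms A 2"
			by (rule emb_form2[OF c K c0 smooth_on_curl[OF open_image[OF c] s]])
		show "vanish_out (emb c (%x. form2 (curl a x))) ?K"
			by (rule emb_vanish[OF c]) (simp add: c0)
		fix x assume x: "x : img c"
		have "form_d A (emb c (%x. form1 (a x))) c x = form2 (curl a x)"
			unfolding form_d_eq[OF c x]
			by (rule ext_deriv_form1[OF open_image[OF c] x s]) (rule emb_self[OF c])
		then show "form_d A (emb c (%x. form1 (a x))) c x = emb c (%x. form2 (curl a x)) c x"
			using emb_self[OF c x] by metis
	qed
	show "form_d A (emb c (%x. form2 (a x))) = emb c (%x. form3 (divg a x))"
		if z: "!!x. x : img c ==> x ~: K ==> a x = 0" and s: "smooth_on (img c) a"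
	proof (rule *[of _ 3])
		have E: "emb c (%x. form2 (a x)) : forms A 2" by (rule emb_form2[OF c K z s])
		have c0: "divg a x = 0" if "x : img c" "x ~: K" for x
			using fd0[OF z that] by (simp add: divg_def)
		show "form_d A (emb c (%x. form2 (a x))) : forms A 3" by (rule forms_d_2[OF E])
		show "vanish_out (form_d A (emb c (%x. form2 (a x)))) ?K"
			by (rule form_d_vanish[OF E cl emb_vanish[OF c]]) (simp add: z)
		show "emb c (%x. form3 (divg a x)) : forms A 3"
			by (rule emb_form3[OF c K c0 smooth_on_divg[OF open_image[OF c] s]])
		show "vanish_out (emb c (%x. form3 (divg a x))) ?K"
			by (rule emb_vanish[OF c]) (simp add: c0)
		fix x assume x: "x : img c"
		have "form_d A (emb c (%x. form2 (a x))) c x = form3 (divg a x)"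
			unfolding form_d_eq[OF c x]
			by (rule ext_deriv_form2[OF open_image[OF c] x s]) (rule emb_self[OF c])
		then show "form_d A (emb c (%x. form2 (a x))) c x = emb c (%x. form3 (divg a x)) c x"
			using emb_self[OF c x] by metis
	qed
qed

text \<open>A function is a 0-form evaluated at the empty list, so \<open>emb_form0\<close> extends
  it by zero.\<close>

lemma smooth_function_bump:
	assumes "c : A" "compact K" "K <= img c" "!!x. x : img c ==> x ~: K ==> f x = 0" "smooth_on (img c) f"
	shows "smooth_function A (%q. if q : fst c then f (snd c q) else 0)"
	unfolding smooth_function_def
proof
	fix c' assume c': "c' : A"
	have "smooth_on (img c') (%x. emb c (%x. form0 (f x)) c' x [])"
		by (rule form_smooth[OF emb_form0[OF assms] c'])
	then show "smooth_on (img c') ((%q. if q : fst c then f (snd c q) else 0) \<circ> chart_inv c')"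
		by (rule smooth_on_cong[OF open_image[OF c'], rotated])
			 (use c' overlap_iff[OF chart[OF c']] in \<open>auto simp: emb_def transition_def\<close>)
qed

lemma smooth_function_sum: "(!!i. i : I ==> smooth_function A (g i)) ==> smooth_function A (%p. \<Sum>i\<in>I. g i p)"
	unfolding smooth_function_def o_def by (auto intro!: smooth_on_sum open_image)

lemma smooth_function_divide:
	assumes "smooth_function A f" "smooth_function A g" "!!p. p : topspace X ==> g p ~= 0"
	shows "smooth_function A (%p. f p / g p)"
	unfolding smooth_function_def o_def
proof
	fix c assume c: "c : A"
	show "smooth_on (img c) (%x. f (chart_inv c x) / g (chart_inv c x))"
		using chart_inv_into[OF chart[OF c]] chart_subset[OF c] assms(3)
		by (intro smooth_on_divide open_image[OF c] smooth_functionD[OF assms(1) c] smooth_functionD[OF assms(2) c]) blast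
qed

lemma smul_vanish: "vanish_out w K ==> vanish_out (smul g w) K"
	by (auto simp: vanish_out_def smul_def fun_eq_iff)

lemma smul_vanish_support: "(!!p. p : topspace X ==> p ~: K ==> g p = 0) ==> vanish_out (smul g w) K"
	unfolding vanish_out_def smul_def
	using chart_inv_into[OF chart] chart_subset by (fastforce simp: fun_eq_iff)

lemma dens_smul: "dens (smul g w) c x = g (chart_inv c x) * dens w c x"
	by (simp add: dens_def smul_def)

lemma dens_algebra: "dens (w + v) c x = dens w c x + dens v c x" "dens (w - v) c x = dens w c x - dens v c x"
	"dens (scale r w) c x = r * dens w c x" "dens 0 c x = 0"
	by (simp_all add: dens_def scale_def)

lemma smooth_extend_chart:
	fixes f :: "real ^ 3 => 'c::euclidean_space"
	assumes c: "c : A" and K: "compactin X K" "K <= fst c" and f: "smooth_on (img c) f"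
		and z: "!!x. x ~: img c \<or> chart_inv c x ~: K ==> f x = 0"
	shows "smooth_on UNIV f" "x ~: snd c ` K ==> f x = 0"
proof -
	have cK: "compact (snd c ` K)" by (rule chart_compact_image[OF chart[OF c] K])
	show z': "f x = 0" if "x ~: snd c ` K" for x
		using z[of x] that chart_chart_inv[OF chart[OF c], of x] by force
	have "snd c ` K <= img c" unfolding chart_image_def by (rule image_mono[OF K(2)])
	then show "smooth_on UNIV f" by (rule smooth_extend_zero[OF open_image[OF c] f compact_imp_closed[OF cK] _ z'])
qed

lemma vanish_outside:
	assumes "w : forms A k" "c : A" "vanish_out w K" "x ~: img c \<or> chart_inv c x ~: K" shows "w c x = 0"
	using assms form_outside[OF assms(1), of c x] by (auto simp: vanish_out_def)

lemma dens_test: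
	assumes w: "w : forms A 3" and c: "c : A" and K: "compactin X K" "K <= fst c" and v: "vanish_out w K"
	shows "smooth_on UNIV (dens w c)" "x ~: snd c ` K ==> dens w c x = 0" "\<exists>r>0. test r (dens w c)"
proof -
	have "dens w c x = 0" if "x ~: img c \<or> chart_inv c x ~: K" for x
		using vanish_outside[OF w c v that] by (simp add: dens_def)
	note s = smooth_extend_chart[OF c K smooth_dens[OF w c] this]
	show "smooth_on UNIV (dens w c)" "x ~: snd c ` K ==> dens w c x = 0" using s by blast+
	obtain r where r: "0 < r" "snd c ` K <= ccube r" using compact_in_some_ccube[OF chart_compact_image[OF chart[OF c] K]] .
	then have "test r (dens w c)" using s unfolding test_def by blast
	then show "\<exists>r>0. test r (dens w c)" using r(1) by blast
qed

lemma vec1_test: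
	assumes w: "w : forms A 1" and c: "c : A" and K: "compactin X K" "K <= fst c" and v: "vanish_out w K"
	shows "smooth_on UNIV (vec1 w c)" "x ~: snd c ` K ==> vec1 w c x = 0"
proof -
	have "vec1 w c x = 0" if "x ~: img c \<or> chart_inv c x ~: K" for x
		using vanish_outside[OF w c v that] by (simp add: vec1_def vec_eq_iff)
	note s = smooth_extend_chart[OF c K smooth_vec1[OF w c] this]
	show "smooth_on UNIV (vec1 w c)" "x ~: snd c ` K ==> vec1 w c x = 0" using s by blast+
qed

lemma vec2_test:
	assumes w: "w : forms A 2" and c: "c : A" and K: "compactin X K" "K <= fst c" and v: "vanish_out w K"
	shows "smooth_on UNIV (vec2 w c)" "x ~: snd c ` K ==> vec2 w c x = 0"
proof -
	have "vec2 w c x = 0" if "x ~: img c \<or> chart_inv c x ~: K" for x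
		using vanish_outside[OF w c v that] by (simp add: vec2_def vec_eq_iff forall_3 vector_3)
	note s = smooth_extend_chart[OF c K smooth_vec2[OF w c] this]
	show "smooth_on UNIV (vec2 w c)" "x ~: snd c ` K ==> vec2 w c x = 0" using s by blast+
qed

lemma fd_outside:
	assumes "compactin X K" "K <= fst c" "c : A" "!!x. x ~: snd c ` K ==> f x = 0" "x ~: img c"
	shows "fd f x v = 0"
proof -
	have "closed (snd c ` K)" by (rule compact_imp_closed[OF chart_compact_image[OF chart[OF assms(3)] assms(1,2)]])
	then have "fd f x = fd (%_. 0) x"
		using assms(2,5) by (intro fd_cong[of "- (snd c ` K)"]) (auto simp: assms(4) chart_image_def)
	then show ?thesis by simp
qed

text \<open>Both integrals live on the overlap, where the densities differ by the Jacobian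
  determinant of the transition map. Its positivity removes the absolute value from the change of
  variables.\<close>

lemma integral_change_chart:
	assumes w: "w : forms A 3" and c: "c : A" "c' : A"
		and K: "compactin X K" "K <= fst c" "K <= fst c'" and v: "vanish_out w K"
	shows "integral UNIV (dens w c) = integral UNIV (dens w c')"
proof -
	let ?S = "overlap c c'" let ?T = "trn c c'"
	have sub: "dens w b x = 0" if "x ~: overlap b b'" "b : A" "K <= fst b" "K <= fst b'" for b b' x
	proof (rule dens_test(2)[OF w that(2) K(1) that(3) v])
		have "snd b ` K <= overlap b b'" unfolding overlap_def by (rule image_mono) (use that in simp)
		then show "x ~: snd b ` K" using that(1) by blast
	qed
	have UN: "integral UNIV (dens w b) = integral (overlap b b') (dens w b)" if "b : A" "K <= fst b" "K <= fst b'" for b b'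
	proof -
		have "(%x. if x : overlap b b' then dens w b x else 0) = dens w b" using sub[OF _ that] by auto
		then show ?thesis using integral_restrict_UNIV[of "overlap b b'" "dens w b"] by simp
	qed
	have img: "?T ` ?S = overlap c' c"
	proof (intro set_eqI iffI)
		fix y assume "y : overlap c' c"
		then show "y : ?T ` ?S"
			using transition_overlap[OF chart[OF c(2)] chart[OF c(1)], of y] by (metis imageI)
	qed (use transition_overlap(1)[OF chart[OF c(1)] chart[OF c(2)]] in blast)
	have ai: "dens w c' absolutely_integrable_on (?T ` ?S)"
	proof -
		obtain r where "test r (dens w c')" using dens_test(3)[OF w c(2) K(1,3) v] by blast
		then have "dens w c' absolutely_integrable_on UNIV" using cc_abs_integrable test_cc by blast
		then show ?thesis unfolding img
			using set_integrable_subset[of lebesgue UNIV "dens w c'" "overlap c' c"]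
				sets_completionI_sets[of "overlap c' c" lborel] open_ovl[OF c(2,1)] by simp
	qed
	have "integral UNIV (dens w c) = integral ?S (dens w c)" by (rule UN[OF c(1) K(2,3)])
	also have "... = integral ?S (%x. \<bar>det (matrix (fd ?T x))\<bar> * dens w c' (?T x))"
		by (rule integral_cong) (simp add: dens_transition[OF w c] abs_of_pos[OF det_transition[OF c]])
	also have "... = integral (?T ` ?S) (dens w c')"
	proof (rule cov_real[OF open_ovl[OF c] _ _ ai])
		show "(?T has_derivative fd ?T x) (at x)" if "x : ?S" for x
			by (rule smooth_on_has_derivative[OF smooth_transition[OF c] that])
		show "inj_on ?T ?S"
			by (rule inj_on_inverseI) (rule transition_overlap(3)[OF chart[OF c(1)] chart[OF c(2)]])
	qed
	also have "... = integral UNIV (dens w c')" unfolding img by (rule UN[OF c(2) K(3,2), symmetric])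
	finally show ?thesis .
qed

end

section \<open>Integration\<close>

locale compact_atlas = atlas +
	assumes compact: "compact_space X"
begin

definition suppt :: "('a => real) => 'a set" where
	"suppt g = X closure_of {p : topspace X. g p ~= 0}"

lemma suppt_compact: "compactin X (suppt g)"
	unfolding suppt_def using closedin_compact_space[OF compact] by simp

lemma suppt_zero: "p : topspace X ==> p ~: suppt g ==> g p = 0"
	unfolding suppt_def using closure_of_subset[of "{p : topspace X. g p ~= 0}" X] by blast

lemma partition_of_unityD:
	assumes "partition_of_unity X A F u"
	shows "finite F" "F <= A" "!!c. c : F ==> smooth_function A (u c)" "!!c p. c : F ==> p : topspace X ==> 0 <= u c p"
		"!!c. c : F ==> suppt (u c) <= fst c" "!!p. p : topspace X ==> (\<Sum>c\<in>F. u c p) = 1"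
	using assms unfolding partition_of_unity_def suppt_def by blast+

lemma finite_subcover:
	assumes "!!p. p : topspace X ==> openin X (U p) & p : U p"
	shows "\<exists>P. finite P & P <= topspace X & topspace X <= (\<Union>p\<in>P. U p)"
proof -
	have "(\<forall>V\<in>U ` topspace X. openin X V) & topspace X <= \<Union>(U ` topspace X)" using assms by auto
	then obtain F where "finite F" "F <= U ` topspace X" "topspace X <= \<Union>F"
		using compact unfolding compact_space_alt by (metis (no_types, lifting))
	then show ?thesis by (metis finite_subset_image)
qed

text \<open>By compactness finitely many coordinate bumps have a positive sum \<Phi>, and dividing
  by it gives the partition.\<close>

lemma partition_of_unity_exists: "\<exists>F u. partition_of_unity X A F u"
proof -
	have "\<forall>p\<in>topspace X. \<exists>c\<in>A. p : fst c" using covers by blast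
	then obtain ch where ch: "!!p. p : topspace X ==> ch p : A & p : fst (ch p)" by metis
	have "\<forall>p\<in>topspace X. \<exists>r>0. cball (snd (ch p) p) r <= img (ch p)"
		using ch open_image open_contains_cball chart_into by metis
	then obtain r where r: "!!p. p : topspace X ==> 0 < r p & cball (snd (ch p) p) (r p) <= img (ch p)" by metis
	define \<phi> where "\<phi> = (%p q. if q : fst (ch p) then ball_bump (snd (ch p) p) (r p) (snd (ch p) q) else 0)"
	have sm\<phi>: "smooth_function A (\<phi> p)" if "p : topspace X" for p
		unfolding \<phi>_def
	proof (rule smooth_function_bump[of _ "cball (snd (ch p) p) (r p)"])
		show "ball_bump (snd (ch p) p) (r p) x = 0" if "x ~: cball (snd (ch p) p) (r p)" for x
			using that ball_bump_eq_0_iff[of "r p"] r[OF \<open>p : topspace X\<close>] ball_subset_cball by blast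
		show "smooth_on (img (ch p)) (ball_bump (snd (ch p) p) (r p))"
			by (rule smooth_on_subset[OF smooth_ball_bump]) simp
	qed (use ch[OF that] r[OF that] in auto)
	have nn: "0 <= \<phi> p q" for p q by (simp add: \<phi>_def ball_bump_nonneg)
	define U where "U = (%p. {q : fst (ch p). snd (ch p) q : ball (snd (ch p) p) (r p)})"
	have pos: "0 < \<phi> p q \<longleftrightarrow> q : U p" if "p : topspace X" for p q
		using ball_bump_pos_iff[of "r p" "snd (ch p) p" "snd (ch p) q"] r[OF that]
		by (simp only: \<phi>_def U_def mem_Collect_eq) (simp del: mem_ball)
	have "openin X (U p)" if "p : topspace X" for p
		unfolding U_def using chart_open_preimage[OF chart[of "ch p"]] ch[OF that] by blast
	moreover have "p : U p" if "p : topspace X" for p using ch[OF that] r[OF that] by (simp add: U_def)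
	ultimately have "\<exists>P. finite P & P <= topspace X & topspace X <= (\<Union>p\<in>P. U p)"
		by (intro finite_subcover) simp
	then obtain P where P: "finite P" "P <= topspace X" "topspace X <= (\<Union>p\<in>P. U p)" by blast
	define \<Phi> where "\<Phi> = (%q. \<Sum>p\<in>P. \<phi> p q)"
	have \<Phi>: "0 < \<Phi> q" if "q : topspace X" for q
	proof -
		obtain p where "p : P" "q : U p" using P(3) \<open>q : topspace X\<close> by blast
		then have "0 < \<phi> p q" using pos P by blast
		also have "\<phi> p q <= \<Phi> q" unfolding \<Phi>_def by (rule member_le_sum[OF \<open>p : P\<close> _ P(1)]) (rule nn)
		finally show ?thesis .
	qed
	\<comment> \<open>Several of the chosen points may use the same chart, but a partition of unity is
	  indexed by charts, so their bumps are added up.\<close>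
	define u where "u = (%c q. (\<Sum>p\<in>{p\<in>P. ch p = c}. \<phi> p q) / \<Phi> q)"
	have "partition_of_unity X A (ch ` P) u"
		unfolding partition_of_unity_def
	proof (intro conjI ballI)
		show "finite (ch ` P)" using P by simp
		show "ch ` P <= A" using ch P by blast
		fix c assume c: "c : ch ` P"
		show "smooth_function A (u c)"
			unfolding u_def \<Phi>_def
			by (rule smooth_function_divide; (rule smooth_function_sum)?)
				 (use sm\<phi> P \<Phi> in \<open>auto simp: \<Phi>_def less_imp_neq[THEN not_sym]\<close>)
		show "0 <= u c q" if "q : topspace X" for q
			using \<Phi>[OF that] nn by (simp add: u_def sum_nonneg)
		let ?K = "\<Union>p\<in>{p\<in>P. ch p = c}. chart_inv c ` cball (snd c p) (r p)"
		have cA: "c : A" using c ch P by blast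
		have "closedin X (chart_inv c ` cball (snd c p) (r p))" "chart_inv c ` cball (snd c p) (r p) <= fst c"
			if "p : P" "ch p = c" for p
		proof -
			have s: "cball (snd c p) (r p) <= img c" using r that P by blast
			show "closedin X (chart_inv c ` cball (snd c p) (r p))"
				by (rule compact_closed[OF chart_compact_preimage[OF chart[OF cA] compact_cball s]])
			show "chart_inv c ` cball (snd c p) (r p) <= fst c"
				using chart_inv_image_eq[OF chart[OF cA] s] by auto
		qed
		then have "closedin X ?K" "?K <= fst c" using P(1) by (auto intro!: closedin_Union)
		moreover have "{q : topspace X. u c q ~= 0} <= ?K"
		proof
			fix q assume "q : {q : topspace X. u c q ~= 0}"
			then have "(\<Sum>p\<in>{p\<in>P. ch p = c}. \<phi> p q) ~= 0" by (auto simp: u_def)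
			then obtain p where p: "p : P" "ch p = c" "\<phi> p q ~= 0" by (metis (mono_tags, lifting) mem_Collect_eq sum.neutral)
			then have "q : U p" using pos nn[of p q] P by (metis less_eq_real_def subsetD)
			then have "q : fst c" "snd c q : cball (snd c p) (r p)" using p by (auto simp: U_def)
			then have "q : chart_inv c ` cball (snd c p) (r p)"
				using chart_inv_chart[OF chart[OF cA]] by (metis imageI)
			then show "q : ?K" using p by blast
		qed
		ultimately show "X closure_of {p : topspace X. u c p ~= 0} <= fst c"
			using closure_of_minimal by (metis (no_types, lifting) subset_trans)
	next
		fix q assume q: "q : topspace X"
		have "(\<Sum>c\<in>ch ` P. u c q) = (\<Sum>c\<in>ch ` P. \<Sum>p\<in>{p\<in>P. ch p = c}. \<phi> p q) / \<Phi> q"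
			by (simp add: u_def sum_divide_distrib)
		also have "(\<Sum>c\<in>ch ` P. \<Sum>p\<in>{p\<in>P. ch p = c}. \<phi> p q) = \<Phi> q"
			unfolding \<Phi>_def using sum.image_gen[OF P(1), of "%p. \<phi> p q" ch] by simp
		finally show "(\<Sum>c\<in>ch ` P. u c q) = 1" using \<Phi>[OF q] by simp
	qed
	then show ?thesis by blast
qed

lemma sum_fun3: "(\<Sum>i\<in>I. w i) c x vs = (\<Sum>i\<in>I. w i c x vs)"
	by (induction I rule: infinite_finite_induct) auto

lemma partition_decompose:
	assumes u: "partition_of_unity X A F u" and w: "w : forms A k"
	shows "(\<Sum>c\<in>F. smul (u c) w) = w"
proof (intro ext)
	fix c x vs
	show "(\<Sum>c\<in>F. smul (u c) w) c x vs = w c x vs"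
	proof (cases "c : A & x : img c")
		case True
		then have "chart_inv c x : topspace X" using chart_inv_into[OF chart] chart_subset by blast
		then show ?thesis
			using partition_of_unityD(6)[OF u] by (simp add: sum_fun3 smul_def sum_distrib_right[symmetric])
	next
		case False
		then show ?thesis using form_outside[OF w] by (auto simp: sum_fun3 smul_def)
	qed
qed

lemma smul_u_vanish:
	"vanish_out (smul g w) (suppt g)"
	using smul_vanish_support suppt_zero by blast

text \<open>Differs from the sum in \<open>form_integral\<close> in that each piece, extended by
  zero, is integrated over the whole space instead of the chart image.\<close>

definition pu_integral :: "'a chart set => ('a chart => 'a => real) => 'a dform => real" where
	"pu_integral F u w = (\<Sum>c\<in>F. integral UNIV (dens (smul (u c) w) c))"

lemma dens_smul_cc:
	assumes u: "smooth_function A g" "suppt g <= fst c" and c: "c : A" and w: "w : forms A 3"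
	shows "\<exists>r>0. test r (dens (smul g w) c)"
	by (rule dens_test(3)[OF forms_smul[OF u(1) w] c suppt_compact u(2) smul_u_vanish])

text \<open>Each piece is moved into the chart \<open>c\<close> by
  \<open>integral_change_chart\<close>; there the pieces add up to \<open>w\<close>.\<close>

lemma pu_integral_supported:
	assumes u: "partition_of_unity X A F u" and w: "w : forms A 3" and c: "c : A"
		and K: "compactin X K" "K <= fst c" and v: "vanish_out w K"
	shows "pu_integral F u w = integral UNIV (dens w c)"
proof -
	note U = partition_of_unityD[OF u]
	have "integral UNIV (dens (smul (u b) w) b) = integral UNIV (dens (smul (u b) w) c)" if b: "b : F" for b
	proof (rule integral_change_chart[OF forms_smul[OF U(3)[OF b] w] _ c, of _ "suppt (u b) \<inter> K"])
		show "b : A" using b U(2) by blast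
		show "compactin X (suppt (u b) \<inter> K)"
			by (rule closed_Int_compactin[OF compact_closed[OF suppt_compact] K(1)])
		show "vanish_out (smul (u b) w) (suppt (u b) \<inter> K)"
			using smul_u_vanish[of "u b" w] smul_vanish[OF v, of "u b"] unfolding vanish_out_def by blast
	qed (use U(5)[OF b] K(2) in auto)
	then have "pu_integral F u w = (\<Sum>b\<in>F. integral UNIV (dens (smul (u b) w) c))"
		unfolding pu_integral_def by simp
	also have "... = integral UNIV (%x. \<Sum>b\<in>F. dens (smul (u b) w) c x)"
	proof (rule integral_sum[OF U(1), symmetric])
		fix b assume b: "b : F"
		have "\<exists>r>0. test r (dens (smul (u b) w) c)"
			by (rule dens_test(3)[OF forms_smul[OF U(3)[OF b] w] c K smul_vanish[OF v]])
		then show "dens (smul (u b) w) c integrable_on UNIV" using cc_integrable test_cc by blast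
	qed
	also have "(%x. \<Sum>b\<in>F. dens (smul (u b) w) c x) = dens w c"
		using partition_decompose[OF u w] unfolding dens_def by (metis sum_fun3)
	finally show ?thesis .
qed

lemma pu_integral_sum:
	assumes u: "partition_of_unity X A F u" and "finite I" and w: "!!i. i : I ==> w i : forms A 3"
	shows "pu_integral F u (\<Sum>i\<in>I. w i) = (\<Sum>i\<in>I. pu_integral F u (w i))"
proof -
	note U = partition_of_unityD[OF u]
	have "integral UNIV (dens (smul (u c) (\<Sum>i\<in>I. w i)) c) = (\<Sum>i\<in>I. integral UNIV (dens (smul (u c) (w i)) c))"
		if c: "c : F" for c
	proof -
		have "dens (smul (u c) (\<Sum>i\<in>I. w i)) c = (%x. \<Sum>i\<in>I. dens (smul (u c) (w i)) c x)"
			unfolding dens_def smul_def sum_fun3 sum_distrib_left ..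
		moreover have "dens (smul (u c) (w i)) c integrable_on UNIV" if "i : I" for i
		proof -
			have "\<exists>r>0. test r (dens (smul (u c) (w i)) c)"
				by (rule dens_smul_cc[OF U(3)[OF c] U(5)[OF c] _ w[OF that]]) (use c U(2) in blast)
			then show ?thesis using cc_integrable test_cc by blast
		qed
		ultimately show ?thesis using integral_sum[OF assms(2), of "%i. dens (smul (u c) (w i)) c" UNIV] by simp
	qed
	then have "pu_integral F u (\<Sum>i\<in>I. w i) = (\<Sum>c\<in>F. \<Sum>i\<in>I. integral UNIV (dens (smul (u c) (w i)) c))"
		unfolding pu_integral_def by simp
	also have "... = (\<Sum>i\<in>I. pu_integral F u (w i))" unfolding pu_integral_def by (rule sum.swap)
	finally show ?thesis .
qed

text \<open>Cut \<open>w\<close> with the first partition. Each piece lies in one chart, where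
  \<open>pu_integral_supported\<close> evaluates its integral with respect to the second
  partition.\<close>

lemma pu_integral_unique:
	assumes u: "partition_of_unity X A F u" and v: "partition_of_unity X A G v" and w: "w : forms A 3"
	shows "pu_integral F u w = pu_integral G v w"
proof -
	note U = partition_of_unityD[OF u]
	have "pu_integral G v w = pu_integral G v (\<Sum>c\<in>F. smul (u c) w)"
		using partition_decompose[OF u w] by simp
	also have "... = (\<Sum>c\<in>F. pu_integral G v (smul (u c) w))"
		by (rule pu_integral_sum[OF v U(1)]) (rule forms_smul[OF U(3) w])
	also have "... = (\<Sum>c\<in>F. integral UNIV (dens (smul (u c) w) c))"
	proof (rule sum.cong[OF refl])
		fix c assume c: "c : F"
		show "pu_integral G v (smul (u c) w) = integral UNIV (dens (smul (u c) w) c)"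
			by (rule pu_integral_supported[OF v forms_smul[OF U(3)[OF c] w] _ suppt_compact U(5)[OF c] smul_u_vanish])
				 (use c U(2) in blast)
	qed
	finally show ?thesis by (simp add: pu_integral_def)
qed

lemma form_integral_eq:
	assumes u: "partition_of_unity X A F u" and w: "w : forms A 3"
	shows "form_integral X A w = pu_integral F u w"
proof -
	have eq: "(\<Sum>c\<in>G. integral (img c) (%x. v c (chart_inv c x) * w c x std_basis)) = pu_integral G v w"
		if "partition_of_unity X A G v" for G v
		unfolding pu_integral_def
	proof (rule sum.cong[OF refl])
		fix c assume c: "c : G"
		have "(%x. if x : img c then v c (chart_inv c x) * w c x std_basis else 0) = dens (smul (v c) w) c"
			using vec_outside(3)[OF _ w, of c] by (auto simp: dens_def smul_def fun_eq_iff)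
		then show "integral (img c) (%x. v c (chart_inv c x) * w c x std_basis) = integral UNIV (dens (smul (v c) w) c)"
			using integral_restrict_UNIV[of "img c" "%x. v c (chart_inv c x) * w c x std_basis"] by simp
	qed
	show ?thesis
		unfolding form_integral_def
	proof (rule the_equality)
		show "\<exists>F' u'. partition_of_unity X A F' u' & pu_integral F u w =
				(\<Sum>c\<in>F'. integral (img c) (%x. u' c (chart_inv c x) * w c x std_basis))"
			by (intro exI[of _ F] exI[of _ u] conjI u eq[OF u, symmetric])
		fix s
		assume "\<exists>F u. partition_of_unity X A F u & s = (\<Sum>c\<in>F. integral (img c) (%x. u c (chart_inv c x) * w c x std_basis))"
		then obtain G v where v: "partition_of_unity X A G v"
			and s: "s = (\<Sum>c\<in>G. integral (img c) (%x. v c (chart_inv c x) * w c x std_basis))" by blast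
		show "s = pu_integral F u w" unfolding s eq[OF v] by (rule pu_integral_unique[OF v u w])
	qed
qed

abbreviation I :: "'a dform => real" where "I w \<equiv> form_integral X A w"

lemma I_supported:
	assumes w: "w : forms A 3" and c: "c : A" and K: "compactin X K" "K <= fst c" and v: "vanish_out w K"
	shows "I w = integral UNIV (dens w c)"
proof -
	obtain F u where u: "partition_of_unity X A F u" using partition_of_unity_exists by blast
	show ?thesis using form_integral_eq[OF u w] pu_integral_supported[OF u w c K v] by simp
qed

lemma I_sum: "finite J ==> (!!i. i : J ==> w i : forms A 3) ==> I (\<Sum>i\<in>J. w i) = (\<Sum>i\<in>J. I (w i))"
proof -
	assume J: "finite J" "!!i. i : J ==> w i : forms A 3"
	obtain F u where u: "partition_of_unity X A F u" using partition_of_unity_exists by blast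
	have "I (\<Sum>i\<in>J. w i) = pu_integral F u (\<Sum>i\<in>J. w i)" by (rule form_integral_eq[OF u forms_sum[OF J(2)]])
	also have "... = (\<Sum>i\<in>J. pu_integral F u (w i))" by (rule pu_integral_sum[OF u J])
	also have "... = (\<Sum>i\<in>J. I (w i))" by (rule sum.cong[OF refl form_integral_eq[OF u J(2), symmetric]])
	finally show ?thesis .
qed

lemma I_add: "w : forms A 3 ==> v : forms A 3 ==> I (w + v) = I w + I v"
proof -
	assume "w : forms A 3" "v : forms A 3"
	then have "I (\<Sum>i\<in>{True, False}. if i then w else v) = (\<Sum>i\<in>{True, False}. I (if i then w else v))"
		by (intro I_sum) auto
	then show ?thesis by simp
qed

lemma I_scale:
	assumes w: "w : forms A 3" shows "I (scale r w) = r * I w"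
proof -
	obtain F u where u: "partition_of_unity X A F u" using partition_of_unity_exists by blast
	have "dens (smul (u c) (scale r w)) c = (%x. r * dens (smul (u c) w) c x)" for c
		by (simp add: dens_smul dens_algebra fun_eq_iff)
	then show ?thesis
		using form_integral_eq[OF u w] form_integral_eq[OF u forms_scale[OF w]]
		by (simp add: pu_integral_def sum_distrib_left)
qed

lemma diff_scale: "w - v = w + scale (-1) v"
	by (simp add: scale_def fun_eq_iff)

lemma I_diff: "w : forms A 3 ==> v : forms A 3 ==> I (w - v) = I w - I v"
	unfolding diff_scale by (simp add: I_add I_scale forms_scale)

lemma stokes_chart:
	assumes w: "w : forms A 2" and c: "c : A" and K: "compactin X K" "K <= fst c" and v: "vanish_out w K"
	shows "I (form_d A w) = 0"
proof -
	have cl: "closedin X K" by (rule compact_closed[OF K(1)])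
	have dw: "form_d A w : forms A 3" "vanish_out (form_d A w) K"
		by (rule forms_d_2[OF w], rule form_d_vanish[OF w cl v])
	have cK: "compact (snd c ` K)" by (rule chart_compact_image[OF chart[OF c] K])
	obtain r where r: "0 < r" "snd c ` K <= ccube r" using compact_in_some_ccube[OF cK] .
	note b = vec2_test[OF w c K v]
	have t: "test r (%x. vec2 w c x $ i)" for i
	proof -
		have "vec2 w c x $ i = 0" if "x ~: ccube r" for x
		proof -
			have "x ~: snd c ` K" using that r(2) by blast
			then show ?thesis using b(2) by simp
		qed
		then show ?thesis unfolding test_def using smooth_on_vec_nth[OF open_UNIV b(1)] by simp
	qed
	have fdz: "divg (vec2 w c) x = fd (%x. vec2 w c x $ 1) x (ax 1) + fd (%x. vec2 w c x $ 2) x (ax 2) + fd (%x. vec2 w c x $ 3) x (ax 3)" for x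
		unfolding divg_def using fd_vec_nth[OF b(1) UNIV_I] by simp
	have D: "dens (form_d A w) c x = divg (vec2 w c) x" for x
	proof (cases "x : img c")
		case True
		then show ?thesis using form_d_2[OF w c True] by (simp add: dens_def)
	next
		case False
		then have "divg (vec2 w c) x = 0" by (simp add: divg_def fd_outside[OF K c b(2)])
		then show ?thesis using vec_outside(3)[OF _ dw(1)] False by simp
	qed
	have "I (form_d A w) = integral UNIV (dens (form_d A w) c)" by (rule I_supported[OF dw(1) c K dw(2)])
	also have "dens (form_d A w) c = (%x. divg (vec2 w c) x)" using D by auto
	also have "integral UNIV ... = 0"
		unfolding fdz using t[THEN test_fd, THEN test_cc, THEN cc_integrable] integral_fd_eq_0[OF t]
		by (simp add: integral_add integrable_add)
	finally show ?thesis .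
qed

lemma stokes:
	assumes w: "w : forms A 2" shows "I (form_d A w) = 0"
proof -
	obtain F u where u: "partition_of_unity X A F u" using partition_of_unity_exists by blast
	note U = partition_of_unityD[OF u]
	have m: "smul (u c) w : forms A 2" if "c : F" for c by (rule forms_smul[OF U(3)[OF that] w])
	have "form_d A w = form_d A (\<Sum>c\<in>F. smul (u c) w)" using partition_decompose[OF u w] by simp
	also have "... = (\<Sum>c\<in>F. form_d A (smul (u c) w))" by (rule form_d_sum[OF m])
	finally have "I (form_d A w) = (\<Sum>c\<in>F. I (form_d A (smul (u c) w)))"
		using I_sum[OF U(1) forms_d_2[OF m]] by simp
	also have "... = 0"
		using stokes_chart[OF m _ suppt_compact U(5) smul_u_vanish] U(2) by (intro sum.neutral) blast
	finally show ?thesis .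
qed

lemma I_nonneg_pos:
	assumes w: "w : forms A 3" and nn: "!!c x. c : A ==> x : img c ==> 0 <= dens w c x"
		and c: "c0 : A" "x0 : img c0" and pos: "0 < dens w c0 x0"
	shows "0 < I w"
proof -
	obtain F u where u: "partition_of_unity X A F u" using partition_of_unity_exists by blast
	note U = partition_of_unityD[OF u]
	have nn': "0 <= dens (smul (u b) w) b x" if b: "b : F" for b x
	proof (cases "x : img b")
		case True
		have bA: "b : A" using b U(2) by blast
		have "chart_inv b x : topspace X" using chart_inv_into[OF chart[OF bA] True] chart_subset[OF bA] by blast
		then show ?thesis using nn[OF bA True] U(4)[OF b] by (simp add: dens_smul)
	next
		case False
		then show ?thesis using vec_outside(3)[OF _ w, of b x] by (simp add: dens_smul)
	qed
	have int: "dens (smul (u b) w) b integrable_on UNIV" if b: "b : F" for b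
	proof -
		have "\<exists>r>0. test r (dens (smul (u b) w) b)"
			by (rule dens_smul_cc[OF U(3)[OF b] U(5)[OF b] _ w]) (use b U(2) in blast)
		then show ?thesis using cc_integrable test_cc by blast
	qed
	define p where "p = chart_inv c0 x0"
	have p: "p : fst c0" "p : topspace X"
		using chart_inv_into[OF chart[OF c(1)] c(2)] chart_subset[OF c(1)] by (auto simp: p_def)
	obtain b where b: "b : F" "u b p ~= 0" using U(6)[OF p(2)] by (metis sum.neutral zero_neq_one)
	have bA: "b : A" using b U(2) by blast
	have pb: "p : fst b" using b suppt_zero[OF p(2), of "u b"] U(5) by blast
	have x0: "x0 : overlap c0 b" using overlap_iff[OF chart[OF c(1)]] c(2) pb by (simp add: p_def)
	have "dens w c0 x0 = det (matrix (fd (trn c0 b) x0)) * dens w b (trn c0 b x0)"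
		by (rule dens_transition[OF w c(1) bA x0])
	then have "0 < dens w b (trn c0 b x0)"
		using pos det_transition[OF c(1) bA x0] by (simp add: zero_less_mult_iff)
	moreover have "chart_inv b (trn c0 b x0) = p"
		using transition_overlap(2)[OF chart[OF c(1)] chart[OF bA] x0] by (simp add: p_def)
	moreover have "0 < u b p" using b U(4)[OF b(1) p(2)] by simp
	ultimately have pos': "0 < dens (smul (u b) w) b (trn c0 b x0)" by (simp add: dens_smul)
	obtain r where "test r (dens (smul (u b) w) b)"
		using dens_smul_cc[OF U(3)[OF b(1)] U(5)[OF b(1)] bA w] by blast
	then have "0 < integral UNIV (dens (smul (u b) w) b)"
		by (intro integral_pos[where x="trn c0 b x0", OF test_cc]) (use nn'[OF b(1)] pos' in auto)
	also have "... <= pu_integral F u w"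
		unfolding pu_integral_def
		by (rule member_le_sum[OF b(1) _ U(1)]) (rule integral_nonneg[OF int nn'], auto)
	finally show ?thesis using form_integral_eq[OF u w] by simp
qed

end

section \<open>The maximal atlas\<close>

text \<open>Positivity is asked for in one direction; for the inverse transition it follows from
  \<open>det_inverse_pos\<close>.\<close>

definition compatible :: "'a topology => 'a chart set => 'a chart => bool" where
	"compatible X A c \<longleftrightarrow> is_chart X c & (\<forall>c'\<in>A.
		 smooth_on (overlap c c') (trn c c') & smooth_on (overlap c' c) (trn c' c) &
		 (\<forall>x\<in>overlap c c'. 0 < det (matrix (fd (trn c c') x))))"

definition maxatlas :: "'a topology => 'a chart set => 'a chart set" where
	"maxatlas X A = {c. compatible X A c}"

lemma det_matrix_compose:
	fixes f g :: "real ^ 3 => real ^ 3"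
	assumes "linear f" "linear g"
	shows "det (matrix (%v. f (g v))) = det (matrix f) * det (matrix g)"
	using matrix_compose[OF assms(2,1)] by (simp add: o_def det_mul)

lemma det_matrix_ident: "det (matrix (%v::real^3. v)) = 1"
proof -
	have "matrix (%v::real^3. v) = mat 1" by (simp add: matrix_def mat_def axis_def vec_eq_iff)
	then show ?thesis by simp
qed

lemma det_inverse_pos:
	fixes f g :: "real ^ 3 => real ^ 3"
	assumes S: "open S" "x : S" and f: "smooth_on S f" and g: "smooth_on T g"
		and "f ` S <= T" "!!y. y : S ==> g (f y) = y" and pos: "0 < det (matrix (fd f x))"
	shows "0 < det (matrix (fd g (f x)))"
proof -
	have fx: "f x : T" using assms by blast
	have "fd (%y. g (f y)) x = fd (%y. y) x" by (rule fd_cong[OF S]) (use assms in auto)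
	then have "fd g (f x) (fd f x v) = v" for v
		using smooth_on_compose_fd[where T = T and f = g and S = S and g = f, OF g f S(2) fx, of v] by simp
	then have "det (matrix (fd g (f x))) * det (matrix (fd f x)) = 1"
		using det_matrix_compose[OF smooth_on_linear_fd[OF g fx] smooth_on_linear_fd[OF f S(2)]] det_matrix_ident by simp
	then show ?thesis using pos by (metis zero_less_mult_pos2 zero_less_one)
qed

context atlas
begin

lemma subset_maxatlas: "A <= maxatlas X A"
	unfolding maxatlas_def compatible_def using chart smooth_transition det_transition by blast

text \<open>Near each point a transition between two compatible charts factors through a chart
  \<open>b\<close> of the given atlas.\<close>

lemma maxatlas_atlas: "oriented_smooth_atlas X (maxatlas X A)"
	unfolding oriented_smooth_atlas_def
proof (intro conjI ballI)
	show "is_chart X c" if "c : maxatlas X A" for c using that by (simp add: maxatlas_def compatible_def)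
	show "(\<Union>c\<in>maxatlas X A. fst c) = topspace X"
	proof
		show "(\<Union>c\<in>maxatlas X A. fst c) <= topspace X"
			using chart_topspace(1) by (fastforce simp: maxatlas_def compatible_def)
		show "topspace X <= (\<Union>c\<in>maxatlas X A. fst c)" using covers subset_maxatlas by blast
	qed
	fix c c' assume c: "c : maxatlas X A" and c': "c' : maxatlas X A"
	have ch: "is_chart X c" "is_chart X c'" using c c' by (auto simp: maxatlas_def compatible_def)
	have loc: "\<exists>O'. open O' & x : O' & smooth_on O' (trn c c') & 0 < det (matrix (fd (trn c c') x))"
		if x: "x : overlap c c'" for x
	proof -
		have p: "chart_inv c x : fst c" "chart_inv c x : fst c'" using x overlap_iff[OF ch(1)] chart_inv_into[OF ch(1)] by auto
		then obtain b where b: "b : A" "chart_inv c x : fst b" using covers chart_topspace(1)[OF ch(1)] by blast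
		let ?O = "overlap c c' \<inter> overlap c b"
		have sm: "smooth_on (overlap c b) (trn c b)" "smooth_on (overlap b c') (trn b c')"
			and det: "!!y. y : overlap c b ==> 0 < det (matrix (fd (trn c b) y))"
				"!!y. y : overlap c' b ==> 0 < det (matrix (fd (trn c' b) y))"
			and sm': "smooth_on (overlap c' b) (trn c' b)"
			using c c' b by (auto simp: maxatlas_def compatible_def)
		have oO: "open ?O" using open_overlap ch chart[OF b(1)] by blast
		have xO: "x : ?O" using x b overlap_iff[OF ch(1)] by auto
		have map: "trn c b y : overlap b c'" "trn b c' (trn c b y) = trn c c' y" if "y : ?O" for y
			using that overlap_iff[OF ch(1)] chart_inv_chart[OF chart[OF b(1)]] by (auto simp: transition_def overlap_def)
		have s: "smooth_on ?O (%y. trn b c' (trn c b y))"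
			by (rule smooth_on_compose[OF oO open_overlap[OF chart[OF b(1)] ch(2)] _ sm(2) smooth_on_subset[OF sm(1)]])
				 (use map in auto)
		have e: "fd (trn c c') x v = fd (trn b c') (trn c b x) (fd (trn c b) x v)" for v
		proof -
			have "fd (trn c c') x v = fd (%y. trn b c' (trn c b y)) x v"
				by (rule fun_cong[OF fd_cong[OF oO xO]]) (simp add: map)
			then show ?thesis
				using smooth_on_compose_fd[OF sm(2) sm(1), of x v] xO map(1)[OF xO] by simp
		qed
		have y: "trn c b x : overlap b c'" by (rule map(1)[OF xO])
		let ?z = "trn b c' (trn c b x)"
		note t = transition_overlap[OF chart[OF b(1)] ch(2) y]
		\<comment> \<open>Compatibility of \<open>c'\<close> controls the determinant from
		  \<open>c'\<close> to \<open>b\<close>; the direction needed is the inverse one.\<close>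
		have "0 < det (matrix (fd (trn b c') (trn c' b ?z)))"
			by (rule det_inverse_pos[OF open_overlap[OF ch(2) chart[OF b(1)]] t(1) sm' sm(2) _ _ det(2)[OF t(1)]])
				 (use transition_overlap[OF ch(2) chart[OF b(1)]] in auto)
		then have d: "0 < det (matrix (fd (trn b c') (trn c b x)))" by (simp add: t(3))
		have "det (matrix (fd (trn c c') x)) = det (matrix (fd (trn b c') (trn c b x))) * det (matrix (fd (trn c b) x))"
			unfolding e[abs_def]
			by (rule det_matrix_compose) (use smooth_on_linear_fd[OF sm(2) y] smooth_on_linear_fd[OF sm(1)] xO in auto)
		then have "0 < det (matrix (fd (trn c c') x))" using d det(1) xO by simp
		moreover have "smooth_on ?O (trn c c')" by (rule smooth_on_cong[OF oO _ s]) (simp add: map)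
		ultimately show ?thesis using oO xO by blast
	qed
	show "smooth_on (overlap c c') (trn c c')" by (rule smooth_on_local) (use loc in blast)
	show "0 < det (matrix (fd (trn c c') x))" if "x : overlap c c'" for x using loc[OF that] by blast
qed

lemma maxatlas_maximal: "maxatlas X (maxatlas X A) <= maxatlas X A"
	using subset_maxatlas by (auto simp: maxatlas_def compatible_def)

lemma subatlas:
	assumes "B <= A" "!!p. p : topspace X ==> \<exists>c\<in>B. p : fst c"
	shows "oriented_smooth_atlas X B"
	unfolding oriented_smooth_atlas_def
proof (intro conjI ballI)
	show "(\<Union>c\<in>B. fst c) = topspace X" using assms chart_subset by fast
	fix c c' assume "c : B" "c' : B"
	then have c: "c : A" "c' : A" using assms(1) by auto
	show "smooth_on (overlap c c') (trn c c')" by (rule smooth_transition[OF c])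
	show "0 < det (matrix (fd (trn c c') x))" if "x : overlap c c'" for x by (rule det_transition[OF c that])
qed (use chart assms(1) in blast)

lemma smooth_function_subatlas:
	assumes B: "B <= A" "!!p. p : topspace X ==> \<exists>c\<in>B. p : fst c" and g: "smooth_function B g"
	shows "smooth_function A g"
	unfolding smooth_function_def o_def
proof
	fix c assume c: "c : A"
	show "smooth_on (img c) (%x. g (chart_inv c x))"
	proof (rule smooth_on_local)
		fix x assume x: "x : img c"
		then obtain b where b: "b : B" "chart_inv c x : fst b"
			using B chart_inv_into[OF chart[OF c]] chart_subset[OF c] by blast
		then have bA: "b : A" using B by blast
		have "smooth_on (overlap c b) (%y. g (chart_inv b (trn c b y)))"
			by (rule smooth_transition_compose[OF bA c]) (use g b in \<open>simp add: smooth_function_def o_def\<close>)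
		then have "smooth_on (overlap c b) (%y. g (chart_inv c y))"
			by (rule smooth_on_cong[OF open_ovl[OF c bA], rotated])
				 (simp add: transition_overlap(2)[OF chart[OF c] chart[OF bA]])
		then show "\<exists>T. open T & x : T & smooth_on T (%x. g (chart_inv c x))"
			using open_ovl[OF c bA] x b overlap_iff[OF chart[OF c]] by blast
	qed
qed

lemma partition_of_unity_subatlas:
	assumes "B <= A" "!!p. p : topspace X ==> \<exists>c\<in>B. p : fst c" "partition_of_unity X B F u"
	shows "partition_of_unity X A F u"
	using assms(3) smooth_function_subatlas[OF assms(1,2)] assms(1) unfolding partition_of_unity_def by blast

definition restr :: "'a chart set => 'a dform => 'a dform" where
	"restr B w = (%c. if c : B then w c else 0)"

lemma restr_forms: "B <= A ==> w : forms A k ==> restr B w : forms B k"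
	unfolding forms_def restr_def by (auto simp: subset_iff)

lemma restr_d: "B <= A ==> restr B (form_d A w) = form_d B (restr B w)"
	by (auto simp: restr_def form_d_def fun_eq_iff)

lemma wedge_zero: "wedge k l 0 b = 0"
	by (auto simp: wedge_def fun_eq_iff)

lemma restr_wedge: "restr B (form_wedge k l w v) = form_wedge k l (restr B w) (restr B v)"
	by (auto simp: restr_def form_wedge_def fun_eq_iff wedge_zero)

lemma smooth_pullback_form:
	assumes B: "atlas X B" and w: "w : forms B k" "k <= 3" and b: "b : B" "b : A" and c: "c : A"
	shows "smooth_on (overlap c b) (%x. w b (trn c b x) (map (fd (trn c b) x) vs))"
proof -
	interpret B: atlas X B by (rule B)
	note st = smooth_transition_compose[OF b(2) c] and so = open_ovl[OF c b(2)] and sT = smooth_transition[OF c b(2)]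
	have "k = 0 \<or> k = 1 \<or> k = 2 \<or> k = 3" using w(2) by auto
	then show ?thesis
	proof (elim disjE)
		assume "k = 0"
		then have w: "w : forms B 0" using w by simp
		show ?thesis
			by (subst B.form0_repr[OF w], rule smooth_pullback(1)[OF so sT st[OF B.form_smooth[OF w b(1)]]])
	next
		assume "k = 1"
		then have w: "w : forms B 1" using w by simp
		show ?thesis
			by (subst B.form1_repr[OF w], rule smooth_pullback(2)[OF so sT st[OF B.smooth_vec1[OF w b(1)]]])
	next
		assume "k = 2"
		then have w: "w : forms B 2" using w by simp
		show ?thesis
			by (subst B.form2_repr[OF w], rule smooth_pullback(3)[OF so sT st[OF B.smooth_vec2[OF w b(1)]]])
	next
		assume "k = 3"
		then have w: "w : forms B 3" using w by simp
		show ?thesis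
			by (subst B.form3_repr[OF w], rule smooth_pullback(4)[OF so sT st[OF B.smooth_dens[OF w b(1)]]])
	qed
qed

text \<open>In a chart outside \<open>B\<close> the value at a point is the pullback from some chart
  of \<open>B\<close> around that point; the cocycle identity makes it independent of the choice
  (\<open>val\<close>). The bound on \<open>k\<close> lets smoothness be read off the vector
  proxies.\<close>

lemma extend_form:
	assumes B: "B <= A" "!!p. p : topspace X ==> \<exists>c\<in>B. p : fst c" and w: "w : forms B k" "k <= 3"
	shows "\<exists>w'\<in>forms A k. restr B w' = w"
proof -
	interpret B: atlas X B
		by (intro atlas.intro subatlas hausdorff) (use B in auto)
	define b where "b = (%c x. SOME b. b : B & chart_inv c x : fst b)"
	have b: "b c x : B" "b c x : A" "x : overlap c (b c x)" if "c : A" "x : img c" for c x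
	proof -
		have "\<exists>b. b : B & chart_inv c x : fst b"
			using B(2) chart_inv_into[OF chart[OF that(1)] that(2)] chart_subset[OF that(1)] by blast
		then have "b c x : B & chart_inv c x : fst (b c x)" unfolding b_def by (rule someI_ex)
		then show "b c x : B" "b c x : A" "x : overlap c (b c x)"
			using B(1) overlap_iff[OF chart[OF that(1)]] that(2) by auto
	qed
	define w' where "w' = (%c x vs. if c : A & x : img c then
		 w (b c x) (trn c (b c x) x) (map (fd (trn c (b c x)) x) vs) else 0)"
	have val: "w' c x vs = w b' (trn c b' x) (map (fd (trn c b') x) vs)"
		if c: "c : A" and b': "b' : B" and x: "x : overlap c b'" for c x vs b'
	proof -
		have b'A: "b' : A" using b' B by blast
		have xc: "x : img c" using x overlap_subset by blast
		note bb = b[OF c xc]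
		note t = transition_cocycle[OF c bb(2) b'A bb(3) x]
		have "w (b c x) (trn c (b c x) x) (map (fd (trn c (b c x)) x) vs) =
			 w b' (trn (b c x) b' (trn c (b c x) x))
				 (map (fd (trn (b c x) b') (trn c (b c x) x)) (map (fd (trn c (b c x)) x) vs))"
			by (rule B.form_transition[OF w(1) bb(1) b' t(1)])
		also have "map (fd (trn (b c x) b') (trn c (b c x) x)) (map (fd (trn c (b c x)) x) vs)
				= map (fd (trn c b') x) vs" using t(3) by simp
		finally show ?thesis using t(2) c xc by (simp add: w'_def)
	qed
	have "w' : forms A k"
	proof (rule formsI)
		fix c x assume "c ~: A \<or> x ~: img c"
		then show "w' c x = 0" by (auto simp: w'_def)
	next
		fix c x assume c: "c : A" "x : img c"
		then have "w' c x = (%vs. w (b c x) (trn c (b c x) x) (map (fd (trn c (b c x)) x) vs))"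
			by (simp add: w'_def)
		then show "alternating_form k (w' c x)"
			using alternating_map[OF B.form_alternating_all[OF w(1)] linear_transition[OF c(1) b(2,3)[OF c]]] by simp
	next
		fix c vs assume c: "c : A"
		show "smooth_on (img c) (%x. w' c x vs)"
		proof (rule smooth_on_local)
			fix x assume x: "x : img c"
			note bb = b[OF c x]
			have "smooth_on (overlap c (b c x)) (%y. w' c y vs)"
				by (rule smooth_on_cong[OF open_ovl[OF c bb(2)] _ smooth_pullback_form[OF B.atlas_axioms w bb(1,2) c]])
					 (simp add: val[OF c bb(1)])
			then show "\<exists>T. open T & x : T & smooth_on T (%x. w' c x vs)"
				using open_ovl[OF c bb(2)] bb(3) by blast
		qed
	next
		fix c c' x vs assume c: "c : A" "c' : A" and x: "x : overlap c c'"
		have x': "trn c c' x : img c'"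
			using transition_overlap(1)[OF chart[OF c(1)] chart[OF c(2)] x] overlap_subset by blast
		define d where "d = b c' (trn c c' x)"
		have d: "d : B" "d : A" "trn c c' x : overlap c' d" unfolding d_def by (rule b[OF c(2) x'])+
		have xd: "x : overlap c d"
			using d(3) transition_overlap(2)[OF chart[OF c(1)] chart[OF c(2)] x] overlap_iff[OF chart[OF c(1)]]
				overlap_iff[OF chart[OF c(2)]] x overlap_subset by (metis subsetD)
		note t = transition_cocycle[OF c d(2) x xd]
		have "map (fd (trn c d) x) vs = map (fd (trn c' d) (trn c c' x)) (map (fd (trn c c') x) vs)"
			using t(3) by simp
		then show "w' c x vs = w' c' (trn c c' x) (map (fd (trn c c') x) vs)"
			unfolding val[OF c(1) d(1) xd] val[OF c(2) d(1,3)] t(2) by (simp only:)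
	qed
	moreover have "restr B w' = w"
	proof (intro ext)
		fix c x vs
		show "restr B w' c x vs = w c x vs"
		proof (cases "c : B & x : img c")
			case True
			then have c: "c : A" "x : overlap c c" using B by (auto simp: overlap_self)
			have "fd (trn c c) x = (%v. v)" using transition_self(2)[OF c(1)] True by auto
			then show ?thesis
				using val[OF c(1) conjunct1[OF True] c(2), of vs] transition_self(1)[OF c(1)] True by (simp add: restr_def)
		next
			case False
			then show ?thesis using B.form_outside[OF w(1), of c x] by (auto simp: restr_def w'_def)
		qed
	qed
	ultimately show ?thesis by blast
qed

lemma restr_eq_iff:
	assumes B: "B <= A" "!!p. p : topspace X ==> \<exists>c\<in>B. p : fst c" and w: "w : forms A k" "v : forms A k"
		and e: "restr B w = restr B v"
	shows "w = v"
proof (rule forms_eqI[OF w])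
	fix p assume "p : topspace X"
	then obtain c where "c : B" "p : fst c" using B by blast
	then show "\<exists>c\<in>A. p : fst c & w c (snd c p) = v c (snd c p)"
		using fun_cong[OF e, of c] B by (auto simp: restr_def)
qed

text \<open>How new charts enter: an orientation preserving diffeomorphism \<Phi> of an open part
  \<open>V\<close> of a chart image onto \<open>W\<close>, with smooth inverse \<Psi>, yields a
  compatible chart, which maximality puts into \<open>A\<close>. It is used for translations and for
  straightening a 1-form.\<close>

lemma compose_chart:
	assumes max: "maxatlas X A <= A" and c: "c : A" and V: "open V" "V <= img c" and W: "open W"
		and \<Phi>: "smooth_on V \<Phi>" "\<Phi> ` V = W" and \<Psi>: "smooth_on W \<Psi>" "!!x. x : V ==> \<Psi> (\<Phi> x) = x"
		and det: "!!x. x : V ==> 0 < det (matrix (fd \<Phi> x))"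
	shows "({p : fst c. snd c p : V}, \<Phi> \<circ> snd c) : A"
		and "img ({p : fst c. snd c p : V}, \<Phi> \<circ> snd c) = W"
		and "x : V ==> x : overlap c ({p : fst c. snd c p : V}, \<Phi> \<circ> snd c)"
		and "x : V ==> trn c ({p : fst c. snd c p : V}, \<Phi> \<circ> snd c) x = \<Phi> x"
proof -
	define d where "d = ({p : fst c. snd c p : V}, \<Phi> \<circ> snd c)"
	have Vim: "snd c ` {p : fst c. snd c p : V} = V" using V(2) by (auto simp: chart_image_def)
	have im: "img d = W" unfolding d_def chart_image_def fst_conv snd_conv image_comp[symmetric] Vim by (rule \<Phi>(2))
	have od: "openin X (fst d)" unfolding d_def using chart_open_preimage[OF chart[OF c] V(1)] by simp
	have \<Psi>V: "\<Psi> y : V" "\<Phi> (\<Psi> y) = y" if "y : W" for y using that \<Phi>(2) \<Psi>(2) by auto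
	have "homeomorphic_map (subtopology X (fst d)) (top_of_set V) (snd c)"
	proof -
		have "homeomorphic_map (subtopology (subtopology X (fst c)) (fst d)) (subtopology (top_of_set (img c)) V) (snd c)"
		proof (rule homeomorphic_map_subtopologies)
			show "homeomorphic_map (subtopology X (fst c)) (top_of_set (img c)) (snd c)"
				using chart[OF c] by (simp add: is_chart_def)
			show "snd c ` (topspace (subtopology X (fst c)) \<inter> fst d) = topspace (top_of_set (img c)) \<inter> V"
				using chart_topspace(2)[OF chart[OF c]] Vim V(2) by (auto simp: d_def)
		qed
		moreover have "subtopology (subtopology X (fst c)) (fst d) = subtopology X (fst d)"
			by (simp add: subtopology_subtopology d_def) (metis (no_types, lifting) Int_absorb1 mem_Collect_eq subsetI)
		moreover have "subtopology (top_of_set (img c)) V = top_of_set V"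
			using V(2) by (simp add: subtopology_subtopology Int_absorb1)
		ultimately show ?thesis by simp
	qed
	moreover have "homeomorphic_map (top_of_set V) (top_of_set W) \<Phi>"
		unfolding homeomorphic_map_maps
	proof
		show "homeomorphic_maps (top_of_set V) (top_of_set W) \<Phi> \<Psi>"
			unfolding homeomorphic_maps_def
			using smooth_on_continuous[OF \<Phi>(1)] smooth_on_continuous[OF \<Psi>(1)] \<Psi>V \<Psi>(2) \<Phi>(2)
			by (auto simp: continuous_map_in_subtopology)
	qed
	ultimately have hm: "homeomorphic_map (subtopology X (fst d)) (top_of_set W) (snd d)"
		unfolding d_def snd_conv by (rule homeomorphic_map_compose)
	have chd: "is_chart X d" using od hm W by (simp add: is_chart_def im)
	have inv: "chart_inv d y = chart_inv c (\<Psi> y)" if y: "y : W" for y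
	proof -
		have p: "chart_inv c (\<Psi> y) : fst c" "snd c (chart_inv c (\<Psi> y)) = \<Psi> y"
			using chart_inv_into[OF chart[OF c]] chart_chart_inv[OF chart[OF c]] \<Psi>V[OF y] V(2) by auto
		then have "chart_inv c (\<Psi> y) : fst d" "snd d (chart_inv c (\<Psi> y)) = y" using \<Psi>V[OF y] by (auto simp: d_def)
		then show ?thesis using chart_inv_chart[OF chd] by metis
	qed
	have ov: "y : overlap d b \<longleftrightarrow> y : W & \<Psi> y : overlap c b" for y b
		using overlap_iff[OF chd, of y b] overlap_iff[OF chart[OF c], of "\<Psi> y" b] inv[of y] \<Psi>V V(2) im by auto
	have tr: "trn d b y = trn c b (\<Psi> y)" if "y : W" for y b
		using inv[OF that] by (simp add: transition_def)
	have "compatible X A d"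
		unfolding compatible_def
	proof (intro conjI ballI)
		show "is_chart X d" by (rule chd)
		fix b assume b: "b : A"
		have ob: "open (overlap d b)" "open (overlap b d)" using open_overlap chd chart[OF b] by blast+
		have sub: "\<Psi> ` overlap d b <= overlap c b" "overlap d b <= W" using ov[of _ b] by auto
		have s: "smooth_on (overlap d b) (%y. trn c b (\<Psi> y))"
			by (rule smooth_on_compose[OF ob(1) open_ovl[OF c b] sub(1) smooth_transition[OF c b] smooth_on_subset[OF \<Psi>(1) sub(2)]])
		then show "smooth_on (overlap d b) (trn d b)"
			by (rule smooth_on_cong[OF ob(1), rotated]) (use sub(2) tr[of _ b] in auto)
		have ov2: "x : overlap b c" "trn b c x : V" "trn b d x = \<Phi> (trn b c x)"
			if "x : overlap b d" for x
			using that overlap_iff[OF chart[OF b]] by (auto simp: transition_def d_def)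
		have "smooth_on (overlap b d) (%x. \<Phi> (trn b c x))"
			by (rule smooth_on_compose[OF ob(2) V(1) _ \<Phi>(1) smooth_on_subset[OF smooth_transition[OF b c]]]) (use ov2 in auto)
		then show "smooth_on (overlap b d) (trn b d)"
			by (rule smooth_on_cong[OF ob(2), rotated]) (use ov2 in auto)
		fix y assume y: "y : overlap d b"
		have yW: "y : W" "\<Psi> y : overlap c b" "\<Psi> y : V" using y ov \<Psi>V by auto
		have "fd (trn d b) y v = fd (trn c b) (\<Psi> y) (fd \<Psi> y v)" for v
		proof -
			have "fd (trn d b) y v = fd (%y. trn c b (\<Psi> y)) y v"
				by (rule fun_cong[OF fd_cong[OF ob(1) y]]) (use sub(2) tr[of _ b] in auto)
			then show ?thesis using smooth_on_compose_fd[OF smooth_transition[OF c b] \<Psi>(1) yW(1,2), of v] by simp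
		qed
		then have "fd (trn d b) y = (%v. fd (trn c b) (\<Psi> y) (fd \<Psi> y v))" by auto
		then have "det (matrix (fd (trn d b) y)) = det (matrix (fd (trn c b) (\<Psi> y))) * det (matrix (fd \<Psi> y))"
			using det_matrix_compose[OF linear_transition[OF c b yW(2)] smooth_on_linear_fd[OF \<Psi>(1) yW(1)]] by simp
		moreover have "0 < det (matrix (fd \<Psi> (\<Phi> (\<Psi> y))))"
			by (rule det_inverse_pos[OF V(1) yW(3) \<Phi>(1) \<Psi>(1) _ \<Psi>(2) det[OF yW(3)]]) (use \<Phi>(2) in auto)
		ultimately show "0 < det (matrix (fd (trn d b) y))"
			using det_transition[OF c b yW(2)] \<Psi>V(2)[OF yW(1)] by simp
	qed
	then show "({p : fst c. snd c p : V}, \<Phi> \<circ> snd c) : A" using max by (auto simp: maxatlas_def d_def)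
	show "img ({p : fst c. snd c p : V}, \<Phi> \<circ> snd c) = W" using im by (simp add: d_def)
	assume x: "x : V"
	then have "chart_inv c x : fst c" "snd c (chart_inv c x) = x"
		using V(2) chart_inv_into[OF chart[OF c]] chart_chart_inv[OF chart[OF c]] by auto
	then show "x : overlap c ({p : fst c. snd c p : V}, \<Phi> \<circ> snd c)"
		"trn c ({p : fst c. snd c p : V}, \<Phi> \<circ> snd c) x = \<Phi> x"
		using x V(2) overlap_iff[OF chart[OF c]] by (auto simp: transition_def)
qed

end

context compact_atlas
begin

text \<open>A partition of unity for the smaller atlas is also one for the larger atlas, and both
  integrals can be computed with it.\<close>

lemma I_subatlas:
	assumes B: "B <= A" "!!p. p : topspace X ==> \<exists>c\<in>B. p : fst c" and w: "w : forms A 3"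
	shows "form_integral X B (restr B w) = I w"
proof -
	interpret B: compact_atlas X B
		by (intro compact_atlas.intro compact_atlas_axioms.intro atlas.intro subatlas hausdorff compact) (use B in auto)
	obtain F u where u: "partition_of_unity X B F u" using B.partition_of_unity_exists by blast
	have "dens (smul (u c) (restr B w)) c = dens (smul (u c) w) c" if "c : F" for c
		using B.partition_of_unityD(2)[OF u] that by (auto simp: dens_def smul_def restr_def fun_eq_iff)
	then have "pu_integral F u (restr B w) = pu_integral F u w" by (simp add: pu_integral_def)
	then show ?thesis
		using B.form_integral_eq[OF u restr_forms[OF B(1) w]]
			form_integral_eq[OF partition_of_unity_subatlas[OF B u] w] by simp
qed

end

section \<open>Exactness of 3-forms with vanishing integral\<close>

lemma fd_translate: "((%x::real^3. x + a) has_derivative (%v. v)) (at x)"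
	using has_derivative_add[OF has_derivative_ident has_derivative_const[of a]] by simp

text \<open>The factor 3 comes from estimating the norm by the sum of the three coordinates.\<close>

lemma ocube_subset_ball: "ocube (e / 3) <= ball 0 e"
proof
	fix x assume x: "x : ocube (e / 3)"
	have "norm x <= \<bar>x $ 1\<bar> + \<bar>x $ 2\<bar> + \<bar>x $ 3\<bar>" using norm_le_l1_cart[of x] by (simp add: sum_3)
	also have "... < e" using x[unfolded ocube_def, simplified, rule_format, of 1]
			x[unfolded ocube_def, simplified, rule_format, of 2] x[unfolded ocube_def, simplified, rule_format, of 3]
		by simp
	finally show "x : ball 0 e" by simp
qed

context compact_atlas
begin

definition embd :: "'a chart => (real ^ 3 => real) => 'a dform" where
	"embd c f = emb c (%x. form3 (f x))"

lemma embd_props: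
	assumes c: "c : A" "ccube r <= img c" and f: "test r f"
	shows "embd c f : forms A 3" "vanish_out (embd c f) (chart_inv c ` ccube r)" "dens (embd c f) c = f"
		"I (embd c f) = integral UNIV f"
proof -
	have z: "f x = 0" if "x ~: ccube r" for x using f that by (simp add: test_def)
	have s: "smooth_on (img c) f" using f smooth_on_subset by (auto simp: test_def)
	show F: "embd c f : forms A 3" unfolding embd_def by (rule emb_form3[OF c(1) compact_ccube c(2) z s])
	show V: "vanish_out (embd c f) (chart_inv c ` ccube r)"
		unfolding embd_def by (rule emb_vanish[OF c(1)]) (simp add: z)
	show D: "dens (embd c f) c = f"
	proof
		fix x show "dens (embd c f) c x = f x"
		proof (cases "x : img c")
			case True
			then show ?thesis unfolding embd_def by (rule vec_emb(3)[OF c(1)])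
		next
			case False
			then have "f x = 0" using z c(2) by blast
			then show ?thesis using vec_outside(3)[OF _ F, of c x] False by simp
		qed
	qed
	have "chart_inv c ` ccube r <= fst c" using chart_inv_image_eq[OF chart[OF c(1)] c(2)] by auto
	then show "I (embd c f) = integral UNIV f"
		using I_supported[OF F c(1) chart_compact_preimage[OF chart[OF c(1)] compact_ccube c(2)] _ V] D by simp
qed

lemma embd_unique:
	assumes w: "w : forms A 3" and c: "c : A" "ccube r <= img c" and f: "test r f"
		and K: "K <= fst c" "vanish_out w K" and e: "!!x. x : img c ==> dens w c x = f x"
	shows "w = embd c f"
proof (rule form3_eqI[OF w embd_props(1)[OF c f]])
	fix p assume p: "p : topspace X"
	show "\<exists>d\<in>A. p : fst d & dens w d (snd d p) = dens (embd c f) d (snd d p)"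
	proof (cases "p : fst c")
		case True
		then have "dens w c (snd c p) = dens (embd c f) c (snd c p)"
			using e[OF chart_into[OF True]] embd_props(3)[OF c f] by simp
		then show ?thesis using c True by blast
	next
		case False
		obtain d where d: "d : A" "p : fst d" using covers[OF p] by blast
		have x: "snd d p : img d" "chart_inv d (snd d p) = p"
			using chart_into[OF d(2)] chart_inv_chart[OF chart[OF d(1)] d(2)] by simp_all
		have "chart_inv d (snd d p) ~: K" using K(1) False x(2) by auto
		then have "w d (snd d p) = 0" using K(2) d(1) x(1) unfolding vanish_out_def by blast
		moreover have "embd c f d (snd d p) = 0"
			unfolding embd_def by (rule emb_outside) (use False x overlap_iff[OF chart[OF d(1)]] in auto)
		ultimately have "dens w d (snd d p) = dens (embd c f) d (snd d p)" by (simp add: dens_def)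
		then show ?thesis using d by blast
	qed
qed

lemma embd_lincomb:
	assumes c: "c : A" "ccube r <= img c" and f: "test r f" "test r g"
	shows "embd c (%x. f x + g x) = embd c f + embd c g" "embd c (%x. f x - g x) = embd c f - embd c g"
		"embd c (%x. k * f x) = scale k (embd c f)"
	by (auto simp: embd_def emb_def scale_def form3_def fun_eq_iff algebra_simps split: list.splits)

lemma embd_sum: "embd c (%x. \<Sum>i\<in>J. g i x) = (\<Sum>i\<in>J. embd c (g i))"
proof (intro ext)
	fix c' x vs
	have "form3 (\<Sum>i\<in>J. h i) us = (\<Sum>i\<in>J. form3 (h i) us)" for h us
		by (auto simp: form3_def sum_distrib_right split: list.splits)
	note f = this
	show "embd c (%x. \<Sum>i\<in>J. g i x) c' x vs = (\<Sum>i\<in>J. embd c (g i)) c' x vs"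
	proof (cases "c' : A & x : overlap c' c")
		case True
		then show ?thesis by (simp add: sum_fun3 embd_def emb_def f)
	next
		case False
		show ?thesis unfolding sum_fun3 embd_def emb_def if_not_P[OF False] by simp
	qed
qed

lemma supported_embd:
	assumes w: "w : forms A 3" and c: "c : A" "img c = ocube R" "0 < R"
		and K: "compactin X K" "K <= fst c" "vanish_out w K"
	shows "\<exists>r>0. r < R & test r (dens w c) & w = embd c (dens w c)"
proof -
	have cK: "compact (snd c ` K)" by (rule chart_compact_image[OF chart[OF c(1)] K(1,2)])
	have "snd c ` K <= ocube R" unfolding c(2)[symmetric] chart_image_def by (rule image_mono[OF K(2)])
	then obtain r where r: "0 < r" "r < R" "snd c ` K <= ccube r" using compact_subset_ccube[OF cK _ c(3)] by blast
	have t: "test r (dens w c)"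
		unfolding test_def using dens_test(1,2)[OF w c(1) K] r(3) by blast
	have "ccube r <= img c" using ccube_subset_ocube[OF r(2)] c(2) by simp
	then have "w = embd c (dens w c)" by (rule embd_unique[OF w c(1) _ t K(2,3) refl])
	then show ?thesis using r t by blast
qed

definition exact3 :: "'a dform => bool" where
	"exact3 w \<longleftrightarrow> (\<exists>s\<in>forms A 2. form_d A s = w)"

lemma exact3_add: "exact3 v ==> exact3 w ==> exact3 (v + w)"
	unfolding exact3_def using forms_add form_d_add by metis

lemma exact3_0: "exact3 0"
	unfolding exact3_def using forms_0 form_d_zero by metis

lemma exact3_sum: "(!!i. i : J ==> exact3 (w i)) ==> exact3 (\<Sum>i\<in>J. w i)"
	by (induction J rule: infinite_finite_induct) (auto intro: exact3_add exact3_0)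

text \<open>The three potentials from \<open>divergence_exact\<close> become the components of a
  2-form supported in the chart.\<close>

lemma local_exact3:
	assumes c: "c : A" "ccube r <= img c" "0 < r" and f: "test r f" "integral UNIV f = 0"
	shows "exact3 (embd c f)"
proof -
	obtain P Q S where t: "test r P" "test r Q" "test r S"
		and e: "!!x. f x = fd P x (ax 1) + fd Q x (ax 2) + fd S x (ax 3)"
		using divergence_exact[OF c(3) f] by blast
	define b where "b = (%x. vector [P x, Q x, S x] :: real^3)"
	have sb: "smooth_on UNIV b"
		unfolding b_def by (intro smooth_on_vector3 open_UNIV) (rule t[THEN test_smooth])+
	have bz: "b x = 0" if "x ~: ccube r" for x
		using t that by (simp add: b_def test_def vec_eq_iff forall_3 vector_3)
	have "divg b x = f x" for x
	proof -
		have "fd b x u $ 1 = fd P x u" "fd b x u $ 2 = fd Q x u" "fd b x u $ 3 = fd S x u" for u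
			using fd_vec_nth[OF sb UNIV_I, of 1 x u] fd_vec_nth[OF sb UNIV_I, of 2 x u] fd_vec_nth[OF sb UNIV_I, of 3 x u]
			by (simp_all add: b_def vector_3)
		then show ?thesis using e[of x] by (simp add: divg_def)
	qed
	then have "divg b = f" by auto
	then have "form_d A (emb c (%x. form2 (b x))) = embd c f"
		using form_d_emb(2)[OF c(1) compact_ccube c(2) bz smooth_on_subset[OF sb]] unfolding embd_def by simp
	moreover have "emb c (%x. form2 (b x)) : forms A 2"
		by (rule emb_form2[OF c(1) compact_ccube c(2) bz smooth_on_subset[OF sb]]) auto
	ultimately show ?thesis unfolding exact3_def by blast
qed

text \<open>The standard volume forms of the charts, weighted by a partition of unity, add up to a
  positive form because all transition determinants are positive.\<close>

lemma positive_form_exists: "\<exists>v\<in>forms A 3. \<forall>c\<in>A. \<forall>x\<in>img c. 0 < dens v c x"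
proof -
	obtain F u where u: "partition_of_unity X A F u" using partition_of_unity_exists by blast
	note U = partition_of_unityD[OF u]
	define e where "e = (%c. emb c (%x. form3 (u c (chart_inv c x))))"
	have e: "e c : forms A 3" if c: "c : F" for c
		unfolding e_def
	proof (rule emb_form3)
		show cA: "c : A" using c U(2) by blast
		show "compact (snd c ` suppt (u c))" by (rule chart_compact_image[OF chart[OF cA] suppt_compact U(5)[OF c]])
		show "snd c ` suppt (u c) <= img c" unfolding chart_image_def by (rule image_mono[OF U(5)[OF c]])
		show "smooth_on (img c) (%x. u c (chart_inv c x))" by (rule smooth_functionD[OF U(3)[OF c] cA])
		fix x assume x: "x : img c" "x ~: snd c ` suppt (u c)"
		then have "chart_inv c x ~: suppt (u c)" using chart_chart_inv[OF chart[OF cA]] by force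
		moreover have "chart_inv c x : topspace X" using x chart_inv_into[OF chart[OF cA]] chart_subset[OF cA] by blast
		ultimately show "u c (chart_inv c x) = 0" using suppt_zero by blast
	qed
	have val: "dens (e c) c' (snd c' p) = (if p : fst c then det (matrix (fd (trn c' c) (snd c' p))) * u c p else 0)"
		if c: "c : F" and c': "c' : A" and p: "p : fst c'" for c c' p
	proof (cases "p : fst c")
		case True
		have cA: "c : A" using c U(2) by blast
		have x: "snd c' p : overlap c' c" using p True by (rule overlapI)
		have "dens (e c) c (trn c' c (snd c' p)) = u c p"
			unfolding e_def transition_chart[OF chart[OF c'] p]
			using vec_emb(3)[OF cA chart_into[OF True]] chart_inv_chart[OF chart[OF cA] True] by simp
		then show ?thesis using dens_transition[OF e[OF c] c' cA x] True by simp
	next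
		case False
		then have "snd c' p ~: overlap c' c"
			using overlap_iff[OF chart[OF c']] chart_inv_chart[OF chart[OF c'] p] by auto
		then show ?thesis using False by (simp add: e_def emb_outside dens_def)
	qed
	have "0 < dens (\<Sum>c\<in>F. e c) c' x" if c': "c' : A" and x: "x : img c'" for c' x
	proof -
		define p where "p = chart_inv c' x"
		have p: "p : fst c'" "snd c' p = x" "p : topspace X"
			using chart_inv_into[OF chart[OF c'] x] chart_chart_inv[OF chart[OF c'] x] chart_subset[OF c'] by (auto simp: p_def)
		have nn: "0 <= dens (e c) c' x" if c: "c : F" for c
			using val[OF c c' p(1)] det_transition[OF c', of c x] c U(2) U(4)[OF c p(3)] p overlapI[of p c' c]
			by (auto simp: mult_nonneg_nonneg less_imp_le)
		obtain c where c: "c : F" "u c p ~= 0" using U(6)[OF p(3)] by (metis sum.neutral zero_neq_one)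
		have pc: "p : fst c" using suppt_zero[OF p(3), of "u c"] c U(5) by blast
		have "0 < dens (e c) c' x"
			using val[OF c(1) c' p(1)] det_transition[OF c', of c x] c U(2) U(4)[OF c(1) p(3)] p overlapI[of p c' c] pc
			by (auto simp: less_le)
		also have "... <= (\<Sum>c\<in>F. dens (e c) c' x)" by (rule member_le_sum[OF c(1) _ U(1)]) (use nn in auto)
		also have "... = dens (\<Sum>c\<in>F. e c) c' x" by (simp add: dens_def sum_fun3)
		finally show ?thesis .
	qed
	moreover have "(\<Sum>c\<in>F. e c) : forms A 3" by (rule forms_sum[OF e])
	ultimately show ?thesis by blast
qed

end

locale max_atlas = compact_atlas +
	assumes maximal: "maxatlas X A <= A" and connected: "connected_space X"
begin

text \<open>Any chart becomes one with a cube as image by restricting it and translating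
  \<open>p\<close> to the origin.\<close>

lemma cube_chart_at:
	assumes c: "c : A" "p : fst c" and V: "openin X V" "p : V"
	shows "\<exists>d\<in>A. \<exists>r>0. p : fst d & fst d <= V & fst d <= fst c & img d = ocube r & snd d p = 0 &
		(\<forall>x\<in>ocube r. x : overlap d c & trn d c x = x + snd c p)"
proof -
	define a where "a = snd c p"
	have "open (snd c ` (fst c \<inter> V))" by (rule chart_open_image[OF chart[OF c(1)] V(1)])
	moreover have "a : snd c ` (fst c \<inter> V)" using c V by (auto simp: a_def)
	ultimately obtain e where e: "e > 0" "ball a e <= snd c ` (fst c \<inter> V)" using open_contains_ball by blast
	define r where "r = e / 3"
	have r: "r > 0" using e by (simp add: r_def)
	have sub: "x + a : snd c ` (fst c \<inter> V)" if "x : ocube r" for x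
	proof -
		have "norm x < e" using ocube_subset_ball[of e] that by (auto simp: r_def)
		then have "x + a : ball a e" by (simp add: dist_norm)
		then show ?thesis using e by blast
	qed
	define V' where "V' = (%x. x + a) ` ocube r"
	have V': "open V'" "V' <= img c"
	proof -
		have "V' = (+) a ` ocube r" by (auto simp: V'_def add.commute)
		then show "open V'" using open_translation[OF open_ocube] by metis
		show "V' <= img c" using sub by (auto simp: V'_def chart_image_def)
	qed
	have tr: "smooth_on S (%x::real^3. x + b)" if "open S" for S b by (intro smooth_on_add that) auto
	have fdt: "fd (%x. x - a) x = (%v. v)" for x using fd_eqI[OF fd_translate[of "- a" x]] by simp
	have d1: "0 < det (matrix (fd (%x. x - a) x))" for x unfolding fdt by (simp add: det_matrix_ident)
	have im: "(%x. x - a) ` V' = ocube r" by (force simp: V'_def)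
	have inv: "(%x. x + a) (x - a) = x" for x by simp
	define d where "d = ({q : fst c. snd c q : V'}, (%x. x - a) \<circ> snd c)"
	have s1: "smooth_on V' (%x. x - a)" using tr[OF V'(1), of "- a"] by simp
	note cc = compose_chart[OF maximal c(1) V' open_ocube s1 im tr[OF open_ocube] inv d1]
	have dA: "d : A" unfolding d_def by (rule cc(1))
	have imd: "img d = ocube r" unfolding d_def by (rule cc(2))
	have dV: "fst d <= V"
	proof
		fix q assume q: "q : fst d"
		then have "snd c q : V'" "q : fst c" by (auto simp: d_def)
		then have "snd c q : snd c ` (fst c \<inter> V)" using sub by (auto simp: V'_def)
		then obtain q' where "q' : fst c" "q' : V" "snd c q = snd c q'" by blast
		then show "q : V" using chart_inj[OF chart[OF c(1)]] \<open>q : fst c\<close> by (metis inj_onD)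
	qed
	have t: "x : overlap d c & trn d c x = x + snd c p" if x: "x : ocube r" for x
	proof -
		have y: "x + a : V'" using x by (auto simp: V'_def)
		have o: "x + a : overlap c d" "trn c d (x + a) = x"
			using cc(3)[OF y] cc(4)[OF y] by (simp_all add: d_def)
		then show ?thesis
			using transition_overlap(1,3)[OF chart[OF c(1)] chart[OF dA] o(1)] by (simp add: a_def)
	qed
	have "a : V'" using r by (force simp: V'_def ocube_def image_iff intro: bexI[of _ 0])
	then have "p : fst d" "snd d p = 0" using c by (auto simp: d_def a_def)
	then show ?thesis using dA imd dV t r by (intro bexI[of _ d] exI[of _ r]) (auto simp: d_def)
qed

text \<open>In a chart with a cube as image every compact support lies in a smaller concentric
  closed cube, which is the form of support that \<open>local_exact3\<close> expects.\<close>

definition cubes :: "'a chart set" where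
	"cubes = {c : A. \<exists>r>0. img c = ocube r}"

lemma cubes_cover: "p : topspace X ==> \<exists>c\<in>cubes. p : fst c"
proof -
	assume p: "p : topspace X"
	then obtain c where "c : A" "p : fst c" using covers by blast
	from cube_chart_at[OF this openin_topspace p] show ?thesis unfolding cubes_def by blast
qed

text \<open>A normalised bump supported in the overlap has integral 1 in either chart. It links the
  reference densities of the two charts.\<close>

lemma cubes_common:
	assumes c: "c : cubes" "d : cubes" and p: "p : fst c" "p : fst d"
	shows "\<exists>w f g r s. w : forms A 3 & w = embd c f & w = embd d g & 0 < r & test r f & ccube r <= img c &
		0 < s & test s g & ccube s <= img d & integral UNIV f = 1 & integral UNIV g = 1"
proof -
	have cd: "c : A" "d : A" using c by (auto simp: cubes_def)
	have o: "open (overlap c d)" "snd c p : overlap c d" using open_ovl[OF cd] overlapI[of p c d] p by auto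
	then obtain e where e: "e > 0" "cball (snd c p) e <= overlap c d" using open_contains_cball by blast
	define b where "b = ball_bump (snd c p) e"
	have bz: "b x = 0" if "x ~: cball (snd c p) e" for x
		using that ball_bump_eq_0_iff[OF e(1), of "snd c p" x] by (simp add: b_def)
	have im: "cball (snd c p) e <= img c" using e overlap_subset by blast
	define w where "w = emb c (%x. form3 (b x))"
	have w: "w : forms A 3"
		unfolding w_def by (rule emb_form3[OF cd(1) compact_cball im bz])
			(simp_all add: b_def smooth_on_subset[OF smooth_ball_bump])
	define K where "K = chart_inv c ` cball (snd c p) e"
	have K: "compactin X K" "K <= fst c" "K <= fst d" "vanish_out w K"
	proof -
		show "compactin X K" unfolding K_def by (rule chart_compact_preimage[OF chart[OF cd(1)] compact_cball im])
		show "K <= fst c" "K <= fst d" using e(2) overlap_iff[OF chart[OF cd(1)], of _ d] chart_inv_into[OF chart[OF cd(1)]]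
			unfolding K_def by blast+
		show "vanish_out w K" unfolding w_def K_def by (rule emb_vanish[OF cd(1)]) (simp add: bz)
	qed
	obtain Rc Rd where R: "img c = ocube Rc" "0 < Rc" "img d = ocube Rd" "0 < Rd"
		using c by (auto simp: cubes_def)
	obtain r where r: "0 < r" "r < Rc" "test r (dens w c)" "w = embd c (dens w c)"
		using supported_embd[OF w cd(1) R(1,2) K(1,2,4)] by blast
	obtain s where s: "0 < s" "s < Rd" "test s (dens w d)" "w = embd d (dens w d)"
		using supported_embd[OF w cd(2) R(3,4) K(1,3,4)] by blast
	have sub: "ccube r <= img c" "ccube s <= img d" using ccube_subset_ocube r(2) s(2) R by auto
	define z where "z = integral UNIV (dens w c)"
	have dc: "dens w c x = b x" if "x : img c" for x unfolding w_def by (rule vec_emb(3)[OF cd(1) that])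
	have "0 < z"
		unfolding z_def
	proof (rule integral_pos[OF test_cc[OF r(3)], of "snd c p"])
		show "0 <= dens w c x" for x
			using dc[of x] vec_outside(3)[OF _ w, of c x] ball_bump_nonneg[of "snd c p" e x] by (cases "x : img c") (auto simp: b_def)
		show "0 < dens w c (snd c p)" using dc[OF chart_into[OF p(1)]] ball_bump_pos_iff[OF e(1), of "snd c p" "snd c p"] e by (simp add: b_def)
	qed
	have zd: "integral UNIV (dens w d) = z"
		unfolding z_def by (rule integral_change_chart[OF w cd(2,1) K(1,3,2,4)])
	define w' where "w' = scale (inverse z) w"
	have w': "w' : forms A 3" unfolding w'_def by (rule forms_scale[OF w])
	have "w' = embd c (%x. inverse z * dens w c x)" "w' = embd d (%x. inverse z * dens w d x)"
		unfolding w'_def using embd_lincomb(3)[OF cd(1) sub(1) r(3,3)] embd_lincomb(3)[OF cd(2) sub(2) s(3,3)] r(4) s(4) by metis+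
	moreover have "integral UNIV (%x. inverse z * dens w c x) = 1" "integral UNIV (%x. inverse z * dens w d x) = 1"
		using \<open>0 < z\<close> zd z_def by simp_all
	ultimately show ?thesis
		using w' r(1) s(1) sub test_cmult[OF r(3)] test_cmult[OF s(3)] by blast
qed

lemma exact3_scale: "exact3 w ==> exact3 (scale k w)"
	unfolding exact3_def using forms_scale form_d_scale by metis

lemma integral_lincomb_test:
	"test r f ==> test r g ==> integral UNIV (%x. f x - k * g x) = integral UNIV f - k * integral UNIV g"
	using integral_diff[OF cc_integrable[OF test_cc] cc_integrable[OF test_cc], of r f r "%x. k * g x"] test_cmult by simp

lemma embd_mod_exact:
	assumes "c : cubes" "ccube r <= img c" "0 < r" "test r f"
		and "ccube s <= img c" "0 < s" "test s g" "integral UNIV g = 1"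
	shows "exact3 (embd c f - scale (integral UNIV f) (embd c g))"
proof -
	have c: "c : A" using assms(1) by (simp add: cubes_def)
	define t where "t = max r s"
	have t: "ccube t <= img c" "0 < t" "test t f" "test t g"
		using assms(2,3,5,6) test_mono[OF assms(4), of t] test_mono[OF assms(7), of t] by (auto simp: t_def max_def)
	have "exact3 (embd c (%x. f x - integral UNIV f * g x))"
		by (rule local_exact3[OF c t(1,2) test_diff[OF t(3) test_cmult[OF t(4)]]])
			 (simp add: integral_lincomb_test[OF t(3,4)] assms(8))
	then show ?thesis
		using embd_lincomb(2)[OF c t(1,3) test_cmult[OF t(4)]] embd_lincomb(3)[OF c t(1,4,4)] by simp
qed

lemma scale_simps: "scale a (v - w) = scale a v - scale a w" "scale a (scale b w) = scale (a * b) w" "scale 1 w = w"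
	"scale (\<Sum>i\<in>J. h i) w = (\<Sum>i\<in>J. scale (h i) w)" "scale 0 w = 0"
	by (auto simp: scale_def fun_eq_iff algebra_simps sum_fun3 sum_distrib_right)

text \<open>All densities are compared with one reference density \<omega>0 of integral 1 supported
  in a single cube. A chart is good if each density in it is exact up to its integral times
  \<omega>0. Overlaps pass this property on, connectedness spreads it to all cubes, and a partition
  of unity reduces \<open>w\<close> to densities in cubes.\<close>

theorem exact_iff_integral_zero:
	assumes w: "w : forms A 3" "I w = 0" and ne: "topspace X ~= {}"
	shows "\<exists>s\<in>forms A 2. form_d A s = w"
proof -
	obtain p0 where "p0 : topspace X" using ne by blast
	then obtain c0 where c0: "c0 : cubes" "p0 : fst c0" using cubes_cover by blast
	obtain \<omega>0 f0 r0 where \<omega>0: "\<omega>0 = embd c0 f0" "0 < r0" "test r0 f0" "ccube r0 <= img c0" "integral UNIV f0 = 1"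
		using cubes_common[OF c0(1,1,2,2)] by blast
	define good where "good = (%c. \<forall>r f. 0 < r --> ccube r <= img c --> test r f -->
			exact3 (embd c f - scale (integral UNIV f) \<omega>0))"
	have good0: "good c0" unfolding good_def \<omega>0(1)
		using embd_mod_exact[OF c0(1) _ _ _ \<omega>0(4,2,3,5)] by blast
	have step: "good d" if c: "c : cubes" "d : cubes" "good c" and p: "p : fst c" "p : fst d" for c d p
		unfolding good_def
	proof (intro allI impI)
		fix r f assume rf: "0 < r" "ccube r <= img d" "test r f"
		obtain w f1 g1 r1 s1 where h: "w = embd c f1" "w = embd d g1" "0 < r1" "test r1 f1" "ccube r1 <= img c"
			"0 < s1" "test s1 g1" "ccube s1 <= img d" "integral UNIV f1 = 1" "integral UNIV g1 = 1"
			using cubes_common[OF c(1,2) p] by blast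
		have "exact3 (embd d f - scale (integral UNIV f) w)"
			unfolding h(2) by (rule embd_mod_exact[OF c(2) rf(2,1,3) h(8,6,7,10)])
		moreover have "exact3 (scale (integral UNIV f) (w - \<omega>0))"
		proof (rule exact3_scale)
			have "exact3 (embd c f1 - scale (integral UNIV f1) \<omega>0)" using c(3) h(3,4,5) unfolding good_def by blast
			then show "exact3 (w - \<omega>0)" using h(1,9) by (simp add: scale_simps)
		qed
		ultimately have "exact3 ((embd d f - scale (integral UNIV f) w) + scale (integral UNIV f) (w - \<omega>0))"
			by (rule exact3_add)
		then show "exact3 (embd d f - scale (integral UNIV f) \<omega>0)" by (simp add: scale_simps algebra_simps)
	qed
	let ?S = "\<Union>c\<in>{c : cubes. good c}. fst c" and ?N = "\<Union>c\<in>{c : cubes. \<not> good c}. fst c"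
	have oc: "openin X (fst c)" if "c : cubes" for c using that chart by (auto simp: cubes_def is_chart_def)
	\<comment> \<open>Since goodness passes between overlapping cubes, no point lies in both a good and
	  a bad one; this makes the good region closed.\<close>
	have "topspace X - ?S = ?N"
	proof (intro set_eqI iffI)
		fix p assume p: "p : topspace X - ?S"
		then obtain c where c: "c : cubes" "p : fst c" using cubes_cover[of p] by auto
		have "\<not> good c" using p c by blast
		then show "p : ?N" using c by blast
	next
		fix p assume "p : ?N"
		then obtain c where c: "c : cubes" "\<not> good c" "p : fst c" by auto
		have "p ~: ?S"
		proof
			assume "p : ?S"
			then obtain d where "d : cubes" "good d" "p : fst d" by auto
			then show False using step[of d c p] c by simp
		qed
		moreover have "p : topspace X" using openin_subset[OF oc[OF c(1)]] c(3) by auto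
		ultimately show "p : topspace X - ?S" by simp
	qed
	moreover have "openin X ?N" "openin X ?S" using oc by (auto intro!: openin_Union)
	ultimately have co: "closedin X ?S" "openin X ?S" unfolding closedin_def using openin_subset by simp_all
	have "p0 : ?S" using c0 good0 by blast
	then have ne: "?S ~= {}" by (rule ex_in_conv[THEN iffD1, OF exI])
	have "?S = {} \<or> ?S = topspace X"
		using connected[unfolded connected_space_clopen_in, rule_format, of ?S] co by simp
	then have S: "?S = topspace X" using ne by (rule disjE[OF _ notE]) (assumption+)
	have all: "good c" if c: "c : cubes" for c
	proof -
		obtain R where "img c = ocube R" "0 < R" using c by (auto simp: cubes_def)
		then have "0 : img c" by (simp add: ocube_def)
		then have p: "chart_inv c 0 : fst c" using chart_inv_into[OF chart] c by (auto simp: cubes_def)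
		have "c : A" using c by (simp add: cubes_def)
		then have "chart_inv c 0 : ?S" unfolding S using chart_subset p by blast
		then obtain d where "d : cubes" "good d" "chart_inv c 0 : fst d" by blast
		then show ?thesis using step[of d c] c p by simp
	qed
	have cub: "cubes <= A" by (auto simp: cubes_def)
	interpret Q: compact_atlas X cubes
		by (intro compact_atlas.intro compact_atlas_axioms.intro atlas.intro subatlas[OF cub cubes_cover] hausdorff compact)
	obtain F u where uQ: "partition_of_unity X cubes F u" using Q.partition_of_unity_exists by blast
	then have u: "partition_of_unity X A F u" using partition_of_unity_subatlas[OF cub cubes_cover] by blast
	note U = partition_of_unityD[OF u]
	have FQ: "F <= cubes" using Q.partition_of_unityD(2)[OF uQ] .
	have ex: "exact3 (smul (u c) w - scale (I (smul (u c) w)) \<omega>0)" if c: "c : F" for c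
	proof -
		have cA: "c : A" using c U(2) by blast
		obtain R where R: "img c = ocube R" "0 < R" using c FQ by (auto simp: cubes_def)
		have m: "smul (u c) w : forms A 3" by (rule forms_smul[OF U(3)[OF c] w(1)])
		obtain r where r: "0 < r" "r < R" "test r (dens (smul (u c) w) c)" "smul (u c) w = embd c (dens (smul (u c) w) c)"
			using supported_embd[OF m cA R suppt_compact U(5)[OF c] smul_u_vanish] by blast
		have "ccube r <= img c" using ccube_subset_ocube[OF r(2)] R by simp
		then show ?thesis
			using all[of c] c FQ r embd_props(4)[OF cA _ r(3)] unfolding good_def by (metis subsetD)
	qed
	have "exact3 (\<Sum>c\<in>F. smul (u c) w - scale (I (smul (u c) w)) \<omega>0)" by (rule exact3_sum[OF ex])
	also have "(\<Sum>c\<in>F. smul (u c) w - scale (I (smul (u c) w)) \<omega>0) = w - scale (\<Sum>c\<in>F. I (smul (u c) w)) \<omega>0"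
		unfolding sum_subtractf partition_decompose[OF u w(1)] scale_simps(4) ..
	also have "(\<Sum>c\<in>F. I (smul (u c) w)) = I w"
		using I_sum[OF U(1), of "%c. smul (u c) w"] forms_smul[OF U(3) w(1)] partition_decompose[OF u w(1)] by simp
	finally show ?thesis using w(2) by (simp add: exact3_def scale_simps)
qed

end

section \<open>Straightening a closed nowhere vanishing 1-form\<close>

lemma curl_zero_symmetric:
	assumes "smooth_on S a" "y : S" "curl a y = 0"
	shows "fd a y u \<bullet> v = fd a y v \<bullet> u"
proof -
	have "fd a y (ax 2) $ 3 = fd a y (ax 3) $ 2" "fd a y (ax 3) $ 1 = fd a y (ax 1) $ 3" "fd a y (ax 1) $ 2 = fd a y (ax 2) $ 1"
		using assms(3) by (auto simp: curl_def vec_eq_iff forall_3 vector_3)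
	then show ?thesis
		unfolding fd_expand[OF assms(1,2), of u] fd_expand[OF assms(1,2), of v]
		by (simp add: inner_vec_def sum_3 algebra_simps)
qed

text \<open>The radial formula f x = x \<bullet> \<integral> a(t x) dt over 0 \<le> t \<le> 1.
  Closedness enters as the symmetry of the derivative of \<open>a\<close>, which turns the integrand
  of the derivative of f in direction v into the t-derivative of t (v \<bullet> a(t x)).\<close>

lemma closed_one_form_primitive:
	assumes a: "smooth_on (ocube R) a" and cl: "!!x. x : ocube R ==> curl a x = 0"
	obtains f where "smooth_on (ocube R) f" "!!x v. x : ocube R ==> fd f x v = a x \<bullet> v" "f 0 = 0"
proof -
	define G where "G = (%x. integral {0..1} (%t. 1 *R a (0 + t *R x)))"
	have inS: "0 + t *R x : ocube R" if "x : ocube R" "t : {0..1}" for x t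
	proof -
		have "\<bar>t * x $ i\<bar> <= 1 * \<bar>x $ i\<bar>" for i unfolding abs_mult using that by (intro mult_right_mono) auto
		then show ?thesis using that by (auto simp: ocube_def intro: le_less_trans)
	qed
	have smG: "smooth_on (ocube R) G" unfolding G_def
		by (rule smooth_on_parameter_integral[OF open_ocube open_ocube a linear_ident]) (auto intro!: continuous_intros inS[simplified])
	have dG: "fd G x v = integral {0..1} (%t. (1 * t) *R fd a (0 + t *R x) v)" if "x : ocube R" for x v
		unfolding G_def
		by (rule fun_cong[OF fd_eqI[OF has_derivative_parameter_integral[OF open_ocube open_ocube a linear_ident]]])
			 (auto intro!: continuous_intros inS[simplified] that)
	define f where "f = (%x. x \<bullet> G x)"
	have smf: "smooth_on (ocube R) f" unfolding f_def by (intro smooth_on_inner open_ocube smG smooth_on_ident)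
	have "fd f x v = a x \<bullet> v" if x: "x : ocube R" for x v
	proof -
		have ca: "continuous_on {0..1} (%t. a (0 + t *R x))"
			by (rule continuous_on_compose2[OF smooth_on_continuous[OF a]]) (use inS[OF x] in \<open>auto intro!: continuous_intros\<close>)
		have cfa: "continuous_on {0..1} (%t. fd a (0 + t *R x) v)" for v
			by (rule continuous_on_compose2[OF smooth_on_continuous[OF smooth_on_fd[OF a]]]) (use inS[OF x] in \<open>auto intro!: continuous_intros\<close>)
		have "fd f x v = x \<bullet> fd G x v + v \<bullet> G x"
			unfolding f_def by (rule fun_cong[OF fd_eqI[OF has_derivative_inner[OF has_derivative_ident smooth_on_has_derivative[OF smG x]]]])
		also have "v \<bullet> G x = integral {0..1} (%t. v \<bullet> a (0 + t *R x))"
			unfolding G_def using ca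
			by (subst integral_linear[OF integrable_continuous_real bounded_linear_inner_right, unfolded o_def, symmetric]) auto
		also have "x \<bullet> fd G x v = integral {0..1} (%t. x \<bullet> ((1 * t) *R fd a (0 + t *R x) v))"
			unfolding dG[OF x] using cfa
			by (subst integral_linear[OF integrable_continuous_real bounded_linear_inner_right, unfolded o_def, symmetric])
				 (auto intro!: continuous_intros)
		also have "integral {0..1} (%t. x \<bullet> ((1 * t) *R fd a (0 + t *R x) v)) + integral {0..1} (%t. v \<bullet> a (0 + t *R x))
				= integral {0..1} (%t. x \<bullet> ((1 * t) *R fd a (0 + t *R x) v) + v \<bullet> a (0 + t *R x))"
			by (rule integral_add[symmetric]) (intro integrable_continuous_real continuous_intros ca cfa)+
		also have "... = 1 *R (v \<bullet> a (0 + 1 *R x)) - 0 *R (v \<bullet> a (0 + 0 *R x))"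
		proof (rule integral_unique, rule fundamental_theorem_of_calculus)
			fix t :: real assume t: "t : {0..1}"
			have "((%t. 0 + t *R x) has_derivative (%s. s *R x)) (at t)"
				using has_derivative_add[OF has_derivative_const[of 0] has_derivative_scaleR_left[OF has_derivative_ident]] by simp
			from diff_chain_at[OF this smooth_on_has_derivative[OF a inS[OF x t]]]
			have "((%t. a (0 + t *R x)) has_derivative (%s. s *R fd a (0 + t *R x) x)) (at t)"
				using linear_scale[OF smooth_on_linear_fd[OF a inS[OF x t]]] by (simp add: o_def)
			from has_derivative_scaleR[OF has_derivative_ident has_derivative_inner_right[OF this, of v]]
			have "((%t. t *R (v \<bullet> a (0 + t *R x))) has_derivative
					(%s. t *R (v \<bullet> (s *R fd a (0 + t *R x) x)) + s *R (v \<bullet> a (0 + t *R x)))) (at t)" .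
			moreover have "t *R (v \<bullet> (s *R fd a (0 + t *R x) x)) + s *R (v \<bullet> a (0 + t *R x))
					= s *R (x \<bullet> ((1 * t) *R fd a (0 + t *R x) v) + v \<bullet> a (0 + t *R x))" for s
				using curl_zero_symmetric[OF a inS[OF x t] cl[OF inS[OF x t]], of x v]
				by (simp add: inner_commute algebra_simps)
			ultimately show "((%t. t *R (v \<bullet> a (0 + t *R x))) has_vector_derivative
					x \<bullet> ((1 * t) *R fd a (0 + t *R x) v) + v \<bullet> a (0 + t *R x)) (at t within {0..1})"
				unfolding has_vector_derivative_def by (auto intro: has_derivative_at_withinI)
		qed simp
		finally show ?thesis by (simp add: inner_commute)
	qed
	then show thesis using that smf by (simp add: f_def)
qed

lemma det_rows:
	"det (matrix (%v. vector [p \<bullet> v, q \<bullet> v, a \<bullet> v] :: real^3)) = a \<bullet> cross3 p q"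
	by (simp add: matrix_def det_3 vec3_simps) (simp add: algebra_simps)

text \<open>The derivative of \<open>g\<close> is a smooth function of \<open>g\<close> itself, so
  each degree of differentiability of \<open>g\<close> yields the next.\<close>

lemma smooth_inverse:
	fixes g :: "real ^ 3 => real ^ 3"
	assumes V: "open V" and U: "open U" and gV: "g ` V <= U" and cg: "continuous_on V g"
		and dg: "!!y. y : V ==> (g has_derivative (%v. G (g y) v)) (at y)"
		and G: "!!v. smooth_on U (%x. G x v)"
	shows "smooth_on V g"
	unfolding smooth_on_def
proof
	fix k show "Ck_on k V g"
	proof (induction k)
		case 0
		then show ?case using cg by simp
	next
		case (Suc k)
		have "Ck_on k V (%y. G (g y) v)" for v
			by (rule Ck_on_compose[OF V U gV _ Suc]) (use G smooth_on_def in blast)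
		then show ?case by (subst Ck_on_Suc_iff[OF V dg]) auto
	qed
qed

text \<open>The new coordinates are (p \<bullet> x, q \<bullet> x, f x), so that df becomes dz. With
  q = a(0) \<times> p their Jacobian determinant at the origin is |q|^2, hence positive, and the
  inverse function theorem applies.\<close>

lemma straighten:
	fixes a :: "real ^ 3 => real ^ 3"
	assumes S: "open S" "0 : S" and a: "smooth_on S a" and f: "smooth_on S f" "!!x v. x : S ==> fd f x v = a x \<bullet> v" "f 0 = 0"
		and a0: "a 0 ~= 0"
	shows "\<exists>V \<Phi> \<Psi> r. open V & V <= S & 0 : V & 0 < r & smooth_on V \<Phi> & \<Phi> ` V = ocube r & smooth_on (ocube r) \<Psi> &
		(\<forall>x\<in>V. \<Psi> (\<Phi> x) = x) & (\<forall>x\<in>V. 0 < det (matrix (fd \<Phi> x))) & \<Phi> 0 = 0 & (\<forall>x\<in>V. \<forall>v. fd \<Phi> x v $ 3 = a x \<bullet> v) &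
		(\<forall>x\<in>V. surj (fd \<Phi> x))"
proof -
	\<comment> \<open>The nonzero vector a(0) cannot be parallel to both of the first two axes.\<close>
	obtain p where p: "cross3 (a 0) p ~= 0"
	proof -
		obtain i where "a 0 $ i ~= 0" using a0 by (auto simp: vec_eq_iff)
		then have "cross3 (a 0) (ax 1) ~= 0 \<or> cross3 (a 0) (ax 2) ~= 0"
			using exhaust_3[of i] by (auto simp: vec_eq_iff forall_3 cross_components axis_nth)
		then show ?thesis using that by blast
	qed
	define q where "q = cross3 (a 0) p"
	define D where "D = (%x. a x \<bullet> cross3 p q)"
	have D0: "D 0 > 0"
	proof -
		have "D 0 = q \<bullet> q"
			unfolding D_def q_def by (simp add: inner_vec_def sum_3 cross_components) (simp add: algebra_simps)
		then show ?thesis using p by (simp add: q_def)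
	qed
	define L where "L = (%x v. vector [p \<bullet> v, q \<bullet> v, a x \<bullet> v] :: real^3)"
	\<comment> \<open>The inverse of the Jacobian \<open>L x\<close> by Cramer's rule; the explicit
	  formula shows that it depends smoothly on x.\<close>
	define G where "G = (%x (v::real^3). inverse (D x) *R ((v $ 1) *R cross3 q (a x) + (v $ 2) *R cross3 (a x) p + (v $ 3) *R cross3 p q))"
	have linL: "linear (L x)" for x
		unfolding L_def by (rule linearI) (simp_all add: vec_eq_iff forall_3 vector_3 inner_add_right)
	have linG: "linear (G x)" for x
		unfolding G_def by (rule linearI) (simp_all add: algebra_simps scaleR_add_left)
	have LG: "L x (G x v) = v" if "D x ~= 0" for x v
	proof -
		have d: "a x \<bullet> cross3 p q = D x" "p \<bullet> cross3 q (a x) = D x" "q \<bullet> cross3 (a x) p = D x"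
			unfolding D_def by (simp_all add: inner_vec_def sum_3 cross_components algebra_simps)
		show ?thesis
			using that unfolding L_def G_def
			by (simp add: vec_eq_iff forall_3 vector_3 inner_add_right d dot_cross_self)
	qed
	have GL: "G x (L x v) = v" if "D x ~= 0" for x v
		using linear_inverse_left[OF linL[of x] linG[of x]] LG[OF that] by (auto simp: fun_eq_iff)
	define U where "U = {x : S. D x > 0}"
	have smD: "smooth_on S D" unfolding D_def by (intro smooth_on_inner_const S a)
	have oU: "open U"
	proof -
		have "U = S \<inter> D -` {0<..}" by (auto simp: U_def)
		then show ?thesis using continuous_open_preimage[OF smooth_on_continuous[OF smD] S(1), of "{0<..}"] by simp
	qed
	define \<Phi> where "\<Phi> = (%x. vector [p \<bullet> x, q \<bullet> x, f x] :: real^3)"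
	have sm\<Phi>: "smooth_on S \<Phi>"
		unfolding \<Phi>_def
		by (intro smooth_on_vector3 S f smooth_on_inner smooth_on_const smooth_on_ident)
	have d\<Phi>: "fd \<Phi> x = L x" if "x : S" for x
	proof
		fix v
		have "fd \<Phi> x v $ i = L x v $ i" for i
		proof -
			have "fd \<Phi> x v $ i = fd (%y. \<Phi> y $ i) x v" using fd_vec_nth[OF sm\<Phi> that] by simp
			also have "... = L x v $ i"
				using exhaust_3[of i] f(2)[OF that, of v]
					fd_linear[OF bounded_linear.linear[OF bounded_linear_inner_right[of p]], of x]
					fd_linear[OF bounded_linear.linear[OF bounded_linear_inner_right[of q]], of x]
				by (auto simp: \<Phi>_def L_def vector_3)
			finally show ?thesis .
		qed
		then show "fd \<Phi> x v = L x v" by (simp add: vec_eq_iff)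
	qed
	have bl: "bounded_linear (L x)" "bounded_linear (G x)" for x
		using linL linG linear_conv_bounded_linear by blast+
	have der\<Phi>: "(\<Phi> has_derivative blinfun_apply (Blinfun (L x))) (at x)" if "x : U" for x
		using smooth_on_has_derivative[OF sm\<Phi>, of x] d\<Phi>[of x] that bounded_linear_Blinfun_apply[OF bl(1)] by (simp add: U_def)
	have cont: "continuous_on U (%x. Blinfun (L x))"
	proof (rule continuous_on_blinfun_componentwise)
		fix i :: "real^3"
		have "continuous_on U (%x. fd \<Phi> x i)"
			by (rule continuous_on_subset[OF smooth_on_continuous[OF smooth_on_fd[OF sm\<Phi>]]]) (auto simp: U_def)
		then show "continuous_on U (%x. blinfun_apply (Blinfun (L x)) i)"
			by (rule continuous_on_eq) (auto simp: U_def d\<Phi> bounded_linear_Blinfun_apply[OF bl(1)])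
	qed
	have inv0: "Blinfun (G 0) o\<^sub>L Blinfun (L 0) = id_blinfun"
		by (rule blinfun_eqI) (use D0 GL[of 0] in \<open>simp add: bounded_linear_Blinfun_apply[OF bl(1)] bounded_linear_Blinfun_apply[OF bl(2)]\<close>)
	have "0 : U" using S D0 by (simp add: U_def)
	from inverse_function_theorem[OF oU der\<Phi> cont this inv0]
	obtain U' V g g' where g: "open U'" "U' <= U" "0 : U'" "open V" "\<Phi> 0 : V" "homeomorphism U' V \<Phi> g"
		and g': "!!y. y : V ==> (g has_derivative (g' y)) (at y)"
			"!!y. y : V ==> g' y = inv (blinfun_apply (Blinfun (L (g y))))" by metis
	have gU: "g y : U'" "\<Phi> (g y) = y" if "y : V" for y using g(6) that unfolding homeomorphism_def by auto
	have g\<Phi>: "g (\<Phi> x) = x" "\<Phi> x : V" if "x : U'" for x using g(6) that unfolding homeomorphism_def by auto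
	have dg: "(g has_derivative (%v. G (g y) v)) (at y)" if y: "y : V" for y
	proof -
		have "D (g y) ~= 0" using gU(1)[OF y] g(2) by (auto simp: U_def)
		then have "inv (L (g y)) = G (g y)"
			using LG GL by (intro inv_unique_comp) (auto simp: fun_eq_iff)
		then show ?thesis using g'[OF y] bounded_linear_Blinfun_apply[OF bl(1)] by simp
	qed
	have smG: "smooth_on U (%x. G x v)" for v
	proof -
		have aU: "smooth_on U a" "smooth_on U D" using smooth_on_subset[OF a] smooth_on_subset[OF smD] by (auto simp: U_def)
		have "smooth_on U (%x. inverse (D x) *R ((v $ 1) *R cross3 q (a x) + (v $ 2) *R cross3 (a x) p + (v $ 3) *R cross3 p q))"
			by (intro smooth_on_scaleR smooth_on_add smooth_on_cross smooth_on_inverse oU aU smooth_on_const) (auto simp: U_def)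
		then show ?thesis by (simp add: G_def)
	qed
	have smg: "smooth_on V g"
		by (rule smooth_inverse[OF g(4) oU _ _ dg smG])
			 (use gU g(2) g(6) in \<open>auto simp: homeomorphism_def\<close>)
	have \<Phi>0: "\<Phi> 0 = 0" by (simp add: \<Phi>_def f(3) vec_eq_iff forall_3 vector_3)
	then obtain e where e: "e > 0" "ball 0 e <= V" using g(4,5) open_contains_ball by metis
	define r where "r = e / 3"
	have rV: "ocube r <= V" "r > 0" using ocube_subset_ball[of e] e by (auto simp: r_def)
	\<comment> \<open>The neighbourhood from the inverse function theorem is cut down so that its image
	  is exactly a cube.\<close>
	define V' where "V' = U' \<inter> \<Phi> -` ocube r"
	have V'U: "V' <= S" "V' <= U" using g(2) by (auto simp: V'_def U_def)
	have "open V'"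
		unfolding V'_def
		by (rule continuous_open_preimage[OF continuous_on_subset[OF smooth_on_continuous[OF sm\<Phi>]] g(1) open_ocube])
			 (use g(2) in \<open>auto simp: U_def\<close>)
	moreover have "0 : V'" using g(3) \<Phi>0 rV(2) by (simp add: V'_def ocube_def)
	moreover have "\<Phi> ` V' = ocube r"
	proof
		show "ocube r <= \<Phi> ` V'"
		proof
			fix y assume y: "y : ocube r"
			then have "y : V" using rV by blast
			then have "g y : V'" "y = \<Phi> (g y)" using gU[of y] y by (auto simp: V'_def)
			then show "y : \<Phi> ` V'" by blast
		qed
	qed (auto simp: V'_def)
	moreover have "surj (fd \<Phi> x)" if "x : V'" for x
		unfolding d\<Phi>[OF subsetD[OF V'U(1) that]] using LG[of x] V'U(2) that by (intro surjI[of _ "G x"]) (auto simp: U_def)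
	moreover have "0 < det (matrix (fd \<Phi> x))" if "x : V'" for x
		unfolding d\<Phi>[OF subsetD[OF V'U(1) that]] L_def det_rows using V'U(2) that by (auto simp: U_def D_def)
	moreover have "fd \<Phi> x v $ 3 = a x \<bullet> v" if "x : V'" for x v
		unfolding d\<Phi>[OF subsetD[OF V'U(1) that]] by (simp add: L_def vector_3)
	moreover have "g (\<Phi> x) = x" if "x : V'" for x using g\<Phi> that by (simp add: V'_def)
	ultimately show ?thesis
		using V'U(1) rV smooth_on_subset[OF sm\<Phi> V'U(1)] smooth_on_subset[OF smg rV(1)] \<Phi>0
		by (intro exI[of _ V'] exI[of _ \<Phi>] exI[of _ g] exI[of _ r]) simp
qed

locale foliation = max_atlas +
	fixes \<alpha> :: "'a dform"
	assumes \<alpha>: "\<alpha> : forms A 1" and closed_\<alpha>: "form_d A \<alpha> = 0" and nonvanishing_\<alpha>: "nowhere_vanishing A \<alpha>"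
begin

text \<open>Foliation charts: \<alpha> is dz, the horizontal slices are plaques of the foliation by
  ker \<alpha>, and the third coordinate plays the role of a height.\<close>

definition boxes :: "'a chart set" where
	"boxes = {c : A. (\<exists>R>0. img c = ocube R) & (\<forall>x\<in>img c. vec1 \<alpha> c x = ax 3)}"

text \<open>In a small cube \<alpha> is df for some f, and \<open>straighten\<close> makes f the
  third coordinate.\<close>

lemma box_at:
	assumes V: "openin X V" "p : V"
	shows "\<exists>c\<in>boxes. p : fst c & fst c <= V & snd c p = 0"
proof -
	have "p : topspace X" using V openin_subset by blast
	then obtain b where b: "b : A" "p : fst b" using covers by blast
	obtain c R where c: "c : A" "0 < R" "p : fst c" "fst c <= V" "img c = ocube R" "snd c p = 0"
		using cube_chart_at[OF b V] by blast
	define a where "a = vec1 \<alpha> c"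
	have sa: "smooth_on (ocube R) a" unfolding a_def using smooth_vec1[OF \<alpha> c(1)] c(5) by simp
	have cl: "curl a x = 0" if "x : ocube R" for x
	proof -
		have "form2 (curl a x) = form_d A \<alpha> c x" using form_d_1[OF \<alpha> c(1)] that c(5) by (simp add: a_def)
		also have "... = form2 0" using closed_\<alpha> by simp
		finally show ?thesis by (simp only: form_inject)
	qed
	obtain f where f: "smooth_on (ocube R) f" "!!x v. x : ocube R ==> fd f x v = a x \<bullet> v" "f 0 = 0"
		using closed_one_form_primitive[OF sa cl] by blast
	have z: "0 : ocube R" using c(2) by (simp add: ocube_def)
	have a0: "a 0 ~= 0"
	proof
		assume "a 0 = 0"
		then have "\<alpha> c 0 = 0" using form1_repr[OF \<alpha>, of c 0] by (simp add: a_def)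
		then show False using nonvanishing_\<alpha> c(1,5) z by (auto simp: nowhere_vanishing_def)
	qed
	have "\<exists>V' \<Phi> \<Psi> r. open V' & V' <= ocube R & 0 : V' & 0 < r & smooth_on V' \<Phi> & \<Phi> ` V' = ocube r &
		smooth_on (ocube r) \<Psi> & (\<forall>x\<in>V'. \<Psi> (\<Phi> x) = x) & (\<forall>x\<in>V'. 0 < det (matrix (fd \<Phi> x))) & \<Phi> 0 = 0 &
		(\<forall>x\<in>V'. \<forall>v. fd \<Phi> x v $ 3 = a x \<bullet> v) & (\<forall>x\<in>V'. surj (fd \<Phi> x))"
		by (rule straighten[OF open_ocube z sa f a0])
	then obtain V' \<Phi> \<Psi> r where s0: "open V' & V' <= ocube R & 0 : V' & 0 < r & smooth_on V' \<Phi> & \<Phi> ` V' = ocube r &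
		smooth_on (ocube r) \<Psi> & (\<forall>x\<in>V'. \<Psi> (\<Phi> x) = x) & (\<forall>x\<in>V'. 0 < det (matrix (fd \<Phi> x))) & \<Phi> 0 = 0 &
		(\<forall>x\<in>V'. \<forall>v. fd \<Phi> x v $ 3 = a x \<bullet> v) & (\<forall>x\<in>V'. surj (fd \<Phi> x))" by (elim exE) (rule that)
	then have s: "open V'" "V' <= ocube R" "0 : V'" "0 < r" "smooth_on V' \<Phi>" "\<Phi> ` V' = ocube r" "smooth_on (ocube r) \<Psi>"
		"!!x. x : V' ==> \<Psi> (\<Phi> x) = x" "!!x. x : V' ==> 0 < det (matrix (fd \<Phi> x))" "\<Phi> 0 = 0"
		"!!x v. x : V' ==> fd \<Phi> x v $ 3 = a x \<bullet> v" "!!x. x : V' ==> surj (fd \<Phi> x)"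
		by simp_all
	have s2: "V' <= img c" using s(2) c(5) by simp
	define d where "d = ({q : fst c. snd c q : V'}, \<Phi> \<circ> snd c)"
	note cc = compose_chart[OF maximal c(1) s(1) s2 open_ocube s(5,6,7,8,9), folded d_def]
	have dA: "d : A" and imd: "img d = ocube r" using cc(1,2) by simp_all
	have "vec1 \<alpha> d y = ax 3" if y: "y : img d" for y
	proof -
		obtain x where x: "x : V'" "y = \<Phi> x" using y imd s(6) by blast
		have o: "x : overlap c d" "trn c d x = y" using cc(3)[OF _ _ x(1)] cc(4)[OF _ _ x(1)] x(2) by simp_all
		have fdt: "fd (trn c d) x = fd \<Phi> x"
			by (rule fd_cong[OF s(1) x(1)]) (use cc(4) in blast)
		have "vec1 \<alpha> d y \<bullet> fd \<Phi> x v = fd \<Phi> x v $ 3" for v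
		proof -
			have "a x \<bullet> v = \<alpha> c x [v]" unfolding a_def using form1_repr[OF \<alpha>, of c x] by simp
			also have "... = \<alpha> d y [fd \<Phi> x v]" using form_transition[OF \<alpha> c(1) dA o(1), of "[v]"] o(2) fdt by simp
			also have "... = vec1 \<alpha> d y \<bullet> fd \<Phi> x v" using form1_repr[OF \<alpha>, of d y] by simp
			finally show ?thesis using s(11)[OF x(1)] by simp
		qed
		then have "vec1 \<alpha> d y \<bullet> u = ax 3 \<bullet> u" for u
			using s(12)[OF x(1)] by (metis surjD inner_axis' inner_real_def mult_1)
		then show ?thesis by (metis vector_eq_rdot)
	qed
	then have "d : boxes" using dA imd s(4) by (auto simp: boxes_def)
	moreover have "p : fst d" "snd d p = 0" "fst d <= V" using c s(3,10) by (auto simp: d_def)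
	ultimately show ?thesis by blast
qed

section \<open>Covers by boxes in which meeting charts have a common box\<close>

lemma openin_finite_Inter: "finite P ==> (!!b. b : P ==> openin X (h b)) ==> openin X (topspace X \<inter> (\<Inter>b\<in>P. h b))"
proof (induction P rule: finite_induct)
	case (insert b P)
	have "openin X (h b \<inter> (topspace X \<inter> (\<Inter>b\<in>P. h b)))"
		by (rule openin_Int) (use insert in auto)
	moreover have "h b \<inter> (topspace X \<inter> (\<Inter>b\<in>P. h b)) = topspace X \<inter> (\<Inter>b\<in>insert b P. h b)" by auto
	ultimately show ?case by simp
qed simp

text \<open>Plaque integrals of densities from two meeting charts are compared inside a box
  containing both, so the cover must be fine enough to provide one. It is a star refinement of a
  finite cover by half-size open cubes \<open>W b\<close> inside the closed cubes
  \<open>K b\<close>.\<close>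

lemma star_refinement:
	"\<exists>Q\<subseteq>boxes. (\<forall>p\<in>topspace X. \<exists>c\<in>Q. p : fst c) &
		(\<forall>c\<in>Q. \<forall>d\<in>Q. fst c \<inter> fst d ~= {} --> (\<exists>b\<in>boxes. fst c <= fst b & fst d <= fst b))"
proof -
	have "\<forall>p\<in>topspace X. \<exists>c\<in>boxes. p : fst c & snd c p = 0" using box_at[OF openin_topspace] by blast
	then obtain B where B: "!!p. p : topspace X ==> B p : boxes & p : fst (B p) & snd (B p) p = 0" by metis
	then have "\<forall>p\<in>topspace X. \<exists>R>0. img (B p) = ocube R" unfolding boxes_def by blast
	then obtain R where R: "!!p. p : topspace X ==> 0 < R p & img (B p) = ocube (R p)" by metis
	define W where "W = (%p. {q : fst (B p). snd (B p) q : ocube (R p / 2)})"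
	define K where "K = (%p. chart_inv (B p) ` ccube (R p / 2))"
	have BA: "B p : A" if "p : topspace X" for p using B[OF that] by (simp add: boxes_def)
	have sub: "ccube (R p / 2) <= img (B p)" if "p : topspace X" for p
		using R[OF that] ccube_subset_ocube[of "R p / 2" "R p"] by simp
	have K: "closedin X (K p)" "K p = {q : fst (B p). snd (B p) q : ccube (R p / 2)}" if "p : topspace X" for p
		unfolding K_def
		using compact_closed[OF chart_compact_preimage[OF chart[OF BA[OF that]] compact_ccube sub[OF that]]]
			chart_inv_image_eq[OF chart[OF BA[OF that]] sub[OF that]] by simp_all
	have "openin X (W p) & p : W p" if "p : topspace X" for p
	proof
		show "openin X (W p)" unfolding W_def by (rule chart_open_preimage[OF chart[OF BA[OF that]] open_ocube])
		show "p : W p" using B[OF that] R[OF that] by (simp add: W_def ocube_def)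
	qed
	then obtain P where P: "finite P" "P <= topspace X" "topspace X <= (\<Union>p\<in>P. W p)" using finite_subcover by meson
	\<comment> \<open>If \<open>N p\<close> meets \<open>W b\<close>, then \<open>p\<close> lies in
	  \<open>K b\<close>, since otherwise \<open>N p\<close> avoids \<open>K b\<close>; hence
	  \<open>N p\<close> is contained in the domain of \<open>B b\<close>. The index \<open>b\<close>
	  depends only on the common point, so it serves both charts.\<close>
	define N where "N = (%p. topspace X \<inter> (\<Inter>b\<in>P. if p : K b then fst (B b) else topspace X - K b))"
	have N: "openin X (N p)" "p : N p" if "p : topspace X" for p
	proof -
		show "openin X (N p)"
			unfolding N_def
		proof (rule openin_finite_Inter[OF P(1)])
			fix b assume "b : P"
			then have b: "b : topspace X" using P by blast
			have "openin X (fst (B b))" using chart[OF BA[OF b]] by (simp add: is_chart_def)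
			then show "openin X (if p : K b then fst (B b) else topspace X - K b)" using K(1)[OF b] by auto
		qed
		have "p : fst (B b)" if "b : P" "p : K b" for b using K(2)[of b] that P(2) by blast
		then show "p : N p" using that by (auto simp: N_def)
	qed
	define Q where "Q = {c : boxes. \<exists>p\<in>topspace X. fst c <= N p}"
	have "\<exists>c\<in>Q. p : fst c" if "p : topspace X" for p
		using box_at[OF N[OF that]] that unfolding Q_def by blast
	moreover have "\<exists>b\<in>boxes. fst c <= fst b & fst d <= fst b" if c: "c : Q" "d : Q" and ne: "fst c \<inter> fst d ~= {}" for c d
	proof -
		obtain p p' where p: "p : topspace X" "fst c <= N p" and p': "p' : topspace X" "fst d <= N p'"
			using c unfolding Q_def by blast
		obtain q where q: "q : fst c" "q : fst d" using ne by blast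
		then have "q : topspace X" using p(2) N_def by blast
		then obtain b where b: "b : P" "q : W b" using P(3) by blast
		have bt: "b : topspace X" using b P(2) by blast
		have qK: "q : K b" using b(2) ocube_subset_ccube unfolding K(2)[OF bt] W_def by blast
		have "N r <= fst (B b)" if "q : N r" for r
		proof -
			have "q : (if r : K b then fst (B b) else topspace X - K b)" using that b(1) unfolding N_def by blast
			then have "r : K b" using qK by (auto split: if_splits)
			then show ?thesis using b(1) unfolding N_def by auto
		qed
		then have "fst c <= fst (B b)" "fst d <= fst (B b)" using p(2) p'(2) q by blast+
		then show ?thesis using B[OF bt] by blast
	qed
	ultimately show ?thesis by (intro exI[of _ Q]) (auto simp: Q_def)
qed

text \<open>Provides the data on which vertical translation depends. The margin
  \<open>10 * \<delta>\<close> lets a few successive shifts by at most \<delta> be carried out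
  inside one chart.\<close>

lemma adapted_partition:
	"\<exists>F u R \<rho> \<delta>. partition_of_unity X A F u & F <= boxes & (0::real) < \<delta> &
		(\<forall>c\<in>F. 0 < \<rho> c & \<rho> c + 10 * \<delta> < R c & img c = ocube (R c) & snd c ` suppt (u c) <= ccube (\<rho> c)) &
		(\<forall>c\<in>F. \<forall>d\<in>F. fst c \<inter> fst d ~= {} --> (\<exists>b\<in>boxes. fst c <= fst b & fst d <= fst b))"
proof -
	obtain Q where Q: "Q <= boxes" "!!p. p : topspace X ==> \<exists>c\<in>Q. p : fst c"
		"!!c d. c : Q ==> d : Q ==> fst c \<inter> fst d ~= {} ==> \<exists>b\<in>boxes. fst c <= fst b & fst d <= fst b"
		using star_refinement by blast
	have QA: "Q <= A" using Q(1) by (auto simp: boxes_def)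
	interpret Q: compact_atlas X Q
		by (intro compact_atlas.intro compact_atlas_axioms.intro atlas.intro subatlas[OF QA] hausdorff compact Q(2))
	obtain F u where uQ: "partition_of_unity X Q F u" using Q.partition_of_unity_exists by blast
	have u: "partition_of_unity X A F u" by (rule partition_of_unity_subatlas[OF QA _ uQ]) (rule Q(2))
	note U = partition_of_unityD[OF u]
	have FQ: "F <= Q" by (rule Q.partition_of_unityD(2)[OF uQ])
	have "\<forall>c\<in>F. \<exists>R \<rho>. 0 < \<rho> & \<rho> < R & img c = ocube R & snd c ` suppt (u c) <= ccube \<rho>"
	proof
		fix c assume c: "c : F"
		have "c : boxes" using c FQ Q(1) by blast
		then obtain R where cA: "c : A" and R: "0 < R" "img c = ocube R" by (auto simp: boxes_def)
		have "compact (snd c ` suppt (u c))" by (rule chart_compact_image[OF chart[OF cA] suppt_compact U(5)[OF c]])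
		moreover have "snd c ` suppt (u c) <= ocube R" unfolding R(2)[symmetric] chart_image_def by (rule image_mono[OF U(5)[OF c]])
		ultimately show "\<exists>R \<rho>. 0 < \<rho> & \<rho> < R & img c = ocube R & snd c ` suppt (u c) <= ccube \<rho>"
			using compact_subset_ccube R by metis
	qed
	then obtain R \<rho> where R: "!!c. c : F ==> 0 < \<rho> c & \<rho> c < R c & img c = ocube (R c) & snd c ` suppt (u c) <= ccube (\<rho> c)"
		by metis
	\<comment> \<open>The denominator 20 leaves the margin \<open>10 * \<delta>\<close> with room to
	  spare; the 1 keeps \<open>Min\<close> meaningful if \<open>F\<close> is empty.\<close>
	define \<delta> where "\<delta> = Min (insert 1 ((%c. (R c - \<rho> c) / 20) ` F))"
	have \<delta>0: "0 < \<delta>" unfolding \<delta>_def using U(1) R by (subst Min_gr_iff) auto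
	have "\<rho> c + 10 * \<delta> < R c" if c: "c : F" for c
	proof -
		have "\<delta> <= (R c - \<rho> c) / 20" unfolding \<delta>_def using U(1) c by (intro Min_le) auto
		then show ?thesis using R[OF c] by (simp add: field_simps)
	qed
	then have "\<forall>c\<in>F. 0 < \<rho> c & \<rho> c + 10 * \<delta> < R c & img c = ocube (R c) & snd c ` suppt (u c) <= ccube (\<rho> c)"
		using R by blast
	moreover have "\<forall>c\<in>F. \<forall>d\<in>F. fst c \<inter> fst d ~= {} --> (\<exists>b\<in>boxes. fst c <= fst b & fst d <= fst b)"
		using Q(3) FQ by (meson subsetD)
	moreover have "F <= boxes" using FQ Q(1) by (rule subset_trans)
	ultimately show ?thesis using u \<delta>0
		by (intro exI[of _ F] exI[of _ u] exI[of _ R] exI[of _ \<rho>] exI[of _ \<delta>] conjI) assumption+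
qed

end

section \<open>3-forms modulo the relation of having equal integrals along the leaves\<close>

lemma form_wedge_right:
	"form_wedge k l w (v + v') = form_wedge k l w v + form_wedge k l w v'"
	"form_wedge k l w (v - v') = form_wedge k l w v - form_wedge k l w v'"
	"form_wedge k l w (%c x vs. r * v c x vs) = (%c x vs. r * form_wedge k l w v c x vs)"
	"form_wedge k l w 0 = 0"
proof -
	show "form_wedge k l w (v + v') = form_wedge k l w v + form_wedge k l w v'"
		by (auto simp: form_wedge_def wedge_def fun_eq_iff distrib_left sum.distrib add_divide_distrib)
	show "form_wedge k l w (v - v') = form_wedge k l w v - form_wedge k l w v'"
		by (auto simp: form_wedge_def wedge_def fun_eq_iff right_diff_distrib sum_subtractf diff_divide_distrib)
	show "form_wedge k l w (%c x vs. r * v c x vs) = (%c x vs. r * form_wedge k l w v c x vs)"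
		by (auto simp: form_wedge_def wedge_def fun_eq_iff sum_distrib_left mult_ac)
	show "form_wedge k l w 0 = 0"
		by (auto simp: form_wedge_def wedge_def fun_eq_iff)
qed

lemma plaque_divergence:
	assumes f: "test r f" and g: "test r g" and h: "smooth_on UNIV h"
	shows "integral UNIV (%x. (fd f x (ax 1) + fd g x (ax 2)) * h (x $ 3)) = 0"
proof -
	have sh: "smooth_on UNIV (%x::real^3. h (x $ 3))" by (rule smooth_on_coord_compose[OF h])
	have p: "fd (%y. f y * h (y $ 3)) x (ax j) = fd f x (ax j) * h (x $ 3)" if "j ~= 3" "test r f" for f j x
		using fd_mult[OF test_differentiable[OF that(2)] smooth_on_differentiable[OF sh UNIV_I], of x "ax j"]
			fd_mult_coord_other[OF h that(1), of x] by simp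
	have "integral UNIV (%x. (fd f x (ax 1) + fd g x (ax 2)) * h (x $ 3)) =
		integral UNIV (%x. fd (%y. f y * h (y $ 3)) x (ax 1) + fd (%y. g y * h (y $ 3)) x (ax 2))"
		by (simp only: p[OF _ f, of 1, simplified] p[OF _ g, of 2, simplified] distrib_right)
	also have "... = 0"
		unfolding integral_add[OF cc_integrable[OF test_cc[OF test_fd[OF test_mult[OF f sh]]]] cc_integrable[OF test_cc[OF test_fd[OF test_mult[OF g sh]]]]]
		by (simp add: integral_fd_eq_0[OF test_mult[OF f sh]] integral_fd_eq_0[OF test_mult[OF g sh]])
	finally show ?thesis .
qed

lemma (in atlas) form_wedge_vanish:
	assumes "vanish_out v K" shows "vanish_out (form_wedge k l w v) K"
	using assms by (auto simp: vanish_out_def form_wedge_def wedge_def fun_eq_iff)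

context foliation
begin

text \<open>The change of \<alpha> \<and> \<beta> when \<open>form_d A \<gamma>\<close> is added to
  \<beta>. The forms equivalent to \<alpha> \<and> \<beta> are thus those obtained by varying
  \<beta> within its cohomology class.\<close>

definition null :: "'a dform => bool" where
	"null \<mu> \<longleftrightarrow> (\<exists>\<gamma>\<in>forms A 1. \<mu> = form_wedge 1 2 \<alpha> (form_d A \<gamma>))"

definition eqv (infix "\<doteq>" 50) where "\<mu> \<doteq> \<nu> \<longleftrightarrow> null (\<mu> - \<nu>)"

lemma null_0: "null 0"
	unfolding null_def using form_wedge_right(4)[of 1 2 \<alpha>] form_d_zero forms_0[of 1] by (metis (no_types))

lemma null_add: "null \<mu> ==> null \<nu> ==> null (\<mu> + \<nu>)"
	unfolding null_def using form_d_add form_wedge_right(1) forms_add by metis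

lemma null_diff: "null \<mu> ==> null \<nu> ==> null (\<mu> - \<nu>)"
	unfolding null_def using form_d_diff form_wedge_right(2) forms_diff by metis

lemma null_scale: "null \<mu> ==> null (scale k \<mu>)"
	unfolding null_def using form_d_scale forms_scale form_wedge_right(3)[of 1 2 \<alpha> k] unfolding scale_def by metis

lemma null_sum: "(!!i. i : J ==> null (w i)) ==> null (\<Sum>i\<in>J. w i)"
	by (induction J rule: infinite_finite_induct) (auto intro: null_add null_0)

lemma eqv_refl: "\<mu> \<doteq> \<mu>" by (simp add: eqv_def null_0)

lemma eqv_sym: "\<mu> \<doteq> \<nu> ==> \<nu> \<doteq> \<mu>"
	unfolding eqv_def using null_diff[OF null_0, of "\<mu> - \<nu>"] by simp

lemma eqv_trans [trans]: "\<mu> \<doteq> \<nu> ==> \<nu> \<doteq> \<tau> ==> \<mu> \<doteq> \<tau>"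
	unfolding eqv_def using null_add[of "\<mu> - \<nu>" "\<nu> - \<tau>"] by simp

lemma eqv_add: "\<mu> \<doteq> \<nu> ==> \<mu>' \<doteq> \<nu>' ==> \<mu> + \<mu>' \<doteq> \<nu> + \<nu>'"
	unfolding eqv_def using null_add[of "\<mu> - \<nu>" "\<mu>' - \<nu>'"] by (simp add: algebra_simps)

lemma eqv_diff: "\<mu> \<doteq> \<nu> ==> \<mu>' \<doteq> \<nu>' ==> \<mu> - \<mu>' \<doteq> \<nu> - \<nu>'"
	unfolding eqv_def using null_diff[of "\<mu> - \<nu>" "\<mu>' - \<nu>'"] by (simp add: algebra_simps)

lemma eqv_sum: "(!!i. i : J ==> w i \<doteq> v i) ==> (\<Sum>i\<in>J. w i) \<doteq> (\<Sum>i\<in>J. v i)"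
	by (induction J rule: infinite_finite_induct) (auto intro: eqv_add eqv_refl)

lemma eqv_scale: "\<mu> \<doteq> \<nu> ==> scale k \<mu> \<doteq> scale k \<nu>"
	unfolding eqv_def scale_simps(1)[symmetric] by (rule null_scale)

lemma boxes_A: "c : boxes ==> c : A" by (simp add: boxes_def)

lemma box_wedge:
	assumes c: "c : boxes" "x : img c" and \<beta>: "\<beta> : forms A 2"
	shows "dens (form_wedge 1 2 \<alpha> \<beta>) c x = vec2 \<beta> c x $ 3"
proof -
	have "vec1 \<alpha> c x = ax 3" using c by (auto simp: boxes_def)
	then show ?thesis unfolding dens_def form_wedge_12[OF \<alpha> \<beta>] by (simp add: inner_axis')
qed

lemma vec2_form2: "w c x = form2 b ==> vec2 w c x = b"
	by (simp add: vec2_def vec_eq_iff forall_3 vec3_simps)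

text \<open>\<open>plaque_exact\<close> writes f as \<partial>_1 A + \<partial>_2 B. Then \<gamma> =
  -B dx + A dy satisfies \<alpha> \<and> d\<gamma> = f dx dy dz, because only the vertical component
  of the curl survives the wedge with dz.\<close>

lemma null_plaque:
	assumes c: "c : boxes" "ccube r <= img c" and r: "0 < r" and f: "test r f"
		and zero: "!!h. smooth_on UNIV h ==> integral UNIV (%x. f x * h (x $ 3)) = 0"
	shows "null (embd c f)"
proof -
	have cA: "c : A" by (rule boxes_A[OF c(1)])
	obtain A' B' where A: "test r A'" and B: "test r B'" and fAB: "!!x. f x = fd A' x (ax 1) + fd B' x (ax 2)"
		using plaque_exact[OF r f zero] by blast
	define a where "a = (%x. vector [- B' x, A' x, 0] :: real ^ 3)"
	have sa: "smooth_on UNIV a" unfolding a_def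
		by (intro smooth_on_vector3 smooth_on_minus test_smooth[OF A] test_smooth[OF B] open_UNIV smooth_on_const)
	have sac: "smooth_on (img c) a" by (rule smooth_on_subset[OF sa]) simp
	have za: "a x = 0" if "x : img c" "x ~: ccube r" for x
		using that A B by (simp add: a_def test_def vec_eq_iff forall_3 vector_3)
	define \<gamma> where "\<gamma> = emb c (%x. form1 (a x))"
	have \<gamma>: "\<gamma> : forms A 1" unfolding \<gamma>_def by (rule emb_form1[OF cA compact_ccube c(2) za sac])
	have v\<gamma>: "vanish_out \<gamma> (chart_inv c ` ccube r)"
		unfolding \<gamma>_def by (rule emb_vanish[OF cA]) (simp add: za)
	have K: "compactin X (chart_inv c ` ccube r)" by (rule chart_compact_preimage[OF chart[OF cA] compact_ccube c(2)])
	have Ks: "chart_inv c ` ccube r <= fst c" using chart_inv_into[OF chart[OF cA]] c(2) by auto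
	have d\<gamma>': "form_d A \<gamma> = emb c (%x. form2 (curl a x))"
		unfolding \<gamma>_def by (rule form_d_emb(1)[OF cA compact_ccube c(2) za sac])
	have d\<gamma>: "form_d A \<gamma> c x = form2 (curl a x)" if "x : img c" for x
		unfolding d\<gamma>' by (rule emb_self[OF cA that])
	have "fd (%y. - B' y) x (ax 2) = - fd B' x (ax 2)" for x by (rule fd_minus[OF test_differentiable[OF B]])
	moreover have "fd a x v $ 2 = fd A' x v" "fd a x v $ 1 = fd (%y. - B' y) x v" for x v
		using fd_vec_nth[OF sa UNIV_I, of 2 x v] fd_vec_nth[OF sa UNIV_I, of 1 x v] by (simp_all add: a_def vector_3)
	ultimately have curl3: "curl a x $ 3 = f x" for x
		by (simp add: curl_def vector_3 fAB)
	have "form_wedge 1 2 \<alpha> (form_d A \<gamma>) = embd c f"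
	proof (rule embd_unique[OF forms_wedge_12[OF \<alpha> forms_d_1[OF \<gamma>]] cA c(2) f Ks])
		show "vanish_out (form_wedge 1 2 \<alpha> (form_d A \<gamma>)) (chart_inv c ` ccube r)"
			by (rule form_wedge_vanish[OF form_d_vanish[OF \<gamma> compact_closed[OF K] v\<gamma>]])
		show "dens (form_wedge 1 2 \<alpha> (form_d A \<gamma>)) c x = f x" if "x : img c" for x
			unfolding box_wedge[OF c(1) that forms_d_1[OF \<gamma>]] vec2_form2[of "form_d A \<gamma>" c x, OF d\<gamma>[OF that]] by (rule curl3)
	qed
	then show ?thesis unfolding null_def using \<gamma> by metis
qed

text \<open>The converse of \<open>null_plaque\<close> for a \<gamma> supported in one box: \<alpha>
  \<and> d\<gamma> is the horizontal divergence of (\<gamma>_2, -\<gamma>_1), which integrates to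
  zero against functions of the height.\<close>

lemma null_local:
	assumes c: "c : boxes" and \<gamma>: "\<gamma> : forms A 1" and K: "compactin X K" "K <= fst c" "vanish_out \<gamma> K" and h: "smooth_on UNIV h"
	shows "integral UNIV (%x. dens (form_wedge 1 2 \<alpha> (form_d A \<gamma>)) c x * h (x $ 3)) = 0"
proof -
	have cA: "c : A" by (rule boxes_A[OF c])
	define g where "g = vec1 \<gamma> c"
	note gt = vec1_test[OF \<gamma> cA K, folded g_def]
	have cK: "compact (snd c ` K)" by (rule chart_compact_image[OF chart[OF cA] K(1,2)])
	obtain r where r: "0 < r" "snd c ` K <= ccube r" by (rule compact_in_some_ccube[OF cK])
	have gz: "g x = 0" if "x ~: ccube r" for x using gt(2) that r(2) by blast
	have t: "test r (%x. g x $ i)" for i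
		unfolding test_def using smooth_on_vec_nth[OF open_UNIV gt(1)] gz by simp
	have dx: "dens (form_wedge 1 2 \<alpha> (form_d A \<gamma>)) c x = fd (%y. g y $ 2) x (ax 1) + fd (%y. - g y $ 1) x (ax 2)" for x
	proof (cases "x : img c")
		case True
		show ?thesis unfolding box_wedge[OF c True forms_d_1[OF \<gamma>]] vec2_form2[of "form_d A \<gamma>" c x, OF form_d_1[OF \<gamma> cA True]]
			by (simp add: curl_def vector_3 g_def[symmetric] fd_vec_nth[OF gt(1) UNIV_I] fd_minus[OF test_differentiable[OF t]])
	next
		case False
		have "fd (%y. g y $ 2) x v = 0" "fd (%y. - g y $ 1) x v = 0" for v by (rule fd_outside[OF K(1,2) cA _ False], simp add: gt(2))+
		then show ?thesis using vec_outside(3)[OF _ forms_wedge_12[OF \<alpha> forms_d_1[OF \<gamma>]]] False by simp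
	qed
	show ?thesis unfolding dx by (rule plaque_divergence[OF t test_minus[OF t] h])
qed

text \<open>Both charts express \<alpha> as dz, so the difference of the heights has zero
  derivative, and the image cube of \<open>c\<close> is convex.\<close>

lemma box_in_box:
	assumes c: "c : boxes" and b: "b : boxes" and sub: "fst c <= fst b"
	shows "\<exists>k. \<forall>x\<in>img c. trn c b x $ 3 = x $ 3 + k"
proof -
	have cA: "c : A" "b : A" using boxes_A c b by auto
	obtain R where R: "img c = ocube R" using c by (auto simp: boxes_def)
	have "fst c \<inter> fst b = fst c" using sub by blast
	then have ov: "overlap c b = ocube R" unfolding overlap_def R[symmetric] chart_image_def by simp
	define g where "g = (%x. trn c b x $ 3 - x $ 3)"
	have st: "smooth_on (ocube R) (trn c b)" using smooth_transition[OF cA] ov by simp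
	have sg: "(g has_derivative (%v. 0)) (at x within ocube R)" if x: "x : ocube R" for x
	proof -
		have "fd (trn c b) x v $ 3 = v $ 3" for v
		proof -
			have "\<alpha> c x [v] = \<alpha> b (trn c b x) [fd (trn c b) x v]"
				using form_transition[OF \<alpha> cA, of x "[v]"] ov x by simp
			moreover have "trn c b x : img b"
				using transition_overlap(1)[OF chart[OF cA(1)] chart[OF cA(2)], of x] overlap_subset[of b c] ov x by blast
			then have "\<alpha> b (trn c b x) = form1 (ax 3)" using b form1_repr[OF \<alpha>, of b "trn c b x"] by (simp add: boxes_def)
			moreover have "\<alpha> c x = form1 (ax 3)" using c x R form1_repr[OF \<alpha>, of c x] by (simp add: boxes_def)
			ultimately show ?thesis by (simp only: form_eval inner_axis' mult_1 inner_real_def)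
		qed
		moreover have "(g has_derivative (%v. fd (trn c b) x v $ 3 - v $ 3)) (at x)" unfolding g_def
			by (intro has_derivative_diff bounded_linear.has_derivative[OF bounded_linear_vec_nth] smooth_on_has_derivative[OF st x] has_derivative_ident)
		ultimately show ?thesis by (simp add: has_derivative_at_withinI)
	qed
	have "convex (ocube R)" unfolding ocube_box by (rule convex_box(2))
	from has_derivative_zero_constant[OF this sg] obtain k where "!!x. x : ocube R ==> g x = k" by blast
	then show ?thesis unfolding R g_def by (intro exI[of _ k]) (auto simp: algebra_simps)
qed

text \<open>Weighting by a function of the height gives again a compactly supported 3-form
  \<open>w\<close>, because the heights in the two charts differ by the constant \<open>k\<close>;
  the integral of \<open>w\<close> is invariant under change of chart.\<close>

lemma box_integral:
	assumes c: "c : boxes" and b: "b : boxes" and sub: "fst c <= fst b"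
		and k: "!!x. x : img c ==> trn c b x $ 3 = x $ 3 + k"
		and f: "test r f" "ccube r <= img c" and h: "smooth_on UNIV h"
	shows "integral UNIV (%y. dens (embd c f) b y * h (y $ 3)) = integral UNIV (%x. f x * h (x $ 3 + k))"
proof -
	have cA: "c : A" "b : A" using boxes_A c b by auto
	have sh: "smooth_on UNIV (%x::real^3. h (x $ 3 + k))"
		by (rule smooth_on_coord_compose[of "%t. h (t + k)"], rule smooth_on_compose_UNIV[OF open_UNIV h])
			(intro smooth_on_add open_UNIV smooth_on_ident smooth_on_const)
	have fh: "test r (%x. f x * h (x $ 3 + k))" by (rule test_mult[OF f(1) sh])
	define w where "w = embd c (%x. f x * h (x $ 3 + k))"
	note W = embd_props[OF cA(1) f(2) fh, folded w_def]
	note W' = embd_props[OF cA(1) f(2,1)]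
	have K: "compactin X (chart_inv c ` ccube r)" by (rule chart_compact_preimage[OF chart[OF cA(1)] compact_ccube f(2)])
	have Ks: "chart_inv c ` ccube r <= fst c" using chart_inv_into[OF chart[OF cA(1)]] f(2) by auto
	have e: "dens w b y = dens (embd c f) b y * h (y $ 3)" for y
	proof (cases "y : overlap b c")
		case True
		define x where "x = trn b c y"
		have x: "x : overlap c b" "trn c b x = y"
			unfolding x_def using transition_overlap(1,3)[OF chart[OF cA(2)] chart[OF cA(1)] True] by simp_all
		then have "y $ 3 = x $ 3 + k" using k[of x] overlap_subset[of c b] by blast
		then show ?thesis
			unfolding dens_transition[OF W(1) cA(2,1) True] dens_transition[OF W'(1) cA(2,1) True] x_def[symmetric] W(3) W'(3) by simp
	next
		case False
		then have "embd c f b y = 0" "w b y = 0" unfolding embd_def w_def by (rule emb_outside)+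
		then show ?thesis by (simp add: dens_def)
	qed
	have "integral UNIV (dens w c) = integral UNIV (dens w b)"
		by (rule integral_change_chart[OF W(1) cA K Ks _ W(2)]) (use Ks sub in blast)
	then show ?thesis unfolding W(3) e[abs_def] by simp
qed

lemma embd_support:
	assumes c: "c : boxes" and b: "b : boxes" and sub: "fst c <= fst b" and f: "test r f" "ccube r <= img c"
	shows "compactin X (chart_inv c ` ccube r)" "chart_inv c ` ccube r <= fst c" "\<exists>s>0. test s (dens (embd c f) b)"
proof -
	have cA: "c : A" "b : A" using boxes_A c b by auto
	show K: "compactin X (chart_inv c ` ccube r)" by (rule chart_compact_preimage[OF chart[OF cA(1)] compact_ccube f(2)])
	show Ks: "chart_inv c ` ccube r <= fst c" using chart_inv_into[OF chart[OF cA(1)]] f(2) by auto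
	show "\<exists>s>0. test s (dens (embd c f) b)"
		by (rule dens_test(3)[OF embd_props(1)[OF cA(1) f(2,1)] cA(2) K _ embd_props(2)[OF cA(1) f(2,1)]]) (use Ks sub in blast)
qed

text \<open>Transfers the criterion \<open>null_plaque\<close> to densities from two charts: their
  difference is a single density in the common box.\<close>

lemma common_box_eqv:
	assumes c: "c : boxes" and d: "d : boxes" and b: "b : boxes" and sub: "fst c <= fst b" "fst d <= fst b"
		and f: "test r f" "ccube r <= img c" and g: "test s g" "ccube s <= img d"
		and e: "!!h. smooth_on UNIV h ==> integral UNIV (%y. dens (embd c f) b y * h (y $ 3)) = integral UNIV (%y. dens (embd d g) b y * h (y $ 3))"
	shows "embd c f \<doteq> embd d g"
proof -
	have A: "c : A" "d : A" "b : A" using boxes_A c d b by auto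
	obtain R where R: "0 < R" "img b = ocube R" using b by (auto simp: boxes_def)
	define w where "w = embd c f - embd d g"
	define K where "K = chart_inv c ` ccube r \<union> chart_inv d ` ccube s"
	note sc = embd_support[OF c b sub(1) f] and sd = embd_support[OF d b sub(2) g]
	note pc = embd_props[OF A(1) f(2,1)] and pd = embd_props[OF A(2) g(2,1)]
	have w: "w : forms A 3" unfolding w_def by (rule forms_diff[OF pc(1) pd(1)])
	have K: "compactin X K" "K <= fst b" unfolding K_def using compactin_Un[OF sc(1) sd(1)] sc(2) sd(2) sub by auto
	have v: "vanish_out w K" using pc(2) pd(2) by (auto simp: vanish_out_def K_def w_def)
	obtain q where q: "0 < q" "q < R" "test q (dens w b)" "w = embd b (dens w b)"
		using supported_embd[OF w A(3) R(2,1) K v] by blast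
	obtain s1 where s1: "test s1 (dens (embd c f) b)" using sc(3) by blast
	obtain s2 where s2: "test s2 (dens (embd d g) b)" using sd(3) by blast
	have "null (embd b (dens w b))"
	proof (rule null_plaque[OF b _ q(1,3)])
		show "ccube q <= img b" using ccube_subset_ocube[OF q(2)] R(2) by simp
		fix h :: "real => real" assume h: "smooth_on UNIV h"
		have sh: "smooth_on UNIV (%x::real^3. h (x $ 3))" by (rule smooth_on_coord_compose[OF h])
		have "integral UNIV (%x. dens w b x * h (x $ 3)) =
			integral UNIV (%x. dens (embd c f) b x * h (x $ 3) - dens (embd d g) b x * h (x $ 3))"
			by (simp add: w_def dens_algebra left_diff_distrib)
		also have "... = 0"
			unfolding integral_diff[OF cc_integrable[OF test_cc[OF test_mult[OF s1 sh]]] cc_integrable[OF test_cc[OF test_mult[OF s2 sh]]]]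
			by (simp add: e[OF h])
		finally show "integral UNIV (%x. dens w b x * h (x $ 3)) = 0" .
	qed
	then show ?thesis unfolding eqv_def using q(4) w_def by metis
qed

end

section \<open>Operators along the vertical coordinate\<close>

text \<open>The adjoint \<open>Kd\<close> acts on functions of the vertical coordinate alone; it shows that \<open>K\<close> descends to densities modulo
	those with vanishing plaque integrals.\<close>

definition vert_adjoint :: "((real ^ 3 => real) => real ^ 3 => real) => ((real => real) => real => real) => bool" where
	"vert_adjoint K Kd \<longleftrightarrow> (\<forall>h. smooth_on UNIV h --> smooth_on UNIV (Kd h) &
			(\<forall>r f k. test r f --> integral UNIV (%x. K f x * h (x $ 3 + k)) = integral UNIV (%x. f x * Kd h (x $ 3 + k))))"

text \<open>The number \<open>a\<close> bounds the growth of supports. The adjoint relation holds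
  for every offset of the height, because the operator has to act alike in boxes whose heights
  differ by a constant.\<close>

definition vert :: "real => ((real ^ 3 => real) => real ^ 3 => real) => bool" where
	"vert a K \<longleftrightarrow> (\<forall>r f. test r f --> test (r + a) (K f)) &
		(\<forall>r f g. test r f --> test r g --> K (%x. f x + g x) = (%x. K f x + K g x)) &
		(\<forall>r f k. test r f --> K (%x. k * f x) = (%x. k * K f x)) &
		(\<exists>Kd. vert_adjoint K Kd)"

lemma vertD:
	assumes "vert a K"
	shows "test r f ==> test (r + a) (K f)" "test r f ==> test r g ==> K (%x. f x + g x) = (%x. K f x + K g x)"
		"test r f ==> K (%x. k * f x) = (%x. k * K f x)"
	using assms unfolding vert_def by blast+

lemma vert_adjointD:
	assumes "vert_adjoint K Kd" "smooth_on UNIV h"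
	shows "smooth_on UNIV (Kd h)"
		"test r f ==> integral UNIV (%x. K f x * h (x $ 3 + k)) = integral UNIV (%x. f x * Kd h (x $ 3 + k))"
	using assms unfolding vert_adjoint_def by blast+

lemma vert_zero: assumes "vert a K" shows "K (%x. 0) = (%x. 0)"
	using vertD(3)[OF assms, of 0 "%x. 0" 0] by simp

lemma vert_diff:
	assumes K: "vert a K" and f: "test r f" "test r g" shows "K (%x. f x - g x) = (%x. K f x - K g x)"
	using vertD(2)[OF K f(1) test_minus[OF f(2)]] vertD(3)[OF K f(2), of "-1"] by simp

lemma vert_sum:
	assumes K: "vert a K" and f: "!!i. i : J ==> test r (f i)"
	shows "K (%x. \<Sum>i\<in>J. f i x) = (%x. \<Sum>i\<in>J. K (f i) x)"
	using f
proof (induction J rule: infinite_finite_induct)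
	case (insert i J)
	have "K (%x. f i x + (\<Sum>i\<in>J. f i x)) = (%x. K (f i) x + K (%x. \<Sum>i\<in>J. f i x) x)"
		by (rule vertD(2)[OF K]) (use insert in \<open>auto intro: test_sum\<close>)
	then show ?case using insert by simp
qed (simp_all add: vert_zero[OF K])

lemma vert_compose:
	assumes K: "vert a K" and L: "vert b L" shows "vert (a + b) (%f. K (L f))"
proof -
	obtain Kd where Kd: "vert_adjoint K Kd" using K unfolding vert_def by blast
	obtain Ld where Ld: "vert_adjoint L Ld" using L unfolding vert_def by blast
	show ?thesis unfolding vert_def
	proof (intro conjI allI impI)
		fix r f g and k :: real assume f: "test r f"
		show "test (r + (a + b)) (K (L f))" using vertD(1)[OF K vertD(1)[OF L f]] by (simp add: add_ac)
		show "K (L (%x. k * f x)) = (%x. k * K (L f) x)"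
			unfolding vertD(3)[OF L f] by (rule vertD(3)[OF K vertD(1)[OF L f]])
		assume g: "test r g"
		show "K (L (%x. f x + g x)) = (%x. K (L f) x + K (L g) x)"
			unfolding vertD(2)[OF L f g] by (rule vertD(2)[OF K vertD(1)[OF L f] vertD(1)[OF L g]])
	next
		have "integral UNIV (%x. K (L f) x * h (x $ 3 + k)) = integral UNIV (%x. f x * Ld (Kd h) (x $ 3 + k))"
			if h: "smooth_on UNIV h" and f: "test r f" for h r f k
			using vert_adjointD(2)[OF Kd h vertD(1)[OF L f], of k] vert_adjointD(2)[OF Ld vert_adjointD(1)[OF Kd h] f, of k] by simp
		then have "vert_adjoint (%f. K (L f)) (%h. Ld (Kd h))"
			unfolding vert_adjoint_def using vert_adjointD(1)[OF Ld vert_adjointD(1)[OF Kd]] by blast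
		then show "\<exists>Md. vert_adjoint (%f. K (L f)) Md" by blast
	qed
qed

text \<open>Moves a density upward by \<open>s\<close>, hence the minus sign in the
  argument.\<close>

definition shift :: "real => (real ^ 3 => real) => real ^ 3 => real" where
	"shift s f x = f (x - s *R ax 3)"

text \<open>The weighted average of the operators \<open>shift t\<close>. The weight 1 sums a
  density along its upward orbit; the weight b - t serves in an integration by parts.\<close>

definition vint :: "(real => real) => real => real => (real ^ 3 => real) => real ^ 3 => real" where
	"vint \<kappa> a b f x = integral {a..b} (%t. \<kappa> t * f (x - t *R ax 3))"

definition vderiv :: "(real ^ 3 => real) => real ^ 3 => real" where
	"vderiv f x = fd f x (ax 3)"

lemma shift_test: "test r f ==> test (r + \<bar>s\<bar>) (shift s f)"
	using test_shift[of r f "- (s *R ax 3)" "\<bar>s\<bar>"] by (simp add: shift_def[abs_def] axis_def)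

lemma smooth_on_real_shift: "smooth_on UNIV h ==> smooth_on UNIV (%t::real. h (t + k))"
	by (rule smooth_on_compose_UNIV[OF open_UNIV]) (intro smooth_on_add open_UNIV smooth_on_ident smooth_on_const | assumption)+

lemma smooth_on_height:
	fixes h :: "real => real"
	shows "smooth_on UNIV h ==> smooth_on UNIV (%x::real^3. h (x $ 3 + k))"
	by (rule smooth_on_coord_compose[of "%t. h (t + k)"]) (rule smooth_on_real_shift)

lemma shift_integral:
	assumes f: "test r f" and h: "smooth_on UNIV h"
	shows "integral UNIV (%x. f (x - s *R ax 3) * h (x $ 3 + k)) = integral UNIV (%x. f x * h (x $ 3 + k + s))"
proof -
	have "cc r (%x. f x * h (x $ 3 + k + s))" using test_cc[OF test_mult[OF f smooth_on_height[OF h, of "k + s"]]] by (simp add: add.assoc)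
	from integral_shift_UNIV[OF this, of "- (s *R ax 3)"] show ?thesis by (simp add: axis_nth)
qed

lemma vert_shift: "vert \<bar>s\<bar> (shift s)"
	unfolding vert_def
proof (intro conjI allI impI)
	have "vert_adjoint (shift s) (%h t. h (t + s))"
		unfolding vert_adjoint_def by (simp add: shift_def shift_integral smooth_on_real_shift)
	then show "\<exists>Kd. vert_adjoint (shift s) Kd" by blast
qed (auto simp: shift_def shift_test)

lemma vint_cong_line:
	assumes f: "smooth_on UNIV f" and \<kappa>: "continuous_on {a..b} \<kappa>"
	shows smooth_vint: "smooth_on UNIV (vint \<kappa> a b f)"
		and fd_vint: "fd (vint \<kappa> a b f) x v = vint \<kappa> a b (%y. fd f y v) x"
proof -
	have e: "vint \<kappa> a b f = (%x. integral {a..b} (%t. \<kappa> t *R f (- (t *R ax 3) + 1 *R x)))"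
		by (simp add: vint_def fun_eq_iff)
	have c: "continuous_on {a..b} (%t. 1::real)" "continuous_on {a..b} (%t. - (t *R ax 3))" by (intro continuous_intros)+
	show "smooth_on UNIV (vint \<kappa> a b f)" unfolding e
		by (rule smooth_on_parameter_integral[OF open_UNIV open_UNIV f linear_ident \<kappa> c]) simp
	have "(vint \<kappa> a b f has_derivative (%v. integral {a..b} (%t. (\<kappa> t * 1) *R fd f (- (t *R ax 3) + 1 *R x) v))) (at x)" unfolding e
		by (rule has_derivative_parameter_integral[OF open_UNIV open_UNIV f linear_ident \<kappa> c]) simp_all
	from fd_eqI[OF this] show "fd (vint \<kappa> a b f) x v = vint \<kappa> a b (%y. fd f y v) x" by (simp add: vint_def)
qed

lemma vint_integrable:
	fixes f :: "real ^ 3 => real" and \<kappa> :: "real => real"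
	assumes f: "smooth_on UNIV f" and \<kappa>: "continuous_on {a..b} \<kappa>"
	shows "(%t. \<kappa> t * f (x - t *R ax 3)) integrable_on {a..b}"
proof (rule integrable_continuous_real)
	have "continuous_on {a..b} (%t. f (x - t *R ax 3))"
		by (rule continuous_on_compose2[OF smooth_on_continuous[OF f]]) (auto intro!: continuous_intros)
	then show "continuous_on {a..b} (%t. \<kappa> t * f (x - t *R ax 3))" by (rule continuous_on_mult[OF \<kappa>])
qed

lemma vint_test:
	assumes f: "test r f" and \<kappa>: "continuous_on {a..b} \<kappa>" and m: "\<bar>a\<bar> <= m" "\<bar>b\<bar> <= m"
	shows "test (r + m) (vint \<kappa> a b f)"
	unfolding test_def
proof (intro conjI allI impI)
	show "smooth_on UNIV (vint \<kappa> a b f)" by (rule smooth_vint[OF test_smooth[OF f] \<kappa>])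
	fix x :: "real ^ 3" assume x: "x ~: ccube (r + m)"
	have "f (x - t *R ax 3) = 0" if t: "t : {a..b}" for t
	proof -
		have "\<bar>t\<bar> <= m" using t m by auto
		then have "test (r + m) (shift t f)" by (intro test_mono[OF shift_test[OF f]]) simp
		then show ?thesis using x by (simp add: test_def shift_def)
	qed
	then show "vint \<kappa> a b f x = 0" unfolding vint_def by (subst integral_cong[where g = "%t. 0"]) auto
qed

text \<open>Fubini, with an adjoint that averages \<open>h\<close> in the opposite
  direction.\<close>

lemma vert_vint:
	assumes \<kappa>: "continuous_on {a..b} \<kappa>" and m: "\<bar>a\<bar> <= m" "\<bar>b\<bar> <= m"
	shows "vert m (vint \<kappa> a b)"
	unfolding vert_def
proof (intro conjI allI impI)
	fix r f g assume f: "test r f"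
	show "test (r + m) (vint \<kappa> a b f)" by (rule vint_test[OF f \<kappa> m])
	show "vint \<kappa> a b (%x. k * f x) = (%x. k * vint \<kappa> a b f x)" for k
		unfolding vint_def by (simp add: mult.left_commute)
	assume g: "test r g"
	show "vint \<kappa> a b (%x. f x + g x) = (%x. vint \<kappa> a b f x + vint \<kappa> a b g x)"
		unfolding vint_def distrib_left
		by (subst integral_add[OF vint_integrable[OF test_smooth[OF f] \<kappa>] vint_integrable[OF test_smooth[OF g] \<kappa>]]) (rule refl)
next
	define Kd where "Kd = (%(h :: real => real) t. integral {a..b} (%s. \<kappa> s *R h (s + 1 *R t)))"
	have Kd: "smooth_on UNIV (Kd h)" if h: "smooth_on UNIV h" for h
		unfolding Kd_def by (rule smooth_on_parameter_integral[OF open_UNIV open_UNIV h linear_ident \<kappa>]) (auto intro: continuous_intros)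
	have "integral UNIV (%x. vint \<kappa> a b f x * h (x $ 3 + k)) = integral UNIV (%x. f x * Kd h (x $ 3 + k))"
		if h: "smooth_on UNIV h" and f: "test r f" for h r f k
	proof -
		\<comment> \<open>A box containing the supports of all translates involved, so that Fubini is
		  applied on a compact domain.\<close>
		define q :: "real ^ 3" where "q = (\<chi> i. r + m)"
		have q: "ccube (r + m) = cbox (- q) q" unfolding ccube_cbox q_def by (rule arg_cong2[of _ _ _ _ cbox]) (simp_all add: vec_eq_iff)
		have cf: "continuous_on UNIV f" and ch: "continuous_on UNIV h" using smooth_on_continuous h test_smooth[OF f] by blast+
		have rm: "r <= r + m" using m by linarith
		have t1: "cc (r + m) (%x. vint \<kappa> a b f x * h (x $ 3 + k))"
			by (rule test_cc[OF test_mult[OF vint_test[OF f \<kappa> m] smooth_on_height[OF h]]])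
		have t2: "cc (r + m) (%x. f x * Kd h (x $ 3 + k))"
			by (rule test_cc[OF test_mult[OF test_mono[OF f rm] smooth_on_height[OF Kd[OF h]]]])
		have \<kappa>': "continuous_on (cbox a b) \<kappa>" using \<kappa> by simp
		have fst_snd: "continuous_on (cbox (a, - q) (b, q)) (%p. \<kappa> (fst p))"
			by (rule continuous_on_compose2[OF \<kappa>']) (auto intro: continuous_intros)
		have c1: "continuous_on (cbox (a, - q) (b, q)) (%(t, x). \<kappa> t * (f (x - t *R ax 3) * h (x $ 3 + k)))"
			unfolding case_prod_unfold
			by (intro continuous_on_mult fst_snd continuous_on_compose2[OF cf] continuous_on_compose2[OF ch] subset_UNIV continuous_intros)
		have c2: "continuous_on (cbox (a, - q) (b, q)) (%(t, x). \<kappa> t * (f x * h (x $ 3 + k + t)))"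
			unfolding case_prod_unfold
			by (intro continuous_on_mult fst_snd continuous_on_compose2[OF cf] continuous_on_compose2[OF ch] subset_UNIV continuous_intros)
		have "integral UNIV (%x. vint \<kappa> a b f x * h (x $ 3 + k)) = integral (cbox (- q) q) (%x. vint \<kappa> a b f x * h (x $ 3 + k))"
			using cc_integral_eq_ccube[OF t1] q by simp
		also have "... = integral (cbox (- q) q) (%x. integral (cbox a b) (%t. \<kappa> t * (f (x - t *R ax 3) * h (x $ 3 + k))))"
			unfolding vint_def integral_mult_left[symmetric] by (simp add: mult.assoc)
		also have "... = integral (cbox a b) (%t. integral (cbox (- q) q) (%x. \<kappa> t * (f (x - t *R ax 3) * h (x $ 3 + k))))"
			by (rule integral_swap_continuous[OF c1, symmetric])
		also have "... = integral (cbox a b) (%t. integral (cbox (- q) q) (%x. \<kappa> t * (f x * h (x $ 3 + k + t))))"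
		proof (rule integral_cong)
			fix t assume "t : cbox a b"
			then have tm: "\<bar>t\<bar> <= m" using m by auto
			then have t: "test (r + m) (shift t f)" by (intro test_mono[OF shift_test[OF f]]) simp
			have u1: "cc (r + m) (%x. f (x - t *R ax 3) * h (x $ 3 + k))"
				using test_cc[OF test_mult[OF t smooth_on_height[OF h]]] by (simp add: shift_def)
			have u2: "cc (r + m) (%x. f x * h (x $ 3 + k + t))"
				using test_cc[OF test_mult[OF test_mono[OF f rm] smooth_on_height[OF h, of "k + t"]]] by (simp add: add.assoc)
			show "integral (cbox (- q) q) (%x. \<kappa> t * (f (x - t *R ax 3) * h (x $ 3 + k))) =
					integral (cbox (- q) q) (%x. \<kappa> t * (f x * h (x $ 3 + k + t)))"
				using cc_integral_eq_ccube[OF u1] cc_integral_eq_ccube[OF u2] shift_integral[OF f h, of t k] q by simp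
		qed
		also have "... = integral (cbox (- q) q) (%x. integral (cbox a b) (%t. \<kappa> t * (f x * h (x $ 3 + k + t))))"
			by (rule integral_swap_continuous[OF c2])
		also have "... = integral (cbox (- q) q) (%x. f x * Kd h (x $ 3 + k))"
			unfolding Kd_def integral_mult_right[symmetric] by (simp add: mult_ac add_ac)
		also have "... = integral UNIV (%x. f x * Kd h (x $ 3 + k))" using cc_integral_eq_ccube[OF t2] q by simp
		finally show ?thesis .
	qed
	then have "vert_adjoint (vint \<kappa> a b) Kd" unfolding vert_adjoint_def using Kd by blast
	then show "\<exists>Kd. vert_adjoint (vint \<kappa> a b) Kd" by blast
qed

text \<open>Integration by parts; the adjoint is minus the derivative.\<close>

lemma vert_vderiv: "vert 0 vderiv"
	unfolding vert_def
proof (intro conjI allI impI)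
	fix r f g assume f: "test r f"
	show "test (r + 0) (vderiv f)" unfolding vderiv_def using test_fd[OF f] by simp
	show "vderiv (%x. k * f x) = (%x. k * vderiv f x)" for k
		unfolding vderiv_def by (simp add: fd_cmult[OF test_differentiable[OF f]])
	assume g: "test r g"
	show "vderiv (%x. f x + g x) = (%x. vderiv f x + vderiv g x)"
		unfolding vderiv_def by (simp add: fd_add[OF test_differentiable[OF f] test_differentiable[OF g]])
next
	define Kd where "Kd = (%(h :: real => real) t. - fd h t 1)"
	have Kd: "smooth_on UNIV (Kd h)" if h: "smooth_on UNIV h" for h
		unfolding Kd_def by (intro smooth_on_minus smooth_on_fd h open_UNIV)
	have "integral UNIV (%x. vderiv f x * h (x $ 3 + k)) = integral UNIV (%x. f x * Kd h (x $ 3 + k))"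
		if h: "smooth_on UNIV h" and f: "test r f" for h r f k
	proof -
		have sh: "smooth_on UNIV (%x::real^3. h (x $ 3 + k))" by (rule smooth_on_height[OF h])
		have dh: "fd (%x::real^3. h (x $ 3 + k)) x (ax 3) = - Kd h (x $ 3 + k)" for x
		proof -
			have "((%x::real^3. x $ 3 + k) has_derivative (%v. v $ 3 + 0)) (at x)"
				by (intro has_derivative_add bounded_linear.has_derivative[OF bounded_linear_vec_nth] has_derivative_ident has_derivative_const)
			from has_derivative_compose[OF this smooth_on_has_derivative[OF h UNIV_I]]
			have "((%x::real^3. h (x $ 3 + k)) has_derivative (%v. fd h (x $ 3 + k) (v $ 3 + 0))) (at x)" .
			from fd_eqI[OF this] show ?thesis by (simp add: Kd_def axis_nth)
		qed
		have m: "fd (%x. f x * h (x $ 3 + k)) x (ax 3) = vderiv f x * h (x $ 3 + k) - f x * Kd h (x $ 3 + k)" for x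
			using fd_mult[OF test_differentiable[OF f] smooth_on_differentiable[OF sh UNIV_I], of x "ax 3"] by (simp add: dh vderiv_def)
		have "0 = integral UNIV (%x. vderiv f x * h (x $ 3 + k) - f x * Kd h (x $ 3 + k))"
			using integral_fd_eq_0[OF test_mult[OF f sh], of "ax 3"] by (simp only: m)
		also have "... = integral UNIV (%x. vderiv f x * h (x $ 3 + k)) - integral UNIV (%x. f x * Kd h (x $ 3 + k))"
			unfolding vderiv_def
			by (rule integral_diff[OF cc_integrable[OF test_cc[OF test_mult[OF test_fd[OF f] sh]]]
						cc_integrable[OF test_cc[OF test_mult[OF f smooth_on_height[OF Kd[OF h]]]]]])
		finally show ?thesis by simp
	qed
	then have "vert_adjoint vderiv Kd" unfolding vert_adjoint_def using Kd by blast
	then show "\<exists>Kd. vert_adjoint vderiv Kd" by blast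
qed

lemma vint_vderiv:
	assumes f: "test r f" and \<kappa>: "continuous_on {a..b} \<kappa>"
	shows "vderiv (vint \<kappa> a b f) = vint \<kappa> a b (vderiv f)"
	by (simp add: fun_eq_iff vderiv_def[abs_def] fd_vint[OF test_smooth[OF f] \<kappa>])

lemma vertical_derivative_line:
	assumes f: "test r f"
	shows "((%t. f (x - t *R ax 3)) has_vector_derivative - vderiv f (x - t *R ax 3)) (at t within T)"
proof -
	have "((%t. x - t *R ax 3) has_derivative (%s. - (s *R ax 3))) (at t)"
		by (auto intro!: derivative_eq_intros)
	from has_derivative_compose[OF this smooth_on_has_derivative[OF test_smooth[OF f] UNIV_I]]
	have "((%t. f (x - t *R ax 3)) has_derivative (%s. fd f (x - t *R ax 3) (- (s *R ax 3)))) (at t)" .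
	moreover have "fd f y (- (s *R ax 3)) = s *R (- vderiv f y)" for y s
		using linear_fd[OF test_differentiable[OF f], of y] by (simp add: vderiv_def linear_neg linear_cmul)
	ultimately show ?thesis unfolding has_vector_derivative_def by (simp add: has_derivative_at_withinI)
qed

lemma vint_1_vderiv:
	assumes f: "test r f" and ab: "a <= b"
	shows "vint (%t. 1) a b (vderiv f) = (%x. shift a f x - shift b f x)"
proof
	fix x
	have "((%t. - vderiv f (x - t *R ax 3)) has_integral (f (x - b *R ax 3) - f (x - a *R ax 3))) {a..b}"
		by (rule fundamental_theorem_of_calculus[OF ab vertical_derivative_line[OF f]])
	from integral_unique[OF this] show "vint (%t. 1) a b (vderiv f) x = shift a f x - shift b f x"
		by (simp add: vint_def shift_def)
qed

text \<open>Integration by parts in t. The weight b - t vanishes at the upper end, so the only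
  boundary term is b f. This compares an average with a multiple of the identity.\<close>

lemma vint_linear_vderiv:
	assumes f: "test r f" and b: "0 <= b"
	shows "vint (%t. b - t) 0 b (vderiv f) = (%x. b * f x - vint (%t. 1) 0 b f x)"
proof
	fix x
	have "((%t. (b - t) * f (x - t *R ax 3)) has_vector_derivative
			((b - t) * (- vderiv f (x - t *R ax 3)) + (0 - 1) * f (x - t *R ax 3))) (at t within {0..b})" for t
		by (intro has_vector_derivative_mult vertical_derivative_line[OF f] has_vector_derivative_diff has_vector_derivative_const has_vector_derivative_id)
	then have "((%t. (b - t) * (- vderiv f (x - t *R ax 3)) + (0 - 1) * f (x - t *R ax 3)) has_integral
			((b - b) * f (x - b *R ax 3) - (b - 0) * f (x - 0 *R ax 3))) {0..b}"
		by (intro fundamental_theorem_of_calculus[OF b])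
	then have i: "((%t. - ((b - t) * vderiv f (x - t *R ax 3) + f (x - t *R ax 3))) has_integral - (b * f x)) {0..b}" by simp
	have "integral {0..b} (%t. (b - t) * vderiv f (x - t *R ax 3) + f (x - t *R ax 3)) = b * f x"
		using integral_unique[OF i] unfolding integral_neg by simp
	moreover have "integral {0..b} (%t. (b - t) * vderiv f (x - t *R ax 3) + f (x - t *R ax 3)) =
			vint (%t. b - t) 0 b (vderiv f) x + vint (%t. 1) 0 b f x"
		unfolding vint_def
		using integral_add[OF vint_integrable[of "vderiv f" 0 b "%t. b - t" x] vint_integrable[of f 0 b "%t. 1" x]]
			test_smooth[OF f] test_smooth[OF vertD(1)[OF vert_vderiv f]] by (simp add: continuous_on_diff)
	ultimately show "vint (%t. b - t) 0 b (vderiv f) x = b * f x - vint (%t. 1) 0 b f x" by linarith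
qed

lemma vint_nonneg:
	assumes f: "smooth_on UNIV f" and \<kappa>: "continuous_on {a..b} \<kappa>" "!!t. t : {a..b} ==> 0 <= \<kappa> t" and nn: "!!x. 0 <= f x"
	shows "0 <= vint \<kappa> a b f x"
	unfolding vint_def by (rule integral_nonneg[OF vint_integrable[OF f \<kappa>(1)]]) (simp add: \<kappa>(2) nn)

section \<open>Vertical operators on 3-forms\<close>

lemma (in foliation) eqv_eq_trans [trans]: "\<mu> = \<nu> ==> \<nu> \<doteq> \<tau> ==> \<mu> \<doteq> \<tau>" "\<mu> \<doteq> \<nu> ==> \<nu> = \<tau> ==> \<mu> \<doteq> \<tau>"
	by simp_all

context max_atlas
begin

lemma embd_zero: "embd c (%x. 0) = 0"
	by (simp add: embd_def emb_def fun_eq_iff)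

definition pos :: "'a dform => bool" where
	"pos w \<longleftrightarrow> (\<forall>c\<in>A. \<forall>x\<in>img c. 0 <= dens w c x)"

lemma dens_sum: "dens (\<Sum>i\<in>J. w i) c x = (\<Sum>i\<in>J. dens (w i) c x)"
	by (simp add: dens_def sum_fun3)

lemma pos_add: "pos v ==> pos w ==> pos (v + w)"
	by (auto simp: pos_def dens_algebra)

lemma pos_sum: "(!!i. i : J ==> pos (w i)) ==> pos (\<Sum>i\<in>J. w i)"
	by (auto simp: pos_def dens_sum intro!: sum_nonneg)

lemma embd_pos:
	assumes c: "c : A" "ccube r <= img c" and f: "test r f" "!!x. 0 <= f x"
	shows "pos (embd c f)"
	unfolding pos_def
proof (intro ballI)
	fix d x assume d: "d : A" "x : img d"
	show "0 <= dens (embd c f) d x"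
	proof (cases "x : overlap d c")
		case True
		show ?thesis unfolding dens_transition[OF embd_props(1)[OF c f(1)] d(1) c(1) True] embd_props(3)[OF c f(1)]
			using det_transition[OF d(1) c(1) True] f(2) by simp
	next
		case False
		then have "embd c f d x = 0" unfolding embd_def by (rule emb_outside)
		then show ?thesis by (simp add: dens_def)
	qed
qed

end

text \<open>\<open>\<rho> c\<close> is the radius of a core containing the support of
  \<open>u c\<close>, and \<open>R c\<close> that of the whole chart. Operators that spread supports
  by at most \<open>10 * \<delta>\<close> keep core densities inside their charts.\<close>

locale adapted = foliation +
	fixes F :: "'a chart set" and u :: "'a chart => 'a => real" and R \<rho> :: "'a chart => real" and \<delta> :: real
	assumes pu: "partition_of_unity X A F u" and F_boxes: "F <= boxes" and \<delta>: "0 < \<delta>"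
		and core: "c : F ==> 0 < \<rho> c" "c : F ==> \<rho> c + 10 * \<delta> < R c" "c : F ==> img c = ocube (R c)"
			"c : F ==> snd c ` suppt (u c) <= ccube (\<rho> c)"
		and common_box: "c : F ==> d : F ==> fst c \<inter> fst d ~= {} ==> \<exists>b\<in>boxes. fst c <= fst b & fst d <= fst b"
begin

lemmas pu_D = partition_of_unityD[OF pu]

lemma F_A: "c : F ==> c : A" using pu_D(2) by blast

lemma F_box: "c : F ==> c : boxes" using F_boxes by blast

lemma core_cube: "c : F ==> s <= 10 * \<delta> ==> ccube (\<rho> c + s) <= img c"
	using ccube_subset_ocube[of "\<rho> c + s" "R c"] core(2,3)[of c] by simp

lemma core_embd:
	assumes w: "w : forms A 3" and c: "c : F" and v: "vanish_out w (suppt (u c))"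
	shows "test (\<rho> c) (dens w c)" "w = embd c (dens w c)"
proof -
	note t = dens_test[OF w F_A[OF c] suppt_compact pu_D(5)[OF c] v]
	show f: "test (\<rho> c) (dens w c)" unfolding test_def using t(1,2) core(4)[OF c] by blast
	show "w = embd c (dens w c)"
		by (rule embd_unique[OF w F_A[OF c] _ f pu_D(5)[OF c] v refl]) (use core_cube[OF c, of 0] \<delta> in simp)
qed

text \<open>A 3-form is handled as a family of densities, one for each chart of the partition. The
  family is far from unique, since a density in an overlap may be booked in either chart.\<close>

definition E :: "('a chart => real ^ 3 => real) => 'a dform" where
	"E g = (\<Sum>c\<in>F. embd c (g c))"

definition loc :: "'a dform => 'a chart => real ^ 3 => real" where
	"loc \<mu> c = dens (smul (u c) \<mu>) c"

definition fam :: "real => ('a chart => real ^ 3 => real) => bool" where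
	"fam s g \<longleftrightarrow> (\<forall>c\<in>F. test (\<rho> c + s) (g c))"

lemma E_forms:
	assumes "fam s g" "s <= 10 * \<delta>" shows "E g : forms A 3"
	unfolding E_def using assms by (intro forms_sum embd_props(1)[OF F_A core_cube]) (auto simp: fam_def)

lemma E_diff:
	assumes "fam s g" "fam s h" "s <= 10 * \<delta>" shows "E (%c x. g c x - h c x) = E g - E h"
	unfolding E_def sum_subtractf[symmetric]
	by (rule sum.cong[OF refl], rule embd_lincomb(2)[OF F_A core_cube]) (use assms in \<open>auto simp: fam_def\<close>)

lemma loc_props:
	assumes \<mu>: "\<mu> : forms A 3" shows "fam 0 (loc \<mu>)" "E (loc \<mu>) = \<mu>"
proof -
	have w: "smul (u c) \<mu> : forms A 3" if "c : F" for c by (rule forms_smul[OF pu_D(3)[OF that] \<mu>])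
	show "fam 0 (loc \<mu>)" unfolding fam_def loc_def using core_embd(1)[OF w _ smul_u_vanish] by simp
	have "E (loc \<mu>) = (\<Sum>c\<in>F. smul (u c) \<mu>)"
		unfolding E_def loc_def by (rule sum.cong[OF refl]) (rule core_embd(2)[OF w _ smul_u_vanish, symmetric])
	then show "E (loc \<mu>) = \<mu>" unfolding partition_decompose[OF pu \<mu>] .
qed

lemma loc_eq: "loc \<mu> c x = u c (chart_inv c x) * dens \<mu> c x"
	by (simp add: loc_def dens_smul)

lemma fam_mono: "fam s g ==> s <= t ==> fam t g"
	unfolding fam_def by (auto intro: test_mono)

lemma fam_vert: "vert a K ==> fam s g ==> fam (s + a) (%c. K (g c))"
	unfolding fam_def using vertD(1)[of a K] by (metis add.assoc)

text \<open>One density is seen in two charts, and the operator is applied in either. If the charts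
  are disjoint the density is zero. Otherwise both results are tested against \<open>h\<close> in a
  common box: the adjoint moves the operator onto \<open>h\<close>, and the remaining integrals
  agree because the densities do.\<close>

lemma vert_local:
	assumes K: "vert a K" "0 <= a" "0 <= s" "s + a <= 10 * \<delta>" and c: "c : F" "d : F"
		and f: "test (\<rho> c + s) f" and g: "test (\<rho> d + s) g" and e: "embd c f = embd d g"
	shows "embd c (K f) \<doteq> embd d (K g)"
proof (cases "fst c \<inter> fst d = {}")
	case True
	have zero: "f x = 0" if "c : F" "d : F" "fst c \<inter> fst d = {}" "test (\<rho> c + s) f" "embd c f = embd d g" for c d f g x
	proof (cases "x : img c")
		case True
		have "embd d g c x = 0" unfolding embd_def by (rule emb_outside) (use that(3) in \<open>simp add: overlap_def\<close>)
		moreover have "embd c f c x = form3 (f x)" unfolding embd_def by (rule emb_self[OF F_A[OF that(1)] True])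
		ultimately have "form3 (f x) = form3 0" using that(5) by simp
		then show ?thesis by (simp only: form_inject)
	next
		case False
		then have "x ~: ccube (\<rho> c + s)" using core_cube[OF that(1), of s] K by auto
		then show ?thesis using that(4) by (simp add: test_def)
	qed
	have "f = (%x. 0)" "g = (%x. 0)"
		using zero[OF c True f e] zero[OF c(2,1) _ g e[symmetric]] True by (auto simp: Int_commute)
	then show ?thesis by (simp add: vert_zero[OF K(1)] embd_zero eqv_refl)
next
	case False
	then obtain b where b: "b : boxes" "fst c <= fst b" "fst d <= fst b" using common_box[OF c] by blast
	obtain kc where kc: "!!x. x : img c ==> trn c b x $ 3 = x $ 3 + kc" using box_in_box[OF F_box[OF c(1)] b(1,2)] by blast
	obtain kd where kd: "!!x. x : img d ==> trn d b x $ 3 = x $ 3 + kd" using box_in_box[OF F_box[OF c(2)] b(1,3)] by blast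
	obtain Kd where Kd: "vert_adjoint K Kd" using K(1) unfolding vert_def by blast
	have sub: "ccube (\<rho> c' + s) <= img c'" "ccube (\<rho> c' + s + a) <= img c'" if "c' : F" for c'
		using core_cube[OF that, of s] core_cube[OF that, of "s + a"] K by (simp_all add: add.assoc)
	show ?thesis
	proof (rule common_box_eqv[OF F_box[OF c(1)] F_box[OF c(2)] b vertD(1)[OF K(1) f] sub(2)[OF c(1)] vertD(1)[OF K(1) g] sub(2)[OF c(2)]])
		fix h :: "real => real" assume h: "smooth_on UNIV h"
		have kh: "smooth_on UNIV (Kd h)" by (rule vert_adjointD(1)[OF Kd h])
		have "integral UNIV (%y. dens (embd c (K f)) b y * h (y $ 3)) = integral UNIV (%x. K f x * h (x $ 3 + kc))"
			by (rule box_integral[OF F_box[OF c(1)] b(1,2) kc vertD(1)[OF K(1) f] sub(2)[OF c(1)] h])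
		also have "... = integral UNIV (%x. f x * Kd h (x $ 3 + kc))" by (rule vert_adjointD(2)[OF Kd h f])
		also have "... = integral UNIV (%y. dens (embd c f) b y * Kd h (y $ 3))"
			by (rule box_integral[OF F_box[OF c(1)] b(1,2) kc f sub(1)[OF c(1)] kh, symmetric])
		also have "... = integral UNIV (%x. g x * Kd h (x $ 3 + kd))"
			unfolding e by (rule box_integral[OF F_box[OF c(2)] b(1,3) kd g sub(1)[OF c(2)] kh])
		also have "... = integral UNIV (%x. K g x * h (x $ 3 + kd))" by (rule vert_adjointD(2)[OF Kd h g, symmetric])
		also have "... = integral UNIV (%y. dens (embd d (K g)) b y * h (y $ 3))"
			by (rule box_integral[OF F_box[OF c(2)] b(1,3) kd vertD(1)[OF K(1) g] sub(2)[OF c(2)] h, symmetric])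
		finally show "integral UNIV (%y. dens (embd c (K f)) b y * h (y $ 3)) = integral UNIV (%y. dens (embd d (K g)) b y * h (y $ 3))" .
	qed
qed

text \<open>Each \<open>g c\<close> is cut by the partition, and the piece cut out by
  \<open>u b\<close> is read as \<open>q b c\<close> in chart \<open>c\<close> and as
  \<open>p b c\<close> in chart \<open>b\<close>. By \<open>vert_local\<close> the operator may be
  applied to either. Collected in chart \<open>b\<close>, the pieces add up to \<open>u b\<close>
  times the zero form.\<close>

lemma E_vert_zero:
	assumes K: "vert a K" "0 <= a" "0 <= s" "s + a <= 10 * \<delta>" and g: "fam s g" and z: "E g = 0"
	shows "null (E (%c. K (g c)))"
proof -
	have s10: "s <= 10 * \<delta>" using K by linarith
	define w where "w = (%b c. smul (u b) (embd c (g c)))"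
	define q where "q = (%b c. dens (w b c) c)"
	define p where "p = (%b c. dens (w b c) b)"
	have gc: "test (\<rho> c + s) (g c)" if "c : F" for c using g that by (simp add: fam_def)
	note pr = embd_props[OF F_A core_cube[OF _ s10] gc]
	have w: "w b c : forms A 3" if "b : F" "c : F" for b c
		unfolding w_def by (rule forms_smul[OF pu_D(3)[OF that(1)] pr(1)]) (use that in auto)
	have p: "test (\<rho> b) (p b c)" "w b c = embd b (p b c)" if "b : F" "c : F" for b c
		using core_embd[OF w[OF that] that(1)] smul_u_vanish[of "u b" "embd c (g c)"] unfolding p_def w_def by blast+
	have qe: "q b c x = u b (chart_inv c x) * g c x" if "c : F" for b c x
		unfolding q_def w_def dens_smul using pr(3)[OF that that that] by simp
	have q: "test (\<rho> c + s) (q b c)" "w b c = embd c (q b c)" if bc: "b : F" "c : F" for b c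
	proof -
		note sp = embd_support[OF F_box[OF bc(2)] F_box[OF bc(2)] subset_refl gc[OF bc(2)] core_cube[OF bc(2) s10]]
		have v: "vanish_out (w b c) (chart_inv c ` ccube (\<rho> c + s))" unfolding w_def by (rule smul_vanish[OF pr(2)]) (use bc in auto)
		have "smooth_on UNIV (q b c)" unfolding q_def by (rule dens_test(1)[OF w[OF bc] F_A[OF bc(2)] sp(1,2) v])
		then show t: "test (\<rho> c + s) (q b c)" using gc[OF bc(2)] by (simp add: test_def qe[OF bc(2)])
		show "w b c = embd c (q b c)"
			by (rule embd_unique[OF w[OF bc] F_A[OF bc(2)] core_cube[OF bc(2) s10] t sp(2) v]) (simp add: q_def)
	qed
	have gq: "g c = (%x. \<Sum>b\<in>F. q b c x)" if c: "c : F" for c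
	proof
		fix x show "g c x = (\<Sum>b\<in>F. q b c x)"
		proof (cases "x : img c")
			case True
			have "chart_inv c x : topspace X" using chart_inv_into[OF chart[OF F_A[OF c]] True] chart_subset[OF F_A[OF c]] by blast
			then show ?thesis using pu_D(6) by (simp add: qe[OF c] sum_distrib_right[symmetric])
		next
			case False
			then have "x ~: ccube (\<rho> c + s)" using core_cube[OF c s10] by blast
			then have "g c x = 0" using gc[OF c] by (simp add: test_def)
			then show ?thesis by (simp add: qe[OF c])
		qed
	qed
	have pz: "(%x. \<Sum>c\<in>F. p b c x) = (%x. 0)" for b
	proof
		fix x
		have "(\<Sum>c\<in>F. p b c x) = u b (chart_inv b x) * dens (E g) b x"
			by (simp add: p_def w_def dens_smul E_def dens_sum sum_distrib_left)
		then show "(\<Sum>c\<in>F. p b c x) = 0" by (simp add: z dens_algebra)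
	qed
	have "E (%c. K (g c)) = (\<Sum>c\<in>F. \<Sum>b\<in>F. embd c (K (q b c)))"
		unfolding E_def
	proof (rule sum.cong[OF refl])
		fix c assume c: "c : F"
		have "K (g c) = (%x. \<Sum>b\<in>F. K (q b c) x)" unfolding gq[OF c] by (rule vert_sum[OF K(1) q(1)[OF _ c]])
		then show "embd c (K (g c)) = (\<Sum>b\<in>F. embd c (K (q b c)))" by (simp add: embd_sum)
	qed
	also have "... \<doteq> (\<Sum>c\<in>F. \<Sum>b\<in>F. embd b (K (p b c)))"
	proof (intro eqv_sum)
		fix c b assume bc: "c : F" "b : F"
		have "test (\<rho> b + s) (p b c)" by (rule test_mono[OF p(1)[OF bc(2,1)]]) (use K in simp)
		then show "embd c (K (q b c)) \<doteq> embd b (K (p b c))"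
			using vert_local[OF K bc q(1)[OF bc(2,1)]] p(2)[OF bc(2,1)] q(2)[OF bc(2,1)] by metis
	qed
	also have "(\<Sum>c\<in>F. \<Sum>b\<in>F. embd b (K (p b c))) = (\<Sum>b\<in>F. \<Sum>c\<in>F. embd b (K (p b c)))" by (rule sum.swap)
	also have "... = (\<Sum>b\<in>F. 0)"
	proof (rule sum.cong[OF refl])
		fix b assume b: "b : F"
		have "(\<Sum>c\<in>F. embd b (K (p b c))) = embd b (%x. \<Sum>c\<in>F. K (p b c) x)" by (simp add: embd_sum)
		also have "(%x. \<Sum>c\<in>F. K (p b c) x) = K (%x. \<Sum>c\<in>F. p b c x)" by (rule vert_sum[OF K(1) p(1)[OF b], symmetric])
		finally show "(\<Sum>c\<in>F. embd b (K (p b c))) = 0" by (simp only: pz vert_zero[OF K(1)] embd_zero)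
	qed
	finally show ?thesis by (simp add: eqv_def)
qed

lemma wedge_d_sum:
	assumes "!!i. i : J ==> g i : forms A 1"
	shows "form_wedge 1 2 \<alpha> (form_d A (\<Sum>i\<in>J. g i)) = (\<Sum>i\<in>J. form_wedge 1 2 \<alpha> (form_d A (g i)))"
proof -
	have "form_wedge 1 2 \<alpha> (\<Sum>i\<in>J. h i) = (\<Sum>i\<in>J. form_wedge 1 2 \<alpha> (h i))" for h
	proof (induction J rule: infinite_finite_induct)
		case (infinite J)
		show ?case by (simp only: sum.infinite[OF infinite] form_wedge_right(4))
	next
		case empty
		show ?case by (simp only: sum.empty form_wedge_right(4))
	next
		case (insert i J)
		show ?case by (simp only: sum.insert[OF insert(1,2)] form_wedge_right(1) insert(3))
	qed
	moreover have "form_d A (\<Sum>i\<in>J. g i) = (\<Sum>i\<in>J. form_d A (g i))" by (rule form_d_sum[OF assms])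
	ultimately show ?thesis by (simp only:)
qed

text \<open>A null sum of local densities is localised by multiplying the primitive with the partition of unity.\<close>

lemma E_vert:
	assumes K: "vert a K" "0 <= a" "0 <= s" "s + a <= 10 * \<delta>" and g: "fam s g" and z: "null (E g)"
	shows "null (E (%c. K (g c)))"
proof -
	have s10: "s <= 10 * \<delta>" using K by linarith
	obtain \<gamma> where \<gamma>: "\<gamma> : forms A 1" "E g = form_wedge 1 2 \<alpha> (form_d A \<gamma>)" using z unfolding null_def by blast
	define v where "v = (%b. form_wedge 1 2 \<alpha> (form_d A (smul (u b) \<gamma>)))"
	define n where "n = (%b. dens (v b) b)"
	have sg: "smul (u b) \<gamma> : forms A 1" if "b : F" for b by (rule forms_smul[OF pu_D(3)[OF that] \<gamma>(1)])
	have v: "v b : forms A 3" if "b : F" for b unfolding v_def by (rule forms_wedge_12[OF \<alpha> forms_d_1[OF sg[OF that]]])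
	have vv: "vanish_out (v b) (suppt (u b))" if "b : F" for b
		unfolding v_def by (rule form_wedge_vanish[OF form_d_vanish[OF sg[OF that] compact_closed[OF suppt_compact] smul_u_vanish]])
	have n: "test (\<rho> b) (n b)" "v b = embd b (n b)" if "b : F" for b
		using core_embd[OF v[OF that] that vv[OF that]] by (simp_all add: n_def)
	have fn: "fam s n" unfolding fam_def using test_mono[OF n(1)] K(3) by simp
	have "E n = (\<Sum>b\<in>F. v b)" unfolding E_def by (rule sum.cong[OF refl]) (simp add: n(2)[symmetric])
	also have "... = form_wedge 1 2 \<alpha> (form_d A (\<Sum>b\<in>F. smul (u b) \<gamma>))" unfolding v_def by (rule wedge_d_sum[OF sg, symmetric])
	also have "... = E g" unfolding partition_decompose[OF pu \<gamma>(1)] \<gamma>(2) ..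
	finally have En: "E n = E g" .
	obtain Kd where Kd: "vert_adjoint K Kd" using K(1) unfolding vert_def by blast
	have nK: "null (E (%c. K (n c)))" unfolding E_def
	proof (rule null_sum)
		fix b assume b: "b : F"
		show "null (embd b (K (n b)))"
		proof (rule null_plaque[OF F_box[OF b] _ _ vertD(1)[OF K(1) n(1)[OF b]]])
			show "ccube (\<rho> b + a) <= img b" "0 < \<rho> b + a" using core_cube[OF b, of a] core(1)[OF b] K by auto
			fix h :: "real => real" assume h: "smooth_on UNIV h"
			have "integral UNIV (%x. K (n b) x * h (x $ 3)) = integral UNIV (%x. n b x * Kd h (x $ 3))"
				using vert_adjointD(2)[OF Kd h n(1)[OF b], of 0] by simp
			also have "... = 0" unfolding n_def v_def
				by (rule null_local[OF F_box[OF b] sg[OF b] suppt_compact pu_D(5)[OF b] smul_u_vanish vert_adjointD(1)[OF Kd h]])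
			finally show "integral UNIV (%x. K (n b) x * h (x $ 3)) = 0" .
		qed
	qed
	\<comment> \<open>The families \<open>g\<close> and \<open>n\<close> have the same sum, so
	  \<open>E_vert_zero\<close> applies to their difference, while the densities
	  \<open>K (n b)\<close> are null chart by chart.\<close>
	have fd: "fam s (%c x. g c x - n c x)" using g fn unfolding fam_def by (auto intro: test_diff)
	have "E (%c x. g c x - n c x) = 0" using E_diff[OF g fn s10] En by simp
	from E_vert_zero[OF K fd this] have z: "null (E (%c. K (%x. g c x - n c x)))" .
	have "E (%c. K (%x. g c x - n c x)) = E (%c x. K (g c) x - K (n c) x)"
		unfolding E_def by (rule sum.cong[OF refl]) (use g fn vert_diff[OF K(1)] in \<open>auto simp: fam_def\<close>)
	also have "... = E (%c. K (g c)) - E (%c. K (n c))"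
		by (rule E_diff[OF fam_vert[OF K(1) g] fam_vert[OF K(1) fn] K(4)])
	finally have "E (%c. K (g c)) = E (%c. K (%x. g c x - n c x)) + E (%c. K (n c))" by simp
	then show ?thesis using null_add[OF z nK] by simp
qed

text \<open>The action of a vertical operator on 3-forms. It uses the family cut out by the
  partition of unity; by \<open>T_E\<close> any other family with the same sum gives an equivalent
  result.\<close>

definition T :: "((real ^ 3 => real) => real ^ 3 => real) => 'a dform => 'a dform" where
	"T K \<mu> = E (%c. K (loc \<mu> c))"

lemma T_forms: "vert a K ==> a <= 10 * \<delta> ==> \<mu> : forms A 3 ==> T K \<mu> : forms A 3"
	unfolding T_def using E_forms[OF fam_vert[OF _ loc_props(1)]] by simp

lemma T_E:
	assumes K: "vert a K" "0 <= a" "0 <= s" "s + a <= 10 * \<delta>" and g: "fam s g" and \<mu>: "\<mu> : forms A 3" "\<mu> \<doteq> E g"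
	shows "T K \<mu> \<doteq> E (%c. K (g c))"
proof -
	have s10: "s <= 10 * \<delta>" using K by linarith
	have l: "fam s (loc \<mu>)" using fam_mono[OF loc_props(1)[OF \<mu>(1)] K(3)] .
	have f: "fam s (%c x. loc \<mu> c x - g c x)" using l g unfolding fam_def by (auto intro: test_diff)
	have "null (E (%c x. loc \<mu> c x - g c x))"
		unfolding E_diff[OF l g s10] loc_props(2)[OF \<mu>(1)] using \<mu>(2) by (simp add: eqv_def)
	from E_vert[OF K f this] have z: "null (E (%c. K (%x. loc \<mu> c x - g c x)))" .
	have "E (%c. K (%x. loc \<mu> c x - g c x)) = E (%c x. K (loc \<mu> c) x - K (g c) x)"
		unfolding E_def by (rule sum.cong[OF refl]) (use g l vert_diff[OF K(1)] in \<open>auto simp: fam_def\<close>)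
	also have "... = T K \<mu> - E (%c. K (g c))"
		unfolding T_def by (rule E_diff[OF fam_vert[OF K(1) l] fam_vert[OF K(1) g] K(4)])
	finally have e: "E (%c. K (%x. loc \<mu> c x - g c x)) = T K \<mu> - E (%c. K (g c))" .
	show ?thesis unfolding eqv_def e[symmetric] by (rule z)
qed

lemma T_eqv:
	assumes K: "vert a K" "0 <= a" "a <= 10 * \<delta>" and \<mu>: "\<mu> : forms A 3" "\<nu> : forms A 3" "\<mu> \<doteq> \<nu>"
	shows "T K \<mu> \<doteq> T K \<nu>"
	unfolding T_def[of K \<nu>] by (rule T_E[OF K(1,2) order_refl _ loc_props(1)[OF \<mu>(2)] \<mu>(1)]) (use K \<mu> loc_props(2) in simp_all)

text \<open>The form \<open>T L \<mu>\<close> comes with the family \<open>L (loc \<mu> c)\<close>,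
  which by \<open>T_E\<close> may be used in place of its own cut. The supports of that family have
  grown by \<open>b\<close>, hence the bound on \<open>a + b\<close>.\<close>

lemma T_T:
	assumes K: "vert a K" "0 <= a" and L: "vert b L" "0 <= b" and ab: "a + b <= 10 * \<delta>" and \<mu>: "\<mu> : forms A 3"
	shows "T K (T L \<mu>) \<doteq> T (%f. K (L f)) \<mu>"
proof -
	have b10: "b <= 10 * \<delta>" using K ab by linarith
	have "fam b (%c. L (loc \<mu> c))" using fam_vert[OF L(1) loc_props(1)[OF \<mu>]] by simp
	from T_E[OF K L(2) _ this T_forms[OF L(1) b10 \<mu>]] show ?thesis
		unfolding T_def[of "%f. K (L f)"] using ab eqv_refl by (simp add: T_def add.commute)
qed

lemma T_embd:
	assumes K: "vert a K" "0 <= a" "0 <= s" "s + a <= 10 * \<delta>" and c: "c : F" and f: "test (\<rho> c + s) f"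
		and \<mu>: "\<mu> : forms A 3" "\<mu> \<doteq> embd c f"
	shows "T K \<mu> \<doteq> embd c (K f)"
proof -
	define g where "g = (%d. if d = c then f else (%x. 0))"
	have g: "fam s g" using f by (simp add: fam_def g_def)
	have single: "E (%d. if d = c then k else (%x. 0)) = embd c k" for k
		unfolding E_def using c pu_D(1) by (simp add: embd_zero if_distrib sum.remove[of F c])
	have "T K \<mu> \<doteq> E (%d. K (g d))" by (rule T_E[OF K g \<mu>(1)]) (use \<mu>(2) single in \<open>simp add: g_def\<close>)
	also have "(%d. K (g d)) = (%d. if d = c then K f else (%x. 0))" by (auto simp: g_def vert_zero[OF K(1)])
	finally show ?thesis by (simp add: single)
qed

lemma T_cong: "(!!r f. test r f ==> K f = L f) ==> \<mu> : forms A 3 ==> T K \<mu> = T L \<mu>"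
	unfolding T_def E_def using loc_props(1)[of \<mu>] by (auto simp: fam_def intro!: sum.cong)

lemma T_id: "\<mu> : forms A 3 ==> T (%f. f) \<mu> = \<mu>"
	unfolding T_def using loc_props(2) by simp

lemma T_op_diff:
	assumes K: "vert a K" "vert b L" "a <= 10 * \<delta>" "b <= 10 * \<delta>" and \<mu>: "\<mu> : forms A 3"
	shows "T (%f x. K f x - L f x) \<mu> = T K \<mu> - T L \<mu>"
	unfolding T_def
	by (rule E_diff[of "max a b"])
		(use fam_mono[OF fam_vert[OF K(1) loc_props(1)[OF \<mu>]]] fam_mono[OF fam_vert[OF K(2) loc_props(1)[OF \<mu>]]] K in auto)

lemma T_scale:
	assumes K: "vert a K" "a <= 10 * \<delta>" and \<mu>: "\<mu> : forms A 3"
	shows "T K (scale k \<mu>) = scale k (T K \<mu>)"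
proof -
	have "T K (scale k \<mu>) = (\<Sum>c\<in>F. embd c (%x. k * K (loc \<mu> c) x))"
		unfolding T_def E_def
	proof (rule sum.cong[OF refl])
		fix c assume "c : F"
		then have "test (\<rho> c) (loc \<mu> c)" using loc_props(1)[OF \<mu>] by (simp add: fam_def)
		moreover have "loc (scale k \<mu>) c = (%x. k * loc \<mu> c x)" by (simp add: fun_eq_iff loc_eq dens_algebra)
		ultimately show "embd c (K (loc (scale k \<mu>) c)) = embd c (%x. k * K (loc \<mu> c) x)" using vertD(3)[OF K(1)] by simp
	qed
	also have "... = (\<Sum>c\<in>F. scale k (embd c (K (loc \<mu> c))))"
	proof (rule sum.cong[OF refl])
		fix c assume c: "c : F"
		have t: "test (\<rho> c + a) (K (loc \<mu> c))" using fam_vert[OF K(1) loc_props(1)[OF \<mu>]] c by (simp add: fam_def)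
		show "embd c (%x. k * K (loc \<mu> c) x) = scale k (embd c (K (loc \<mu> c)))"
			by (rule embd_lincomb(3)[OF F_A[OF c] core_cube[OF c K(2)] t t])
	qed
	also have "... = scale k (T K \<mu>)"
		by (simp add: T_def E_def scale_def fun_eq_iff sum_fun3 sum_distrib_left)
	finally show ?thesis .
qed

lemma T_diff:
	assumes K: "vert a K" "a <= 10 * \<delta>" and \<mu>: "\<mu> : forms A 3" "\<nu> : forms A 3"
	shows "T K (\<mu> - \<nu>) = T K \<mu> - T K \<nu>"
proof -
	have "T K (\<mu> - \<nu>) = E (%c x. K (loc \<mu> c) x - K (loc \<nu> c) x)"
		unfolding T_def E_def
	proof (rule sum.cong[OF refl])
		fix c assume "c : F"
		then have "test (\<rho> c) (loc \<mu> c)" "test (\<rho> c) (loc \<nu> c)" using loc_props(1)[OF \<mu>(1)] loc_props(1)[OF \<mu>(2)] by (simp_all add: fam_def)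
		moreover have "loc (\<mu> - \<nu>) c = (%x. loc \<mu> c x - loc \<nu> c x)" by (simp add: fun_eq_iff loc_eq dens_algebra right_diff_distrib)
		ultimately show "embd c (K (loc (\<mu> - \<nu>) c)) = embd c (%x. K (loc \<mu> c) x - K (loc \<nu> c) x)" using vert_diff[OF K(1)] by simp
	qed
	also have "... = T K \<mu> - T K \<nu>"
		unfolding T_def by (rule E_diff[OF fam_vert[OF K(1) loc_props(1)[OF \<mu>(1)]] fam_vert[OF K(1) loc_props(1)[OF \<mu>(2)]]]) (use K in simp)
	finally show ?thesis .
qed

text \<open>The resulting form itself is nonnegative, not just some equivalent one, since the cut
  family is nonnegative in every chart.\<close>

lemma T_pos:
	assumes K: "vert a K" "a <= 10 * \<delta>" "!!r f x. test r f ==> (!!x. 0 <= f x) ==> 0 <= K f x" and \<mu>: "\<mu> : forms A 3" "pos \<mu>"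
	shows "pos (T K \<mu>)"
	unfolding T_def E_def
proof (rule pos_sum)
	fix c assume c: "c : F"
	have l: "test (\<rho> c) (loc \<mu> c)" using loc_props(1)[OF \<mu>(1)] c by (simp add: fam_def)
	have nn: "0 <= loc \<mu> c x" for x
	proof (cases "x : img c")
		case True
		have "chart_inv c x : topspace X" using chart_inv_into[OF chart[OF F_A[OF c]] True] chart_subset[OF F_A[OF c]] by blast
		then show ?thesis using pu_D(4)[OF c] \<mu>(2) F_A[OF c] True by (simp add: loc_eq pos_def)
	next
		case False
		then show ?thesis using vec_outside(3)[OF _ \<mu>(1)] by (simp add: loc_eq)
	qed
	show "pos (embd c (K (loc \<mu> c)))"
		by (rule embd_pos[OF F_A[OF c] core_cube[OF c K(2)] vertD(1)[OF K(1) l] K(3)[OF l nn]])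
qed

text \<open>In a box, \<open>d\<sigma>\<close> is the divergence of \<open>\<sigma>\<close>, of which only the vertical part survives modulo null densities.\<close>

lemma form_d_eqv:
	assumes \<sigma>: "\<sigma> : forms A 2"
	shows "form_d A \<sigma> \<doteq> T vderiv (form_wedge 1 2 \<alpha> \<sigma>)"
proof -
	define s where "s = (%c. smul (u c) \<sigma>)"
	have s: "s c : forms A 2" if "c : F" for c unfolding s_def by (rule forms_smul[OF pu_D(3)[OF that] \<sigma>])
	have "form_d A (\<Sum>c\<in>F. s c) = (\<Sum>c\<in>F. form_d A (s c))" by (rule form_d_sum[OF s])
	then have "form_d A \<sigma> = (\<Sum>c\<in>F. form_d A (s c))" unfolding s_def partition_decompose[OF pu \<sigma>] .
	also have "... \<doteq> (\<Sum>c\<in>F. embd c (vderiv (loc (form_wedge 1 2 \<alpha> \<sigma>) c)))"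
	proof (rule eqv_sum)
		fix c assume c: "c : F"
		note cA = F_A[OF c]
		define a where "a = vec2 (s c) c"
		have v: "vanish_out (s c) (suppt (u c))" unfolding s_def by (rule smul_u_vanish)
		note at = vec2_test[OF s[OF c] cA suppt_compact pu_D(5)[OF c] v, folded a_def]
		have "a x = 0" if "x ~: ccube (\<rho> c)" for x using at(2)[of x] core(4)[OF c] that by blast
		then have t: "test (\<rho> c) (%x. a x $ i)" for i
			unfolding test_def using smooth_on_vec_nth[OF open_UNIV at(1)] by simp
		have a3: "loc (form_wedge 1 2 \<alpha> \<sigma>) c = (%x. a x $ 3)"
		proof
			fix x show "loc (form_wedge 1 2 \<alpha> \<sigma>) c x = a x $ 3"
			proof (cases "x : img c")
				case True
				show ?thesis unfolding loc_eq box_wedge[OF F_box[OF c] True \<sigma>]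
					by (simp add: a_def s_def vec2_def smul_def vec3_simps)
			next
				case False
				then have "a x = 0" unfolding a_def using vec_outside(2)[OF _ s[OF c]] by blast
				then show ?thesis using vec_outside(3)[OF _ forms_wedge_12[OF \<alpha> \<sigma>]] False by (simp add: loc_eq)
			qed
		qed
		define f where "f = (%x. fd (%x. a x $ 1) x (ax 1) + fd (%x. a x $ 2) x (ax 2))"
		have tf: "test (\<rho> c) f" unfolding f_def by (intro test_add test_fd t)
		have tv: "test (\<rho> c) (vderiv (%x. a x $ 3))" using vertD(1)[OF vert_vderiv t] by simp
		have c0: "ccube (\<rho> c) <= img c" using core_cube[OF c, of 0] \<delta> by simp
		have "form_d A (s c) = embd c (%x. f x + vderiv (%x. a x $ 3) x)"
		proof (rule embd_unique[OF forms_d_2[OF s[OF c]] cA c0 test_add[OF tf tv] pu_D(5)[OF c]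
					form_d_vanish[OF s[OF c] compact_closed[OF suppt_compact] v]])
			fix x assume x: "x : img c"
			show "dens (form_d A (s c)) c x = f x + vderiv (%x. a x $ 3) x"
				unfolding dens_def form_d_2[OF s[OF c] cA x] form3_std_basis a_def[symmetric]
				by (simp add: f_def vderiv_def divg_def fd_vec_nth[OF at(1) UNIV_I])
		qed
		also have "... = embd c f + embd c (vderiv (%x. a x $ 3))" by (rule embd_lincomb(1)[OF cA c0 tf tv])
		also have "... \<doteq> 0 + embd c (vderiv (%x. a x $ 3))"
		proof (rule eqv_add[OF _ eqv_refl])
			have "null (embd c f)"
				by (rule null_plaque[OF F_box[OF c] c0 core(1)[OF c] tf]) (unfold f_def, rule plaque_divergence[OF t t])
			then show "embd c f \<doteq> 0" by (simp add: eqv_def)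
		qed
		finally show "form_d A (s c) \<doteq> embd c (vderiv (loc (form_wedge 1 2 \<alpha> \<sigma>) c))" unfolding a3 add_0_left .
	qed
	finally show ?thesis by (simp add: T_def E_def)
qed

end

section \<open>Invariant positive 3-forms and averaging\<close>

lemma vert_cmult: "vert 0 (%f x. k * f x)"
proof -
	have "vert_adjoint (%f x. k * f x) (%h t. k * h t)"
		unfolding vert_adjoint_def by (auto intro: smooth_on_mult simp: mult_ac)
	then have "\<exists>Kd. vert_adjoint (%f x. k * f x) Kd" by blast
	then show ?thesis unfolding vert_def by (simp add: test_cmult distrib_left mult_ac)
qed

lemma (in max_atlas) dens_sign:
	assumes w: "w : forms A 3" and c: "c : A" "d : A" "q : fst c" "q : fst d"
	shows "0 < dens w c (snd c q) ==> 0 < dens w d (snd d q)"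
	using dens_transition[OF w c(2,1) overlapI[OF c(4,3)]] det_transition[OF c(2,1) overlapI[OF c(4,3)]]
		transition_chart[OF chart[OF c(2)] c(4), of c] by simp

lemma (in max_atlas) open_positive:
	assumes w: "w : forms A 3" and c: "c : A"
	shows "openin X {q : fst c. 0 < dens w c (snd c q)}"
proof -
	have "open (img c \<inter> dens w c -` {0<..})"
		by (rule continuous_open_preimage[OF smooth_on_continuous[OF smooth_dens[OF w c]] open_image[OF c] open_greaterThan])
	from chart_open_preimage[OF chart[OF c] this] show ?thesis
		by (rule back_subst[where P = "openin X"]) (auto simp: chart_image_def)
qed

text \<open>Near each point some multiple of \<open>e\<close> exceeds \<nu>; by compactness finitely
  many multiples suffice, and their sum works everywhere.\<close>

lemma (in max_atlas) dominated:
	assumes e: "e : forms A 3" "!!c x. c : A ==> x : img c ==> 0 < dens e c x" and \<nu>: "\<nu> : forms A 3"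
	shows "\<exists>C. pos (scale C e - \<nu>)"
proof -
	have "\<exists>m c. 0 < m & c : A & p : fst c & 0 < dens (scale m e - \<nu>) c (snd c p)" if p: "p : topspace X" for p
	proof -
		obtain c where c: "c : A" "p : fst c" using covers[OF p] by blast
		have e0: "0 < dens e c (snd c p)" by (rule e(2)[OF c(1) chart_into[OF c(2)]])
		define m where "m = \<bar>dens \<nu> c (snd c p)\<bar> / dens e c (snd c p) + 1"
		have "m * dens e c (snd c p) = \<bar>dens \<nu> c (snd c p)\<bar> + dens e c (snd c p)"
			using e0 by (simp add: m_def field_simps)
		moreover have "0 < m" using e0 by (simp add: m_def add_nonneg_pos)
		ultimately show ?thesis using c e0 by (intro exI[of _ m] exI[of _ c]) (simp add: dens_algebra)
	qed
	then obtain m c where mc: "!!p. p : topspace X ==> 0 < m p & c p : A & p : fst (c p) & 0 < dens (scale (m p) e - \<nu>) (c p) (snd (c p) p)"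
		by metis
	define U where "U = (%p. {q : fst (c p). 0 < dens (scale (m p) e - \<nu>) (c p) (snd (c p) q)})"
	have f: "scale r e - \<nu> : forms A 3" for r by (intro forms_diff forms_scale e(1) \<nu>)
	have "openin X (U p) & p : U p" if "p : topspace X" for p
		using open_positive[OF f, of "c p" "m p"] mc[OF that] by (simp add: U_def)
	from finite_subcover[OF this] obtain P where P: "finite P" "P <= topspace X" "topspace X <= (\<Union>p\<in>P. U p)" by blast
	define C where "C = (\<Sum>p\<in>P. m p)"
	have "pos (scale C e - \<nu>)" unfolding pos_def
	proof (intro ballI)
		fix d x assume d: "d : A" "x : img d"
		define q where "q = chart_inv d x"
		have q: "q : fst d" "snd d q = x" unfolding q_def using chart_inv_into[OF chart[OF d(1)] d(2)] chart_chart_inv[OF chart[OF d(1)] d(2)] by simp_all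
		then obtain p where p: "p : P" "q : U p" using P(3) chart_subset[OF d(1)] by blast
		note mp = mc[OF subsetD[OF P(2) p(1)]]
		have "0 < dens (scale (m p) e - \<nu>) d (snd d q)"
			by (rule dens_sign[OF f _ d(1) _ q(1)]) (use mp p(2) in \<open>auto simp: U_def\<close>)
		moreover have "m p <= C" unfolding C_def by (rule member_le_sum[OF p(1) _ P(1)]) (use mc P(2) in \<open>auto intro: less_imp_le\<close>)
		then have "m p * dens e d x <= C * dens e d x" using e(2)[OF d] by (intro mult_right_mono) auto
		ultimately show "0 <= dens (scale C e - \<nu>) d x" by (simp add: q(2) dens_algebra)
	qed
	then show ?thesis ..
qed

context adapted
begin

abbreviation U where "U s \<equiv> T (shift s)"
abbreviation D where "D \<equiv> T vderiv"
abbreviation J where "J a b \<equiv> vint (%t. 1) a b"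

lemma vJ: "\<bar>a\<bar> <= \<delta> ==> \<bar>b\<bar> <= \<delta> ==> vert \<delta> (J a b)"
	by (rule vert_vint) auto

lemma U_forms: "\<bar>s\<bar> <= \<delta> ==> \<mu> : forms A 3 ==> U s \<mu> : forms A 3"
	by (rule T_forms[OF vert_shift]) (use \<delta> in auto)

lemma D_forms: "\<mu> : forms A 3 ==> D \<mu> : forms A 3"
	by (rule T_forms[OF vert_vderiv]) (use \<delta> in auto)

lemma J_forms: "\<bar>a\<bar> <= \<delta> ==> \<bar>b\<bar> <= \<delta> ==> \<mu> : forms A 3 ==> T (J a b) \<mu> : forms A 3"
	by (rule T_forms[OF vJ]) (use \<delta> in auto)

lemma U_eqv: "\<bar>s\<bar> <= \<delta> ==> \<mu> : forms A 3 ==> \<nu> : forms A 3 ==> \<mu> \<doteq> \<nu> ==> U s \<mu> \<doteq> U s \<nu>"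
	by (rule T_eqv[OF vert_shift]) (use \<delta> in auto)

lemma T_zero: assumes "vert a K" "a <= 10 * \<delta>" shows "T K 0 = 0"
	using T_diff[OF assms forms_0 forms_0] by simp

lemma T_add:
	assumes "vert a K" "a <= 10 * \<delta>" "\<mu> : forms A 3" "\<nu> : forms A 3"
	shows "T K (\<mu> + \<nu>) = T K \<mu> + T K \<nu>"
	using T_diff[OF assms(1,2) forms_add[OF assms(3,4)] assms(4)] by (simp add: algebra_simps)

lemma D_sum: "(!!i. i : Q ==> w i : forms A 3) ==> D (\<Sum>i\<in>Q. w i) = (\<Sum>i\<in>Q. D (w i))"
proof (induction Q rule: infinite_finite_induct)
	case (insert i Q)
	have "D (w i + (\<Sum>i\<in>Q. w i)) = D (w i) + D (\<Sum>i\<in>Q. w i)"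
		by (rule T_add[OF vert_vderiv]) (use \<delta> insert in \<open>auto intro: forms_sum\<close>)
	moreover have "D (\<Sum>i\<in>Q. w i) = (\<Sum>i\<in>Q. D (w i))" using insert by blast
	ultimately show ?case by (simp only: sum.insert[OF insert.hyps])
next
	case (infinite Q)
	show ?case unfolding sum.infinite[OF infinite.hyps] by (rule T_zero[OF vert_vderiv]) (use \<delta> in simp)
next
	case empty
	show ?case unfolding sum.empty by (rule T_zero[OF vert_vderiv]) (use \<delta> in simp)
qed

lemma shift_shift: "shift a (shift b f) = shift (a + b) f"
	by (simp add: shift_def fun_eq_iff algebra_simps)

lemma shift_0: "shift 0 f = f"
	by (simp add: shift_def fun_eq_iff)

lemma U_0: "\<mu> : forms A 3 ==> U 0 \<mu> = \<mu>"
	using T_cong[of "shift 0" "%f. f" \<mu>] T_id shift_0 by simp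

lemma U_U:
	assumes "\<bar>a\<bar> <= \<delta>" "\<bar>b\<bar> <= \<delta>" "\<mu> : forms A 3" shows "U a (U b \<mu>) \<doteq> U (a + b) \<mu>"
	using T_T[OF vert_shift[of a] _ vert_shift[of b] _ _ assms(3)] assms \<delta> by (simp add: shift_shift)

lemma U_cancel:
	assumes "\<mu> : forms A 3" "\<nu> : forms A 3" "U \<delta> \<mu> \<doteq> U \<delta> \<nu>" shows "\<mu> \<doteq> \<nu>"
proof -
	have inv: "U (- \<delta>) (U \<delta> w) \<doteq> w" if "w : forms A 3" for w
		using U_U[of "- \<delta>" \<delta> w] that \<delta> by (simp add: U_0)
	have "U (- \<delta>) (U \<delta> \<mu>) \<doteq> U (- \<delta>) (U \<delta> \<nu>)"
		by (rule U_eqv[OF _ U_forms[OF _ assms(1)] U_forms[OF _ assms(2)] assms(3)]) (use \<delta> in simp_all)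
	then show ?thesis using inv[OF assms(1)] inv[OF assms(2)] eqv_sym eqv_trans by metis
qed

text \<open>Long translations are taken as iterates of the step \<delta>, each of which stays within
  the margin of the charts.\<close>

lemma Un_forms: "\<mu> : forms A 3 ==> (U \<delta> ^^ n) \<mu> : forms A 3"
	using \<delta> by (induction n) (auto intro: U_forms)

lemma Un_cancel: "\<mu> : forms A 3 ==> \<nu> : forms A 3 ==> (U \<delta> ^^ n) \<mu> \<doteq> (U \<delta> ^^ n) \<nu> ==> \<mu> \<doteq> \<nu>"
	using \<delta> by (induction n) (auto intro: U_cancel Un_forms)

lemma Un_commute:
	assumes a: "\<bar>a\<bar> <= \<delta>" and \<mu>: "\<mu> : forms A 3"
	shows "U a ((U \<delta> ^^ n) \<mu>) \<doteq> (U \<delta> ^^ n) (U a \<mu>)"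
proof (induction n)
	case (Suc n)
	have d: "\<bar>\<delta>\<bar> <= \<delta>" using \<delta> by simp
	have f: "(U \<delta> ^^ n) \<mu> : forms A 3" by (rule Un_forms[OF \<mu>])
	have "U a (U \<delta> ((U \<delta> ^^ n) \<mu>)) \<doteq> U (a + \<delta>) ((U \<delta> ^^ n) \<mu>)" by (rule U_U[OF a d f])
	also have "... \<doteq> U \<delta> (U a ((U \<delta> ^^ n) \<mu>))"
		using eqv_sym[OF U_U[OF d a f]] by (simp add: add.commute)
	also have "... \<doteq> U \<delta> ((U \<delta> ^^ n) (U a \<mu>))" by (rule U_eqv[OF d U_forms[OF a f] Un_forms[OF U_forms[OF a \<mu>]] Suc.IH])
	finally show ?case by simp
qed (simp add: eqv_refl)

lemma Un_diff: "\<mu> : forms A 3 ==> \<nu> : forms A 3 ==> (U \<delta> ^^ n) (\<mu> - \<nu>) = (U \<delta> ^^ n) \<mu> - (U \<delta> ^^ n) \<nu>"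
proof (induction n)
	case (Suc n)
	have "U \<delta> ((U \<delta> ^^ n) \<mu> - (U \<delta> ^^ n) \<nu>) = U \<delta> ((U \<delta> ^^ n) \<mu>) - U \<delta> ((U \<delta> ^^ n) \<nu>)"
		by (rule T_diff[OF vert_shift _ Un_forms[OF Suc.prems(1)] Un_forms[OF Suc.prems(2)]]) (use \<delta> in simp)
	then show ?case using Suc.IH[OF Suc.prems] by (simp only: funpow.simps o_apply)
qed (simp only: funpow_0)

lemma Un_pos: "\<mu> : forms A 3 ==> pos \<mu> ==> pos ((U \<delta> ^^ n) \<mu>)"
proof (induction n)
	case (Suc n)
	have nn: "0 <= shift \<delta> f x" if "!!x. 0 <= f x" for f x using that by (simp add: shift_def)
	have "pos (U \<delta> ((U \<delta> ^^ n) \<mu>))"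
		by (rule T_pos[OF vert_shift _ nn Un_forms[OF Suc.prems(1)] Suc.IH[OF Suc.prems]]) (use \<delta> in simp_all)
	then show ?case by simp
qed simp

text \<open>The fundamental theorem of calculus along the vertical direction, with the derivative
  taken after or before the integration. Since \<open>shift t\<close> moves upward, the lower limit
  carries the positive sign.\<close>

lemma D_J:
	assumes ab: "\<bar>a\<bar> <= \<delta>" "\<bar>b\<bar> <= \<delta>" "a <= b" and \<mu>: "\<mu> : forms A 3"
	shows "D (T (J a b) \<mu>) \<doteq> U a \<mu> - U b \<mu>" "T (J a b) (D \<mu>) \<doteq> U a \<mu> - U b \<mu>"
proof -
	have e: "T (%f x. shift a f x - shift b f x) \<mu> = U a \<mu> - U b \<mu>"
		by (rule T_op_diff[OF vert_shift vert_shift _ _ \<mu>]) (use ab \<delta> in auto)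
	have "D (T (J a b) \<mu>) \<doteq> T (%f. vderiv (J a b f)) \<mu>"
		by (rule T_T[OF vert_vderiv _ vJ[OF ab(1,2)] _ _ \<mu>]) (use \<delta> in auto)
	also have "... = T (%f x. shift a f x - shift b f x) \<mu>"
		by (rule T_cong[OF _ \<mu>]) (simp add: vint_vderiv vint_1_vderiv ab(3))
	finally show "D (T (J a b) \<mu>) \<doteq> U a \<mu> - U b \<mu>" unfolding e .
	have "T (J a b) (D \<mu>) \<doteq> T (%f. J a b (vderiv f)) \<mu>"
		by (rule T_T[OF vJ[OF ab(1,2)] _ vert_vderiv _ _ \<mu>]) (use \<delta> in auto)
	also have "... = T (%f x. shift a f x - shift b f x) \<mu>"
		by (rule T_cong[OF _ \<mu>]) (simp add: vint_1_vderiv ab(3))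
	finally show "T (J a b) (D \<mu>) \<doteq> U a \<mu> - U b \<mu>" unfolding e .
qed

lemma D_zero_T:
	assumes "vert \<delta> K" "\<mu> : forms A 3" "D \<mu> \<doteq> 0" shows "T K (D \<mu>) \<doteq> 0"
	using T_eqv[OF assms(1) _ _ D_forms[OF assms(2)] forms_0 assms(3)] T_zero[OF assms(1)] \<delta> by simp

lemma D_zero_U:
	assumes \<mu>: "\<mu> : forms A 3" "D \<mu> \<doteq> 0" shows "U \<delta> \<mu> \<doteq> \<mu>"
proof -
	have "U 0 \<mu> - U \<delta> \<mu> \<doteq> T (J 0 \<delta>) (D \<mu>)" by (rule eqv_sym, rule D_J(2)) (use \<mu> \<delta> in auto)
	also have "... \<doteq> 0" by (rule D_zero_T[OF vJ \<mu>]) (use \<delta> in auto)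
	finally have "\<mu> \<doteq> U \<delta> \<mu>" by (simp add: U_0[OF \<mu>(1)] eqv_def)
	then show ?thesis by (rule eqv_sym)
qed

text \<open>By \<open>vint_linear_vderiv\<close> the difference of the two sides is, modulo null
  forms, an operator applied to \<open>D \<mu>\<close>.\<close>

lemma D_zero_J:
	assumes \<mu>: "\<mu> : forms A 3" "D \<mu> \<doteq> 0" shows "T (J 0 \<delta>) \<mu> \<doteq> scale \<delta> \<mu>"
proof -
	have \<kappa>: "continuous_on {0..\<delta>} (%t. \<delta> - t)" by (intro continuous_intros)
	have vK: "vert \<delta> (vint (%t. \<delta> - t) 0 \<delta>)" by (rule vert_vint[OF \<kappa>]) (use \<delta> in auto)
	have s: "T (%f x. \<delta> * f x) \<mu> = scale \<delta> \<mu>"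
	proof -
		have "(%c x. \<delta> * loc \<mu> c x) = loc (scale \<delta> \<mu>)" by (simp add: fun_eq_iff loc_eq dens_algebra)
		then show ?thesis unfolding T_def by (simp add: loc_props(2) forms_scale \<mu>(1))
	qed
	have "scale \<delta> \<mu> - T (J 0 \<delta>) \<mu> = T (%f x. \<delta> * f x - J 0 \<delta> f x) \<mu>"
		unfolding s[symmetric] by (rule T_op_diff[OF vert_cmult vJ _ _ \<mu>(1), symmetric]) (use \<delta> in auto)
	also have "... = T (%f. vint (%t. \<delta> - t) 0 \<delta> (vderiv f)) \<mu>"
		by (rule T_cong[OF _ \<mu>(1)]) (simp add: vint_linear_vderiv \<delta> less_imp_le)
	also have "... \<doteq> T (vint (%t. \<delta> - t) 0 \<delta>) (D \<mu>)"
		by (rule eqv_sym, rule T_T[OF vK _ vert_vderiv _ _ \<mu>(1)]) (use \<delta> in auto)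
	also have "... \<doteq> 0" by (rule D_zero_T[OF vK \<mu>])
	finally have "scale \<delta> \<mu> \<doteq> T (J 0 \<delta>) \<mu>" by (simp add: eqv_def)
	then show ?thesis by (rule eqv_sym)
qed

section \<open>Bumps, their upward orbits and invariant densities\<close>

definition bump :: "'a chart => real ^ 3 => real ^ 3 => real" where
	"bump c x = (%y. ball_bump 0 \<delta> (y - x))"

lemma bump_test: "x : ccube r ==> test (\<delta> + r) (bump c x)"
proof -
	assume x: "x : ccube r"
	have "test \<delta> (ball_bump (0::real^3) \<delta>)"
		unfolding test_def
	proof (intro conjI allI impI)
		show "smooth_on UNIV (ball_bump (0::real^3) \<delta>)" by (rule smooth_ball_bump)
		fix y :: "real ^ 3" assume "y ~: ccube \<delta>"
		then obtain i where "\<delta> < \<bar>y $ i\<bar>" by (rule not_ccubeE)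
		then have "y ~: ball 0 \<delta>" using component_le_norm_cart[of y i] by simp
		then show "ball_bump 0 \<delta> y = 0" using ball_bump_eq_0_iff[OF \<delta>] by blast
	qed
	from test_shift[OF this, of "- x" r] x show ?thesis by (simp add: bump_def ccube_def)
qed

lemma shift_bump: "shift s (bump c x) = bump c (x + s *R ax 3)"
	by (simp add: shift_def bump_def fun_eq_iff algebra_simps)

lemma bump_embd:
	assumes "c : F" "x : ccube (\<rho> c + s)" "s <= 8 * \<delta>"
	shows "test (\<rho> c + (s + \<delta>)) (bump c x)" "ccube (\<rho> c + (s + \<delta>)) <= img c" "embd c (bump c x) : forms A 3"
		"pos (embd c (bump c x))"
proof -
	show t: "test (\<rho> c + (s + \<delta>)) (bump c x)" using bump_test[OF assms(2)] by (simp add: add_ac)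
	show k: "ccube (\<rho> c + (s + \<delta>)) <= img c" by (rule core_cube[OF assms(1)]) (use assms(3) \<delta> in simp)
	show "embd c (bump c x) : forms A 3" by (rule embd_props(1)[OF F_A[OF assms(1)] k t])
	show "pos (embd c (bump c x))" by (rule embd_pos[OF F_A[OF assms(1)] k t]) (simp add: bump_def ball_bump_nonneg)
qed

text \<open>All bumps are translates of one function, so their plaque integrals depend only on the
  height of the centre; modulo null forms its position within the plaque does not matter.\<close>

lemma bump_eqv:
	assumes c: "c : F" "d : F" and b: "b : boxes" "fst c <= fst b" "fst d <= fst b"
		and x: "x : ccube (\<rho> c + 2 * \<delta>)" "y : ccube (\<rho> d + 2 * \<delta>)"
		and h: "trn c b x $ 3 = trn d b y $ 3"
	shows "embd c (bump c x) \<doteq> embd d (bump d y)"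
proof -
	have s: "2 * \<delta> <= 8 * \<delta>" using \<delta> by simp
	note bc = bump_embd[OF c(1) x(1) s] and bd = bump_embd[OF c(2) x(2) s]
	have height: "integral UNIV (%z. dens (embd c (bump c x)) b z * h (z $ 3)) =
			integral UNIV (%z::real^3. ball_bump 0 \<delta> z * h (z $ 3 + trn c b x $ 3))"
		if c: "c : F" "fst c <= fst b" and x: "x : ccube (\<rho> c + 2 * \<delta>)" and h: "smooth_on UNIV h" for c x h
	proof -
		note bc = bump_embd[OF c(1) x s]
		obtain k where k: "!!z. z : img c ==> trn c b z $ 3 = z $ 3 + k" using box_in_box[OF F_box[OF c(1)] b(1) c(2)] by blast
		have xi: "x : img c" using core_cube[OF c(1), of "2 * \<delta>"] x \<delta> by auto
		have t0: "test (\<delta> + 0) (bump c 0)" by (rule bump_test) (simp add: ccube_def)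
		have "cc (\<delta> + 0) (%z. bump c 0 z * h (z $ 3 + (x $ 3 + k)))" by (rule test_cc[OF test_mult[OF t0 smooth_on_height[OF h]]])
		from integral_shift_UNIV[OF this, of "- x"]
		have "integral UNIV (%z. bump c x z * h (z $ 3 + k)) = integral UNIV (%z::real^3. ball_bump 0 \<delta> z * h (z $ 3 + (x $ 3 + k)))"
			by (simp add: bump_def)
		then show ?thesis
			unfolding k[OF xi] using box_integral[OF F_box[OF c(1)] b(1) c(2) k bc(1,2) h] by simp
	qed
	show ?thesis
	proof (rule common_box_eqv[OF F_box[OF c(1)] F_box[OF c(2)] b bc(1,2) bd(1,2)])
		fix k :: "real => real" assume k: "smooth_on UNIV k"
		show "integral UNIV (%z. dens (embd c (bump c x)) b z * k (z $ 3)) = integral UNIV (%z. dens (embd d (bump d y)) b z * k (z $ 3))"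
			by (rule trans[OF height[OF c(1) b(2) x(1) k, unfolded h] height[OF c(2) b(3) x(2) k, symmetric]])
	qed
qed

lemma ccube_vertical: "x : ccube r ==> \<bar>s\<bar> <= t ==> x + s *R ax 3 : ccube (r + t)"
	unfolding ccube_def
proof (intro CollectI allI)
	fix i assume "x : {x. \<forall>i. \<bar>x $ i\<bar> <= r}" "\<bar>s\<bar> <= t"
	then have "\<bar>x $ i\<bar> <= r" "\<bar>s * ax 3 $ i\<bar> <= t" by (auto simp: axis_nth)
	then show "\<bar>(x + s *R ax 3) $ i\<bar> <= r + t" by simp
qed

lemma active_chart:
	assumes "p : topspace X" shows "\<exists>c\<in>F. p : fst c & snd c p : ccube (\<rho> c)"
proof -
	have "\<exists>c\<in>F. u c p ~= 0" using pu_D(6)[OF assms] by (metis sum.neutral zero_neq_one)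
	then obtain c where c: "c : F" "u c p ~= 0" by blast
	then have "p : suppt (u c)" using suppt_zero[OF assms] by blast
	then show ?thesis using core(4)[OF c(1)] pu_D(5)[OF c(1)] c(1) by blast
qed

lemma U_bump:
	assumes c: "c : F" "x : ccube (\<rho> c + \<delta>)" and s: "\<bar>s\<bar> <= \<delta>"
	shows "U s (embd c (bump c x)) \<doteq> embd c (bump c (x + s *R ax 3))"
proof -
	note b = bump_embd[OF c]
	have "U s (embd c (bump c x)) \<doteq> embd c (shift s (bump c x))"
		by (rule T_embd[OF vert_shift _ _ _ c(1) b(1) b(3) eqv_refl]) (use \<delta> s in auto)
	then show ?thesis unfolding shift_bump .
qed

text \<open>A shift by \<delta> may carry the centre out of the enlarged core of its chart. The bump
  is then replaced by one around the same point in a chart whose core contains it, which restores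
  the margin for the next step.\<close>

lemma bump_step:
	assumes c: "c : F" "x : ccube (\<rho> c + \<delta>)"
	shows "\<exists>d y. d : F & y : ccube (\<rho> d + \<delta>) & U \<delta> (embd c (bump c x)) \<doteq> embd d (bump d y)"
proof -
	define z where "z = x + \<delta> *R ax 3"
	have z: "z : ccube (\<rho> c + 2 * \<delta>)" using ccube_vertical[OF c(2), of \<delta> \<delta>] \<delta> by (simp add: z_def add.assoc)
	have zi: "z : img c" using core_cube[OF c(1), of "2 * \<delta>"] z \<delta> by auto
	define p where "p = chart_inv c z"
	have p: "p : fst c" using chart_inv_into[OF chart[OF F_A[OF c(1)]] zi] by (simp add: p_def)
	then obtain d where d: "d : F" "p : fst d" "snd d p : ccube (\<rho> d)" using active_chart chart_subset[OF F_A[OF c(1)]] by blast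
	obtain b where b: "b : boxes" "fst c <= fst b" "fst d <= fst b" using common_box[OF c(1) d(1)] p d(2) by blast
	have y: "snd d p : ccube (\<rho> d + 2 * \<delta>)" "snd d p : ccube (\<rho> d + \<delta>)"
		using d(3) ccube_mono[of "\<rho> d" "\<rho> d + 2 * \<delta>"] ccube_mono[of "\<rho> d" "\<rho> d + \<delta>"] \<delta> by auto
	have "trn c b z = trn d b (snd d p)"
		using transition_chart[OF chart[OF F_A[OF d(1)]] d(2), of b] by (simp add: transition_def p_def)
	then have "embd c (bump c z) \<doteq> embd d (bump d (snd d p))" by (intro bump_eqv[OF c(1) d(1) b z y(1)]) simp
	moreover have "U \<delta> (embd c (bump c x)) \<doteq> embd c (bump c z)"
		unfolding z_def by (rule U_bump[OF c]) (use \<delta> in simp)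
	ultimately show ?thesis using d(1) y(2) eqv_trans by blast
qed

text \<open>Following the upward flow from a small bump, the pigeonhole principle yields two times at which the bump returns to almost
	the same height in the same chart.\<close>

lemma bump_return:
	assumes c: "c : F" "x : ccube (\<rho> c + \<delta>)"
	shows "\<exists>m a. 1 <= m & \<bar>a\<bar> < \<delta> / 2 & (U \<delta> ^^ m) (embd c (bump c x)) \<doteq> U a (embd c (bump c x))"
proof -
	\<comment> \<open>The orbit is a sequence of pairs of a chart and a centre, obtained by dependent
	  choice; the last clause pins its start.\<close>
	define P where "P = (%(n::nat) s. fst s : F & snd s : ccube (\<rho> (fst s) + \<delta>) & (n = 0 --> s = (c, x)))"
	define \<beta> where "\<beta> = (%s. embd (fst s) (bump (fst s) (snd s)))"
	have "\<exists>s. P 0 s" using c by (intro exI[of _ "(c, x)"]) (simp add: P_def)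
	moreover have "\<exists>t. P (Suc n) t & U \<delta> (\<beta> s) \<doteq> \<beta> t" if "P n s" for n s
		using bump_step[of "fst s" "snd s"] that unfolding P_def \<beta>_def by (metis fst_conv snd_conv nat.distinct(1))
	ultimately obtain f where f: "!!n. P n (f n)" "!!n. U \<delta> (\<beta> (f n)) \<doteq> \<beta> (f (Suc n))"
		using dependent_nat_choice[of P "%n s t. U \<delta> (\<beta> s) \<doteq> \<beta> t"] by blast
	have f0: "f 0 = (c, x)" using f(1)[of 0] by (simp add: P_def)
	have fn: "fst (f n) : F" "snd (f n) : ccube (\<rho> (fst (f n)) + \<delta>)" for n using f(1)[of n] by (simp_all add: P_def)
	have \<beta>f: "\<beta> (f n) : forms A 3" for n unfolding \<beta>_def by (rule bump_embd(3)[OF fn]) (use \<delta> in simp)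
	have it: "(U \<delta> ^^ n) (\<beta> (f 0)) \<doteq> \<beta> (f n)" for n
	proof (induction n)
		case (Suc n)
		have "U \<delta> ((U \<delta> ^^ n) (\<beta> (f 0))) \<doteq> U \<delta> (\<beta> (f n))" by (rule U_eqv[OF _ Un_forms[OF \<beta>f] \<beta>f Suc.IH]) (use \<delta> in simp)
		then show ?case using f(2) eqv_trans by simp
	qed (simp add: eqv_refl)
	\<comment> \<open>The pigeonholes: the chart together with the height rounded down to a multiple of
	  \<delta>/2. Heights in an enlarged core are bounded, so there are finitely many.\<close>
	define G where "G = (%n. (fst (f n), \<lfloor>2 * snd (f n) $ 3 / \<delta>\<rfloor>))"
	have "range G <= (SIGMA d:F. {\<lfloor>- (2 * (\<rho> d + \<delta>) / \<delta>)\<rfloor>..\<lfloor>2 * (\<rho> d + \<delta>) / \<delta>\<rfloor>})"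
	proof
		fix z assume "z : range G"
		then obtain n where z: "z = G n" by blast
		have "\<bar>snd (f n) $ 3\<bar> <= \<rho> (fst (f n)) + \<delta>" using fn(2)[of n] by (simp add: ccube_def)
		then have "2 * snd (f n) $ 3 / \<delta> <= 2 * (\<rho> (fst (f n)) + \<delta>) / \<delta>" "- (2 * (\<rho> (fst (f n)) + \<delta>) / \<delta>) <= 2 * snd (f n) $ 3 / \<delta>"
			unfolding minus_divide_left using \<delta> by (intro divide_right_mono, simp_all)+
		then show "z : (SIGMA d:F. {\<lfloor>- (2 * (\<rho> d + \<delta>) / \<delta>)\<rfloor>..\<lfloor>2 * (\<rho> d + \<delta>) / \<delta>\<rfloor>})"
			unfolding z G_def using fn(1) by (simp add: floor_mono del: floor_diff_of_int)
	qed
	then have "finite (range G)" by (rule finite_subset) (use pu_D(1) in auto)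
	then have "\<not> inj G" using finite_imageD infinite_UNIV_nat by blast
	then obtain k l where kl: "k < l" "G k = G l" unfolding inj_on_def by (metis linorder_neqE_nat)
	define d where "d = fst (f k)"
	define a where "a = snd (f l) $ 3 - snd (f k) $ 3"
	have dl: "fst (f l) = d" using kl(2) by (simp add: G_def d_def)
	have "\<lfloor>2 * snd (f k) $ 3 / \<delta>\<rfloor> = \<lfloor>2 * snd (f l) $ 3 / \<delta>\<rfloor>" using kl(2) by (simp add: G_def)
	then have "\<bar>2 * snd (f l) $ 3 / \<delta> - 2 * snd (f k) $ 3 / \<delta>\<bar> < 1" by linarith
	moreover have "2 * snd (f l) $ 3 / \<delta> - 2 * snd (f k) $ 3 / \<delta> = 2 * a / \<delta>" by (simp add: a_def diff_divide_distrib)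
	ultimately have a: "\<bar>a\<bar> < \<delta> / 2" using \<delta> by (simp add: abs_mult field_simps)
	have a\<delta>: "\<bar>a\<bar> <= \<delta>" using a \<delta> by linarith
	have dF: "d : F" unfolding d_def by (rule fn)
	note xk = fn(2)[of k, folded d_def] and xl = fn(2)[of l, unfolded dl]
	have xk2: "snd (f k) + a *R ax 3 : ccube (\<rho> d + 2 * \<delta>)" using ccube_vertical[OF xk a\<delta>] by (simp add: add.assoc)
	have xl2: "snd (f l) : ccube (\<rho> d + 2 * \<delta>)" using xl ccube_mono[of "\<rho> d + \<delta>" "\<rho> d + 2 * \<delta>"] \<delta> by auto
	have im: "ccube (\<rho> d + 2 * \<delta>) <= img d" by (rule core_cube[OF dF]) (use \<delta> in simp)
	have "U a (\<beta> (f k)) \<doteq> embd d (bump d (snd (f k) + a *R ax 3))"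
		unfolding \<beta>_def d_def[symmetric] by (rule U_bump[OF dF xk a\<delta>])
	also have "... \<doteq> embd d (bump d (snd (f l)))"
		by (rule bump_eqv[OF dF dF F_box[OF dF] subset_refl subset_refl xk2 xl2])
			(use transition_self(1)[OF F_A[OF dF]] im xk2 xl2 in \<open>auto simp: a_def axis_nth subset_iff\<close>)
	also have "... = \<beta> (f l)" by (simp add: \<beta>_def dl)
	finally have ul: "U a (\<beta> (f k)) \<doteq> \<beta> (f l)" .
	define m where "m = l - k"
	have \<beta>0: "\<beta> (f 0) = embd c (bump c x)" by (simp add: \<beta>_def f0)
	\<comment> \<open>The coincidence is between the times k and l. Commuting \<open>U a\<close> with
	  the first k steps and cancelling them moves it to time 0.\<close>
	have "(U \<delta> ^^ k) ((U \<delta> ^^ m) (\<beta> (f 0))) = (U \<delta> ^^ l) (\<beta> (f 0))"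
		using funpow_add[of k m "U \<delta>"] kl(1) by (simp add: m_def)
	also have "... \<doteq> \<beta> (f l)" by (rule it)
	also have "... \<doteq> U a (\<beta> (f k))" by (rule eqv_sym[OF ul])
	also have "... \<doteq> U a ((U \<delta> ^^ k) (\<beta> (f 0)))" by (rule U_eqv[OF a\<delta> \<beta>f Un_forms[OF \<beta>f] eqv_sym[OF it]])
	also have "... \<doteq> (U \<delta> ^^ k) (U a (\<beta> (f 0)))" by (rule Un_commute[OF a\<delta> \<beta>f])
	finally have "(U \<delta> ^^ m) (\<beta> (f 0)) \<doteq> U a (\<beta> (f 0))" by (rule Un_cancel[OF Un_forms[OF \<beta>f] U_forms[OF a\<delta> \<beta>f]])
	then show ?thesis unfolding \<beta>0 using a kl(1) by (intro exI[of _ m] exI[of _ a]) (simp add: m_def)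
qed

text \<open>\<open>e\<close> integrates the orbit of the bump \<beta> over the times from a to m
  \<delta>. Its vertical derivative consists of the boundary terms \<open>U a \<beta>\<close> and
  \<open>(U \<delta> ^^ m) \<beta>\<close>, which cancel modulo null forms by
  \<open>bump_return\<close>.\<close>

lemma invariant_positive_at:
	assumes q: "q : topspace X"
	shows "\<exists>e\<in>forms A 3. pos e & D e \<doteq> 0 & (\<exists>c\<in>A. q : fst c & 0 < dens e c (snd c q))"
proof -
	obtain c where c: "c : F" "q : fst c" "snd c q : ccube (\<rho> c)" using active_chart[OF q] by blast
	define x where "x = snd c q"
	\<comment> \<open>The bump starts below x and is centred at x at time 3/4 \<delta>. As a <
	  \<delta>/2, this time lies between a and \<delta>, so the first segment already covers x,
	  whatever the sign of a.\<close>
	define y where "y = x + (- (3 / 4 * \<delta>)) *R ax 3"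
	have y: "y : ccube (\<rho> c + \<delta>)" unfolding y_def by (rule ccube_vertical) (use c(3) \<delta> in \<open>auto simp: x_def\<close>)
	define \<beta> where "\<beta> = embd c (bump c y)"
	obtain m a where m: "1 <= m" and a: "\<bar>a\<bar> < \<delta> / 2" and ret: "(U \<delta> ^^ m) \<beta> \<doteq> U a \<beta>"
		using bump_return[OF c(1) y] unfolding \<beta>_def by blast
	have a\<delta>: "\<bar>a\<bar> <= \<delta>" "a <= \<delta>" "\<bar>\<delta>\<bar> <= \<delta>" "\<bar>0\<bar> <= \<delta>" "0 <= \<delta>" using a \<delta> by auto
	have d8: "\<delta> <= 8 * \<delta>" "\<delta> <= 10 * \<delta>" using \<delta> by auto
	note b = bump_embd[OF c(1) y d8(1)]
	have \<beta>: "\<beta> : forms A 3" "pos \<beta>" unfolding \<beta>_def using b by blast+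
	\<comment> \<open>The first segment, from time a to \<delta>, is kept as a density in the single
	  chart \<open>c\<close>, so that its value at x can be computed.\<close>
	define f where "f = J a \<delta> (bump c y)"
	have tf: "test (\<rho> c + (\<delta> + \<delta>) + \<delta>) f" unfolding f_def by (rule vertD(1)[OF vJ[OF a\<delta>(1,3)] b(1)])
	then have tf: "test (\<rho> c + 3 * \<delta>) f" by (simp add: add.assoc)
	have k3: "ccube (\<rho> c + 3 * \<delta>) <= img c" by (rule core_cube[OF c(1)]) (use \<delta> in simp)
	have nn: "0 <= bump c y z" for z by (simp add: bump_def ball_bump_nonneg)
	have fnn: "0 <= f z" for z unfolding f_def
		by (rule vint_nonneg[OF test_smooth[OF b(1)]]) (auto simp: nn)
	note ef = embd_props(1,3)[OF F_A[OF c(1)] k3 tf] and pf = embd_pos[OF F_A[OF c(1)] k3 tf fnn]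
	define g where "g = (%j. T (J 0 \<delta>) ((U \<delta> ^^ j) \<beta>))"
	have g: "g j : forms A 3" for j unfolding g_def by (rule J_forms[OF a\<delta>(4,3) Un_forms[OF \<beta>(1)]])
	have gp: "pos (g j)" for j unfolding g_def
		by (rule T_pos[OF vJ[OF a\<delta>(4,3)] d8(2) _ Un_forms[OF \<beta>(1)] Un_pos[OF \<beta>]]) (rule vint_nonneg, auto intro: test_smooth)
	\<comment> \<open>The segments \<open>g j\<close> with 1 \<le> j < m cover the times from \<delta>
	  to m \<delta>.\<close>
	define e where "e = embd c f + (\<Sum>j\<in>{1..<m}. g j)"
	have e: "e : forms A 3" unfolding e_def by (intro forms_add ef(1) forms_sum g)
	have ep: "pos e" unfolding e_def by (intro pos_add pf pos_sum gp)
	have 1: "D (embd c f) \<doteq> U a \<beta> - U \<delta> \<beta>"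
	proof -
		have sh: "test (\<rho> c + 3 * \<delta>) (shift s (bump c y))" if "\<bar>s\<bar> <= \<delta>" for s
			using test_mono[OF vertD(1)[OF vert_shift b(1)]] that by simp
		have "D (embd c f) \<doteq> embd c (vderiv f)"
			by (rule T_embd[OF vert_vderiv _ _ _ c(1) tf ef(1) eqv_refl]) (use \<delta> in auto)
		also have "vderiv f = (%z. shift a (bump c y) z - shift \<delta> (bump c y) z)"
			unfolding f_def by (simp add: vint_vderiv[OF b(1)] vint_1_vderiv[OF b(1) a\<delta>(2)])
		also have "embd c ... = embd c (shift a (bump c y)) - embd c (shift \<delta> (bump c y))"
			by (rule embd_lincomb(2)[OF F_A[OF c(1)] k3 sh[OF a\<delta>(1)] sh[OF a\<delta>(3)]])
		also have "... \<doteq> U a \<beta> - U \<delta> \<beta>"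
			unfolding shift_bump \<beta>_def by (rule eqv_diff[OF eqv_sym[OF U_bump[OF c(1) y a\<delta>(1)]] eqv_sym[OF U_bump[OF c(1) y a\<delta>(3)]]])
		finally show ?thesis .
	qed
	have "D (\<Sum>j\<in>{1..<m}. g j) = (\<Sum>j\<in>{1..<m}. D (g j))" by (rule D_sum[OF g])
	also have "... \<doteq> (\<Sum>j\<in>{1..<m}. (U \<delta> ^^ j) \<beta> - (U \<delta> ^^ Suc j) \<beta>)"
	proof (rule eqv_sum)
		fix j
		show "D (g j) \<doteq> (U \<delta> ^^ j) \<beta> - (U \<delta> ^^ Suc j) \<beta>"
			unfolding g_def using D_J(1)[OF a\<delta>(4,3,5) Un_forms[OF \<beta>(1)], of j] by (simp add: U_0 Un_forms[OF \<beta>(1)])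
	qed
	also have "... = U \<delta> \<beta> - (U \<delta> ^^ m) \<beta>"
		using m by (induction m rule: dec_induct) auto
	finally have 2: "D (\<Sum>j\<in>{1..<m}. g j) \<doteq> U \<delta> \<beta> - (U \<delta> ^^ m) \<beta>" .
	have "D e = D (embd c f) + D (\<Sum>j\<in>{1..<m}. g j)"
		unfolding e_def by (rule T_add[OF vert_vderiv _ ef(1) forms_sum[OF g]]) (use \<delta> in simp)
	also have "... \<doteq> (U a \<beta> - U \<delta> \<beta>) + (U \<delta> \<beta> - (U \<delta> ^^ m) \<beta>)" by (rule eqv_add[OF 1 2])
	also have "... = U a \<beta> - (U \<delta> ^^ m) \<beta>" by simp
	also have "... \<doteq> U a \<beta> - U a \<beta>" by (rule eqv_diff[OF eqv_refl ret])
	finally have De: "D e \<doteq> 0" by simp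
	have fx: "0 < f x"
	proof -
		define \<psi> where "\<psi> = (%t. ball_bump (0::real^3) \<delta> ((3 / 4 * \<delta> - t) *R ax 3))"
		have arg: "x - t *R ax 3 - y = (3 / 4 * \<delta> - t) *R ax 3" for t by (simp add: y_def algebra_simps)
		have fe: "f x = integral {a..\<delta>} \<psi>" unfolding f_def vint_def bump_def arg \<psi>_def by simp
		have c\<psi>: "continuous_on {a..\<delta>} \<psi>" unfolding \<psi>_def
			by (rule continuous_on_compose2[OF smooth_on_continuous[OF smooth_ball_bump]]) (auto intro!: continuous_intros)
		have "integral {a..\<delta>} \<psi> ~= 0"
		proof
			assume z: "integral {a..\<delta>} \<psi> = 0"
			have "a < \<delta>" using a \<delta> by linarith
			moreover have "0 <= \<psi> t" for t unfolding \<psi>_def by (rule ball_bump_nonneg)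
			ultimately have "\<forall>t\<in>{a..\<delta>}. \<psi> t = 0" using integral_eq_0_iff[OF c\<psi>] z by blast
			moreover have "3 / 4 * \<delta> : {a..\<delta>}" unfolding atLeastAtMost_iff using a \<delta> by linarith
			ultimately have "\<psi> (3 / 4 * \<delta>) = 0" by blast
			then have "ball_bump (0::real^3) \<delta> 0 = 0" by (simp add: \<psi>_def)
			then show False unfolding ball_bump_eq_0_iff[OF \<delta>] using \<delta> by simp
		qed
		then have "f x ~= 0" using fe by simp
		then show ?thesis using fnn[of x] by simp
	qed
	have "0 <= dens (\<Sum>j\<in>{1..<m}. g j) c x"
		using pos_sum[of "{1..<m}" g, OF gp] F_A[OF c(1)] chart_into[OF c(2)] unfolding pos_def x_def by blast
	then have "0 < dens e c x" using fx by (simp add: e_def dens_algebra ef(2))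
	then show ?thesis using e ep De c(2) F_A[OF c(1)] x_def by blast
qed

lemma invariant_positive:
	"\<exists>e\<in>forms A 3. D e \<doteq> 0 & (\<forall>c\<in>A. \<forall>x\<in>img c. 0 < dens e c x)"
proof -
	obtain e c where ec: "!!q. q : topspace X ==> e q : forms A 3 & pos (e q) & D (e q) \<doteq> 0 & c q : A & q : fst (c q) & 0 < dens (e q) (c q) (snd (c q) q)"
		using invariant_positive_at by metis
	define V where "V = (%p. {q : fst (c p). 0 < dens (e p) (c p) (snd (c p) q)})"
	have "openin X (V p) & p : V p" if "p : topspace X" for p
		using open_positive[of "e p" "c p"] ec[OF that] by (simp add: V_def)
	from finite_subcover[OF this] obtain P where P: "finite P" "P <= topspace X" "topspace X <= (\<Union>p\<in>P. V p)" by blast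
	have eP: "e p : forms A 3" "pos (e p)" "D (e p) \<doteq> 0" "c p : A" if "p : P" for p using ec P(2) that by blast+
	have "D (\<Sum>p\<in>P. e p) = (\<Sum>p\<in>P. D (e p))" by (rule D_sum[OF eP(1)])
	also have "... \<doteq> (\<Sum>p\<in>P. 0)" by (rule eqv_sum[OF eP(3)])
	finally have "D (\<Sum>p\<in>P. e p) \<doteq> (\<Sum>p\<in>P. 0)" .
	then have "D (\<Sum>p\<in>P. e p) \<doteq> 0" by simp
	moreover have "0 < dens (\<Sum>p\<in>P. e p) d x" if d: "d : A" "x : img d" for d x
	proof -
		define q where "q = chart_inv d x"
		have q: "q : fst d" "snd d q = x" unfolding q_def using chart_inv_into[OF chart[OF d(1)] d(2)] chart_chart_inv[OF chart[OF d(1)] d(2)] by simp_all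
		then obtain p where p: "p : P" "q : V p" using P(3) chart_subset[OF d(1)] by blast
		have "0 < dens (e p) d (snd d q)"
			by (rule dens_sign[OF eP(1)[OF p(1)] eP(4)[OF p(1)] d(1) _ q(1)]) (use p(2) in \<open>auto simp: V_def\<close>)
		then show ?thesis unfolding dens_sum using eP(2) d by (intro sum_pos2[OF P(1) p(1)]) (auto simp: q(2) pos_def)
	qed
	moreover have "(\<Sum>p\<in>P. e p) : forms A 3" by (rule forms_sum[OF eP(1)])
	ultimately show ?thesis by (intro bexI[of _ "\<Sum>p\<in>P. e p"]) simp_all
qed

theorem positive_representative:
	assumes \<beta>: "\<beta> : forms A 2" "form_d A \<beta> = 0" "0 < I (form_wedge 1 2 \<alpha> \<beta>)" and ne: "topspace X ~= {}"
	shows "\<exists>\<gamma>\<in>forms A 1. \<forall>c\<in>A. \<forall>x\<in>img c. 0 < dens (form_wedge 1 2 \<alpha> (\<beta> + form_d A \<gamma>)) c x"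
proof -
	obtain e where e: "e : forms A 3" "D e \<doteq> 0" "!!c x. c : A ==> x : img c ==> 0 < dens e c x"
		using invariant_positive by blast
	obtain p c0 where p: "p : topspace X" "c0 : A" "p : fst c0" using ne covers by blast
	have Ie: "0 < I e" by (rule I_nonneg_pos[OF e(1) less_imp_le[OF e(3)] p(2) chart_into[OF p(3)] e(3)[OF p(2) chart_into[OF p(3)]]])
	define \<mu> where "\<mu> = form_wedge 1 2 \<alpha> \<beta>"
	have \<mu>: "\<mu> : forms A 3" unfolding \<mu>_def by (rule forms_wedge_12[OF \<alpha> \<beta>(1)])
	\<comment> \<open>Closedness of \<beta> enters here: \<open>D \<mu>\<close> is equivalent to
	  \<open>form_d A \<beta>\<close>.\<close>
	have D\<mu>: "D \<mu> \<doteq> 0" using eqv_sym[OF form_d_eqv[OF \<beta>(1)]] \<beta>(2) by (simp add: \<mu>_def)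
	\<comment> \<open>With this \<open>k\<close> the difference \<open>w\<close> has integral zero,
	  hence is exact; it also inherits a null vertical derivative from \<mu> and
	  \<open>e\<close>.\<close>
	define k where "k = I \<mu> / I e"
	have k: "0 < k" using \<beta>(3) Ie by (simp add: k_def \<mu>_def)
	define w where "w = \<mu> - scale k e"
	have se: "scale r e : forms A 3" for r by (rule forms_scale[OF e(1)])
	have w: "w : forms A 3" unfolding w_def by (rule forms_diff[OF \<mu> se])
	have D10: "(0::real) <= 10 * \<delta>" using \<delta> by simp
	have scale_zero: "scale r 0 = 0" for r by (simp add: scale_def fun_eq_iff)
	have Dse: "D (scale r e) \<doteq> 0" for r
		unfolding T_scale[OF vert_vderiv D10 e(1)] using eqv_scale[OF e(2), of r] by (simp add: scale_zero)
	have Dw: "D w \<doteq> 0" unfolding w_def T_diff[OF vert_vderiv D10 \<mu> se] using eqv_diff[OF D\<mu> Dse] by simp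
	have "I w = 0" unfolding w_def I_diff[OF \<mu> se] I_scale[OF e(1)] using Ie by (simp add: k_def)
	then obtain \<sigma> where \<sigma>: "\<sigma> : forms A 2" "form_d A \<sigma> = w" using exact_iff_integral_zero[OF w _ ne] by blast
	define \<nu> where "\<nu> = form_wedge 1 2 \<alpha> \<sigma>"
	have \<nu>: "\<nu> : forms A 3" unfolding \<nu>_def by (rule forms_wedge_12[OF \<alpha> \<sigma>(1)])
	have wD: "w \<doteq> D \<nu>" using form_d_eqv[OF \<sigma>(1)] \<sigma>(2) by (simp add: \<nu>_def)
	have ad: "\<bar>0\<bar> <= \<delta>" "\<bar>\<delta>\<bar> <= \<delta>" "0 <= \<delta>" "\<delta> <= 10 * \<delta>" using \<delta> by auto
	have "scale \<delta> w \<doteq> T (J 0 \<delta>) w" by (rule eqv_sym[OF D_zero_J[OF w Dw]])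
	also have "... \<doteq> T (J 0 \<delta>) (D \<nu>)" by (rule T_eqv[OF vJ[OF ad(1,2)] ad(3,4) w D_forms[OF \<nu>] wD])
	also have "... \<doteq> U 0 \<nu> - U \<delta> \<nu>" by (rule D_J(2)[OF ad(1-3) \<nu>])
	also have "... = \<nu> - U \<delta> \<nu>" by (simp add: U_0[OF \<nu>])
	finally have one: "scale \<delta> w \<doteq> \<nu> - U \<delta> \<nu>" .
	\<comment> \<open>The left side of \<open>one\<close> is invariant under \<open>U \<delta>\<close>,
	  so adding up the translates of \<open>one\<close> multiplies it by n, while the right side
	  telescopes.\<close>
	have n: "scale (real n * \<delta>) w \<doteq> \<nu> - (U \<delta> ^^ n) \<nu>" for n
	proof (induction n)
		case 0 show ?case by (simp add: scale_simps(5) eqv_refl)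
	next
		case (Suc n)
		have Sn: "scale (real n * \<delta>) w : forms A 3" by (rule forms_scale[OF w])
		have "scale (real n * \<delta>) w \<doteq> scale (real n * \<delta>) (U \<delta> w)" by (rule eqv_scale[OF eqv_sym[OF D_zero_U[OF w Dw]]])
		also have "... = U \<delta> (scale (real n * \<delta>) w)" by (rule T_scale[OF vert_shift _ w, symmetric]) (use \<delta> in simp)
		also have "... \<doteq> U \<delta> (\<nu> - (U \<delta> ^^ n) \<nu>)" by (rule U_eqv[OF ad(2) Sn forms_diff[OF \<nu> Un_forms[OF \<nu>]] Suc.IH])
		also have "... = U \<delta> \<nu> - U \<delta> ((U \<delta> ^^ n) \<nu>)" by (rule T_diff[OF vert_shift _ \<nu> Un_forms[OF \<nu>]]) (use \<delta> in simp)
		finally have "scale (real n * \<delta>) w + scale \<delta> w \<doteq> (U \<delta> \<nu> - U \<delta> ((U \<delta> ^^ n) \<nu>)) + (\<nu> - U \<delta> \<nu>)" using one by (rule eqv_add)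
		moreover have "scale (real n * \<delta>) w + scale \<delta> w = scale (real (Suc n) * \<delta>) w"
			by (simp add: scale_def fun_eq_iff algebra_simps)
		moreover have "(x - y) + (z - x) = z - y" for x y z :: "'a dform" by simp
		ultimately show ?case by (simp only: funpow.simps o_apply)
	qed
	obtain C1 where C1: "pos (scale C1 e - \<nu>)" using dominated[OF e(1,3) \<nu>] by blast
	obtain C2 where C2: "pos (scale C2 e - (0 - \<nu>))" using dominated[OF e(1,3) forms_diff[OF forms_0 \<nu>]] by blast
	obtain n :: nat where n0: "(C1 + C2) / (\<delta> * k) < real n" using reals_Archimedean2 by blast
	\<comment> \<open>The successor makes \<open>n'\<close> positive even if \<open>C1 + C2\<close> is
	  negative; the final form is divided by \<open>real n' * \<delta>\<close>.\<close>
	obtain n' :: nat where n': "n' = Suc n" by blast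
	have nk: "C1 + C2 < real n' * \<delta> * k"
	proof -
		have "(C1 + C2) / (\<delta> * k) < real n'" using n0 n' by simp
		then show ?thesis using \<delta> k by (simp add: pos_divide_less_eq mult_ac)
	qed
	\<comment> \<open>The first two summands are nonnegative and the last is positive. Modulo null
	  forms \<open>Q\<close> is \<mu> times n' \<delta>, because \<open>e\<close> is invariant, so that
	  the multiples of \<open>e\<close> by C1 and C2 cancel.\<close>
	define Q where "Q = (\<nu> + scale C2 e) + (U \<delta> ^^ n') (scale C1 e - \<nu>) + scale (real n' * \<delta> * k - (C1 + C2)) e"
	have Q: "Q : forms A 3" unfolding Q_def by (intro forms_add \<nu> se Un_forms forms_diff)
	have "pos ((\<nu> + scale C2 e) + (U \<delta> ^^ n') (scale C1 e - \<nu>))"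
		using pos_add[OF _ Un_pos[OF forms_diff[OF se \<nu>] C1], of "\<nu> + scale C2 e" n'] C2 by (simp add: add.commute)
	then have Qp: "0 < dens Q c x" if "c : A" "x : img c" for c x
		unfolding Q_def dens_algebra(1)[of "_ + _" "scale _ _"] using e(3)[OF that] nk that
		by (intro add_nonneg_pos) (simp_all add: pos_def dens_algebra(3))
	have Ue: "(U \<delta> ^^ n) (scale C1 e) \<doteq> scale C1 e" for n
	proof (induction n)
		case (Suc n)
		have "U \<delta> ((U \<delta> ^^ n) (scale C1 e)) \<doteq> U \<delta> (scale C1 e)" by (rule U_eqv[OF ad(2) Un_forms[OF se] se Suc.IH])
		then show ?case using D_zero_U[OF se Dse] eqv_trans by simp
	qed (simp add: eqv_refl)
	have Qe: "Q = (\<nu> - (U \<delta> ^^ n') \<nu>) + ((U \<delta> ^^ n') (scale C1 e) - scale C1 e) + scale (real n' * \<delta> * k) e"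
		unfolding Q_def Un_diff[OF se \<nu>] by (simp add: scale_def fun_eq_iff algebra_simps)
	have "Q \<doteq> (\<nu> - (U \<delta> ^^ n') \<nu>) + (scale C1 e - scale C1 e) + scale (real n' * \<delta> * k) e"
		unfolding Qe by (rule eqv_add[OF eqv_add[OF eqv_refl eqv_diff[OF Ue eqv_refl]] eqv_refl])
	also have "... \<doteq> scale (real n' * \<delta>) w + scale (real n' * \<delta> * k) e"
		using eqv_add[OF eqv_sym[OF n[of n']] eqv_refl] by simp
	also have "... = scale (real n' * \<delta>) \<mu>" by (simp add: w_def scale_def fun_eq_iff algebra_simps)
	finally have "scale (1 / (real n' * \<delta>)) Q \<doteq> scale (1 / (real n' * \<delta>)) (scale (real n' * \<delta>) \<mu>)" by (rule eqv_scale)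
	moreover have "scale (1 / (real n' * \<delta>)) (scale (real n' * \<delta>) \<mu>) = \<mu>"
		using \<delta> n' by (simp add: scale_simps(2) scale_simps(3))
	ultimately obtain \<gamma> where \<gamma>: "\<gamma> : forms A 1" "scale (1 / (real n' * \<delta>)) Q - \<mu> = form_wedge 1 2 \<alpha> (form_d A \<gamma>)"
		unfolding eqv_def null_def by auto
	have "form_wedge 1 2 \<alpha> (\<beta> + form_d A \<gamma>) = scale (1 / (real n' * \<delta>)) Q"
		unfolding form_wedge_right(1) \<gamma>(2)[symmetric] \<mu>_def[symmetric] by simp
	then have "\<forall>c\<in>A. \<forall>x\<in>img c. 0 < dens (form_wedge 1 2 \<alpha> (\<beta> + form_d A \<gamma>)) c x"
		using Qp \<delta> n' by (simp add: dens_algebra(3))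
	then show ?thesis using \<gamma>(1) by blast
qed

end

section \<open>Leibniz rules and cohomology classes\<close>

lemma divg_cross:
	assumes a: "smooth_on S a" and g: "smooth_on S g" and x: "x : S"
	shows "divg (%x. cross3 (a x) (g x)) x = curl a x \<bullet> g x - a x \<bullet> curl g x"
proof -
	have "((%x. cross3 (a x) (g x)) has_derivative (%v. cross3 (a x) (fd g x v) + cross3 (fd a x v) (g x))) (at x)"
		by (rule bounded_bilinear.FDERIV[OF bounded_bilinear_cross smooth_on_has_derivative[OF a x] smooth_on_has_derivative[OF g x]])
	from fd_eqI[OF this] show ?thesis
		by (simp add: divg_def curl_def vec3_simps algebra_simps)
qed

lemma divg_scaleR:
	assumes h: "smooth_on S h" and b: "smooth_on S b" and x: "x : S"
	shows "divg (%x. h x *R b x) x = grad h x \<bullet> b x + h x * divg b x"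
proof -
	have "((%x. h x *R b x) has_derivative (%v. h x *R fd b x v + fd h x v *R b x)) (at x)"
		by (rule has_derivative_scaleR[OF smooth_on_has_derivative[OF h x] smooth_on_has_derivative[OF b x]])
	from fd_eqI[OF this] show ?thesis
		by (simp add: divg_def grad_def inner_vec_def sum_3 algebra_simps)
qed

theorem (in foliation) foliated_positive:
	assumes \<beta>: "\<beta> : forms A 2" "form_d A \<beta> = 0" "0 < I (form_wedge 1 2 \<alpha> \<beta>)" and ne: "topspace X ~= {}"
	shows "\<exists>\<gamma>\<in>forms A 1. \<forall>c\<in>A. \<forall>x\<in>img c. 0 < dens (form_wedge 1 2 \<alpha> (\<beta> + form_d A \<gamma>)) c x"
proof -
	obtain F u R \<rho> \<delta> where 1: "partition_of_unity X A F u" "F <= boxes" "(0::real) < \<delta>"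
		and 2: "\<forall>c\<in>F. 0 < \<rho> c & \<rho> c + 10 * \<delta> < R c & img c = ocube (R c) & snd c ` suppt (u c) <= ccube (\<rho> c)"
		and 3: "\<forall>c\<in>F. \<forall>d\<in>F. fst c \<inter> fst d ~= {} --> (\<exists>b\<in>boxes. fst c <= fst b & fst d <= fst b)"
		using adapted_partition by (elim exE conjE) (rule that)
	interpret ad: adapted X A \<alpha> F u R \<rho> \<delta>
		by (rule adapted.intro[OF foliation_axioms adapted_axioms.intro]) (use 1 2 3 in auto)
	show ?thesis by (rule ad.positive_representative[OF \<beta> ne])
qed

context atlas
begin

text \<open>A 0-form has the same value in all charts around a point, so any of them may be chosen
  to define the function there.\<close>

lemma form0_function:
	assumes f: "f : forms A 0"
	shows "\<exists>g. smooth_function A g & (\<forall>c\<in>A. \<forall>x\<in>img c. f c x [] = g (chart_inv c x))"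
proof -
	define k where "k = (%p. SOME c. c : A & p : fst c)"
	define g where "g = (%p. f (k p) (snd (k p) p) [])"
	have k: "k p : A" "p : fst (k p)" if "p : topspace X" for p
		using someI_ex[of "%c. c : A & p : fst c"] covers[OF that] unfolding k_def by blast+
	have e: "f c x [] = g (chart_inv c x)" if c: "c : A" "x : img c" for c x
	proof -
		define p where "p = chart_inv c x"
		have p: "p : fst c" "snd c p = x" unfolding p_def using chart_inv_into[OF chart[OF c(1)] c(2)] chart_chart_inv[OF chart[OF c(1)] c(2)] by simp_all
		have pt: "p : topspace X" using p(1) chart_subset[OF c(1)] by blast
		have "f c (snd c p) [] = f (k p) (trn c (k p) (snd c p)) []"
			using form_transition[OF f c(1) k(1)[OF pt] overlapI[of p c "k p", OF p(1) k(2)[OF pt]], of "[]"] by simp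
		then show ?thesis unfolding transition_chart[OF chart[OF c(1)] p(1)] by (simp add: p(2) g_def p_def[symmetric])
	qed
	have "smooth_function A g" unfolding smooth_function_def comp_def
	proof
		fix c assume c: "c : A"
		show "smooth_on (img c) (%x. g (chart_inv c x))"
			by (rule smooth_on_cong[OF open_image[OF c] e[OF c] form_smooth[OF f c]])
	qed
	then show ?thesis using e by blast
qed

lemma vec_of_form: "w c x = form1 a ==> vec1 w c x = a" "w c x = form2 b ==> vec2 w c x = b" "w c x = form3 f ==> dens w c x = f"
	by (simp_all add: vec1_def inner_axis vec2_def dens_def vec_eq_iff forall_3 vec3_simps)

lemma vec_d:
	assumes "c : A" "x : img c"
	shows "f : forms A 0 ==> vec1 (form_d A f) c x = grad (%y. f c y []) x"
		"w : forms A 1 ==> vec2 (form_d A w) c x = curl (vec1 w c) x"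
		"b : forms A 2 ==> dens (form_d A b) c x = divg (vec2 b c) x"
	using vec_of_form[of "form_d A _" c x] form_d_0[OF _ assms] form_d_1[OF _ assms] form_d_2[OF _ assms] by blast+

lemma vec_wedge:
	"w : forms A 1 ==> v : forms A 1 ==> vec2 (form_wedge 1 1 w v) c = (%x. cross3 (vec1 w c x) (vec1 v c x))"
	"w : forms A 1 ==> b : forms A 2 ==> dens (form_wedge 1 2 w b) c x = vec1 w c x \<bullet> vec2 b c x"
	"f : forms A 0 ==> \<tau> : forms A 3 ==> dens (form_wedge 0 3 f \<tau>) c x = f c x [] * dens \<tau> c x"
	using vec_of_form(2)[of "form_wedge 1 1 w v", OF form_wedge_11] vec_of_form(3)[of "form_wedge 1 2 w b", OF form_wedge_12]
		vec_of_form(3)[of "form_wedge 0 3 f \<tau>", OF form_wedge_03] by (blast intro: ext)+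

lemma leibniz_1_1:
	assumes \<alpha>: "\<alpha> : forms A 1" "form_d A \<alpha> = 0" and \<gamma>: "\<gamma> : forms A 1"
	shows "form_wedge 1 2 \<alpha> (form_d A \<gamma>) = form_d A (scale (-1) (form_wedge 1 1 \<alpha> \<gamma>))"
proof (rule form3_eqI)
	have w: "form_wedge 1 1 \<alpha> \<gamma> : forms A 2" by (rule forms_wedge_11[OF \<alpha>(1) \<gamma>])
	show "form_wedge 1 2 \<alpha> (form_d A \<gamma>) : forms A 3" by (rule forms_wedge_12[OF \<alpha>(1) forms_d_1[OF \<gamma>]])
	show "form_d A (scale (-1) (form_wedge 1 1 \<alpha> \<gamma>)) : forms A 3" by (rule forms_d_2[OF forms_scale[OF w]])
	fix p assume "p : topspace X"
	then obtain c where c: "c : A" "p : fst c" using covers by blast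
	define x where "x = snd c p"
	have x: "x : img c" unfolding x_def by (rule chart_into[OF c(2)])
	have cl: "curl (vec1 \<alpha> c) x = 0"
		using vec_d(2)[OF c(1) x \<alpha>(1)] \<alpha>(2) by (simp add: vec2_def vec_eq_iff forall_3 vector_3)
	have "dens (form_wedge 1 2 \<alpha> (form_d A \<gamma>)) c x = vec1 \<alpha> c x \<bullet> curl (vec1 \<gamma> c) x"
		unfolding vec_wedge(2)[OF \<alpha>(1) forms_d_1[OF \<gamma>]] vec_d(2)[OF c(1) x \<gamma>] ..
	moreover have "dens (form_d A (form_wedge 1 1 \<alpha> \<gamma>)) c x = - (vec1 \<alpha> c x \<bullet> curl (vec1 \<gamma> c) x)"
		unfolding vec_d(3)[OF c(1) x w] vec_wedge(1)[OF \<alpha>(1) \<gamma>] divg_cross[OF smooth_vec1[OF \<alpha>(1) c(1)] smooth_vec1[OF \<gamma> c(1)] x] cl by simp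
	moreover have "form_d A (scale (-1) (form_wedge 1 1 \<alpha> \<gamma>)) = scale (-1) (form_d A (form_wedge 1 1 \<alpha> \<gamma>))" by (rule form_d_scale[OF w])
	ultimately have "dens (form_wedge 1 2 \<alpha> (form_d A \<gamma>)) c x = dens (form_d A (scale (-1) (form_wedge 1 1 \<alpha> \<gamma>))) c x"
		by (simp only: dens_algebra(3))
	then show "\<exists>c\<in>A. p : fst c & dens (form_wedge 1 2 \<alpha> (form_d A \<gamma>)) c (snd c p) = dens (form_d A (scale (-1) (form_wedge 1 1 \<alpha> \<gamma>))) c (snd c p)"
		using c x_def by blast
qed

lemma leibniz_0_2:
	assumes f: "f : forms A 0" and \<beta>: "\<beta> : forms A 2" "form_d A \<beta> = 0"
	shows "\<exists>\<sigma>\<in>forms A 2. form_wedge 1 2 (form_d A f) \<beta> = form_d A \<sigma>"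
proof -
	obtain g where g: "smooth_function A g" "!!c x. c : A ==> x : img c ==> f c x [] = g (chart_inv c x)"
		using form0_function[OF f] by blast
	have s: "smul g \<beta> : forms A 2" by (rule forms_smul[OF g(1) \<beta>(1)])
	have df: "form_d A f : forms A 1" by (rule forms_d_0[OF f])
	have "form_wedge 1 2 (form_d A f) \<beta> = form_d A (smul g \<beta>)"
	proof (rule form3_eqI[OF forms_wedge_12[OF df \<beta>(1)] forms_d_2[OF s]])
		fix p assume "p : topspace X"
		then obtain c where c: "c : A" "p : fst c" using covers by blast
		define x where "x = snd c p"
		have x: "x : img c" unfolding x_def by (rule chart_into[OF c(2)])
		define h where "h = (%y. g (chart_inv c y))"
		have cl: "divg (vec2 \<beta> c) x = 0" using vec_d(3)[OF c(1) x \<beta>(1)] \<beta>(2) by (simp add: dens_algebra)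
		have gr: "grad (%y. f c y []) x = grad h x"
			unfolding grad_def by (subst fd_cong[OF open_image[OF c(1)] x, of _ h]) (simp_all add: g(2)[OF c(1)] h_def)
		have "dens (form_wedge 1 2 (form_d A f) \<beta>) c x = grad h x \<bullet> vec2 \<beta> c x"
			unfolding vec_wedge(2)[OF df \<beta>(1)] vec_d(1)[OF c(1) x f] gr ..
		moreover have "vec2 (smul g \<beta>) c = (%y. h y *R vec2 \<beta> c y)"
			by (rule ext) (simp add: vec2_def smul_def h_def vec_eq_iff forall_3 vector_3)
		then have "dens (form_d A (smul g \<beta>)) c x = grad h x \<bullet> vec2 \<beta> c x"
			using vec_d(3)[OF c(1) x s] divg_scaleR[OF smooth_functionD[OF g(1) c(1)] smooth_vec2[OF \<beta>(1) c(1)] x] cl by (simp add: h_def)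
		ultimately show "\<exists>c\<in>A. p : fst c & dens (form_wedge 1 2 (form_d A f) \<beta>) c (snd c p) = dens (form_d A (smul g \<beta>)) c (snd c p)"
			using c x_def by auto
	qed
	then show ?thesis using s by blast
qed

section \<open>De Rham classes and integrals over them\<close>

lemma exact_forms_simps: "exact_forms A 0 = {0}" "exact_forms A 1 = form_d A ` forms A 0" "exact_forms A 2 = form_d A ` forms A 1"
	"exact_forms A 3 = form_d A ` forms A 2"
	by (simp_all add: exact_forms_def numeral_2_eq_2 numeral_3_eq_3)

lemma exact_forms_diff: "v : exact_forms A k ==> w : exact_forms A k ==> v - w : exact_forms A k"
	by (cases k) (auto simp: exact_forms_def form_d_diff[symmetric] intro: forms_diff)

lemma exact_forms_0: "0 : exact_forms A k"
proof (cases k)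
	case (Suc j)
	have "form_d A 0 : form_d A ` forms A j" by (rule imageI[OF forms_0])
	then show ?thesis by (simp add: Suc exact_forms_def form_d_zero)
qed (simp add: exact_forms_def)

lemma coho_class_iff: "w : closed_forms A k ==> v : coho_class A k w \<longleftrightarrow> v : closed_forms A k & w - v : exact_forms A k"
	by (simp add: coho_class_def cohomologous_def)

lemma coho_class_self: "w : closed_forms A k ==> w : coho_class A k w"
	using coho_class_iff exact_forms_0[of k] by simp

lemma coho_class_eq:
	assumes "w : closed_forms A k" "v : closed_forms A k" "w - v : exact_forms A k"
	shows "coho_class A k w = coho_class A k v"
proof -
	have s: "coho_class A k v <= coho_class A k w" if "w : closed_forms A k" "v : closed_forms A k" "w - v : exact_forms A k" for v w
	proof
		fix z assume "z : coho_class A k v"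
		then have z: "z : closed_forms A k" "v - z : exact_forms A k" using coho_class_iff[OF that(2)] by blast+
		have "v - w : exact_forms A k" using exact_forms_diff[OF exact_forms_0 that(3)] by simp
		from exact_forms_diff[OF z(2) this] have "w - z : exact_forms A k" by simp
		then show "z : coho_class A k w" using coho_class_iff[OF that(1)] z(1) by blast
	qed
	have "v - w : exact_forms A k" using exact_forms_diff[OF exact_forms_0 assms(3)] by simp
	then show ?thesis using s assms by blast
qed

lemma coho_iff: "a : coho A k \<longleftrightarrow> (\<exists>w\<in>closed_forms A k. a = coho_class A k w)"
	by (auto simp: coho_def quotient_def coho_class_def)

lemma coho_member: "a : coho A k ==> w : a ==> w : closed_forms A k & a = coho_class A k w"
	using coho_iff coho_class_iff coho_class_eq by metis

lemma closed_forms_3: "closed_forms A 3 = forms A 3"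
	using form_d_3 by (auto simp: closed_forms_def)

lemma coho_class_0_eq:
	assumes "w : closed_forms A 0" "coho_class A 0 w = coho_zero A 0" shows "w = 0"
	using coho_class_self[OF assms(1)] coho_class_iff[of 0 0 w] forms_0 form_d_zero
	unfolding assms(2) coho_zero_def by (auto simp: exact_forms_simps closed_forms_def)

end

context compact_atlas
begin

lemma coho_class_integral: "w : forms A 3 ==> v : coho_class A 3 w ==> v : forms A 3 & I v = I w"
proof -
	assume w: "w : forms A 3" and "v : coho_class A 3 w"
	then have v: "v : forms A 3" "w - v : form_d A ` forms A 2"
		using coho_class_iff[of w 3 v] unfolding closed_forms_3 exact_forms_simps by blast+
	then have "I (w - v) = 0" using stokes by auto
	then show ?thesis using I_diff[OF w v(1)] v(1) by simp
qed

text \<open>\<open>coho_integral\<close> is \<open>the_elem\<close> of the set of integrals of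
  members, and a constant integral makes that set a singleton.\<close>

lemma coho_integral_eq:
	assumes "w : a" "!!v. v : a ==> I v = I w"
	shows "coho_integral X A a = I w"
proof -
	have "form_integral X A ` a <= {I w}" by (rule image_subsetI) (simp only: assms(2) singleton_iff)
	moreover have "I w : form_integral X A ` a" by (rule imageI[OF assms(1)])
	ultimately have "form_integral X A ` a = {I w}" by blast
	then show ?thesis by (simp add: coho_integral_def)
qed

text \<open>A cup product is the union of the classes of all products of representatives. By the
  Leibniz rules a change of representatives changes the product by an exact form, so all members
  have the same integral, which is what \<open>coho_integral\<close> needs.\<close>

lemma cup_12_member:
	assumes w: "w : closed_forms A 1" and v: "v : closed_forms A 2"
	shows "form_wedge 1 2 w v : cup A 1 2 (coho_class A 1 w) (coho_class A 2 v)"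
		and "z : cup A 1 2 (coho_class A 1 w) (coho_class A 2 v) ==> z : forms A 3 & I z = I (form_wedge 1 2 w v)"
proof -
	have eq: "cup A 1 2 (coho_class A 1 w) (coho_class A 2 v) =
			(\<Union>w'\<in>coho_class A 1 w. \<Union>v'\<in>coho_class A 2 v. coho_class A 3 (form_wedge 1 2 w' v'))"
		unfolding cup_def by (simp only: one_plus_numeral add_num_simps)
	have f: "form_wedge 1 2 w' v' : forms A 3" if "w' : closed_forms A 1" "v' : closed_forms A 2" for w' v'
		using that by (intro forms_wedge_12) (simp_all add: closed_forms_def)
	have "form_wedge 1 2 w v : coho_class A 3 (form_wedge 1 2 w v)"
		by (rule coho_class_self) (use f[OF w v] closed_forms_3 in simp)
	then show "form_wedge 1 2 w v : cup A 1 2 (coho_class A 1 w) (coho_class A 2 v)"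
		unfolding eq using coho_class_self[OF w] coho_class_self[OF v] by blast
	assume "z : cup A 1 2 (coho_class A 1 w) (coho_class A 2 v)"
	then obtain w' v' where w': "w' : coho_class A 1 w" and v': "v' : coho_class A 2 v"
		and z: "z : coho_class A 3 (form_wedge 1 2 w' v')" unfolding eq by blast
	obtain g where g: "w' : closed_forms A 1" "g : forms A 0" "w - w' = form_d A g"
		using w' unfolding coho_class_iff[OF w] exact_forms_simps by blast
	obtain \<gamma> where \<gamma>: "v' : closed_forms A 2" "\<gamma> : forms A 1" "v - v' = form_d A \<gamma>"
		using v' unfolding coho_class_iff[OF v] exact_forms_simps by blast
	have cl: "w' : forms A 1" "form_d A w' = 0" "v : forms A 2" "form_d A v = 0" using g(1) v by (simp_all add: closed_forms_def)
	obtain \<sigma> where \<sigma>: "\<sigma> : forms A 2" "form_wedge 1 2 (form_d A g) v = form_d A \<sigma>" using leibniz_0_2[OF g(2) cl(3,4)] by blast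
	have s: "scale (-1) (form_wedge 1 1 w' \<gamma>) : forms A 2" by (rule forms_scale[OF forms_wedge_11[OF cl(1) \<gamma>(2)]])
	have "form_wedge 1 2 w v - form_wedge 1 2 w' v' = form_wedge 1 2 (w - w') v + form_wedge 1 2 w' (v - v')"
		by (auto simp: form_wedge_def wedge_def fun_eq_iff left_diff_distrib right_diff_distrib sum_subtractf diff_divide_distrib)
	also have "... = form_d A \<sigma> + form_d A (scale (-1) (form_wedge 1 1 w' \<gamma>))"
		unfolding g(3) \<gamma>(3) \<sigma>(2) leibniz_1_1[OF cl(1,2) \<gamma>(2)] ..
	finally have "I (form_wedge 1 2 w v - form_wedge 1 2 w' v') = 0"
		using I_add[OF forms_d_2[OF \<sigma>(1)] forms_d_2[OF s]] stokes[OF \<sigma>(1)] stokes[OF s] by simp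
	then have "I (form_wedge 1 2 w' v') = I (form_wedge 1 2 w v)" unfolding I_diff[OF f[OF w v] f[OF g(1) \<gamma>(1)]] by simp
	then show "z : forms A 3 & I z = I (form_wedge 1 2 w v)"
		using coho_class_integral[OF f[OF g(1) \<gamma>(1)] z] by simp
qed

lemma cup_12_integral:
	assumes "w : closed_forms A 1" "v : closed_forms A 2"
	shows "coho_integral X A (cup A 1 2 (coho_class A 1 w) (coho_class A 2 v)) = I (form_wedge 1 2 w v)"
	by (rule coho_integral_eq) (use cup_12_member[OF assms] in blast)+

end

section \<open>Passage to the maximal atlas\<close>

locale closed_manifold = compact_atlas +
	assumes connected: "connected_space X" and nonempty: "topspace X ~= {}"
begin

abbreviation A' where "A' \<equiv> maxatlas X A"

text \<open>Straightened and translated charts lie in the maximal atlas. Forms are extended to it by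
  \<open>extend_form\<close>, results are obtained there and restricted back, and integrals are
  unchanged by \<open>I_subatlas\<close>.\<close>

sublocale max: max_atlas X A'
	by (intro max_atlas.intro max_atlas_axioms.intro compact_atlas.intro compact_atlas_axioms.intro atlas.intro
			maxatlas_atlas hausdorff compact maxatlas_maximal connected)

text \<open>A zero gradient makes the function locally constant, and connectedness does the
  rest.\<close>

lemma closed_function_constant:
	assumes w: "w : closed_forms A 0"
	shows "\<exists>k. \<forall>c\<in>A. \<forall>x\<in>img c. w c x [] = k"
proof -
	have wf: "w : forms A 0" "form_d A w = 0" using w by (simp_all add: closed_forms_def)
	obtain g where g: "!!c x. c : A ==> x : img c ==> w c x [] = g (chart_inv c x)"
		using form0_function[OF wf(1)] by blast
	have loc: "\<exists>U. openin X U & p : U & (\<forall>q\<in>U. g q = g p)" if "p : topspace X" for p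
	proof -
		obtain c where c: "c : A" "p : fst c" using covers[OF \<open>p : topspace X\<close>] by blast
		obtain r where r: "0 < r" "ball (snd c p) r <= img c"
			using open_image[OF c(1)] chart_into[OF c(2)] open_contains_ball by blast
		have sf: "smooth_on (img c) (%y. w c y [])" by (rule form_smooth[OF wf(1) c(1)])
		have d: "((%y. w c y []) has_derivative (%v. 0)) (at x within ball (snd c p) r)" if x: "x : ball (snd c p) r" for x
		proof -
			have xc: "x : img c" using x r(2) by blast
			have "form1 (grad (%y. w c y []) x) = form1 0" using form_d_0[OF wf(1) c(1) xc] wf(2) by simp
			then have "grad (%y. w c y []) x = 0" by (simp only: form_inject)
			then have z: "fd (%y. w c y []) x (ax i) = 0" for i by (simp add: grad_def vec_eq_iff)
			have "fd (%y. w c y []) x v = 0" for v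
				by (subst lin3_expand[OF smooth_on_linear_fd[OF sf xc]]) (simp only: z scaleR_zero_right add_0_left)
			then have e: "fd (%y. w c y []) x = (%v. 0)" by (rule ext)
			show ?thesis by (rule has_derivative_at_withinI[OF smooth_on_has_derivative[OF sf xc, unfolded e]])
		qed
		obtain k where k: "!!x. x : ball (snd c p) r ==> w c x [] = k"
			using has_derivative_zero_constant[OF convex_ball d] by blast
		have gk: "g q = k" if "q : fst c" "snd c q : ball (snd c p) r" for q
			using g[OF c(1) chart_into[OF that(1)]] k[OF that(2)] chart_inv_chart[OF chart[OF c(1)] that(1)] by simp
		then show ?thesis
			using chart_open_preimage[OF chart[OF c(1)] open_ball, of "snd c p" r] gk[OF c(2)] c(2) r(1)
			by (intro exI[of _ "{q : fst c. snd c q : ball (snd c p) r}"]) simp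
	qed
	obtain p0 where p0: "p0 : topspace X" using nonempty by blast
	have op: "openin X {p : topspace X. P (g p)}" for P
	proof (subst openin_subopen, clarify)
		fix p assume p: "p : topspace X" "P (g p)"
		obtain U where U: "openin X U" "p : U" "\<forall>q\<in>U. g q = g p" using loc[OF p(1)] by blast
		have "U <= {p : topspace X. P (g p)}"
		proof
			fix q assume q: "q : U"
			have "g q = g p" using U(3) q by blast
			then have "P (g q)" using p(2) by (simp only:)
			then show "q : {p : topspace X. P (g p)}" using openin_subset[OF U(1)] q by blast
		qed
		then show "\<exists>T. openin X T & p : T & T <= {p : topspace X. P (g p)}" using U(1,2) by blast
	qed
	have "topspace X - {p : topspace X. g p = g p0} = {p : topspace X. g p ~= g p0}" by blast
	then have "closedin X {p : topspace X. g p = g p0}"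
		unfolding closedin_def using op[of "%t. t ~= g p0"] by (simp only: Collect_subset simp_thms)
	moreover have "p0 : {p : topspace X. g p = g p0}" using p0 by simp
	ultimately have all: "{p : topspace X. g p = g p0} = topspace X"
		using connected op[of "%t. t = g p0"] unfolding connected_space_clopen_in by blast
	have "w c x [] = g p0" if c: "c : A" "x : img c" for c x
	proof -
		have "chart_inv c x : topspace X" using chart_inv_into[OF chart[OF c(1)] c(2)] chart_subset[OF c(1)] by blast
		then have "g (chart_inv c x) = g p0" using all by blast
		then show ?thesis using g[OF c] by (simp only:)
	qed
	then show ?thesis by blast
qed

lemma constant_wedge:
	assumes w: "w : forms A 0" "!!c x. c : A ==> x : img c ==> w c x [] = k" and v: "v : forms A 3"
	shows "form_wedge 0 3 w v = scale k v"
proof (rule form3_eqI[OF forms_wedge_03[OF w(1) v] forms_scale[OF v]])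
	fix p assume "p : topspace X"
	then obtain c where c: "c : A" "p : fst c" using covers by blast
	have "dens (form_wedge 0 3 w v) c (snd c p) = dens (scale k v) c (snd c p)"
		unfolding vec_wedge(3)[OF w(1) v] dens_algebra w(2)[OF c(1) chart_into[OF c(2)]] ..
	then show "\<exists>c\<in>A. p : fst c & dens (form_wedge 0 3 w v) c (snd c p) = dens (scale k v) c (snd c p)" using c by blast
qed

lemma cone_integral:
	assumes w: "w0 : closed_forms A 0" "w1 : closed_forms A 1" "w2 : closed_forms A 2" "w3 : closed_forms A 3"
	shows "coho_integral X A (coho_diff A 3 (cup A 0 3 (coho_class A 0 w0) (coho_class A 3 w3)) (cup A 1 2 (coho_class A 1 w1) (coho_class A 2 w2)))
		= I (form_wedge 0 3 w0 w3 - form_wedge 1 2 w1 w2)"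
proof -
	define Q where "Q = cup A 1 2 (coho_class A 1 w1) (coho_class A 2 w2)"
	define P where "P = cup A 0 3 (coho_class A 0 w0) (coho_class A 3 w3)"
	have f: "w0 : forms A 0" "w1 : forms A 1" "w2 : forms A 2" "w3 : forms A 3" using w by (simp_all add: closed_forms_def)
	obtain k where k: "!!c x. c : A ==> x : img c ==> w0 c x [] = k" using closed_function_constant[OF w(1)] by blast
	\<comment> \<open>In degree 0 the only exact form is 0, so a class has a single
	  representative.\<close>
	have c0: "v = w0" if "v : coho_class A 0 w0" for v using that unfolding coho_class_iff[OF w(1)] exact_forms_simps by simp
	have w03: "form_wedge 0 3 w0 w3 : forms A 3" and w12: "form_wedge 1 2 w1 w2 : forms A 3"
		by (rule forms_wedge_03[OF f(1,4)], rule forms_wedge_12[OF f(2,3)])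
	have P: "P = (\<Union>w'\<in>coho_class A 0 w0. \<Union>v'\<in>coho_class A 3 w3. coho_class A 3 (form_wedge 0 3 w' v'))"
		unfolding P_def cup_def by simp
	have "form_wedge 0 3 w0 w3 : coho_class A 3 (form_wedge 0 3 w0 w3)" by (rule coho_class_self) (use w03 closed_forms_3 in simp)
	then have Pm: "form_wedge 0 3 w0 w3 : P" unfolding P using coho_class_self[OF w(1)] coho_class_self[OF w(4)] by blast
	have Pz: "z : forms A 3 & I z = I (form_wedge 0 3 w0 w3)" if z: "z : P" for z
	proof -
		obtain v where v: "v : coho_class A 3 w3" "z : coho_class A 3 (form_wedge 0 3 w0 v)" using z c0 unfolding P by blast
		have v': "v : forms A 3" "I v = I w3" using coho_class_integral[OF f(4) v(1)] by blast+
		have cw: "form_wedge 0 3 w0 \<tau> = scale k \<tau>" if "\<tau> : forms A 3" for \<tau> by (rule constant_wedge[OF f(1) k that])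
		have "I (form_wedge 0 3 w0 v) = I (form_wedge 0 3 w0 w3)"
			unfolding cw[OF v'(1)] cw[OF f(4)] using I_scale[OF v'(1)] I_scale[OF f(4)] v'(2) by simp
		then show ?thesis using coho_class_integral[OF forms_wedge_03[OF f(1) v'(1)] v(2)] by simp
	qed
	note Q = cup_12_member[OF w(2,3), folded Q_def]
	define z where "z = form_wedge 0 3 w0 w3 - form_wedge 1 2 w1 w2"
	have zf: "z : forms A 3" unfolding z_def by (rule forms_diff[OF w03 w12])
	have "z : coho_class A 3 z" by (rule coho_class_self) (use zf closed_forms_3 in simp)
	then have zm: "z : coho_diff A 3 P Q" unfolding coho_diff_def using Pm Q(1) z_def by blast
	have "I y = I z" if y: "y : coho_diff A 3 P Q" for y
	proof -
		obtain a b where ab: "a : P" "b : Q" "y : coho_class A 3 (a - b)" using y unfolding coho_diff_def by blast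
		have a: "a : forms A 3" "I a = I (form_wedge 0 3 w0 w3)" and b: "b : forms A 3" "I b = I (form_wedge 1 2 w1 w2)"
			using Pz[OF ab(1)] Q(2)[OF ab(2)] by blast+
		show ?thesis using coho_class_integral[OF forms_diff[OF a(1) b(1)] ab(3)] I_diff[OF a(1) b(1)] I_diff[OF w03 w12] a(2) b(2)
			by (simp add: z_def)
	qed
	then show ?thesis using coho_integral_eq[OF zm] unfolding P_def Q_def z_def by blast
qed

text \<open>Subtracting the multiple of a positive form that has the same integral leaves an exact
  form.\<close>

lemma positive_3form:
	assumes w: "w : forms A 3" "0 < I w"
	shows "\<exists>\<sigma>\<in>forms A 2. \<forall>c\<in>A. \<forall>x\<in>img c. 0 < dens (w + form_d A \<sigma>) c x"
proof -
	obtain w' where w': "w' : forms A' 3" "restr A w' = w" using max.extend_form[OF subset_maxatlas covers w(1)] by auto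
	obtain v where v: "v : forms A' 3" "!!c x. c : A' ==> x : img c ==> 0 < dens v c x" using max.positive_form_exists by blast
	obtain p c where p: "p : topspace X" "c : A'" "p : fst c" using nonempty max.covers by blast
	have Iv: "0 < max.I v" by (rule max.I_nonneg_pos[OF v(1) less_imp_le[OF v(2)] p(2) chart_into[OF p(3)] v(2)[OF p(2) chart_into[OF p(3)]]])
	have Iw: "max.I w' = I w" using max.I_subatlas[OF subset_maxatlas covers w'(1)] w'(2) by simp
	define k where "k = I w / max.I v"
	have k: "0 < k" using w(2) Iv by (simp add: k_def)
	have sv: "max.scale k v : forms A' 3" by (rule max.forms_scale[OF v(1)])
	have "max.I (w' - max.scale k v) = 0" unfolding max.I_diff[OF w'(1) sv] max.I_scale[OF v(1)] Iw using Iv by (simp add: k_def)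
	then obtain \<sigma> where \<sigma>: "\<sigma> : forms A' 2" "form_d A' \<sigma> = w' - max.scale k v"
		using max.exact_iff_integral_zero[OF max.forms_diff[OF w'(1) sv] _ nonempty] by blast
	define \<tau> where "\<tau> = restr A (max.scale (-1) \<sigma>)"
	have \<tau>: "\<tau> : forms A 2" unfolding \<tau>_def by (rule max.restr_forms[OF subset_maxatlas max.forms_scale[OF \<sigma>(1)]])
	have "form_d A \<tau> = restr A (max.scale (-1) (w' - max.scale k v))"
		unfolding \<tau>_def max.restr_d[OF subset_maxatlas, symmetric] max.form_d_scale[OF \<sigma>(1)] \<sigma>(2) ..
	then have "(w + form_d A \<tau>) c x vs = k * v c x vs" if "c : A" for c x vs
		using that unfolding w'(2)[symmetric] by (simp add: max.restr_def max.scale_def)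
	then have "dens (w + form_d A \<tau>) c x = k * max.dens v c x" if "c : A" for c x
		using that by (simp only: dens_def max.dens_def)
	then show ?thesis using \<tau> v(2) k subset_maxatlas by (intro bexI[of _ \<tau>]) auto
qed

text \<open>Extension to the maximal atlas preserves closedness and the absence of zeros, so
  \<open>foliated_positive\<close> applies there and its \<gamma> is restricted back.\<close>

lemma positive_12:
	assumes \<alpha>: "\<alpha> : closed_forms A 1" "nowhere_vanishing A \<alpha>" and \<beta>: "\<beta> : closed_forms A 2" "0 < I (form_wedge 1 2 \<alpha> \<beta>)"
	shows "\<exists>\<gamma>\<in>forms A 1. \<forall>c\<in>A. \<forall>x\<in>img c. 0 < dens (form_wedge 1 2 \<alpha> (\<beta> + form_d A \<gamma>)) c x"
proof -
	have f: "\<alpha> : forms A 1" "\<beta> : forms A 2" "form_d A \<alpha> = 0" "form_d A \<beta> = 0" using \<alpha> \<beta> by (simp_all add: closed_forms_def)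
	obtain a where a: "a : forms A' 1" "restr A a = \<alpha>" using max.extend_form[OF subset_maxatlas covers f(1)] by auto
	obtain b where b: "b : forms A' 2" "restr A b = \<beta>" using max.extend_form[OF subset_maxatlas covers f(2)] by auto
	have r0: "restr A 0 = 0" by (simp add: max.restr_def fun_eq_iff)
	have da: "form_d A' a = 0"
		by (rule max.restr_eq_iff[OF subset_maxatlas covers max.forms_d_1[OF a(1)] max.forms_0])
			(simp_all add: max.restr_d[OF subset_maxatlas] a(2) f(3) r0)
	have db: "form_d A' b = 0"
		by (rule max.restr_eq_iff[OF subset_maxatlas covers max.forms_d_2[OF b(1)] max.forms_0])
			(simp_all add: max.restr_d[OF subset_maxatlas] b(2) f(4) r0)
	have "nowhere_vanishing A' a" unfolding nowhere_vanishing_def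
	proof (intro ballI notI)
		fix c x assume c: "c : A'" "x : img c" and z: "a c x = 0"
		define p where "p = chart_inv c x"
		have p: "p : fst c" "snd c p = x" unfolding p_def using chart_inv_into[OF max.chart[OF c(1)] c(2)] chart_chart_inv[OF max.chart[OF c(1)] c(2)] by simp_all
		obtain d where d: "d : A" "p : fst d" using covers p(1) max.chart_subset[OF c(1)] by blast
		have dA: "d : A'" using d(1) subset_maxatlas by blast
		have "a d (snd d p) = 0"
			by (rule max.form_zero_transition[OF a(1) dA c(1) overlapI[of p d c, OF d(2) p(1)]])
				(simp add: transition_chart[OF max.chart[OF dA] d(2)] p(2) z)
		moreover have "a d = \<alpha> d" using d(1) a(2) by (auto simp: max.restr_def)
		ultimately show False using \<alpha>(2) d(1) chart_into[OF d(2)] by (auto simp: nowhere_vanishing_def)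
	qed
	then interpret fol: foliation X A' a
		by (intro foliation.intro foliation_axioms.intro max.max_atlas_axioms a(1) da)
	have rw: "restr A (form_wedge 1 2 a v) = form_wedge 1 2 \<alpha> (restr A v)" for v
		by (simp only: max.restr_wedge a(2))
	have "max.I (form_wedge 1 2 a b) = I (form_wedge 1 2 \<alpha> \<beta>)"
		using max.I_subatlas[OF subset_maxatlas covers max.forms_wedge_12[OF a(1) b(1)]] unfolding rw b(2) by simp
	then obtain \<gamma> where \<gamma>: "\<gamma> : forms A' 1" "!!c x. c : A' ==> x : img c ==> 0 < max.dens (form_wedge 1 2 a (b + form_d A' \<gamma>)) c x"
		using fol.foliated_positive[OF b(1) db _ nonempty] \<beta>(2) by auto
	have "restr A (b + form_d A' \<gamma>) = \<beta> + form_d A (restr A \<gamma>)"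
		unfolding b(2)[symmetric] max.restr_d[OF subset_maxatlas, symmetric] by (simp add: max.restr_def fun_eq_iff)
	then have e: "form_wedge 1 2 \<alpha> (\<beta> + form_d A (restr A \<gamma>)) = restr A (form_wedge 1 2 a (b + form_d A' \<gamma>))" using rw by simp
	have "0 < dens (form_wedge 1 2 \<alpha> (\<beta> + form_d A (restr A \<gamma>))) c x" if "c : A" "x : img c" for c x
		using \<gamma>(2)[of c x] subset_maxatlas that unfolding e by (auto simp: max.restr_def dens_def max.dens_def)
	then show ?thesis using max.restr_forms[OF subset_maxatlas \<gamma>(1)] by blast
qed

end

section \<open>The two inclusions between the cone and its description\<close>

context closed_manifold
begin

lemma self_pairing_eq: "self_pairing (w0, w1, w2, w3) = scale 2 (form_wedge 0 3 w0 w3 - form_wedge 1 2 w1 w2)"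
	by (simp add: scale_def fun_eq_iff)

lemma coneI:
	assumes w: "w0 : closed_forms A 0" "w1 : closed_forms A 1" "w2 : closed_forms A 2" "w3 : closed_forms A 3"
		and pos: "!!c x. c : A ==> x : img c ==> dens (form_wedge 1 2 w1 w2) c x < dens (form_wedge 0 3 w0 w3) c x"
	shows "(coho_class A 0 w0, coho_class A 1 w1, coho_class A 2 w2, coho_class A 3 w3) : G22_cone A"
proof -
	have f: "w0 : forms A 0" "w1 : forms A 1" "w2 : forms A 2" "w3 : forms A 3"
		and d: "form_d A w0 = 0" "form_d A w1 = 0" "form_d A w2 = 0" using w by (simp_all add: closed_forms_def)
	define s where "s = self_pairing (w0, w1, w2, w3)"
	have sf: "s : forms A 3" unfolding s_def self_pairing_eq
		by (rule forms_scale[OF forms_diff[OF forms_wedge_03[OF f(1,4)] forms_wedge_12[OF f(2,3)]]])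
	have p: "0 < dens s c x" if "c : A" "x : img c" for c x
		unfolding s_def self_pairing_eq dens_algebra using pos[OF that] by simp
	have "s c x ~= 0" if "c : A" "x : img c" for c x using p[OF that] by (auto simp: dens_def)
	then have "G22_structure A (w0, w1, w2, w3)"
		unfolding G22_structure_def nowhere_vanishing_def s_def[symmetric] using f d by (simp add: mforms_def)
	moreover have "positive_volume_form A (self_pairing (w0, w1, w2, w3))"
		unfolding positive_volume_form_def s_def[symmetric] using sf p by (simp add: dens_def)
	ultimately have "mclass_of A (w0, w1, w2, w3) : G22_cone A" unfolding G22_cone_def by blast
	then show ?thesis by (simp only: mclass_of.simps)
qed

lemma coneE:
	assumes "a : G22_cone A"
	shows "\<exists>w0\<in>closed_forms A 0. \<exists>w1\<in>closed_forms A 1. \<exists>w2\<in>closed_forms A 2. \<exists>w3\<in>closed_forms A 3.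
		a = (coho_class A 0 w0, coho_class A 1 w1, coho_class A 2 w2, coho_class A 3 w3) &
		(\<forall>c\<in>A. \<forall>x\<in>img c. dens (form_wedge 1 2 w1 w2) c x < dens (form_wedge 0 3 w0 w3) c x)"
proof -
	obtain w where w: "a = mclass_of A w" "G22_structure A w" "positive_volume_form A (self_pairing w)"
		using assms unfolding G22_cone_def by blast
	obtain w0 w1 w2 w3 where we: "w = (w0, w1, w2, w3)" by (cases w) auto
	have m: "w0 : forms A 0" "w1 : forms A 1" "w2 : forms A 2" "w3 : forms A 3"
		"form_d A w0 = 0" "form_d A w1 = 0" "form_d A w2 = 0"
		using w(2) unfolding we G22_structure_def mforms_def by simp_all
	then have cl: "w0 : closed_forms A 0" "w1 : closed_forms A 1" "w2 : closed_forms A 2" "w3 : closed_forms A 3"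
		using closed_forms_3 by (simp_all add: closed_forms_def)
	have "dens (form_wedge 1 2 w1 w2) c x < dens (form_wedge 0 3 w0 w3) c x" if "c : A" "x : img c" for c x
	proof -
		have "0 < dens (self_pairing (w0, w1, w2, w3)) c x"
			using w(3) that unfolding we positive_volume_form_def dens_def by blast
		then show ?thesis unfolding self_pairing_eq dens_algebra by simp
	qed
	then show ?thesis using cl w(1) unfolding we mclass_of.simps by blast
qed

definition open_part :: "'a mclass set" where
	"open_part = {(a0, a1, a2, a3) : total_coho A. a0 ~= coho_zero A 0 &
		 0 < coho_integral X A (coho_diff A 3 (cup A 0 3 a0 a3) (cup A 1 2 a1 a2))}"

definition null_part :: "'a mclass set" where
	"null_part = {(a0, a1, a2, a3). a0 = coho_zero A 0 & (a1, a2) : C_cone X A & a3 : coho A 3}"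

lemma some_point: "\<exists>c\<in>A. \<exists>x. x : img c"
proof -
	obtain p where "p : topspace X" using nonempty by blast
	then obtain c where c: "c : A" "p : fst c" using covers by blast
	then show ?thesis using chart_into[OF c(2)] by blast
qed

lemma zero_wedge: "v : forms A 3 ==> dens (form_wedge 0 3 0 v) c x = 0"
	using vec_wedge(3)[OF forms_0, of v c x] by simp

text \<open>Integrating the pointwise inequality gives the inequality between classes. If the degree
  0 class vanishes, so does w0, and then w1 \<and> w2 is negative everywhere, which leaves no zeros
  for w1.\<close>

lemma cone_subset: "G22_cone A <= open_part \<union> null_part"
proof
	fix a assume "a : G22_cone A"
	then obtain w0 w1 w2 w3 where w: "w0 : closed_forms A 0" "w1 : closed_forms A 1" "w2 : closed_forms A 2" "w3 : closed_forms A 3"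
		and a: "a = (coho_class A 0 w0, coho_class A 1 w1, coho_class A 2 w2, coho_class A 3 w3)"
		and p: "!!c x. c : A ==> x : img c ==> dens (form_wedge 1 2 w1 w2) c x < dens (form_wedge 0 3 w0 w3) c x"
		using coneE by blast
	have f: "w0 : forms A 0" "w1 : forms A 1" "w2 : forms A 2" "w3 : forms A 3" using w by (simp_all add: closed_forms_def)
	note f03 = forms_wedge_03[OF f(1,4)] and f12 = forms_wedge_12[OF f(2,3)]
	define s where "s = form_wedge 0 3 w0 w3 - form_wedge 1 2 w1 w2"
	have s: "s : forms A 3" unfolding s_def by (rule forms_diff[OF f03 f12])
	have sp: "0 < dens s c x" if "c : A" "x : img c" for c x unfolding s_def dens_algebra using p[OF that] by simp
	obtain c x where cx: "c : A" "x : img c" using some_point by blast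
	have Is: "0 < I s" by (rule I_nonneg_pos[OF s less_imp_le[OF sp] cx sp[OF cx]])
	have co: "coho_class A 0 w0 : coho A 0" "coho_class A 1 w1 : coho A 1" "coho_class A 2 w2 : coho A 2" "coho_class A 3 w3 : coho A 3"
		using coho_iff w by blast+
	show "a : open_part \<union> null_part"
	proof (cases "coho_class A 0 w0 = coho_zero A 0")
		case False
		have "a : open_part" unfolding open_part_def a total_coho_def using co False Is cone_integral[OF w] by (simp add: s_def)
		then show ?thesis by simp
	next
		case True
		then have w0: "w0 = 0" by (rule coho_class_0_eq[OF w(1)])
		have neg: "dens (form_wedge 1 2 w1 w2) c x < 0" if "c : A" "x : img c" for c x
			using p[OF that] unfolding w0 zero_wedge[OF f(4)] .
		have "w1 c x ~= 0" if "c : A" "x : img c" for c x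
		proof
			assume "w1 c x = 0"
			then have "vec1 w1 c x = 0" by (simp add: vec1_def vec_eq_iff)
			then show False using neg[OF that] unfolding vec_wedge(2)[OF f(2,3)] by simp
		qed
		then have "nowhere_vanishing A w1" by (simp add: nowhere_vanishing_def)
		then have "coho_class A 1 w1 : nonvanishing_classes A"
			unfolding nonvanishing_classes_def using co(2) coho_class_self[OF w(2)] by blast
		moreover have "I (form_wedge 1 2 w1 w2) < 0"
		proof -
			have "I (form_wedge 0 3 w0 w3) = 0"
				using constant_wedge[OF f(1) _ f(4), of 0] I_scale[OF f(4), of 0] by (simp add: w0)
			then show ?thesis using Is unfolding s_def I_diff[OF f03 f12] by simp
		qed
		ultimately have "a : null_part"
			unfolding null_part_def a C_cone_def using True co cup_12_integral[OF w(2,3)] by simp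
		then show ?thesis by simp
	qed
qed

text \<open>The degree 0 component is a nonzero constant k, so adding d(\<sigma>/k) to w3 adds the
  exact form d\<sigma> to w0 w3 - w1 \<and> w2; \<open>positive_3form\<close> provides a suitable
  \<sigma>.\<close>

lemma open_part_subset: "open_part <= G22_cone A"
proof
	fix a assume "a : open_part"
	then obtain a0 a1 a2 a3 where a: "a = (a0, a1, a2, a3)" "a0 : coho A 0" "a1 : coho A 1" "a2 : coho A 2" "a3 : coho A 3"
		"a0 ~= coho_zero A 0" "0 < coho_integral X A (coho_diff A 3 (cup A 0 3 a0 a3) (cup A 1 2 a1 a2))"
		unfolding open_part_def total_coho_def by blast
	obtain w0 w1 w2 w3 where w: "w0 : closed_forms A 0" "w1 : closed_forms A 1" "w2 : closed_forms A 2" "w3 : closed_forms A 3"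
		and e: "a0 = coho_class A 0 w0" "a1 = coho_class A 1 w1" "a2 = coho_class A 2 w2" "a3 = coho_class A 3 w3"
		using a(2-5) unfolding coho_iff by blast
	have f: "w0 : forms A 0" "w1 : forms A 1" "w2 : forms A 2" "w3 : forms A 3" using w by (simp_all add: closed_forms_def)
	note f03 = forms_wedge_03[OF f(1,4)] and f12 = forms_wedge_12[OF f(2,3)]
	obtain k where k: "!!c x. c : A ==> x : img c ==> w0 c x [] = k" using closed_function_constant[OF w(1)] by blast
	have k0: "k ~= 0"
	proof
		assume "k = 0"
		have "w0 c x = 0 c x" for c x
		proof (cases "c : A & x : img c")
			case True
			then have "w0 c x [] = 0" using k \<open>k = 0\<close> by simp
			then show ?thesis using form0_repr[OF f(1), of c x] by simp
		next
			case False
			then show ?thesis using form_outside[OF f(1)] by auto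
		qed
		then have "w0 = 0" by (intro ext) simp
		then show False using a(6) e(1) by (simp add: coho_zero_def)
	qed
	define s where "s = form_wedge 0 3 w0 w3 - form_wedge 1 2 w1 w2"
	have s: "s : forms A 3" "0 < I s"
		unfolding s_def using a(7) cone_integral[OF w] forms_diff[OF f03 f12] by (simp_all add: e)
	obtain \<sigma> where \<sigma>: "\<sigma> : forms A 2" "\<forall>c\<in>A. \<forall>x\<in>img c. 0 < dens (s + form_d A \<sigma>) c x" using positive_3form[OF s] by blast
	have d\<sigma>: "form_d A (scale (1 / k) \<sigma>) = scale (1 / k) (form_d A \<sigma>)" by (rule form_d_scale[OF \<sigma>(1)])
	define v3 where "v3 = w3 + form_d A (scale (1 / k) \<sigma>)"
	have ex: "form_d A (scale (1 / k) \<sigma>) : form_d A ` forms A 2" by (rule imageI[OF forms_scale[OF \<sigma>(1)]])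
	have v3: "v3 : forms A 3" unfolding v3_def by (rule forms_add[OF f(4) forms_d_2[OF forms_scale[OF \<sigma>(1)]]])
	have "v3 - w3 : exact_forms A 3" unfolding v3_def exact_forms_simps using ex by simp
	then have "coho_class A 3 v3 = a3" unfolding e using coho_class_eq[of v3 3 w3] v3 f(4) closed_forms_3 by simp
	moreover have "(coho_class A 0 w0, coho_class A 1 w1, coho_class A 2 w2, coho_class A 3 v3) : G22_cone A"
	proof (rule coneI[OF w(1-3)])
		show "v3 : closed_forms A 3" using v3 closed_forms_3 by simp
		fix c x assume c: "c : A" "x : img c"
		have "dens (form_wedge 0 3 w0 v3) c x = k * dens w3 c x + dens (form_d A \<sigma>) c x"
			unfolding vec_wedge(3)[OF f(1) v3] k[OF c] unfolding v3_def d\<sigma> dens_algebra using k0 by (simp add: distrib_left)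
		moreover have "dens (form_wedge 0 3 w0 w3) c x = k * dens w3 c x" unfolding vec_wedge(3)[OF f(1,4)] k[OF c] ..
		moreover have "0 < dens (s + form_d A \<sigma>) c x" using \<sigma>(2) c by blast
		ultimately show "dens (form_wedge 1 2 w1 w2) c x < dens (form_wedge 0 3 w0 v3) c x"
			unfolding s_def dens_algebra by linarith
	qed
	ultimately show "a : G22_cone A" by (simp only: a(1) e)
qed

text \<open>With zero degree 0 part the pairing is -2 w1 \<and> w2, so \<open>positive_12\<close> is
  applied to v = -w2 and the sign is restored afterwards.\<close>

lemma null_part_subset: "null_part <= G22_cone A"
proof
	fix a assume "a : null_part"
	then obtain a1 a2 a3 where a: "a = (coho_zero A 0, a1, a2, a3)" "(a1, a2) : C_cone X A" "a3 : coho A 3"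
		unfolding null_part_def by blast
	obtain w1 where w1: "w1 : a1" "nowhere_vanishing A w1" "a1 : coho A 1" using a(2) unfolding C_cone_def nonvanishing_classes_def by blast
	have a2: "a2 : coho A 2" "coho_integral X A (cup A 1 2 a1 a2) < 0" using a(2) unfolding C_cone_def by blast+
	have c1: "w1 : closed_forms A 1" "a1 = coho_class A 1 w1" using coho_member[OF w1(3,1)] by blast+
	obtain w2 where c2: "w2 : closed_forms A 2" "a2 = coho_class A 2 w2" using a2(1) unfolding coho_iff by blast
	obtain w3 where c3: "w3 : closed_forms A 3" "a3 = coho_class A 3 w3" using a(3) unfolding coho_iff by blast
	have c0: "(0 :: 'a dform) : closed_forms A 0" using forms_0 form_d_zero by (simp add: closed_forms_def)
	have f: "w1 : forms A 1" "w2 : forms A 2" "w3 : forms A 3" "form_d A w2 = 0" using c1 c2 c3 by (simp_all add: closed_forms_def)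
	define v where "v = scale (-1) w2"
	have v: "v : closed_forms A 2"
		using forms_scale[OF f(2), of "-1"] form_d_scale[OF f(2), of "-1"] f(4) by (simp add: v_def closed_forms_def scale_def fun_eq_iff)
	have vw: "form_wedge 1 2 w1 v = scale (-1) (form_wedge 1 2 w1 w2)"
		unfolding v_def scale_def by (rule form_wedge_right(3))
	have "I (form_wedge 1 2 w1 w2) < 0" using a2(2) cup_12_integral[OF c1(1) c2(1)] by (simp only: c1(2) c2(2))
	then have "0 < I (form_wedge 1 2 w1 v)" unfolding vw I_scale[OF forms_wedge_12[OF f(1,2)]] by simp
	then obtain \<gamma> where \<gamma>: "\<gamma> : forms A 1" "\<forall>c\<in>A. \<forall>x\<in>img c. 0 < dens (form_wedge 1 2 w1 (v + form_d A \<gamma>)) c x"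
		using positive_12[OF c1(1) w1(2) v] by blast
	define b where "b = w2 - form_d A \<gamma>"
	have b: "b : forms A 2" unfolding b_def by (rule forms_diff[OF f(2) forms_d_1[OF \<gamma>(1)]])
	have "form_d A b = 0" unfolding b_def form_d_diff[OF f(2) forms_d_1[OF \<gamma>(1)]] f(4) d_d_1[OF \<gamma>(1)] by simp
	then have bc: "b : closed_forms A 2" using b by (simp add: closed_forms_def)
	have "w2 - b : exact_forms A 2" unfolding b_def exact_forms_simps using imageI[OF \<gamma>(1), of "form_d A"] by simp
	then have be: "coho_class A 2 b = a2" using coho_class_eq[OF c2(1) bc] c2(2) by simp
	have "b = scale (-1) (v + form_d A \<gamma>)" by (simp add: b_def v_def scale_def fun_eq_iff)
	then have bw: "form_wedge 1 2 w1 b = scale (-1) (form_wedge 1 2 w1 (v + form_d A \<gamma>))"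
		unfolding scale_def using form_wedge_right(3)[of 1 2 w1 "-1" "v + form_d A \<gamma>"] by simp
	have "(coho_class A 0 0, coho_class A 1 w1, coho_class A 2 b, coho_class A 3 w3) : G22_cone A"
		by (rule coneI[OF c0 c1(1) bc c3(1)]) (unfold zero_wedge[OF f(3)] bw dens_algebra, use \<gamma>(2) in simp)
	then show "a : G22_cone A" by (simp only: a(1) be c1(2) c3(2) coho_zero_def)
qed

lemma G22_cone_eq: "G22_cone A = open_part \<union> null_part"
	using cone_subset open_part_subset null_part_subset by blast

end

theorem theorem3p13:
  fixes M :: "'a topology" and A :: "'a chart set"
  assumes "oriented_smooth_3manifold M A"
    and "compact_space M"
    and "connected_space M"
    and "topspace M \<noteq> {}"
  shows "G22_cone A =
    {(a0, a1, a2, a3) \<in> total_coho A.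
       a0 \<noteq> coho_zero A 0 \<and>
       0 < coho_integral M A (coho_diff A 3 (cup A 0 3 a0 a3) (cup A 1 2 a1 a2))} \<union>
    {(a0, a1, a2, a3).
       a0 = coho_zero A 0 \<and> (a1, a2) \<in> C_cone M A \<and> a3 \<in> coho A 3}"
proof -
	interpret closed_manifold M A
		by (intro closed_manifold.intro closed_manifold_axioms.intro compact_atlas.intro compact_atlas_axioms.intro atlas.intro)
			(use assms in \<open>simp_all add: oriented_smooth_3manifold_def\<close>)
	show ?thesis using G22_cone_eq unfolding open_part_def null_part_def .
qed

end
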